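(* Let $\eta>0$ and let $n\ge 1$ be an integer. Consider the piecewise polynomial system $$(\dot x,\dot y)=\big(y-2x^2-\eta+\varepsilon f^k(x,y),\ -2xy+\varepsilon g^k(x,y)\big)\quad\text{on } Q_k,\qquad k=1,2,3,4,\quad 0<|\varepsilon|\ll 1,$$ where $Q_1=\{x>0,y>\eta\}$, $Q_2=\{x>0,y<\eta\}$, $Q_3=\{x<0,y<\eta\}$, $Q_4=\{x<0,y>\eta\}$, and $f^k,g^k$ ($k=1,2,3,4$) are real polynomials in $(x,y)$ of degree at most $n$ for which the first order Melnikov function $M$ is not identically zero on $(-\frac1{2\eta},0)$. Then the number of limit cycles of this system bifurcating from the period annulus $\{L_h: h\in(-\frac1{2\eta},0)\}$ around the center $(0,\eta)$ of the unperturbed system is not more than $41n-23$ (counting multiplicity).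
   Context: For $\varepsilon=0$ the system is $\dot x=y-2x^2-\eta$, $\dot y=-2xy$. It has the first integral $H(x,y)=y^{-2}\big(x^2-y+\frac{\eta}{2}\big)$ with integrating factor $y^{-3}$, and the unique center $(0,\eta)$ (called a global center), surrounded by the period annulus of clockwise periodic orbits $L_h=\{H(x,y)=h\}$ (in the region $y>0$), $h\in\Sigma=(-\frac1{2\eta},0)$. The orbit $L_h$ tends to the center as $h\to-\frac1{2\eta}$ and to the invariant curve $x^2-y+\frac\eta2=0$ as $h\to0$. Write $L^k_h=L_h\cap Q_k$, oriented clockwise. The first order Melnikov function of the perturbed system is $$M(h)=\sum_{k=1}^4\int_{L_h^k}y^{-3}\big[g^k(x,y)\,dx-f^k(x,y)\,dy\big],\qquad h\in\Sigma.$$ "The number of limit cycles bifurcating from the period annulus is not more than $N$ (counting multiplicity)" is used in the usual first-order Melnikov sense: for every compact $K\subset\Sigma$ there is $\varepsilon_0>0$ such that for all $0<|\varepsilon|<\varepsilon_0$ the perturbed system has at most $N$ limit cycles, counted with multiplicity (as zeros of the displacement map), that are close to the periodic orbits $L_h$, $h\in K$, i.e. that meet the section $\{x=0,\ y>\eta\}$ at a point where $H$ takes a value in $K$. *)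

theory Defs
  imports "HOL-Analysis.Analysis" "HOL-Library.Extended_Nat"
begin

definition poly2_deg_le :: "nat \<Rightarrow> (real \<Rightarrow> real \<Rightarrow> real) \<Rightarrow> bool" where
  "poly2_deg_le n p \<longleftrightarrow>
     (\<exists>c :: nat \<Rightarrow> nat \<Rightarrow> real. \<forall>x y. p x y = (\<Sum>i\<le>n. \<Sum>j\<le>n - i. c i j * x ^ i * y ^ j))"

definition quadrant :: "real \<Rightarrow> nat \<Rightarrow> (real \<times> real) set" where
  "quadrant \<eta> k =
     (if k = 1 then {(x, y). x > 0 \<and> y > \<eta>}
      else if k = 2 then {(x, y). x > 0 \<and> y < \<eta>}
      else if k = 3 then {(x, y). x < 0 \<and> y < \<eta>}
      else if k = 4 then {(x, y). x < 0 \<and> y > \<eta>}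
      else {})"

text \<open>The vector field on the \<open>k\<close>-th quadrant; \<open>\<epsilon> = 0\<close> gives the unperturbed system.\<close>

definition vfield :: "real \<Rightarrow> real \<Rightarrow> (nat \<Rightarrow> real \<Rightarrow> real \<Rightarrow> real) \<Rightarrow> (nat \<Rightarrow> real \<Rightarrow> real \<Rightarrow> real)
    \<Rightarrow> nat \<Rightarrow> real \<times> real \<Rightarrow> real \<times> real" where
  "vfield \<eta> \<epsilon> f g k = (\<lambda>(x, y).
     (y - 2 * x\<^sup>2 - \<eta> + \<epsilon> * f k x y, - 2 * x * y + \<epsilon> * g k x y))"

definition first_integral :: "real \<Rightarrow> real \<times> real \<Rightarrow> real" where
  "first_integral \<eta> = (\<lambda>(x, y). (x\<^sup>2 - y + \<eta> / 2) / y\<^sup>2)"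

definition level_orbit :: "real \<Rightarrow> real \<Rightarrow> (real \<times> real) set" where
  "level_orbit \<eta> h = {p. snd p > 0 \<and> first_integral \<eta> p = h}"

text \<open>For \<open>-1/(2\<eta>) < h < 0\<close> the orbit \<open>L\<^sub>h\<close> is the ellipse
  \<open>x\<^sup>2 - h (y + 1/(2h))\<^sup>2 = -1/(4h) - \<eta>/2\<close>. The path below runs through it once as
  \<open>\<theta>\<close> goes from \<open>0\<close> to \<open>2\<pi>\<close>, clockwise from its highest point; see
  \<open>orbit_path_image\<close>, \<open>orbit_path_inj\<close> and \<open>orbit_path_clockwise\<close>.\<close>

definition orbit_path :: "real \<Rightarrow> real \<Rightarrow> real \<Rightarrow> real \<times> real" where
  "orbit_path \<eta> h \<theta> =
     (let R = sqrt (- 1 / (4 * h) - \<eta> / 2)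
      in (R * sin \<theta>, - 1 / (2 * h) + R / sqrt (- h) * cos \<theta>))"

lemma orbit_radius_pos:
  fixes h \<eta> :: real
  assumes "- 1 / (2 * \<eta>) < h" "h < 0" "\<eta> > 0"
  shows "- 1 / (4 * h) - \<eta> / 2 > 0"
proof -
  have "- h * (2 * \<eta>) < 1" using assms by (simp add: field_simps)
  then show ?thesis using assms(2) by (simp add: field_simps)
qed

lemma level_orbit_iff_ellipse:
  assumes "- 1 / (2 * \<eta>) < h" "h < 0" "\<eta> > 0"
  shows "(x, y) \<in> level_orbit \<eta> h \<longleftrightarrow> x\<^sup>2 - h * (y + 1 / (2 * h))\<^sup>2 = - 1 / (4 * h) - \<eta> / 2"
proof -
  have *: "x\<^sup>2 - h * (y + 1 / (2 * h))\<^sup>2 = - 1 / (4 * h) - \<eta> / 2 \<longleftrightarrow> x\<^sup>2 - y + \<eta> / 2 = h * y\<^sup>2"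
  proof -
    have "h * (y + 1 / (2 * h))\<^sup>2 = h * y\<^sup>2 + y + 1 / (4 * h)"
      using assms(2) by (simp add: power2_sum power_divide power_mult_distrib distrib_left)
        (simp add: power2_eq_square)
    then show ?thesis by (auto simp: algebra_simps)
  qed
  have pos: "y > 0" if "x\<^sup>2 - y + \<eta> / 2 = h * y\<^sup>2"
  proof -
    have "h * y\<^sup>2 \<le> 0" using assms(2) by (simp add: mult_nonpos_nonneg)
    moreover have "x\<^sup>2 \<ge> 0" by simp
    ultimately show ?thesis using that assms(3) by linarith
  qed
  show ?thesis unfolding * using pos
    by (auto simp: level_orbit_def first_integral_def divide_eq_eq)
qed

lemma orbit_path_image:
  assumes "- 1 / (2 * \<eta>) < h" "h < 0" "\<eta> > 0"
  shows "orbit_path \<eta> h ` {0..<2 * pi} = level_orbit \<eta> h"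
proof -
  define R where "R = sqrt (- 1 / (4 * h) - \<eta> / 2)"
  define s where "s = sqrt (- h)"
  have R: "R > 0" "R\<^sup>2 = - 1 / (4 * h) - \<eta> / 2"
    using orbit_radius_pos[OF assms] by (auto simp: R_def)
  have s: "s > 0" "s\<^sup>2 = - h" using assms(2) by (auto simp: s_def)
  have path: "orbit_path \<eta> h t = (R * sin t, - 1 / (2 * h) + R / s * cos t)" for t
    by (simp add: orbit_path_def Let_def R_def s_def)
  show ?thesis
  proof (intro equalityI subsetI)
    fix p assume "p \<in> orbit_path \<eta> h ` {0..<2 * pi}"
    then obtain t where p: "p = (R * sin t, - 1 / (2 * h) + R / s * cos t)" using path by auto
    have "(R * sin t)\<^sup>2 - h * (R / s * cos t)\<^sup>2 = R\<^sup>2 * ((sin t)\<^sup>2 + (- h / s\<^sup>2) * (cos t)\<^sup>2)"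
      by (simp add: power_mult_distrib power_divide algebra_simps)
    also have "\<dots> = R\<^sup>2" using assms(2) by (simp add: s(2))
    finally show "p \<in> level_orbit \<eta> h"
      unfolding p level_orbit_iff_ellipse[OF assms] R(2)[symmetric] by simp
  next
    fix p assume p: "p \<in> level_orbit \<eta> h"
    obtain x y where xy: "p = (x, y)" by (cases p)
    have "x\<^sup>2 - h * (y + 1 / (2 * h))\<^sup>2 = R\<^sup>2"
      using p unfolding xy level_orbit_iff_ellipse[OF assms] R(2) .
    then have "x\<^sup>2 + (s * (y + 1 / (2 * h)))\<^sup>2 = R\<^sup>2"
      by (simp add: power_mult_distrib s(2))
    then have "(s * (y + 1 / (2 * h)) / R)\<^sup>2 + (x / R)\<^sup>2 = 1"
      using R(1) by (simp add: power_divide add_divide_distrib[symmetric] add.commute)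
    then obtain t where t: "0 \<le> t" "t < 2 * pi"
      "s * (y + 1 / (2 * h)) / R = cos t" "x / R = sin t"
      by (rule sincos_total_2pi)
    have "x = R * sin t" using t(4) R(1) by (auto simp: field_simps)
    moreover have "s * (y + 1 / (2 * h)) = R * cos t"
      using t(3) R(1) by (auto simp: divide_eq_eq mult.commute)
    then have "y + 1 / (2 * h) = R / s * cos t"
      using s(1) by (simp add: eq_divide_eq mult.commute)
    then have "y = - 1 / (2 * h) + R / s * cos t" by simp
    ultimately show "p \<in> orbit_path \<eta> h ` {0..<2 * pi}"
      using t(1,2) xy by (auto simp: path)
  qed
qed

lemma orbit_path_inj:
  assumes "- 1 / (2 * \<eta>) < h" "h < 0" "\<eta> > 0"
  shows "inj_on (orbit_path \<eta> h) {0..<2 * pi}"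
proof (rule inj_onI)
  fix t u assume tu: "t \<in> {0..<2 * pi}" "u \<in> {0..<2 * pi}"
    and eq: "orbit_path \<eta> h t = orbit_path \<eta> h u"
  have "sqrt (- 1 / (4 * h) - \<eta> / 2) > 0" "sqrt (- h) > 0"
    using orbit_radius_pos[OF assms] assms(2) by auto
  then have "sin t = sin u" "cos t = cos u"
    using eq by (auto simp: orbit_path_def Let_def)
  then obtain n :: int where n: "t = u + 2 * pi * n"
    using sin_cos_eq_iff[of t u] by auto
  then have "2 * pi * \<bar>real_of_int n\<bar> = \<bar>t - u\<bar>" by (simp add: abs_mult)
  also have "\<dots> < 2 * pi * 1" using tu by auto
  finally have "\<bar>real_of_int n\<bar> < 1" using pi_gt_zero by (subst (asm) mult_less_cancel_left_pos) auto
  then have "n = 0" by linarith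
  then show "t = u" using n by simp
qed

lemma orbit_path_clockwise:
  assumes "- 1 / (2 * \<eta>) < h" "h < 0" "\<eta> > 0"
  shows "\<exists>c>0. (orbit_path \<eta> h has_vector_derivative
                  c *\<^sub>R vfield \<eta> 0 f g k (orbit_path \<eta> h \<theta>)) (at \<theta>)"
proof -
  define R where "R = sqrt (- 1 / (4 * h) - \<eta> / 2)"
  define s where "s = sqrt (- h)"
  define x where "x = R * sin \<theta>"
  define y where "y = - 1 / (2 * h) + R / s * cos \<theta>"
  have s: "s > 0" "s\<^sup>2 = - h" using assms(2) by (auto simp: s_def)
  have path: "orbit_path \<eta> h = (\<lambda>t. (R * sin t, - 1 / (2 * h) + R / s * cos t))"
    by (simp add: orbit_path_def Let_def R_def s_def fun_eq_iff)
  have "orbit_path \<eta> h (2 * pi * frac (\<theta> / (2 * pi))) \<in> level_orbit \<eta> h"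
    using orbit_path_image[OF assms] by (auto simp: frac_lt_1)
  moreover have "orbit_path \<eta> h (2 * pi * frac (\<theta> / (2 * pi))) = (x, y)"
  proof -
    have *: "2 * pi * frac (\<theta> / (2 * pi)) = \<theta> + 2 * pi * of_int (- \<lfloor>\<theta> / (2 * pi)\<rfloor>)"
      by (simp add: frac_def algebra_simps)
    have "sin (2 * pi * frac (\<theta> / (2 * pi))) = sin \<theta> \<and> cos (2 * pi * frac (\<theta> / (2 * pi))) = cos \<theta>"
      unfolding sin_cos_eq_iff using * by blast
    then show ?thesis by (simp add: path x_def y_def)
  qed
  ultimately have L: "y > 0" "x\<^sup>2 - y + \<eta> / 2 = h * y\<^sup>2"
    by (auto simp: level_orbit_def first_integral_def divide_eq_eq)
  define c where "c = 1 / (2 * s * y)"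
  have c: "c > 0" using s L by (simp add: c_def)
  have "s * (y + 1 / (2 * h)) = R * cos \<theta>" using s(1) by (simp add: y_def)
  then have "R * cos \<theta> = s * y + s / (2 * h)" by (simp add: distrib_left)
  also have "s / (2 * h) = - 1 / (2 * s)"
    using s assms(2) by (simp add: field_simps power2_eq_square)
  finally have Rc: "R * cos \<theta> = s * y - 1 / (2 * s)" by simp
  have *: "y - 2 * x\<^sup>2 - \<eta> = - y + 2 * s\<^sup>2 * y\<^sup>2" using L(2) s(2) by (simp add: algebra_simps)
  have A: "c * (y - 2 * x\<^sup>2 - \<eta>) = R * cos \<theta>"
    unfolding * Rc c_def using s(1) L(1) by (simp add: field_simps power2_eq_square)
  have B: "c * (- 2 * x * y) = - (R / s * sin \<theta>)"
    using s(1) L(1) by (simp add: x_def c_def field_simps)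
  have "(orbit_path \<eta> h has_vector_derivative (R * cos \<theta>, - (R / s * sin \<theta>))) (at \<theta>)"
    unfolding path
    using s(1) by (intro has_vector_derivative_Pair)
       (auto intro!: derivative_eq_intros simp: has_real_derivative_iff_has_vector_derivative[symmetric])
  moreover have "c *\<^sub>R vfield \<eta> 0 f g k (orbit_path \<eta> h \<theta>) = (R * cos \<theta>, - (R / s * sin \<theta>))"
    using A B by (simp add: vfield_def path x_def y_def)
  ultimately show ?thesis using c by (intro exI[of _ c]) simp
qed

definition line_integral ::
    "(real \<times> real \<Rightarrow> real) \<Rightarrow> (real \<times> real \<Rightarrow> real) \<Rightarrow> (real \<Rightarrow> real \<times> real) \<Rightarrow> real set \<Rightarrow> real" where
  "line_integral P Q \<gamma> S =
     integral S (\<lambda>t. P (\<gamma> t) * fst (vector_derivative \<gamma> (at t))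
                    + Q (\<gamma> t) * snd (vector_derivative \<gamma> (at t)))"

text \<open>\<open>M(h) = \<Sum>\<^sub>k \<integral> y\<^sup>-\<^sup>3 (g\<^sup>k dx - f\<^sup>k dy)\<close> over \<open>L\<^sub>h \<inter> Q\<^sub>k\<close>. Since the integrand ignores
  orientation-preserving reparametrisation, it is irrelevant that the parameter set of
  \<open>L\<^sub>h \<inter> Q\<^sub>4\<close> is a final segment of \<open>[0, 2\<pi>]\<close> and that of \<open>L\<^sub>h \<inter> Q\<^sub>1\<close> an initial one.\<close>

definition melnikov :: "real \<Rightarrow> (nat \<Rightarrow> real \<Rightarrow> real \<Rightarrow> real) \<Rightarrow> (nat \<Rightarrow> real \<Rightarrow> real \<Rightarrow> real)
    \<Rightarrow> real \<Rightarrow> real" where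
  "melnikov \<eta> f g h =
     (\<Sum>k = 1..4. line_integral (\<lambda>(x, y). g k x y / y ^ 3) (\<lambda>(x, y). - f k x y / y ^ 3)
        (orbit_path \<eta> h) {\<theta> \<in> {0..2 * pi}. orbit_path \<eta> h \<theta> \<in> quadrant \<eta> k})"

text \<open>A solution on \<open>I\<close> crosses the switching lines at a locally finite set of times and solves the
  \<open>k\<close>-th smooth system while in \<open>Q\<^sub>k\<close>. Sliding motion is not needed: for small \<open>\<epsilon>\<close> every switching
  line is crossed transversally near a compact family of orbits \<open>L\<^sub>h\<close>.\<close>

definition pw_solution :: "real \<Rightarrow> real \<Rightarrow> (nat \<Rightarrow> real \<Rightarrow> real \<Rightarrow> real) \<Rightarrow> (nat \<Rightarrow> real \<Rightarrow> real \<Rightarrow> real)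
    \<Rightarrow> (real \<Rightarrow> real \<times> real) \<Rightarrow> real set \<Rightarrow> bool" where
  "pw_solution \<eta> \<epsilon> f g \<gamma> I \<longleftrightarrow>
     continuous_on I \<gamma> \<and>
     (\<forall>a b. finite {t \<in> I \<inter> {a..b}. \<gamma> t \<notin> (\<Union>k\<in>{1..4}. quadrant \<eta> k)}) \<and>
     (\<forall>t\<in>I. \<forall>k\<in>{1..4}. \<gamma> t \<in> quadrant \<eta> k \<longrightarrow>
        (\<gamma> has_vector_derivative vfield \<eta> \<epsilon> f g k (\<gamma> t)) (at t within I))"

definition pw_periodic_orbit :: "real \<Rightarrow> real \<Rightarrow> (nat \<Rightarrow> real \<Rightarrow> real \<Rightarrow> real)
    \<Rightarrow> (nat \<Rightarrow> real \<Rightarrow> real \<Rightarrow> real) \<Rightarrow> (real \<times> real) set \<Rightarrow> bool" where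
  "pw_periodic_orbit \<eta> \<epsilon> f g \<Gamma> \<longleftrightarrow>
     (\<exists>\<gamma> T. pw_solution \<eta> \<epsilon> f g \<gamma> UNIV \<and> T > 0 \<and> (\<forall>t. \<gamma> (t + T) = \<gamma> t) \<and>
            (\<exists>s t. \<gamma> s \<noteq> \<gamma> t) \<and> \<Gamma> = range \<gamma>)"

definition limit_cycle :: "real \<Rightarrow> real \<Rightarrow> (nat \<Rightarrow> real \<Rightarrow> real \<Rightarrow> real)
    \<Rightarrow> (nat \<Rightarrow> real \<Rightarrow> real \<Rightarrow> real) \<Rightarrow> (real \<times> real) set \<Rightarrow> bool" where
  "limit_cycle \<eta> \<epsilon> f g \<Gamma> \<longleftrightarrow>
     pw_periodic_orbit \<eta> \<epsilon> f g \<Gamma> \<and>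
     (\<exists>U. open U \<and> \<Gamma> \<subseteq> U \<and> (\<forall>\<Gamma>'. pw_periodic_orbit \<eta> \<epsilon> f g \<Gamma>' \<and> \<Gamma>' \<subseteq> U \<longrightarrow> \<Gamma>' = \<Gamma>))"

text \<open>The section \<open>{x = 0, y > \<eta>}\<close> is parametrised by \<open>y\<close>.\<close>

definition first_return :: "real \<Rightarrow> real \<Rightarrow> (nat \<Rightarrow> real \<Rightarrow> real \<Rightarrow> real)
    \<Rightarrow> (nat \<Rightarrow> real \<Rightarrow> real \<Rightarrow> real) \<Rightarrow> real \<Rightarrow> real \<Rightarrow> bool" where
  "first_return \<eta> \<epsilon> f g y0 y1 \<longleftrightarrow>
     y0 > \<eta> \<and> y1 > \<eta> \<and>
     (\<exists>\<gamma> T. T > 0 \<and> pw_solution \<eta> \<epsilon> f g \<gamma> {0..T} \<and> \<gamma> 0 = (0, y0) \<and> \<gamma> T = (0, y1) \<and>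
            (\<forall>t\<in>{0<..<T}. \<gamma> t \<notin> {(x, y). x = 0 \<and> y > \<eta>}))"

definition displacement :: "real \<Rightarrow> real \<Rightarrow> (nat \<Rightarrow> real \<Rightarrow> real \<Rightarrow> real)
    \<Rightarrow> (nat \<Rightarrow> real \<Rightarrow> real \<Rightarrow> real) \<Rightarrow> real \<Rightarrow> real" where
  "displacement \<eta> \<epsilon> f g y = (THE y'. first_return \<eta> \<epsilon> f g y y') - y"

text \<open>Order of vanishing at a point; \<open>\<infinity>\<close> if all derivatives vanish.\<close>

definition zero_mult :: "(real \<Rightarrow> real) \<Rightarrow> real \<Rightarrow> enat" where
  "zero_mult d y = Sup {enat m | m. \<forall>j<m. (deriv ^^ j) d y = 0}"

text \<open>A limit cycle encircling the center once meets the section in a single point, so the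
  supremum is just the order of the displacement map there. For small \<open>\<epsilon>\<close> no other cycle
  meets the section at a point with \<open>H \<in> K\<close>, \<open>K\<close> a compact subset of \<open>(-1/(2\<eta>), 0)\<close>.\<close>

definition cycle_mult :: "real \<Rightarrow> real \<Rightarrow> (nat \<Rightarrow> real \<Rightarrow> real \<Rightarrow> real)
    \<Rightarrow> (nat \<Rightarrow> real \<Rightarrow> real \<Rightarrow> real) \<Rightarrow> (real \<times> real) set \<Rightarrow> enat" where
  "cycle_mult \<eta> \<epsilon> f g \<Gamma> =
     (SUP y\<in>{y. y > \<eta> \<and> (0, y) \<in> \<Gamma>}. zero_mult (displacement \<eta> \<epsilon> f g) y)"

definition limit_cycles_near :: "real \<Rightarrow> real \<Rightarrow> (nat \<Rightarrow> real \<Rightarrow> real \<Rightarrow> real)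
    \<Rightarrow> (nat \<Rightarrow> real \<Rightarrow> real \<Rightarrow> real) \<Rightarrow> real set \<Rightarrow> (real \<times> real) set set" where
  "limit_cycles_near \<eta> \<epsilon> f g K =
     {\<Gamma>. limit_cycle \<eta> \<epsilon> f g \<Gamma> \<and> (\<exists>y>\<eta>. (0, y) \<in> \<Gamma> \<and> first_integral \<eta> (0, y) \<in> K)}"

definition bifurcating_limit_cycles_le :: "real \<Rightarrow> (nat \<Rightarrow> real \<Rightarrow> real \<Rightarrow> real)
    \<Rightarrow> (nat \<Rightarrow> real \<Rightarrow> real \<Rightarrow> real) \<Rightarrow> nat \<Rightarrow> bool" where
  "bifurcating_limit_cycles_le \<eta> f g N \<longleftrightarrow>
     (\<forall>K. compact K \<and> K \<subseteq> {- 1 / (2 * \<eta>)<..<0} \<longrightarrow>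
        (\<exists>\<epsilon>0>0. \<forall>\<epsilon>. 0 < \<bar>\<epsilon>\<bar> \<and> \<bar>\<epsilon>\<bar> < \<epsilon>0 \<longrightarrow>
           finite (limit_cycles_near \<eta> \<epsilon> f g K) \<and>
           (\<Sum>\<Gamma>\<in>limit_cycles_near \<eta> \<epsilon> f g K. cycle_mult \<eta> \<epsilon> f g \<Gamma>) \<le> enat N))"

end

theory Submission imports Defs "HOL-Complex_Analysis.Complex_Analysis"
begin

text \<open>
  The unperturbed system is a rotation in disguise. With \<open>\<kappa> = sqrt (2\<eta>)\<close> the map
  \<open>zeta (x, y) = (1 - \<eta>/y) + \<i> \<kappa> x/y\<close> of the upper half plane turns it into
  \<open>zeta' = \<i> \<kappa> zeta\<close>; the level orbit \<open>L\<^sub>h\<close> becomes the circle of radius \<open>s\<close> with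
  \<open>h = (s\<^sup>2 - 1)/(2\<eta>)\<close>, the period annulus becomes \<open>0 < s < 1\<close>, the four quadrants become the four
  quarter turns of the angle \<open>\<theta>\<close>, and the section \<open>{x = 0, y > \<eta>}\<close> becomes \<open>\<theta> = 0\<close>.
  In these coordinates the perturbed system reads \<open>ds/d\<theta> = \<epsilon> G\<^sub>k / (\<kappa> + \<epsilon> J\<^sub>k/s)\<close> on the
  \<open>k\<close>-th quarter turn, with \<open>G\<^sub>k\<close> and \<open>J\<^sub>k\<close> the radial and angular components of the perturbation.
  The proof has three parts.

  \<^bold>\<open>The Melnikov function has few zeros.\<close>
  To first order the radius grows over one turn by \<open>\<epsilon>\<close> times the sum \<open>mel1\<close> of the integrals of
  \<open>G\<^sub>k/\<kappa>\<close>, and \<open>M(h) = (s/\<eta>) mel1 s\<close> (\<open>melnikov_mel1\<close>; the parameter of the ellipse and the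
  angle \<open>\<theta>\<close> are related as eccentric and true anomaly). The integrands are combinations of products of powers of
  \<open>s sin \<theta>\<close> and integer powers of \<open>1 - s cos \<theta>\<close>, so recursions under the integral sign bring
  \<open>u\<^sup>N s mel1 s\<close>, with \<open>u = 1 - s\<^sup>2\<close> and \<open>N = max (n - 2) 0\<close>, to the form
  \<open>A(s) + L(u) ln (1 - s) + L'(u) ln (1 + s) + (B(u) arcsin s + C(u)) / sqrt u\<close> with \<open>deg A \<le> 2d + 3\<close>
  and the other degrees at most \<open>d = N + n div 2 + 1\<close> (\<open>mel1_log_arc_form\<close>). The derivation
  \<open>(1/s) d/ds\<close> lowers the degree of a polynomial in \<open>u\<close>, so applying it \<open>d + 1\<close> times removes the
  logarithms, and \<open>d + 1\<close> further times, after multiplication by a power of \<open>u\<close> and \<open>sqrt u\<close>, removes the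
  arcsine; a rational function remains. By Rolle's theorem each step loses at most one zero. Altogether
  \<open>mel1\<close> has at most \<open>8d + 9 \<le> 41n - 23\<close> zeros in \<open>(0, 1)\<close> with multiplicity, or vanishes there
  identically (\<open>mel1_zeros\<close>).

  \<^bold>\<open>The first return map is a holomorphic perturbation of the identity.\<close>
  Picard iteration over one turn, carried out for complex initial radii near a compact interval of real ones,
  yields the value \<open>\<sigma>(\<epsilon>, 2\<pi>, z)\<close> after one turn as a holomorphic function of the initial radius \<open>z\<close>,
  with \<open>(\<sigma> - z)/\<epsilon>\<close> converging uniformly to \<open>mel1\<close> (\<open>flow_family\<close>). Cauchy's estimates carry
  the nonvanishing of a derivative of \<open>mel1\<close> over to \<open>(\<sigma> - z)/\<epsilon>\<close>; Rolle's theorem and compactness then show that this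
  function has, on the compact interval, no more zeros with multiplicity than \<open>mel1\<close>
  (\<open>zeros_le_perturb\<close>).

  \<^bold>\<open>Limit cycles are zeros of \<open>\<sigma> - z\<close>.\<close>
  A solution of the piecewise system that starts on the section is only known to be continuous and to solve the equation off
  a locally finite set of times. Lifting its angle continuously and comparing with the
  solution in polar form by Gronwall's lemma shows that it follows the curve \<open>\<theta> \<mapsto> \<sigma>(\<epsilon>, \<theta>, s)\<close> for a full
  turn (\<open>follow\<close>). Hence the first return map exists and is \<open>\<sigma>(\<epsilon>, 2\<pi>, \<cdot>)\<close> in the coordinate \<open>s\<close>
  (\<open>displacement_eq\<close>). A periodic orbit through a section point with \<open>\<sigma> \<noteq> s\<close> is impossible: the
  spiral arc through a nearby radius, closed by a piece of the section, is a curve that can be crossed in one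
  direction only (\<open>no_return\<close>). So every periodic orbit that meets the section in the relevant range is
  the closed curve through its unique section point, and its multiplicity is the order of the zero of
  \<open>\<sigma> - z\<close> (\<open>periodic_orbit_loop\<close>, \<open>displacement_zero_vanishes\<close>).
\<close>

section \<open>Zeros of holomorphic functions on real sets, with multiplicity\<close>

text \<open>The point \<open>x\<close> is a zero of order at least \<open>m\<close>. A factorisation is used, not the vanishing of
  derivatives, because it is stable under products and substitutions by inspection.\<close>

definition vanishes :: "(complex \<Rightarrow> complex) \<Rightarrow> complex \<Rightarrow> nat \<Rightarrow> bool" where
  "vanishes F x m \<longleftrightarrow>
     (\<exists>G. G analytic_on {x} \<and> (\<forall>\<^sub>F z in nhds x. F z = (z - x) ^ m * G z))"

text \<open>Weights \<open>m\<close> below the true orders are admitted, so the definition makes sense for functions that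
  vanish identically somewhere (no bound holds then), and bounds pass to functions with fewer zeros.\<close>

definition zeros_le :: "(complex \<Rightarrow> complex) \<Rightarrow> real set \<Rightarrow> nat \<Rightarrow> bool" where
  "zeros_le F S N \<longleftrightarrow>
     (\<forall>X m. finite X \<and> X \<subseteq> S \<and> (\<forall>x\<in>X. vanishes F (of_real x) (m x)) \<longrightarrow> sum m X \<le> N)"

definition zeros_bd :: "(complex \<Rightarrow> complex) \<Rightarrow> real set \<Rightarrow> nat \<Rightarrow> bool" where
  "zeros_bd F S N \<longleftrightarrow> (\<forall>x\<in>S. F (of_real x) = 0) \<or> zeros_le F S N"

definition real_on :: "real set \<Rightarrow> (complex \<Rightarrow> complex) \<Rightarrow> bool" where
  "real_on S F \<longleftrightarrow> (\<forall>x\<in>S. F (of_real x) \<in> \<real>)"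

lemma vanishesI:
  assumes "G analytic_on {x}" "open U" "x \<in> U" "\<And>z. z \<in> U \<Longrightarrow> F z = (z - x) ^ m * G z"
  shows "vanishes F x m"
  unfolding vanishes_def eventually_nhds using assms by blast

lemma vanishesE:
  assumes "vanishes F x m"
  obtains G U where "open U" "x \<in> U" "G holomorphic_on U" "\<And>z. z \<in> U \<Longrightarrow> F z = (z - x) ^ m * G z"
proof -
  obtain G where G: "G analytic_on {x}" "\<forall>\<^sub>F z in nhds x. F z = (z - x) ^ m * G z"
    using assms by (auto simp: vanishes_def)
  obtain V where V: "open V" "x \<in> V" "G holomorphic_on V"
    using G(1) by (auto simp: analytic_at)
  obtain W where W: "open W" "x \<in> W" "\<And>z. z \<in> W \<Longrightarrow> F z = (z - x) ^ m * G z"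
    using G(2) by (auto simp: eventually_nhds)
  show ?thesis
    by (rule that[of "V \<inter> W" G]) (use V W in \<open>auto intro: holomorphic_on_subset\<close>)
qed

lemma vanishes_mult:
  assumes "vanishes F x m" "W analytic_on {x}"
  shows "vanishes (\<lambda>z. W z * F z) x m"
proof -
  obtain G where G: "G analytic_on {x}" "\<forall>\<^sub>F z in nhds x. F z = (z - x) ^ m * G z"
    using assms by (auto simp: vanishes_def)
  have "\<forall>\<^sub>F z in nhds x. W z * F z = (z - x) ^ m * (W z * G z)"
    using G(2) by eventually_elim simp
  then show ?thesis unfolding vanishes_def
    by (intro exI[of _ "\<lambda>z. W z * G z"] conjI analytic_on_mult assms G)
qed

lemma vanishes_cong:
  assumes "vanishes F x m" "open U" "x \<in> U" "\<And>z. z \<in> U \<Longrightarrow> F z = H z"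
  shows "vanishes H x m"
proof -
  obtain G where G: "G analytic_on {x}" "\<forall>\<^sub>F z in nhds x. F z = (z - x) ^ m * G z"
    using assms by (auto simp: vanishes_def)
  have "\<forall>\<^sub>F z in nhds x. z \<in> U" using assms(2,3) by (simp add: eventually_nhds_in_open)
  with G(2) have "\<forall>\<^sub>F z in nhds x. H z = (z - x) ^ m * G z"
    by eventually_elim (simp add: assms(4)[symmetric])
  then show ?thesis unfolding vanishes_def using G(1) by blast
qed

lemma vanishes_Suc_zero: "vanishes F x (Suc m) \<Longrightarrow> F x = 0"
  by (auto elim!: vanishesE)

text \<open>The difference quotient of \<open>\<phi>\<close> at \<open>x\<close> extends holomorphically over \<open>x\<close>; its \<open>m\<close>-th power
  is the factor that turns \<open>(\<phi> z - \<phi> x)\<^sup>m\<close> into \<open>(z - x)\<^sup>m\<close>.\<close>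

lemma vanishes_compose:
  assumes "vanishes F (\<phi> x) m" "\<phi> analytic_on {x}"
  shows "vanishes (\<lambda>z. F (\<phi> z)) x m"
proof -
  obtain G U where G: "open U" "\<phi> x \<in> U" "G holomorphic_on U"
    "\<And>z. z \<in> U \<Longrightarrow> F z = (z - \<phi> x) ^ m * G z"
    using assms(1) by (rule vanishesE) blast
  obtain V where V: "open V" "x \<in> V" "\<phi> holomorphic_on V"
    using assms(2) by (auto simp: analytic_at)
  define W where "W = V \<inter> \<phi> -` U"
  have W: "open W" unfolding W_def
    by (rule continuous_open_preimage) (use V G in \<open>auto intro: holomorphic_on_imp_continuous_on\<close>)
  have xW: "x \<in> W" using V G by (simp add: W_def)
  define \<psi> where "\<psi> z = (if z = x then deriv \<phi> x else (\<phi> z - \<phi> x) / (z - x))" for z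
  have "\<psi> holomorphic_on W"
  proof -
    have "\<phi> holomorphic_on W" using V(3) by (rule holomorphic_on_subset) (auto simp: W_def)
    then have "(\<lambda>z. if z = x then deriv \<phi> x else (\<phi> z - \<phi> x) / (z - x)) holomorphic_on W"
      by (rule pole_lemma_open[OF _ W])
    then show ?thesis by (simp add: \<psi>_def[abs_def])
  qed
  moreover have "(\<lambda>z. G (\<phi> z)) holomorphic_on W"
    using holomorphic_on_compose_gen[OF _ G(3), of \<phi> W] V(3)
    by (auto simp: W_def o_def intro: holomorphic_on_subset)
  ultimately have "(\<lambda>z. \<psi> z ^ m * G (\<phi> z)) holomorphic_on W"
    by (intro holomorphic_intros)
  then have an: "(\<lambda>z. \<psi> z ^ m * G (\<phi> z)) analytic_on {x}"
    using W xW by (auto simp: analytic_at)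
  have "\<phi> z - \<phi> x = (z - x) * \<psi> z" for z by (simp add: \<psi>_def)
  then have "F (\<phi> z) = (z - x) ^ m * (\<psi> z ^ m * G (\<phi> z))" if "z \<in> W" for z
    using that G(4)[of "\<phi> z"] by (simp add: W_def power_mult_distrib)
  from vanishesI[OF an W xW this] show ?thesis .
qed

lemma vanishes_deriv:
  assumes "vanishes F x (Suc m)"
  shows "vanishes (deriv F) x m"
proof -
  obtain G U where G: "open U" "x \<in> U" "G holomorphic_on U"
    "\<And>z. z \<in> U \<Longrightarrow> F z = (z - x) ^ Suc m * G z"
    using assms by (rule vanishesE) blast
  have "deriv F z = (z - x) ^ m * (of_nat (Suc m) * G z + (z - x) * deriv G z)" if z: "z \<in> U" for z
  proof -
    have "(G has_field_derivative deriv G z) (at z)"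
      using G(1,3) z by (simp add: holomorphic_derivI)
    then have "((\<lambda>z. (z - x) ^ Suc m * G z) has_field_derivative
        (z - x) ^ m * (of_nat (Suc m) * G z + (z - x) * deriv G z)) (at z)"
      by (auto intro!: derivative_eq_intros simp: algebra_simps simp del: power_Suc)
        (simp add: algebra_simps)
    then have "(F has_field_derivative
        (z - x) ^ m * (of_nat (Suc m) * G z + (z - x) * deriv G z)) (at z)"
      by (rule has_field_derivative_transform_within_open[OF _ G(1) z]) (use G(4) in auto)
    then show ?thesis by (rule DERIV_imp_deriv)
  qed
  moreover have "(\<lambda>z. of_nat (Suc m) * G z + (z - x) * deriv G z) holomorphic_on U"
    using G by (intro holomorphic_intros) auto
  then have "(\<lambda>z. of_nat (Suc m) * G z + (z - x) * deriv G z) analytic_on {x}"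
    using G by (auto simp: analytic_at)
  ultimately show ?thesis using vanishesI G(1,2) by blast
qed

lemma vanishes_higher_deriv:
  assumes "F holomorphic_on U" "open U" "x \<in> U" "\<And>j. j < m \<Longrightarrow> (deriv ^^ j) F x = 0"
  shows "vanishes F x m"
proof (cases "\<forall>j. (deriv ^^ j) F x = 0")
  case True
  obtain r where r: "r > 0" "ball x r \<subseteq> U" using assms(2,3) openE by blast
  have "F z = 0" if "z \<in> ball x r" for z
    by (rule holomorphic_fun_eq_0_on_ball[of F x r])
      (use r assms(1) True that in \<open>auto intro: holomorphic_on_subset\<close>)
  then show ?thesis
    by (intro vanishesI[of "\<lambda>_. 0" x "ball x r"]) (use r in auto)
next
  case False
  define n where "n = (LEAST j. (deriv ^^ j) F x \<noteq> 0)"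
  have n: "(deriv ^^ n) F x \<noteq> 0" "\<And>j. j < n \<Longrightarrow> (deriv ^^ j) F x = 0"
    using False LeastI_ex[of "\<lambda>j. (deriv ^^ j) F x \<noteq> 0"] not_less_Least
    unfolding n_def by auto
  have mn: "m \<le> n" using n(1) assms(4) by (meson not_le)
  show ?thesis
  proof (cases "n = 0")
    case True
    with mn have "m = 0" by simp
    with assms show ?thesis
      by (intro vanishesI[of F x U]) (auto simp: analytic_at)
  next
    case n0: False
    obtain g r where g: "0 < r" "g holomorphic_on ball x r"
      "\<And>w. w \<in> ball x r \<Longrightarrow> F w - F x = (w - x) ^ n * g w"
      by (rule holomorphic_factor_order_of_zero[OF assms(1-3) _ n(1)]) (use n n0 in auto)
    have "F x = 0" using n(2)[of 0] n0 by simp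
    then have "F w = (w - x) ^ m * ((w - x) ^ (n - m) * g w)" if "w \<in> ball x r" for w
      using g(3)[OF that] mn by (simp add: mult.assoc[symmetric] power_add[symmetric])
    moreover have "(\<lambda>w. (w - x) ^ (n - m) * g w) holomorphic_on ball x r"
      by (intro holomorphic_intros g)
    then have "(\<lambda>w. (w - x) ^ (n - m) * g w) analytic_on {x}"
      using g(1) by (auto simp: analytic_at intro!: exI[of _ "ball x r"])
    ultimately show ?thesis
      by (intro vanishesI[of _ x "ball x r"]) (use g(1) in auto)
  qed
qed

lemma zeros_le_mono: "zeros_le F S N \<Longrightarrow> N \<le> N' \<Longrightarrow> zeros_le F S N'"
  unfolding zeros_le_def by (meson le_trans)

lemma zeros_bd_mono: "zeros_bd F S N \<Longrightarrow> N \<le> N' \<Longrightarrow> zeros_bd F S N'"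
  unfolding zeros_bd_def using zeros_le_mono by blast

lemma zeros_le_subset: "zeros_le F S N \<Longrightarrow> T \<subseteq> S \<Longrightarrow> zeros_le F T N"
  unfolding zeros_le_def by (meson subset_trans)

lemma zeros_le_0I:
  assumes "\<And>x. x \<in> S \<Longrightarrow> F (of_real x) \<noteq> 0"
  shows "zeros_le F S 0"
  unfolding zeros_le_def
proof (intro allI impI, elim conjE)
  fix X and m :: "real \<Rightarrow> nat"
  assume X: "finite X" "X \<subseteq> S" "\<forall>x\<in>X. vanishes F (of_real x) (m x)"
  have "m x = 0" if "x \<in> X" for x
  proof (cases "m x")
    case (Suc k)
    have "vanishes F (of_real x) (Suc k)" using X(3) that Suc by force
    then show ?thesis using vanishes_Suc_zero assms X(2) that by blast
  qed
  then show "sum m X \<le> 0" by simp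
qed

lemma zeros_bd_unit:
  assumes "zeros_bd (\<lambda>z. W z * F z) S N" "open U" "of_real ` S \<subseteq> U" "W holomorphic_on U"
    "\<And>z. z \<in> U \<Longrightarrow> W z \<noteq> 0"
  shows "zeros_bd F S N"
proof (cases "\<forall>x\<in>S. F (of_real x) = 0")
  case False
  then obtain x where "x \<in> S" "F (of_real x) \<noteq> 0" by blast
  then have "zeros_le (\<lambda>z. W z * F z) S N"
    using assms unfolding zeros_bd_def by auto
  moreover have "vanishes (\<lambda>z. W z * F z) (of_real x) k"
    if "x \<in> S" "vanishes F (of_real x) k" for x k
    using that assms(2-4) by (intro vanishes_mult) (auto simp: analytic_at)
  ultimately have "zeros_le F S N" unfolding zeros_le_def by (meson subsetD)
  then show ?thesis by (simp add: zeros_bd_def)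
qed (simp add: zeros_bd_def)

lemma real_on_deriv:
  assumes "real_on S F" "open S" "open U" "of_real ` S \<subseteq> U" "F holomorphic_on U" "x \<in> S"
  shows "deriv F (of_real x) \<in> \<real>"
    and "((\<lambda>t. Re (F (of_real t))) has_real_derivative Re (deriv F (of_real x))) (at x)"
proof -
  have D: "(F has_field_derivative deriv F (of_real x)) (at (of_real x))"
    using assms by (auto intro: holomorphic_derivI)
  have V: "((\<lambda>t. F (of_real t)) has_vector_derivative deriv F (of_real x)) (at x)"
    using has_vector_derivative_real_field[OF D] .
  show "((\<lambda>t. Re (F (of_real t))) has_real_derivative Re (deriv F (of_real x))) (at x)"
    using bounded_linear.has_vector_derivative[OF bounded_linear_Re V]
    by (simp add: has_real_derivative_iff_has_vector_derivative)
  have "((\<lambda>t. Im (F (of_real t))) has_real_derivative Im (deriv F (of_real x))) (at x)"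
    using bounded_linear.has_vector_derivative[OF bounded_linear_Im V]
    by (simp add: has_real_derivative_iff_has_vector_derivative)
  then have "((\<lambda>t. 0) has_real_derivative Im (deriv F (of_real x))) (at x)"
    by (rule has_field_derivative_transform_within_open[OF _ assms(2,6)])
      (use assms(1) in \<open>auto simp: real_on_def complex_is_Real_iff\<close>)
  then have "Im (deriv F (of_real x)) = 0" using DERIV_unique DERIV_const by blast
  then show "deriv F (of_real x) \<in> \<real>" by (simp add: complex_is_Real_iff)
qed

text \<open>Induction on the largest zero: Rolle's theorem supplies a critical point between the two largest
  zeros. That all critical points lie below \<open>Max X\<close> keeps the new one different from the old ones.\<close>

lemma critical_points_between:
  fixes f f' :: "real \<Rightarrow> real"
  assumes "finite X" "X \<noteq> {}" "X \<subseteq> S" "is_interval S"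
    and "\<And>x. x \<in> S \<Longrightarrow> (f has_real_derivative f' x) (at x)"
    and "\<And>x. x \<in> X \<Longrightarrow> f x = 0"
  shows "\<exists>Y. finite Y \<and> Y \<subseteq> S \<and> Y \<inter> X = {} \<and> card Y + 1 = card X \<and> (\<forall>y\<in>Y. y < Max X \<and> f' y = 0)"
  using assms(1-3,6)
proof (induction X rule: finite_linorder_max_induct)
  case (insert b A)
  show ?case
  proof (cases "A = {}")
    case True
    then show ?thesis by (intro exI[of _ "{}"]) auto
  next
    case False
    then obtain Y where Y: "finite Y" "Y \<subseteq> S" "Y \<inter> A = {}" "card Y + 1 = card A"
      "\<forall>y\<in>Y. y < Max A \<and> f' y = 0" using insert by auto
    define a where "a = Max A"
    have a: "a \<in> A" "a < b" using insert False by (auto simp: a_def)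
    have sub: "{a..b} \<subseteq> S"
      using assms(4) a insert.prems by (auto simp: is_interval_1 subset_iff)
    have "\<exists>z. a < z \<and> z < b \<and> DERIV f z :> 0"
    proof (rule Rolle)
      show "f a = f b" using insert.prems a by auto
      show "continuous_on {a..b} f"
        using sub assms(5) by (intro continuous_at_imp_continuous_on) (auto intro: DERIV_isCont)
      show "f differentiable (at x)" if "a < x" "x < b" for x
      proof -
        have "x \<in> S" using sub that by auto
        from assms(5)[OF this] show ?thesis by (auto simp: real_differentiable_def)
      qed
    qed (use a in auto)
    then obtain z where z: "a < z" "z < b" "DERIV f z :> 0" by blast
    have "z \<in> S" using z sub by auto
    with z have "f' z = 0" using assms(5) DERIV_unique by blast
    have zY: "z \<notin> Y" "z \<notin> A"
      using Y(5) z insert.hyps(1) unfolding a_def by (force, meson Max_ge not_le)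
    have mx: "Max (insert b A) = b"
      using insert by (intro Max_eqI) auto
    have "y < b" if "y \<in> Y" for y using Y(5) that a by (force simp: a_def)
    then show ?thesis unfolding mx
      using Y zY z \<open>z \<in> S\<close> \<open>f' z = 0\<close> insert.hyps a
      by (intro exI[of _ "insert z Y"]) (auto simp: a_def)
  qed
qed simp

text \<open>A zero of order \<open>m\<close> of \<open>F\<close> is a zero of order \<open>m - 1\<close> of the derivative, and there is a further
  zero of the derivative between consecutive zeros of \<open>F\<close>.\<close>

lemma Rolle_zeros_le:
  assumes "zeros_le (deriv F) S N"
    and "real_on S F" "open S" "is_interval S" "open U" "of_real ` S \<subseteq> U" "F holomorphic_on U"
  shows "zeros_le F S (Suc N)"
  unfolding zeros_le_def
proof (intro allI impI, elim conjE)
  fix X and m :: "real \<Rightarrow> nat"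
  assume X: "finite X" "X \<subseteq> S" "\<forall>x\<in>X. vanishes F (of_real x) (m x)"
  define X0 where "X0 = {x \<in> X. m x > 0}"
  have sumX: "sum m X = sum m X0" using X(1) by (intro sum.mono_neutral_right) (auto simp: X0_def)
  show "sum m X \<le> Suc N"
  proof (cases "X0 = {}")
    case False
    have fin: "finite X0" "X0 \<subseteq> S" using X by (auto simp: X0_def)
    have "F (of_real x) = 0" if "x \<in> X0" for x
    proof -
      have "m x \<noteq> 0" using that by (simp add: X0_def)
      then obtain k where "m x = Suc k" using not0_implies_Suc by blast
      then show ?thesis using X(3) that vanishes_Suc_zero by (auto simp: X0_def)
    qed
    then obtain Y where Y: "finite Y" "Y \<subseteq> S" "Y \<inter> X0 = {}" "card Y + 1 = card X0"
      "\<forall>y\<in>Y. y < Max X0 \<and> Re (deriv F (of_real y)) = 0"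
      using critical_points_between[OF fin(1) False fin(2) assms(4) real_on_deriv(2)[OF assms(2,3,5-7)]]
      by auto
    (* The weights that the derivative inherits at the old zeros, and weight one at the new ones. *)
    define m' where "m' x = (if x \<in> X0 then m x - 1 else 1)" for x
    have "vanishes (deriv F) (of_real x) (m' x)" if "x \<in> X0 \<union> Y" for x
    proof (cases "x \<in> X0")
      case True
      then have "vanishes F (of_real x) (Suc (m' x))" using X(3) by (auto simp: X0_def m'_def)
      then show ?thesis by (rule vanishes_deriv)
    next
      case xn: False
      then have "x \<in> S" "Re (deriv F (of_real x)) = 0" using that Y by auto
      then have "deriv F (of_real x) = 0"
        using real_on_deriv(1)[OF assms(2,3,5-7)] by (simp add: complex_eq_iff complex_is_Real_iff)
      then show ?thesis
        using xn \<open>x \<in> S\<close> assms(5-7)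
        by (intro vanishes_higher_deriv[of _ U]) (auto simp: m'_def intro: holomorphic_deriv)
    qed
    then have le: "sum m' (X0 \<union> Y) \<le> N"
      using fin Y(1,2) by (intro assms(1)[unfolded zeros_le_def, rule_format]) simp
    have "sum m' (X0 \<union> Y) = sum m' X0 + sum m' Y"
      using fin Y by (intro sum.union_disjoint) auto
    also have "sum m' Y = card Y"
      using Y(3) by (subst sum.cong[of Y Y m' "\<lambda>_. 1"]) (auto simp: m'_def)
    also have "sum m' X0 = sum m X0 - card X0"
    proof -
      have "sum m X0 = (\<Sum>x\<in>X0. m' x + 1)" by (intro sum.cong) (auto simp: m'_def X0_def)
      also have "\<dots> = sum m' X0 + card X0" by (subst sum.distrib) simp
      finally show ?thesis by simp
    qed
    finally show ?thesis using le Y(4) sumX by linarith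
  qed (use sumX in simp)
qed

text \<open>If the derivative vanishes identically then \<open>F\<close> is constant on the interval: it is zero, or it has no
  zeros.\<close>

lemma Rolle_zeros_bd:
  assumes "zeros_bd (deriv F) S N"
    and "real_on S F" "open S" "is_interval S" "open U" "of_real ` S \<subseteq> U" "F holomorphic_on U"
  shows "zeros_bd F S (Suc N)"
proof (cases "zeros_le (deriv F) S N")
  case True
  then show ?thesis using Rolle_zeros_le assms(2-) by (auto simp: zeros_bd_def)
next
  case False
  then have z: "deriv F (of_real x) = 0" if "x \<in> S" for x using assms(1) that by (auto simp: zeros_bd_def)
  have const: "Re (F (of_real x)) = Re (F (of_real y))" if "x \<in> S" "y \<in> S" for x y
  proof (rule has_field_derivative_zero_constant[of S "\<lambda>t. Re (F (of_real t))", THEN exE])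
    show "convex S" using assms(4) is_interval_convex by blast
    show "((\<lambda>t. Re (F (of_real t))) has_real_derivative 0) (at x within S)" if "x \<in> S" for x
      using real_on_deriv(2)[OF assms(2,3,5-7) that] z[OF that]
      by (auto intro: has_field_derivative_at_within)
  qed (use that in auto)
  have F: "F (of_real x) = of_real (Re (F (of_real x)))" if "x \<in> S" for x
    using assms(2) that by (simp add: real_on_def)
  show ?thesis
  proof (cases "\<exists>x\<in>S. F (of_real x) = 0")
    case True
    then obtain x0 where x0: "x0 \<in> S" "F (of_real x0) = 0" by blast
    have "F (of_real x) = 0" if "x \<in> S" for x
      using F[OF that] const[OF that x0(1)] x0(2) by simp
    then show ?thesis by (simp add: zeros_bd_def)
  next
    case False
    then have "zeros_le F S 0" by (intro zeros_le_0I) auto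
    then show ?thesis using zeros_le_mono zeros_bd_def by blast
  qed
qed

lemma poly_holo: "poly (A :: complex poly) holomorphic_on S"
  unfolding holomorphic_on_def field_differentiable_def
  using poly_DERIV has_field_derivative_at_within by blast

lemma zeros_bd_poly:
  fixes A :: "complex poly"
  assumes "real_on S (poly A)" "open S" "is_interval S" "degree A \<le> D"
  shows "zeros_bd (poly A) S D"
  using assms(1,4)
proof (induction D arbitrary: A)
  case 0
  then obtain c where "A = [:c:]" using degree_eq_zeroE by auto
  show ?case
  proof (cases "c = 0")
    case False
    have "zeros_le (poly A) S 0" by (rule zeros_le_0I) (use False \<open>A = [:c:]\<close> in simp)
    then show ?thesis unfolding zeros_bd_def by blast
  qed (use \<open>A = [:c:]\<close> in \<open>simp add: zeros_bd_def\<close>)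
next
  case (Suc D)
  have d: "deriv (poly A) = poly (pderiv A)" by (rule ext) (simp add: DERIV_imp_deriv)
  have r: "real_on S (poly (pderiv A))"
    unfolding real_on_def d[symmetric]
    by (intro ballI real_on_deriv(1)[OF Suc.prems(1) assms(2) open_UNIV subset_UNIV poly_holo])
  have "degree (pderiv A) \<le> D" using Suc.prems(2) degree_pderiv[of A] by linarith
  from Suc.IH[OF r this] have "zeros_bd (deriv (poly A)) S D" unfolding d .
  then show ?case
    by (rule Rolle_zeros_bd[OF _ Suc.prems(1) assms(2,3) open_UNIV subset_UNIV poly_holo])
qed

section \<open>Rolle counts for polynomials in logarithms and an arcsine\<close>

text \<open>The functions to be counted are holomorphic on this strip: \<open>1 - z\<^sup>2\<close>, \<open>1 - z\<close> and \<open>1 + z\<close> avoid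
  the cuts of the principal branches there.\<close>

definition strip :: "complex set" where "strip = {z. 0 < Re z \<and> Re z < 1}"

abbreviation uu :: "complex \<Rightarrow> complex" where "uu z \<equiv> 1 - z\<^sup>2"
abbreviation ww :: "complex \<Rightarrow> complex" where "ww z \<equiv> csqrt (1 - z\<^sup>2)"

lemma strip_open: "open strip"
  unfolding strip_def by (simp add: open_Collect_conj open_Collect_less continuous_on_Re)

lemma strip_convex: "convex strip"
proof -
  have eq: "strip = {z. Re z > 0} \<inter> {z. Re z < 1}" by (auto simp: strip_def)
  show ?thesis unfolding eq by (intro convex_Int convex_halfspace_Re_gt convex_halfspace_Re_lt)
qed

lemma of_real_strip: "of_real ` {0<..<1} \<subseteq> strip" by (auto simp: strip_def)

lemma strip_nonpos:
  assumes "z \<in> strip"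
  shows "1 - z\<^sup>2 \<notin> \<real>\<^sub>\<le>\<^sub>0" "z \<noteq> 0" "1 - z\<^sup>2 \<noteq> 0" "1 - z \<notin> \<real>\<^sub>\<le>\<^sub>0" "1 + z \<notin> \<real>\<^sub>\<le>\<^sub>0" "ww z \<noteq> 0" "Im z = 0 \<Longrightarrow> \<bar>Re z\<bar> < 1"
proof -
  show 1: "1 - z\<^sup>2 \<notin> \<real>\<^sub>\<le>\<^sub>0"
    using assms by (intro one_minus_z2_notin_nonpos_Reals) (auto simp: strip_def)
  then show "1 - z\<^sup>2 \<noteq> 0" by force
  then show "ww z \<noteq> 0" by simp
  show "z \<noteq> 0" "1 - z \<notin> \<real>\<^sub>\<le>\<^sub>0" "1 + z \<notin> \<real>\<^sub>\<le>\<^sub>0" "Im z = 0 \<Longrightarrow> \<bar>Re z\<bar> < 1"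
    using assms by (auto simp: strip_def complex_nonpos_Reals_iff)
qed

lemma ww_deriv: "z \<in> strip \<Longrightarrow> (ww has_field_derivative - z / ww z) (at z)"
  using strip_nonpos[of z] by (auto intro!: derivative_eq_intros simp: field_simps)

lemma cos_Arcsin_strip: "z \<in> strip \<Longrightarrow> cos (Arcsin z) = ww z"
  using strip_nonpos[of z] by (intro cos_Arcsin) (auto simp: strip_def)

lemma Arcsin_deriv: "z \<in> strip \<Longrightarrow> (Arcsin has_field_derivative 1 / ww z) (at z)"
  using strip_nonpos[of z] has_field_derivative_Arcsin[of z]
  by (simp add: cos_Arcsin_strip field_simps)

lemma poly_uu_deriv:
  "((\<lambda>z. poly B (uu z)) has_field_derivative - 2 * z * poly (pderiv B) (uu z)) (at z)"
  by (rule DERIV_chain2[OF poly_DERIV, THEN DERIV_cong]) (auto intro!: derivative_eq_intros)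

text \<open>The numerator of \<open>(1/z) d/dz (A / (z\<^sup>a (1 - z\<^sup>2)\<^sup>b))\<close> over the denominator with both exponents raised (by
  two and by one).\<close>

definition quotient_numerator :: "nat \<Rightarrow> nat \<Rightarrow> complex poly \<Rightarrow> complex poly" where
  "quotient_numerator a b A = pderiv A * [:0, 1, 0, -1:] - smult (of_nat a) (A * [:1, 0, -1:])
      + smult (2 * of_nat b) (A * [:0, 0, 1:])"

lemma poly_quotient_numerator:
  "poly (quotient_numerator a b A) z = poly (pderiv A) z * (z * uu z) - of_nat a * (poly A z * uu z)
      + 2 * of_nat b * (poly A z * z\<^sup>2)"
  by (simp add: quotient_numerator_def algebra_simps power2_eq_square)

lemma degree_mult_le3: "degree (p :: complex poly) \<le> k \<Longrightarrow> degree q \<le> l \<Longrightarrow> degree (p * q) \<le> k + l"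
  by (meson add_mono degree_mult_le order_trans)

lemma degree_quotient_numerator: "degree A \<le> D \<Longrightarrow> degree (quotient_numerator a b A) \<le> D + 2"
proof -
  assume A: "degree A \<le> D"
  have 1: "degree (pderiv A * [:0, 1, 0, -1:]) \<le> D + 2"
  proof (cases "degree A = 0")
    case True
    then have "pderiv A = 0" by (simp add: pderiv_eq_0_iff)
    then show ?thesis by simp
  next
    case False
    have "degree (pderiv A * [:0, 1, 0, -1:]) \<le> (degree A - 1) + 3"
      by (intro degree_mult_le3) (auto simp: degree_pderiv)
    then show ?thesis using False A by linarith
  qed
  have 2: "degree (A * [:1, 0, -1:]) \<le> D + 2" "degree (A * [:0, 0, 1:]) \<le> D + 2"
    by (rule degree_mult_le3[OF A]; simp)+
  show ?thesis unfolding quotient_numerator_def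
    by (intro degree_add_le degree_diff_le 1 order_trans[OF degree_smult_le] 2)
qed

lemma zpow_deriv: "(z::complex) \<noteq> 0 \<Longrightarrow> ((\<lambda>z. z ^ a) has_field_derivative of_nat a * z ^ a / z) (at z)"
proof (cases a)
  case (Suc k)
  have "((\<lambda>z::complex. z ^ Suc k) has_field_derivative of_nat (Suc k) * z ^ k) (at z)"
    by (rule derivative_eq_intros refl | simp del: power_Suc)+
  moreover assume "z \<noteq> 0"
  ultimately show ?thesis using Suc by simp
qed simp

lemma upow_deriv: "uu z \<noteq> 0 \<Longrightarrow>
    ((\<lambda>z. uu z ^ b) has_field_derivative - 2 * z * (of_nat b * uu z ^ b / uu z)) (at z)"
  by (rule DERIV_chain2[OF zpow_deriv, THEN DERIV_cong]) (auto intro!: derivative_eq_intros)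

lemma rat_deriv:
  assumes "z \<in> strip"
  shows "((\<lambda>z. poly A z / (z ^ a * uu z ^ b)) has_field_derivative
            z * (poly (quotient_numerator a b A) z / (z ^ (a + 2) * uu z ^ (b + 1)))) (at z)"
proof -
  note nz = strip_nonpos[OF assms]
  have *: "((\<lambda>z. poly A z / (z ^ a * uu z ^ b)) has_field_derivative
      (poly (pderiv A) z * (z ^ a * uu z ^ b) - poly A z *
        (of_nat a * z ^ a / z * uu z ^ b + (- 2 * z * (of_nat b * uu z ^ b / uu z)) * z ^ a))
       / ((z ^ a * uu z ^ b) * (z ^ a * uu z ^ b))) (at z)"
    using nz by (intro DERIV_divide DERIV_mult poly_DERIV zpow_deriv upow_deriv) auto
  define Z U u where "Z = z ^ a" and "U = uu z ^ b" and "u = uu z"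
  have "Z \<noteq> 0" "U \<noteq> 0" "u \<noteq> 0" using nz by (auto simp: Z_def U_def u_def)
  then have "(poly (pderiv A) z * (Z * U) - poly A z *
        (of_nat a * Z / z * U + (- 2 * z * (of_nat b * U / u)) * Z)) / ((Z * U) * (Z * U))
      = z * ((poly (pderiv A) z * (z * u) - of_nat a * (poly A z * u) + 2 * of_nat b * (poly A z * z\<^sup>2))
          / (Z * z\<^sup>2 * (U * u)))"
    using nz(2) by (simp add: field_simps power2_eq_square)
  then have "(poly (pderiv A) z * (z ^ a * uu z ^ b) - poly A z *
        (of_nat a * z ^ a / z * uu z ^ b + (- 2 * z * (of_nat b * uu z ^ b / uu z)) * z ^ a))
       / ((z ^ a * uu z ^ b) * (z ^ a * uu z ^ b))
     = z * (poly (quotient_numerator a b A) z / (z ^ (a + 2) * uu z ^ (b + 1)))"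
  proof -
    have e: "z ^ (a + 2) * uu z ^ (b + 1) = Z * z\<^sup>2 * (U * u)"
      by (simp add: Z_def U_def u_def power_add power2_eq_square)
    show ?thesis unfolding e poly_quotient_numerator using \<open>_ = z * (_ / _)\<close> unfolding Z_def U_def u_def .
  qed
  with * show ?thesis by simp
qed

text \<open>The condition on the coefficients bounds the degree by \<open>e\<close>. In this form degree bounds for
  polynomials that eventually become zero can be lowered through zero: \<open>\<forall>i\<ge>0. coeff B i = 0\<close> says \<open>B = 0\<close>.\<close>

lemma degree_ucomp:
  assumes "\<And>i. i \<ge> Suc e \<Longrightarrow> coeff B i = 0"
  shows "degree (pcompose B [:1, 0, -1 :: complex:]) \<le> 2 * e"
proof -
  have "degree B \<le> e" using assms by (intro degree_le) auto
  then show ?thesis by (simp add: degree_pcompose)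
qed

lemma poly_ucomp: "poly (pcompose B [:1, 0, -1 :: complex:]) z = poly B (uu z)"
  by (simp add: poly_pcompose power2_eq_square)

lemma zeros_bd_cong:
  assumes "zeros_bd F S N" "open U" "of_real ` S \<subseteq> U" "\<And>z. z \<in> U \<Longrightarrow> F z = H z"
  shows "zeros_bd H S N"
proof -
  have "vanishes F (of_real x) k" if "vanishes H (of_real x) k" "x \<in> S" for x k
    by (rule vanishes_cong[OF that(1) assms(2)]) (use that assms in auto)
  then have "zeros_le F S N \<Longrightarrow> zeros_le H S N" unfolding zeros_le_def by (meson subsetD)
  moreover have "F (of_real x) = H (of_real x)" if "x \<in> S" for x using that assms by auto
  ultimately show ?thesis using assms(1) by (auto simp: zeros_bd_def)
qed

lemma real_on_mult: "real_on S F \<Longrightarrow> real_on S H \<Longrightarrow> real_on S (\<lambda>z. F z * H z)"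
  by (simp add: real_on_def)

lemma ww_of_real: "x \<in> {0<..<1} \<Longrightarrow> ww (of_real x) = of_real (sqrt (1 - x\<^sup>2))"
proof -
  assume "x \<in> {0<..<1}"
  then have "x\<^sup>2 \<le> 1" by (simp add: power_le_one)
  then have "csqrt (of_real (1 - x\<^sup>2)) = of_real (sqrt (1 - x\<^sup>2))" by (subst csqrt_of_real_nonneg) auto
  then show ?thesis by simp
qed

lemma real_on_ww: "real_on {0<..<1} ww"
  unfolding real_on_def by (auto simp: ww_of_real simp del: of_real_diff)

lemma real_on_inverse: "real_on S F \<Longrightarrow> real_on S (\<lambda>z. inverse (F z))"
  by (simp add: real_on_def)

text \<open>Rolle's theorem for the derivation \<open>(1/z) d/dz\<close>, which differs from \<open>d/dz\<close> by a factor without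
  zeros.\<close>

lemma delta_step:
  assumes "G holomorphic_on strip" "real_on {0<..<1} G"
    and "\<And>z. z \<in> strip \<Longrightarrow> (G has_field_derivative z * H z) (at z)"
    and "H holomorphic_on strip \<Longrightarrow> real_on {0<..<1} H \<Longrightarrow> zeros_bd H {0<..<1} N"
  shows "zeros_bd G {0<..<1} (Suc N)"
proof -
  have d: "deriv G z = z * H z" if "z \<in> strip" for z using assms(3)[OF that] by (rule DERIV_imp_deriv)
  have H: "H z = inverse z * deriv G z" if "z \<in> strip" for z
    using d[OF that] strip_nonpos(2)[OF that] by simp
  have "(\<lambda>z. inverse z * deriv G z) holomorphic_on strip"
    using strip_nonpos(2) by (intro holomorphic_intros assms strip_open) auto
  then have h: "H holomorphic_on strip" by (rule holomorphic_transform) (simp add: H)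
  have "real_on {0<..<1} H" unfolding real_on_def
  proof
    fix x :: real assume x: "x \<in> {0<..<1}"
    have "deriv G (of_real x) \<in> \<real>"
      by (rule real_on_deriv(1)[OF assms(2) open_greaterThanLessThan strip_open of_real_strip assms(1) x])
    moreover have "complex_of_real x \<in> strip" using of_real_strip x by auto
    ultimately show "H (of_real x) \<in> \<real>" using H by simp
  qed
  from assms(4)[OF h this] have "zeros_bd (\<lambda>z. inverse z * deriv G z) {0<..<1} N"
    by (rule zeros_bd_cong[OF _ strip_open of_real_strip]) (simp add: H)
  then have "zeros_bd (deriv G) {0<..<1} N"
    by (rule zeros_bd_unit[OF _ strip_open of_real_strip])
       (use strip_nonpos(2) in \<open>auto intro!: holomorphic_intros\<close>)
  then show ?thesis
    by (rule Rolle_zeros_bd[OF _ assms(2) open_greaterThanLessThan _ strip_open of_real_strip assms(1)])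
       simp
qed

text \<open>The derivation \<open>(1/z) d/dz\<close> acts on polynomials in \<open>1 - z\<^sup>2\<close> as \<open>- 2 d/du\<close>, and maps \<open>Arcsin z\<close>
  to \<open>1/(z sqrt (1 - z\<^sup>2))\<close>, which is absorbed in the first summand. After \<open>e\<close> steps only that summand
  is left. Each step costs one zero and raises the degree of the numerator by two, whence \<open>D + 3e\<close>;
  the second hypothesis makes the absorbed term obey the degree bound, and it is preserved by the step.\<close>

lemma zeros_bd_arc_form:
  assumes "degree A \<le> D" "2 * e + a + 2 * b \<le> D + 3"
    and "\<And>i. i \<ge> e \<Longrightarrow> coeff B i = 0" "\<And>i. i \<ge> e \<Longrightarrow> coeff C i = 0"
    and "G holomorphic_on strip" "real_on {0<..<1} G"
    and "\<And>z. z \<in> strip \<Longrightarrow>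
      G z = ww z * (poly A z / (z ^ a * uu z ^ b)) + poly B (uu z) * Arcsin z + poly C (uu z)"
  shows "zeros_bd G {0<..<1} (D + 3 * e)"
  using assms
proof (induction e arbitrary: A B C D a b G)
  case 0
  have BC: "B = 0" "C = 0" using 0(3,4) by (auto simp: poly_eq_iff)
  define W where "W z = inverse (ww z) * (z ^ a * uu z ^ b)" for z
  have W0: "W z \<noteq> 0" if "z \<in> strip" for z using strip_nonpos[OF that] by (auto simp: W_def)
  have WG: "W z * G z = poly A z" if "z \<in> strip" for z
    using strip_nonpos[OF that] 0(7)[OF that] by (simp add: W_def BC)
  have Wh: "W holomorphic_on strip" unfolding W_def
    using strip_nonpos by (intro holomorphic_intros) auto
  have "real_on {0<..<1} W" unfolding W_def
    by (intro real_on_mult real_on_inverse real_on_ww) (simp_all add: real_on_def)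
  then have "real_on {0<..<1} (\<lambda>z. W z * G z)" using 0 by (intro real_on_mult)
  then have "real_on {0<..<1} (poly A)"
    unfolding real_on_def using WG of_real_strip by (metis image_subset_iff)
  then have "zeros_bd (poly A) {0<..<1} D" using 0 by (intro zeros_bd_poly) auto
  then have "zeros_bd (\<lambda>z. W z * G z) {0<..<1} D"
    by (rule zeros_bd_cong[OF _ strip_open of_real_strip]) (simp add: WG)
  then show ?case
    using zeros_bd_unit[OF _ strip_open of_real_strip Wh W0] by simp
next
  case (Suc e)
  define A1 where "A1 = quotient_numerator a b A - A * [:0, 0, 1:]
    + pcompose B [:1, 0, -1:] * (monom 1 (a + 1) * [:1, 0, -1:] ^ b)"
  define H where "H z = ww z * (poly A1 z / (z ^ (a + 2) * uu z ^ (b + 1)))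
      + poly (smult (-2) (pderiv B)) (uu z) * Arcsin z + poly (smult (-2) (pderiv C)) (uu z)" for z
  have pA1: "poly A1 z = poly (quotient_numerator a b A) z - poly A z * z\<^sup>2 + poly B (uu z) * (z ^ (a + 1) * uu z ^ b)" for z
    unfolding A1_def by (simp add: poly_ucomp poly_monom power2_eq_square)
  have dA1: "degree A1 \<le> D + 2"
  proof -
    have "degree (pcompose B [:1, 0, -1:] * (monom 1 (a + 1) * [:1, 0, -1:] ^ b)) \<le> 2 * e + (a + 1 + b * 2)"
      by (intro degree_mult_le3 degree_ucomp Suc.prems(3) degree_monom_le order_trans[OF degree_power_le]) auto
    also have "\<dots> \<le> D + 2" using Suc.prems(2) by simp
    finally show ?thesis unfolding A1_def
      by (intro degree_add_le degree_diff_le degree_quotient_numerator Suc.prems(1)) (use Suc.prems(1) in \<open>auto intro!: degree_mult_le3\<close>)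
  qed
  have step: "(G has_field_derivative z * H z) (at z)" if z: "z \<in> strip" for z
  proof -
    note nz = strip_nonpos[OF z]
    define R where "R = poly A z / (z ^ a * uu z ^ b)"
    define Q where "Q = z ^ (a + 2) * uu z ^ (b + 1)"
    define u w where "u = uu z" and "w = ww z"
    have w2: "w * w = u" "w \<noteq> 0" "u \<noteq> 0" "z \<noteq> 0" using nz by (auto simp: w_def u_def simp flip: power2_eq_square)
    have Q0: "Q \<noteq> 0" using nz by (auto simp: Q_def)
    have RQ: "R = poly A z * (z\<^sup>2 * u) / Q" unfolding R_def Q_def u_def
      using nz by (simp add: field_simps power2_eq_square)
    have BQ: "poly B u / u = z * (poly B u * (z ^ (a + 1) * u ^ b)) / Q" unfolding Q_def u_def
      using nz by (simp add: field_simps power2_eq_square)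
    have "((\<lambda>z. ww z * (poly A z / (z ^ a * uu z ^ b)) + poly B (uu z) * Arcsin z + poly C (uu z))
       has_field_derivative
        ((- z / w) * R + z * (poly (quotient_numerator a b A) z / Q) * w
         + ((- 2 * z * poly (pderiv B) u) * Arcsin z + 1 / w * poly B u)
         + - 2 * z * poly (pderiv C) u)) (at z)"
      unfolding R_def Q_def u_def w_def
      by (intro DERIV_add DERIV_mult ww_deriv rat_deriv poly_uu_deriv Arcsin_deriv z)
    also have "(- z / w) * R + z * (poly (quotient_numerator a b A) z / Q) * w
         + ((- 2 * z * poly (pderiv B) u) * Arcsin z + 1 / w * poly B u)
         + - 2 * z * poly (pderiv C) u = z * H z"
    proof -
      have 1: "(- z / w) * R = z * w * (- (poly A z * z\<^sup>2) / Q)"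
        unfolding RQ using w2 Q0 by (simp add: field_simps w2(1)[symmetric])
      have "1 / w * poly B u = w * (poly B u / u)"
        using w2(2,3) by (simp add: w2(1)[symmetric] field_simps)
      also have "poly B u / u = z * (poly B u * (z ^ (a + 1) * u ^ b)) / Q"
        by (rule BQ)
      finally have 2: "1 / w * poly B u = z * w * (poly B u * (z ^ (a + 1) * u ^ b) / Q)" by simp
      show ?thesis unfolding 1 2 H_def pA1 unfolding Q_def[symmetric] unfolding w_def[symmetric] unfolding u_def[symmetric]
        by (simp add: algebra_simps add_divide_distrib diff_divide_distrib)
    qed
    finally show ?thesis
      by (rule has_field_derivative_transform_within_open[OF _ strip_open z]) (use Suc.prems(7) in auto)
  qed
  have "zeros_bd G {0<..<1} (Suc ((D + 2) + 3 * e))"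
  proof (rule delta_step[OF Suc.prems(5,6) step])
    assume H: "H holomorphic_on strip" "real_on {0<..<1} H"
    show "zeros_bd H {0<..<1} ((D + 2) + 3 * e)"
      by (rule Suc.IH[OF dA1 _ _ _ H H_def])
         (use Suc.prems(2,3,4) in \<open>auto simp: coeff_pderiv\<close>)
  qed
  then show ?case by (rule zeros_bd_mono) simp
qed

text \<open>As before, but the logarithms are removed first: their derivatives are rational. The quotient by
  \<open>sqrt (1 - z\<^sup>2)\<close> does not interfere, since its numerator keeps its degree in \<open>1 - z\<^sup>2\<close> while the denominator
  gains a factor. When no logarithm is left, multiplication by that denominator leads to the previous form.\<close>

lemma zeros_bd_log_arc_form:
  assumes "degree A \<le> D" "2 * e + a + 2 * b \<le> D + 2" "2 * e' + a \<le> D + 3"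
    and "\<And>i. i \<ge> e \<Longrightarrow> coeff L i = 0" "\<And>i. i \<ge> e \<Longrightarrow> coeff L' i = 0"
    and "\<And>i. i \<ge> e' \<Longrightarrow> coeff B i = 0" "\<And>i. i \<ge> e' \<Longrightarrow> coeff C i = 0"
    and "G holomorphic_on strip" "real_on {0<..<1} G"
    and "\<And>z. z \<in> strip \<Longrightarrow>
      G z = poly A z / (z ^ a * uu z ^ b) + (poly L (uu z) * Ln (1 - z) + poly L' (uu z) * Ln (1 + z))
        + (poly B (uu z) * Arcsin z + poly C (uu z)) / (ww z * uu z ^ b)"
  shows "zeros_bd G {0<..<1} (D + 3 * e + 3 * e')"
  using assms
proof (induction e arbitrary: A B C L L' D a b G)
  case 0
  have L: "L = 0" "L' = 0" using 0(4,5) by (auto simp: poly_eq_iff)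
  define W where "W z = ww z * uu z ^ b" for z
  have W0: "W z \<noteq> 0" if "z \<in> strip" for z using strip_nonpos[OF that] by (auto simp: W_def)
  have Wh: "W holomorphic_on strip" unfolding W_def
    using strip_nonpos by (intro holomorphic_intros) auto
  have "real_on {0<..<1} W" unfolding W_def
    by (intro real_on_mult real_on_ww) (simp_all add: real_on_def)
  then have r: "real_on {0<..<1} (\<lambda>z. W z * G z)" using 0 by (intro real_on_mult)
  have h: "(\<lambda>z. W z * G z) holomorphic_on strip" using 0 by (intro holomorphic_intros Wh)
  have "zeros_bd (\<lambda>z. W z * G z) {0<..<1} (D + 3 * e')"
  proof (rule zeros_bd_arc_form[OF 0(1) _ 0(6,7) h r, where a = a and b = 0])
    show "W z * G z = ww z * (poly A z / (z ^ a * uu z ^ 0)) + poly B (uu z) * Arcsin z + poly C (uu z)"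
      if "z \<in> strip" for z
      using strip_nonpos[OF that] 0(10)[OF that] by (simp add: W_def L field_simps)
  qed (use 0 in auto)
  then show ?case
    using zeros_bd_unit[OF _ strip_open of_real_strip Wh W0] by simp
next
  case (Suc e)
  define A1 where "A1 = quotient_numerator a b A
    + (pcompose L' [:1, 0, -1:] * [:1, -1:] - pcompose L [:1, 0, -1:] * [:1, 1:])
        * (monom 1 (a + 1) * [:1, 0, -1:] ^ b)
    + pcompose B [:1, 0, -1:] * monom 1 (a + 1)"
  (* The effect of the derivation on the numerator over the odd half power of 1 - z^2. *)
  define B1 where "B1 P = smult (-2) (pderiv P * [:0, 1:]) + smult (2 * of_nat b + 1) P" for P :: "complex poly"
  have pB1: "poly (B1 P) x = (2 * of_nat b + 1) * poly P x - 2 * (poly (pderiv P) x * x)" for P x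
    unfolding B1_def by simp
  have cB1: "coeff (B1 P) i = 0" if "\<And>i. i \<ge> e' \<Longrightarrow> coeff P i = 0" "i \<ge> e'" for P i
    using that by (cases i) (simp_all add: B1_def coeff_pderiv)
  define H where "H z = poly A1 z / (z ^ (a + 2) * uu z ^ (b + 1))
      + (poly (smult (-2) (pderiv L)) (uu z) * Ln (1 - z) + poly (smult (-2) (pderiv L')) (uu z) * Ln (1 + z))
      + (poly (B1 B) (uu z) * Arcsin z + poly (B1 C) (uu z)) / (ww z * uu z ^ (b + 1))" for z
  have pA1: "poly A1 z = poly (quotient_numerator a b A) z
      + (poly L' (uu z) * (1 - z) - poly L (uu z) * (1 + z)) * (z ^ (a + 1) * uu z ^ b)
      + poly B (uu z) * z ^ (a + 1)" for z
    unfolding A1_def by (simp add: poly_ucomp poly_monom power2_eq_square algebra_simps)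
  have dA1: "degree A1 \<le> D + 2"
  proof -
    have 1: "degree ((pcompose L' [:1, 0, -1:] * [:1, -1:] - pcompose L [:1, 0, -1:] * [:1, 1:])
        * (monom 1 (a + 1) * [:1, 0, -1:] ^ b)) \<le> (2 * e + 1) + (a + 1 + b * 2)"
      by (intro degree_mult_le3 degree_diff_le degree_ucomp Suc.prems(4,5) degree_monom_le order_trans[OF degree_power_le]) auto
    have 2: "degree (pcompose B [:1, 0, -1:] * monom 1 (a + 1)) \<le> D + 2"
    proof (cases e')
      case 0
      then have "B = 0" using Suc.prems(6) by (auto simp: poly_eq_iff)
      then show ?thesis by simp
    next
      case (Suc k)
      have "degree (pcompose B [:1, 0, -1:] * monom 1 (a + 1)) \<le> 2 * k + (a + 1)"
        by (intro degree_mult_le3 degree_ucomp Suc.prems(6) degree_monom_le) (use Suc in auto)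
      then show ?thesis using Suc.prems(3) Suc by simp
    qed
    have "(2 * e + 1) + (a + 1 + b * 2) \<le> D + 2" using Suc.prems(2) by simp
    then show ?thesis unfolding A1_def
      by (intro degree_add_le degree_quotient_numerator Suc.prems(1) order_trans[OF 1] 2)
  qed
  have step: "(G has_field_derivative z * H z) (at z)" if z: "z \<in> strip" for z
  proof -
    note nz = strip_nonpos[OF z]
    define Q where "Q = z ^ (a + 2) * uu z ^ (b + 1)"
    define u w where "u = uu z" and "w = ww z"
    have w2: "w * w = u" "w \<noteq> 0" "u \<noteq> 0" "z \<noteq> 0" using nz by (auto simp: w_def u_def simp flip: power2_eq_square)
    have Q0: "Q \<noteq> 0" using nz by (auto simp: Q_def)
    have uz: "u = (1 - z) * (1 + z)" by (simp add: u_def power2_eq_square algebra_simps)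
    have z1: "1 - z \<noteq> 0" "1 + z \<noteq> 0" using uz w2 by auto
    have l1: "((\<lambda>z. Ln (1 - z)) has_field_derivative - (1 + z) / u) (at z)"
    proof -
      have "- (1 + z) / u = - 1 / (1 - z)" unfolding uz using z1
        by (subst frac_eq_eq[OF w2(3)[unfolded uz]]) (simp_all add: algebra_simps)
      then show ?thesis using nz by (auto intro!: derivative_eq_intros simp: inverse_eq_divide)
    qed
    have l2: "((\<lambda>z. Ln (1 + z)) has_field_derivative (1 - z) / u) (at z)"
    proof -
      have "(1 - z) / u = 1 / (1 + z)" unfolding uz using z1
        by (subst frac_eq_eq[OF w2(3)[unfolded uz]]) (simp_all add: algebra_simps)
      then show ?thesis using nz by (auto intro!: derivative_eq_intros simp: inverse_eq_divide)
    qed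
    define P Pd where "P = poly B u * Arcsin z + poly C u"
      and "Pd = (- 2 * z * poly (pderiv B) u) * Arcsin z + 1 / w * poly B u + - 2 * z * poly (pderiv C) u"
    have dP: "((\<lambda>z. poly B (uu z) * Arcsin z + poly C (uu z)) has_field_derivative Pd) (at z)"
      unfolding Pd_def u_def w_def
      by (intro DERIV_add DERIV_mult poly_uu_deriv Arcsin_deriv z)
    have dD: "((\<lambda>z. ww z * uu z ^ b) has_field_derivative
        (- z / w) * u ^ b + (- 2 * z * (of_nat b * u ^ b / u)) * w) (at z)"
      unfolding u_def w_def using nz by (intro DERIV_mult ww_deriv z upow_deriv) auto
    have dq: "((\<lambda>z. (poly B (uu z) * Arcsin z + poly C (uu z)) / (ww z * uu z ^ b)) has_field_derivative
        (Pd * (w * u ^ b) - P * ((- z / w) * u ^ b + (- 2 * z * (of_nat b * u ^ b / u)) * w))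
          / ((w * u ^ b) * (w * u ^ b))) (at z)"
      using DERIV_divide[OF dP dD] w2 nz unfolding P_def u_def w_def by simp
    have "((\<lambda>z. poly A z / (z ^ a * uu z ^ b) + (poly L (uu z) * Ln (1 - z) + poly L' (uu z) * Ln (1 + z))
        + (poly B (uu z) * Arcsin z + poly C (uu z)) / (ww z * uu z ^ b))
       has_field_derivative
        (z * (poly (quotient_numerator a b A) z / Q)
         + (((- 2 * z * poly (pderiv L) u) * Ln (1 - z) + - (1 + z) / u * poly L u)
            + ((- 2 * z * poly (pderiv L') u) * Ln (1 + z) + (1 - z) / u * poly L' u))
         + (Pd * (w * u ^ b) - P * ((- z / w) * u ^ b + (- 2 * z * (of_nat b * u ^ b / u)) * w))
          / ((w * u ^ b) * (w * u ^ b)))) (at z)"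
      unfolding Q_def using dq l1 l2 unfolding u_def
      by (intro DERIV_add DERIV_mult rat_deriv poly_uu_deriv z)
    also have "z * (poly (quotient_numerator a b A) z / Q)
         + (((- 2 * z * poly (pderiv L) u) * Ln (1 - z) + - (1 + z) / u * poly L u)
            + ((- 2 * z * poly (pderiv L') u) * Ln (1 + z) + (1 - z) / u * poly L' u))
         + (Pd * (w * u ^ b) - P * ((- z / w) * u ^ b + (- 2 * z * (of_nat b * u ^ b / u)) * w))
          / ((w * u ^ b) * (w * u ^ b)) = z * H z"
    proof -
      define U where "U = u ^ b"
      have U0: "U \<noteq> 0" using w2 by (simp add: U_def)
      have Q: "Q = z ^ (a + 1) * z * (U * u)" unfolding Q_def U_def u_def by (simp add: power_add mult_ac power2_eq_square)
      have za: "z ^ (a + 1) \<noteq> 0" using w2 by simp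
      have 1: "(Pd * (w * U) - P * ((- z / w) * U + (- 2 * z * (of_nat b * U / u)) * w)) / ((w * U) * (w * U))
         = z * ((poly (B1 B) u * Arcsin z + poly (B1 C) u) / (w * (U * u)) + poly B u / (z * (U * u)))"
      proof -
        have "(Pd * (w * U) - P * ((- z / w) * U + (- 2 * z * (of_nat b * U / u)) * w)) / ((w * U) * (w * U))
          = (Pd * (w * w) + P * z * (1 + 2 * of_nat b * (w * w / u))) / (w * (w * w) * U)"
          using w2(2-4) U0 by (simp add: field_simps)
        also have "\<dots> = (Pd * u + P * z * (1 + 2 * of_nat b)) / (w * u * U)"
          using w2 by simp
        also have "Pd * u = z * (- 2 * (poly (pderiv B) u * u) * Arcsin z + - 2 * (poly (pderiv C) u * u)) + w * poly B u"
          unfolding Pd_def using w2(2) by (simp add: w2(1)[symmetric] field_simps)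
        also have "(\<dots> + P * z * (1 + 2 * of_nat b)) / (w * u * U)
            = z * ((poly (B1 B) u * Arcsin z + poly (B1 C) u) / (w * (U * u)) + poly B u / (z * (U * u)))"
          unfolding pB1 P_def using w2(2-4) U0 by (simp add: field_simps)
        finally show ?thesis .
      qed
      have 2: "- (1 + z) / u * poly L u + (1 - z) / u * poly L' u
          = z * ((poly L' u * (1 - z) - poly L u * (1 + z)) * (z ^ (a + 1) * U) / Q)"
        unfolding Q using w2(2-4) U0 za by (simp add: field_simps)
      have 3: "poly B u / (z * (U * u)) = poly B u * z ^ (a + 1) / Q"
        unfolding Q using w2(2-4) U0 za by simp
      have "z * H z = z * (poly (quotient_numerator a b A) z / Q)
        + z * ((poly L' u * (1 - z) - poly L u * (1 + z)) * (z ^ (a + 1) * U) / Q)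
        + z * (poly B u * z ^ (a + 1) / Q)
        + z * (- 2 * poly (pderiv L) u * Ln (1 - z) + - 2 * poly (pderiv L') u * Ln (1 + z))
        + z * ((poly (B1 B) u * Arcsin z + poly (B1 C) u) / (w * (U * u)))"
        unfolding H_def pA1 unfolding Q_def[symmetric] unfolding w_def[symmetric] unfolding u_def[symmetric] U_def
        by (simp add: algebra_simps add_divide_distrib diff_divide_distrib)
      also have "\<dots> = z * (poly (quotient_numerator a b A) z / Q)
         + (((- 2 * z * poly (pderiv L) u) * Ln (1 - z) + - (1 + z) / u * poly L u)
            + ((- 2 * z * poly (pderiv L') u) * Ln (1 + z) + (1 - z) / u * poly L' u))
         + (Pd * (w * U) - P * ((- z / w) * U + (- 2 * z * (of_nat b * U / u)) * w)) / ((w * U) * (w * U))"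
        unfolding 1 2[symmetric] 3 by (simp add: algebra_simps)
      finally show ?thesis unfolding U_def by simp
    qed
    finally show ?thesis
      by (rule has_field_derivative_transform_within_open[OF _ strip_open z]) (use Suc.prems(10) in auto)
  qed
  have "zeros_bd G {0<..<1} (Suc ((D + 2) + 3 * e + 3 * e'))"
  proof (rule delta_step[OF Suc.prems(8,9) step])
    assume H: "H holomorphic_on strip" "real_on {0<..<1} H"
    show "zeros_bd H {0<..<1} ((D + 2) + 3 * e + 3 * e')"
      by (rule Suc.IH[OF dA1 _ _ _ _ cB1[OF Suc.prems(6)] cB1[OF Suc.prems(7)] H H_def])
         (use Suc.prems(2-5) in \<open>auto simp: coeff_pderiv\<close>)
  qed
  then show ?case by (rule zeros_bd_mono) simp
qed

section \<open>Integrals over quarter turns\<close>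

definition quarter :: "nat \<Rightarrow> real set" where
  "quarter k = {(real k - 1) * (pi / 2) .. real k * (pi / 2)}"

text \<open>The relation between the two anomalies in Kepler's problem. It is a primitive of
  \<open>sqrt (1 - s\<^sup>2) / (1 - s cos \<theta>)\<close> for \<open>s = 2\<beta>/(1 + \<beta>\<^sup>2)\<close> that is smooth on the whole circle; the usual
  primitive with \<open>tan (\<theta>/2)\<close> jumps at \<open>\<pi>\<close>. With \<open>- \<beta>\<close> it is the inverse relation.\<close>

definition kepler :: "real \<Rightarrow> real \<Rightarrow> real" where
  "kepler \<beta> \<theta> = \<theta> + 2 * arctan (\<beta> * sin \<theta> / (1 - \<beta> * cos \<theta>))"

lemma kepler_denom_pos: fixes \<beta> \<theta> :: real shows "\<bar>\<beta>\<bar> < 1 \<Longrightarrow> 1 - \<beta> * cos \<theta> > 0"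
proof -
  assume "\<bar>\<beta>\<bar> < 1"
  moreover have "\<bar>\<beta> * cos \<theta>\<bar> \<le> \<bar>\<beta>\<bar> * 1" by (simp add: abs_mult mult_left_le)
  ultimately show ?thesis by linarith
qed

lemma kepler_deriv:
  assumes "\<bar>\<beta>\<bar> < 1"
  shows "(kepler \<beta> has_real_derivative (1 - \<beta>\<^sup>2) / (1 - 2 * \<beta> * cos \<theta> + \<beta>\<^sup>2)) (at \<theta>)"
proof -
  define c s where "c = cos \<theta>" and "s = sin \<theta>"
  have cs: "s\<^sup>2 = 1 - c\<^sup>2" by (simp add: c_def s_def sin_squared_eq)
  have D: "1 - \<beta> * c > 0" using kepler_denom_pos[OF assms] by (simp add: c_def)
  have P: "1 - 2 * \<beta> * c + \<beta>\<^sup>2 = (1 - \<beta> * c)\<^sup>2 + (\<beta> * s)\<^sup>2"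
    by (simp add: power_mult_distrib cs) (simp add: power2_eq_square algebra_simps)
  then have P0: "1 - 2 * \<beta> * c + \<beta>\<^sup>2 > 0" using D by (simp add: add_pos_nonneg)
  have "((\<lambda>\<theta>. \<beta> * sin \<theta> / (1 - \<beta> * cos \<theta>)) has_real_derivative
      (\<beta> * c * (1 - \<beta> * c) - \<beta> * s * (\<beta> * s)) / ((1 - \<beta> * c) * (1 - \<beta> * c))) (at \<theta>)"
    using D by (auto intro!: derivative_eq_intros simp: c_def s_def)
  then have "(kepler \<beta> has_real_derivative
      1 + 2 * (inverse (1 + (\<beta> * s / (1 - \<beta> * c))\<^sup>2) *
        ((\<beta> * c * (1 - \<beta> * c) - \<beta> * s * (\<beta> * s)) / ((1 - \<beta> * c) * (1 - \<beta> * c))))) (at \<theta>)"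
    unfolding kepler_def[abs_def] c_def s_def
    using DERIV_add[OF DERIV_ident DERIV_cmult[OF DERIV_chain2[OF DERIV_arctan]]] by blast
  also have "inverse (1 + (\<beta> * s / (1 - \<beta> * c))\<^sup>2) = (1 - \<beta> * c)\<^sup>2 / (1 - 2 * \<beta> * c + \<beta>\<^sup>2)"
    unfolding P using D by (simp add: power_divide field_simps)
  also have "1 + 2 * ((1 - \<beta> * c)\<^sup>2 / (1 - 2 * \<beta> * c + \<beta>\<^sup>2) *
        ((\<beta> * c * (1 - \<beta> * c) - \<beta> * s * (\<beta> * s)) / ((1 - \<beta> * c) * (1 - \<beta> * c))))
      = 1 + 2 * ((\<beta> * c * (1 - \<beta> * c) - \<beta>\<^sup>2 * s\<^sup>2) / (1 - 2 * \<beta> * c + \<beta>\<^sup>2))"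
    using D by (simp add: power2_eq_square)
  also have "\<dots> = (1 - \<beta>\<^sup>2) / (1 - 2 * \<beta> * c + \<beta>\<^sup>2)"
    unfolding cs using P0 by (simp add: field_simps) (simp add: power2_eq_square algebra_simps)
  finally show ?thesis by (simp add: c_def)
qed

text \<open>Here \<open>\<beta> = (1 - sqrt (1 - s\<^sup>2)) / s\<close> is the tangent of half the angle whose sine is \<open>s\<close>.\<close>

lemma half_angle_param:
  fixes s :: real
  assumes "0 < s" "s < 1"
  obtains \<beta> where "0 < \<beta>" "\<beta> < 1" "s = 2 * \<beta> / (1 + \<beta>\<^sup>2)" "sqrt (1 - s\<^sup>2) = (1 - \<beta>\<^sup>2) / (1 + \<beta>\<^sup>2)"
    "2 * arctan \<beta> = arcsin s"
proof -
  define w where "w = sqrt (1 - s\<^sup>2)"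
  have s2: "s\<^sup>2 < 1" using assms by (simp add: power_less_one_iff)
  have w: "w > 0" "w\<^sup>2 = 1 - s\<^sup>2" using s2 by (auto simp: w_def)
  have w1: "w < 1" using assms unfolding w_def by (simp add: power2_eq_square)
  define \<beta> where "\<beta> = (1 - w) / s"
  have b2: "\<beta>\<^sup>2 = (1 - w) / (1 + w)"
  proof -
    have "s\<^sup>2 = (1 - w) * (1 + w)" using w by (simp add: power2_eq_square algebra_simps)
    then show ?thesis using w w1 unfolding \<beta>_def by (simp add: power_divide power2_eq_square)
  qed
  have b0: "\<beta> > 0" using w1 assms by (simp add: \<beta>_def)
  have "\<beta>\<^sup>2 < 1" unfolding b2 using w by simp
  then have b1: "\<beta> < 1" using b0 by (simp add: power2_less_1_iff abs_square_less_1)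
  have p: "1 + \<beta>\<^sup>2 = 2 / (1 + w)" unfolding b2 using w by (simp add: field_simps)
  have m: "1 - \<beta>\<^sup>2 = 2 * w / (1 + w)" unfolding b2 using w by (simp add: field_simps)
  have 1: "s = 2 * \<beta> / (1 + \<beta>\<^sup>2)"
  proof -
    have "s * s = (1 - w) * (1 + w)" using w by (simp add: power2_eq_square algebra_simps)
    then show ?thesis unfolding p using w assms by (simp add: \<beta>_def field_simps)
  qed
  have 2: "w = (1 - \<beta>\<^sup>2) / (1 + \<beta>\<^sup>2)" unfolding p m using w by simp
  have "sin (2 * arctan \<beta>) = s"
    unfolding sin_double sin_arctan cos_arctan 1 using b0
    by (simp add: power2_eq_square)
  moreover have "- (pi / 2) \<le> 2 * arctan \<beta>" "2 * arctan \<beta> \<le> pi / 2"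
  proof -
    have "arctan \<beta> > 0" using b0 by simp
    then show "- (pi / 2) \<le> 2 * arctan \<beta>" using pi_gt_zero by linarith
    show "2 * arctan \<beta> \<le> pi / 2" using b1 arctan_less_iff[of \<beta> 1] arctan_one by linarith
  qed
  ultimately have "2 * arctan \<beta> = arcsin s" using arcsin_sin by metis
  with b0 b1 1 2 show ?thesis using that unfolding w_def by blast
qed

lemma quarter_cases:
  assumes "k \<in> {1..4::nat}"
  obtains "k = 1" | "k = 2" | "k = 3" | "k = 4"
  using assms by fastforce

lemma trig_quarter:
  "cos (3 * (pi / 2)) = 0" "sin (3 * (pi / 2)) = -1"
  "cos (2 * (pi / 2)) = -1" "sin (2 * (pi / 2)) = 0" "cos (4 * (pi / 2)) = 1" "sin (4 * (pi / 2)) = 0"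
proof -
  have "3 * (pi / 2) = pi + pi / 2" by simp
  then show "cos (3 * (pi / 2)) = 0" "sin (3 * (pi / 2)) = -1"
    by (simp_all only: cos_add sin_add) simp_all
qed auto

lemma trig32: "cos (3 * pi / 2) = 0" "sin (3 * pi / 2) = -1"
  using trig_quarter(1,2) by simp_all

lemma denom_pos: fixes s \<theta> :: real shows "0 < s \<Longrightarrow> s < 1 \<Longrightarrow> 1 - s * cos \<theta> > 0"
  using kepler_denom_pos[of s \<theta>] by simp

text \<open>The exponent \<open>e\<close> is an integer: the coordinate \<open>y\<close> is a multiple of \<open>1/(1 - s cos \<theta>)\<close>, so that
  high powers of \<open>y\<close> appear as negative exponents.\<close>

definition trig_integral :: "nat \<Rightarrow> nat \<Rightarrow> int \<Rightarrow> real \<Rightarrow> real" where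
  "trig_integral k i e s = integral (quarter k) (\<lambda>\<theta>. (s * sin \<theta>) ^ i * (1 - s * cos \<theta>) powi e)"

text \<open>The form is relative to a fixed power of \<open>u = 1 - s\<^sup>2\<close> so that it is closed under sums, and the degrees
  of the coefficients of the transcendental functions are measured in \<open>u\<close>: this is what \<open>zeros_bd_log_arc_form\<close>
  exploits.\<close>

definition log_arc_form :: "nat \<Rightarrow> nat \<Rightarrow> (real \<Rightarrow> real) \<Rightarrow> bool" where
  "log_arc_form N d F \<longleftrightarrow> (\<exists>A L L' B C :: real poly.
     degree A \<le> 2 * d + 3 \<and> degree L \<le> d \<and> degree L' \<le> d \<and> degree B \<le> d \<and> degree C \<le> d \<and>
     (\<forall>s\<in>{0<..<1}. (1 - s\<^sup>2) ^ N * F s =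
        poly A s + (poly L (1 - s\<^sup>2) * ln (1 - s) + poly L' (1 - s\<^sup>2) * ln (1 + s))
         + (poly B (1 - s\<^sup>2) * arcsin s + poly C (1 - s\<^sup>2)) / sqrt (1 - s\<^sup>2)))"

lemma log_arc_form_cong: "log_arc_form N d F \<Longrightarrow> (\<And>s. 0 < s \<Longrightarrow> s < 1 \<Longrightarrow> F s = H s) \<Longrightarrow> log_arc_form N d H"
  unfolding log_arc_form_def by auto

lemma log_arc_form_mono: "log_arc_form N d F \<Longrightarrow> d \<le> d' \<Longrightarrow> log_arc_form N d' F"
  unfolding log_arc_form_def by (elim exE) (intro exI conjI; fastforce)

lemma log_arc_form_0: "log_arc_form N d (\<lambda>_. 0)"
  unfolding log_arc_form_def by (intro exI[of _ 0]) auto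

lemma log_arc_form_add:
  assumes "log_arc_form N d F" "log_arc_form N d H"
  shows "log_arc_form N d (\<lambda>s. F s + H s)"
proof -
  obtain A L L' B C where 1: "degree A \<le> 2 * d + 3" "degree L \<le> d" "degree L' \<le> d" "degree B \<le> d" "degree C \<le> d"
    "\<And>s. s\<in>{0<..<1} \<Longrightarrow> (1 - s\<^sup>2) ^ N * F s =
        poly A s + (poly L (1 - s\<^sup>2) * ln (1 - s) + poly L' (1 - s\<^sup>2) * ln (1 + s))
         + (poly B (1 - s\<^sup>2) * arcsin s + poly C (1 - s\<^sup>2)) / sqrt (1 - s\<^sup>2)"
    using assms(1) unfolding log_arc_form_def by auto
  obtain A2 L2 L2' B2 C2 where 2: "degree A2 \<le> 2 * d + 3" "degree L2 \<le> d" "degree L2' \<le> d" "degree B2 \<le> d" "degree C2 \<le> d"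
    "\<And>s. s\<in>{0<..<1} \<Longrightarrow> (1 - s\<^sup>2) ^ N * H s =
        poly A2 s + (poly L2 (1 - s\<^sup>2) * ln (1 - s) + poly L2' (1 - s\<^sup>2) * ln (1 + s))
         + (poly B2 (1 - s\<^sup>2) * arcsin s + poly C2 (1 - s\<^sup>2)) / sqrt (1 - s\<^sup>2)"
    using assms(2) unfolding log_arc_form_def by auto
  show ?thesis unfolding log_arc_form_def
    by (rule exI[of _ "A + A2"], rule exI[of _ "L + L2"], rule exI[of _ "L' + L2'"], rule exI[of _ "B + B2"],
        rule exI[of _ "C + C2"], intro conjI ballI degree_add_le 1 2)
       (subst distrib_left, subst 1(6), assumption, subst 2(6), assumption, simp add: algebra_simps add_divide_distrib)
qed

lemma log_arc_form_cmult:
  assumes "log_arc_form N d F"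
  shows "log_arc_form N d (\<lambda>s. c * F s)"
proof -
  obtain A L L' B C where 1: "degree A \<le> 2 * d + 3" "degree L \<le> d" "degree L' \<le> d" "degree B \<le> d" "degree C \<le> d"
    "\<And>s. s\<in>{0<..<1} \<Longrightarrow> (1 - s\<^sup>2) ^ N * F s =
        poly A s + (poly L (1 - s\<^sup>2) * ln (1 - s) + poly L' (1 - s\<^sup>2) * ln (1 + s))
         + (poly B (1 - s\<^sup>2) * arcsin s + poly C (1 - s\<^sup>2)) / sqrt (1 - s\<^sup>2)"
    using assms(1) unfolding log_arc_form_def by auto
  have m: "(1 - s\<^sup>2) ^ N * (c * F s) = c * ((1 - s\<^sup>2) ^ N * F s)" for s by simp
  show ?thesis unfolding log_arc_form_def
    by (rule exI[of _ "smult c A"], rule exI[of _ "smult c L"], rule exI[of _ "smult c L'"], rule exI[of _ "smult c B"],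
        rule exI[of _ "smult c C"], intro conjI ballI order_trans[OF degree_smult_le] 1)
       (subst m, subst 1(6), assumption, simp add: algebra_simps add_divide_distrib)
qed

lemma log_arc_form_u:
  assumes "log_arc_form N d F"
  shows "log_arc_form N (Suc d) (\<lambda>s. (1 - s\<^sup>2) * F s)"
proof -
  obtain A L L' B C where 1: "degree A \<le> 2 * d + 3" "degree L \<le> d" "degree L' \<le> d" "degree B \<le> d" "degree C \<le> d"
    "\<And>s. s\<in>{0<..<1} \<Longrightarrow> (1 - s\<^sup>2) ^ N * F s =
        poly A s + (poly L (1 - s\<^sup>2) * ln (1 - s) + poly L' (1 - s\<^sup>2) * ln (1 + s))
         + (poly B (1 - s\<^sup>2) * arcsin s + poly C (1 - s\<^sup>2)) / sqrt (1 - s\<^sup>2)"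
    using assms(1) unfolding log_arc_form_def by auto
  have dX: "degree (pCons 0 P) \<le> Suc d" if "degree P \<le> d" for P :: "real poly"
    using that by (meson Suc_le_mono degree_pCons_le order_trans)
  have dA: "degree ([:1, 0, -1:] * A) \<le> 2 * Suc d + 3"
    using degree_mult_le[of "[:1, 0, -1:]" A] 1(1) by simp
  have m: "(1 - s\<^sup>2) ^ N * ((1 - s\<^sup>2) * F s) = (1 - s\<^sup>2) * ((1 - s\<^sup>2) ^ N * F s)" for s by simp
  have A: "poly ([:1, 0, -1:] * A) s = (1 - s\<^sup>2) * poly A s" for s
    by (simp add: power2_eq_square algebra_simps)
  show ?thesis unfolding log_arc_form_def
  proof (rule exI[of _ "[:1, 0, -1:] * A"], rule exI[of _ "pCons 0 L"], rule exI[of _ "pCons 0 L'"], rule exI[of _ "pCons 0 B"],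
        rule exI[of _ "pCons 0 C"], intro conjI ballI dA dX 1)
    fix s :: real assume s: "s \<in> {0<..<1}"
    define u where "u = 1 - s\<^sup>2"
    show "(1 - s\<^sup>2) ^ N * ((1 - s\<^sup>2) * F s) = poly ([:1, 0, -1:] * A) s
      + (poly (pCons 0 L) (1 - s\<^sup>2) * ln (1 - s) + poly (pCons 0 L') (1 - s\<^sup>2) * ln (1 + s))
       + (poly (pCons 0 B) (1 - s\<^sup>2) * arcsin s + poly (pCons 0 C) (1 - s\<^sup>2)) / sqrt (1 - s\<^sup>2)"
      unfolding m 1(6)[OF s] A unfolding u_def[symmetric]
      by (simp add: algebra_simps add_divide_distrib)
  qed
qed

lemma log_arc_form_sum:
  "finite I \<Longrightarrow> (\<And>i. i \<in> I \<Longrightarrow> log_arc_form N d (F i)) \<Longrightarrow> log_arc_form N d (\<lambda>s. \<Sum>i\<in>I. F i s)"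
  by (induction I rule: finite_induct) (auto simp: log_arc_form_0 intro: log_arc_form_add)

lemma log_arc_form_poly:
  assumes "degree A \<le> 2 * d + 3" "\<And>s. 0 < s \<Longrightarrow> s < 1 \<Longrightarrow> (1 - s\<^sup>2) ^ N * F s = poly A s"
  shows "log_arc_form N d F"
  unfolding log_arc_form_def
  by (rule exI[of _ A], rule exI[of _ 0], rule exI[of _ 0], rule exI[of _ 0], rule exI[of _ 0]) (use assms in auto)

lemma u_poly: "poly ([:1, 0, -1:] ^ N) s = (1 - s\<^sup>2 :: real) ^ N"
  by (simp add: poly_power power2_eq_square)

lemma u_factor: "1 - s\<^sup>2 = (1 - s) * (1 + s :: real)" by (simp add: power2_eq_square algebra_simps)

text \<open>Boundary values of \<open>1 - s cos \<theta>\<close> at multiples of \<open>\<pi>/2\<close> are \<open>1 - s\<close>, \<open>1\<close> and \<open>1 + s\<close>. A negative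
  power is cleared by \<open>u\<^sup>N = (1 - s)\<^sup>N (1 + s)\<^sup>N\<close>.\<close>

lemma log_arc_form_powi:
  assumes "c \<in> {-1, 0, 1 :: real}" "- int N \<le> m" "m \<le> 3"
  shows "log_arc_form N N (\<lambda>s. (1 + c * s) powi m)"
proof (cases "m \<ge> 0")
  case True
  then obtain j where j: "m = int j" using nonneg_int_cases by blast
  show ?thesis
  proof (rule log_arc_form_poly[of "[:1, 0, -1:] ^ N * [:1, c:] ^ j"])
    have "degree ([:1, 0, -1:] ^ N * [:1, c:] ^ j :: real poly) \<le> degree ([:1, 0, -1::real:]) * N + degree [:1, c:] * j"
      by (intro order_trans[OF degree_mult_le] add_mono degree_power_le)
    also have "\<dots> \<le> 2 * N + 3" using j assms(3) by simp
    finally show "degree ([:1, 0, -1:] ^ N * [:1, c:] ^ j) \<le> 2 * N + 3" .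
    show "(1 - s\<^sup>2) ^ N * (1 + c * s) powi m = poly ([:1, 0, -1:] ^ N * [:1, c:] ^ j) s" for s
      unfolding poly_mult u_poly by (simp add: j poly_power mult.commute)
  qed
next
  case False
  define j where "j = nat (- m)"
  have j: "m = - int j" "j \<le> N" using False assms(2) by (auto simp: j_def)
  consider "c = 0" | "c = -1 \<or> c = 1" using assms(1) by auto
  then show ?thesis
  proof cases
    case 1
    have "degree ([:1, 0, -1::real:] ^ N) \<le> 2 * N" using degree_power_le[of "[:1, 0, -1::real:]" N] by simp
    then show ?thesis by (intro log_arc_form_poly[of "[:1, 0, -1:] ^ N"]) (unfold u_poly, auto simp: 1)
  next
    case 2
    show ?thesis
    proof (rule log_arc_form_poly[of "[:1, c:] ^ (N - j) * [:1, -c:] ^ N"])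
      have "degree ([:1, c:] ^ (N - j) * [:1, -c:] ^ N :: real poly) \<le> degree [:1, c:] * (N - j) + degree [:1, -c:] * N"
        by (intro order_trans[OF degree_mult_le] add_mono degree_power_le)
      also have "\<dots> \<le> 2 * N + 3" using diff_le_self[of N j] by (auto simp: le_Suc_eq intro: le_trans)
      finally show "degree ([:1, c:] ^ (N - j) * [:1, -c:] ^ N) \<le> 2 * N + 3" .
      fix s :: real assume s: "0 < s" "s < 1"
      have nz: "1 + c * s \<noteq> 0" using s 2 by auto
      have uf: "1 - s\<^sup>2 = (1 + c * s) * (1 - c * s)" using 2 u_factor[of s] by (auto simp: mult.commute)
      have "(1 + c * s) ^ N = (1 + c * s) ^ (N - j) * (1 + c * s) ^ j"
        using j(2) by (simp flip: power_add)
      then have "(1 - s\<^sup>2) ^ N * (1 + c * s) powi m = (1 + c * s) ^ (N - j) * (1 - c * s) ^ N"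
        unfolding uf power_mult_distrib j(1) power_int_minus power_int_of_nat using nz by simp
      then show "(1 - s\<^sup>2) ^ N * (1 + c * s) powi m = poly ([:1, c:] ^ (N - j) * [:1, -c:] ^ N) s"
        by (simp add: poly_power mult.commute)
    qed
  qed
qed

lemma log_arc_form_ln: "log_arc_form N N (\<lambda>s. ln (1 - s))" "log_arc_form N N (\<lambda>s. ln (1 + s))"
  unfolding log_arc_form_def
   apply (rule exI[of _ 0], rule exI[of _ "monom 1 N"], rule exI[of _ 0], rule exI[of _ 0], rule exI[of _ 0], simp add: degree_monom_le poly_monom)
  apply (rule exI[of _ 0], rule exI[of _ 0], rule exI[of _ "monom 1 N"], rule exI[of _ 0], rule exI[of _ 0], simp add: degree_monom_le poly_monom)
  done

definition quarter_end :: "nat \<Rightarrow> real" where "quarter_end k = real k * (pi / 2)"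

lemma quarter_eq_Icc: "quarter k = {quarter_end k - pi / 2 .. quarter_end k}"
  by (simp add: quarter_def quarter_end_def field_simps)

lemma quarter_FTC:
  fixes F f :: "real \<Rightarrow> real"
  assumes "\<And>x. (F has_real_derivative f x) (at x)"
  shows "integral (quarter k) f = F (quarter_end k) - F (quarter_end k - pi / 2)"
    and "f integrable_on quarter k"
proof -
  have "(f has_integral F (quarter_end k) - F (quarter_end k - pi / 2)) (quarter k)"
    unfolding quarter_eq_Icc
    by (rule fundamental_theorem_of_calculus)
       (use assms in \<open>auto simp flip: has_real_derivative_iff_has_vector_derivative intro: has_field_derivative_at_within\<close>)
  then show "integral (quarter k) f = F (quarter_end k) - F (quarter_end k - pi / 2)" "f integrable_on quarter k"
    by (auto simp: integral_unique has_integral_integrable)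
qed

lemma powi_Suc: "(x::real) \<noteq> 0 \<Longrightarrow> x powi (e + 1) = x powi e * x" "x \<noteq> 0 \<Longrightarrow> x powi (e + 2) = x powi e * x\<^sup>2"
  by (simp_all add: power_int_add)

lemma trig_integral_continuous: fixes s :: real shows "0 < s \<Longrightarrow> s < 1 \<Longrightarrow>
    continuous_on S (\<lambda>\<theta>. (s * sin \<theta>) ^ i * (1 - s * cos \<theta>) powi e)"
  using denom_pos[of s] by (intro continuous_intros) (metis less_numeral_extra(3))

lemma trig_integral_integrable: "0 < s \<Longrightarrow> s < 1 \<Longrightarrow>
    (\<lambda>\<theta>. (s * sin \<theta>) ^ i * (1 - s * cos \<theta>) powi e) integrable_on quarter k"
  unfolding quarter_def by (intro integrable_continuous_interval trig_integral_continuous)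

text \<open>With \<open>D = 1 - s cos \<theta>\<close> one has \<open>(s sin \<theta>)\<^sup>2 = - (1 - s\<^sup>2) + 2D - D\<^sup>2\<close>. So it is enough to know the integrals
  without and with one factor \<open>s sin \<theta>\<close>.\<close>

lemma trig_integral_rec:
  assumes "0 < s" "s < 1"
  shows "trig_integral k (Suc (Suc i)) e s = - ((1 - s\<^sup>2) * trig_integral k i e s) + 2 * trig_integral k i (e + 1) s - trig_integral k i (e + 2) s"
proof -
  note I = trig_integral_integrable[OF assms]
  have "(s * sin \<theta>) ^ Suc (Suc i) * (1 - s * cos \<theta>) powi e
      = - ((1 - s\<^sup>2) * ((s * sin \<theta>) ^ i * (1 - s * cos \<theta>) powi e))
        + 2 * ((s * sin \<theta>) ^ i * (1 - s * cos \<theta>) powi (e + 1))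
        - (s * sin \<theta>) ^ i * (1 - s * cos \<theta>) powi (e + 2)" for \<theta>
  proof -
    define D S where "D = 1 - s * cos \<theta>" and "S = s * sin \<theta>"
    have "S\<^sup>2 = s\<^sup>2 - (1 - D)\<^sup>2" by (simp add: D_def S_def power_mult_distrib sin_squared_eq algebra_simps)
    then have S2: "S * S = - (1 - s\<^sup>2) + 2 * D - D\<^sup>2" by (simp add: power2_eq_square algebra_simps)
    have "D \<noteq> 0" using denom_pos[OF assms, of \<theta>] by (simp add: D_def)
    then have "S ^ Suc (Suc i) * D powi e = - ((1 - s\<^sup>2) * (S ^ i * D powi e)) + 2 * (S ^ i * D powi (e + 1)) - S ^ i * D powi (e + 2)"
      by (simp add: powi_Suc S2 mult.assoc[symmetric]) (simp add: algebra_simps)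
    then show ?thesis by (simp add: D_def S_def)
  qed
  then have eq: "(\<lambda>\<theta>. (s * sin \<theta>) ^ Suc (Suc i) * (1 - s * cos \<theta>) powi e)
      = (\<lambda>\<theta>. - ((1 - s\<^sup>2) * ((s * sin \<theta>) ^ i * (1 - s * cos \<theta>) powi e))
        + 2 * ((s * sin \<theta>) ^ i * (1 - s * cos \<theta>) powi (e + 1))
        - (s * sin \<theta>) ^ i * (1 - s * cos \<theta>) powi (e + 2))" by blast
  show ?thesis unfolding trig_integral_def eq
    by (intro integral_unique has_integral_diff has_integral_add has_integral_neg has_integral_mult_right
        integrable_integral I)
qed

lemma quarter_end_trig:
  assumes "k \<in> {1..4::nat}"
  shows "\<exists>c\<in>{-1,0,1}. cos (quarter_end k) = c" "\<exists>c\<in>{-1,0,1}. cos (quarter_end k - pi / 2) = c"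
proof -
  show "\<exists>c\<in>{-1,0,1}. cos (quarter_end k) = c"
    by (rule quarter_cases[OF assms]) (simp_all add: quarter_end_def trig32)
  show "\<exists>c\<in>{-1,0,1}. cos (quarter_end k - pi / 2) = c"
    by (rule quarter_cases[OF assms]) (simp_all add: quarter_end_def cos_diff trig32)
qed

text \<open>Since \<open>s sin \<theta>\<close> is the derivative of \<open>1 - s cos \<theta>\<close>, the integral is elementary; this is
  where the logarithms come from.\<close>

lemma trig_integral_1_log_arc_form:
  assumes k: "k \<in> {1..4::nat}" and e: "- int N - 1 \<le> e" "e \<le> 2"
  shows "log_arc_form N N (trig_integral k 1 e)"
proof -
  obtain c1 c2 where c: "c1 \<in> {-1,0,1}" "c2 \<in> {-1,0,1}" "cos (quarter_end k) = c1" "cos (quarter_end k - pi / 2) = c2"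
    using quarter_end_trig[OF k] by blast
  have c': "- c1 \<in> {-1,0,1}" "- c2 \<in> {-1,0,1}" using c by auto
  have dD: "((\<lambda>\<theta>. 1 - s * cos \<theta>) has_real_derivative s * sin \<theta>) (at \<theta>)" for s \<theta>
    by (auto intro!: derivative_eq_intros)
  show ?thesis
  proof (cases "e = -1")
    case True
    have v: "trig_integral k 1 e s = ln (1 + - c1 * s) - ln (1 + - c2 * s)" if "0 < s" "s < 1" for s
    proof -
      have "((\<lambda>\<theta>. ln (1 - s * cos \<theta>)) has_real_derivative (s * sin \<theta>) ^ 1 * (1 - s * cos \<theta>) powi e) (at \<theta>)" for \<theta>
        using DERIV_chain2[OF DERIV_ln dD] denom_pos[OF that, of \<theta>] True
        by (simp add: power_int_minus mult.commute)
      from quarter_FTC(1)[OF this, of k] show ?thesis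
        unfolding trig_integral_def c by (simp add: mult.commute)
    qed
    have l: "log_arc_form N N (\<lambda>s. ln (1 + c * s))" if "c \<in> {-1,0,1}" for c
      using that log_arc_form_ln log_arc_form_0 by auto
    have "log_arc_form N N (\<lambda>s. ln (1 + - c1 * s) + (-1) * ln (1 + - c2 * s))"
      by (intro log_arc_form_add log_arc_form_cmult l c')
    then show ?thesis by (rule log_arc_form_cong) (subst v, simp_all)
  next
    case False
    then have e1: "of_int (e + 1) \<noteq> (0::real)" by simp
    have v: "trig_integral k 1 e s = 1 / of_int (e + 1) * (1 + - c1 * s) powi (e + 1)
         + (- 1 / of_int (e + 1)) * (1 + - c2 * s) powi (e + 1)" if "0 < s" "s < 1" for s
    proof -
      have D0: "1 - s * cos \<theta> \<noteq> 0" for \<theta> using denom_pos[OF that, of \<theta>] by simp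
      have "((\<lambda>\<theta>. 1 / of_int (e + 1) * (1 - s * cos \<theta>) powi (e + 1)) has_real_derivative
          (s * sin \<theta>) ^ 1 * (1 - s * cos \<theta>) powi e) (at \<theta>)" for \<theta>
        using D0[of \<theta>] e1 by (auto intro!: derivative_eq_intros)
      from quarter_FTC(1)[OF this, of k] show ?thesis
        unfolding trig_integral_def c by (simp add: mult.commute)
    qed
    have "log_arc_form N N (\<lambda>s. 1 / of_int (e + 1) * (1 + - c1 * s) powi (e + 1)
         + (- 1 / of_int (e + 1)) * (1 + - c2 * s) powi (e + 1))"
      using e by (intro log_arc_form_add log_arc_form_cmult log_arc_form_powi c') auto
    then show ?thesis by (rule log_arc_form_cong) (simp only: v)
  qed
qed

lemma integral_poly:
  "\<exists>p. degree p \<le> e \<and> (\<forall>s. integral (quarter k) (\<lambda>\<theta>. cos \<theta> ^ c * (1 - s * cos \<theta>) ^ e) = poly p (s::real))"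
proof (induction e arbitrary: c)
  case 0
  show ?case by (rule exI[of _ "[:integral (quarter k) (\<lambda>\<theta>. cos \<theta> ^ c):]"]) simp
next
  case (Suc e)
  obtain p where p: "degree p \<le> e" "\<And>s. integral (quarter k) (\<lambda>\<theta>. cos \<theta> ^ c * (1 - s * cos \<theta>) ^ e) = poly p s"
    using Suc by blast
  obtain q where q: "degree q \<le> e" "\<And>s. integral (quarter k) (\<lambda>\<theta>. cos \<theta> ^ Suc c * (1 - s * cos \<theta>) ^ e) = poly q s"
    using Suc by blast
  have I: "(\<lambda>\<theta>. cos \<theta> ^ c * (1 - s * cos \<theta>) ^ e) integrable_on quarter k" for s c
    unfolding quarter_def by (intro integrable_continuous_interval continuous_intros)
  have "cos \<theta> ^ c * (1 - s * cos \<theta>) ^ Suc e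
     = cos \<theta> ^ c * (1 - s * cos \<theta>) ^ e - s * (cos \<theta> ^ Suc c * (1 - s * cos \<theta>) ^ e)" for s \<theta> :: real
    by (simp add: algebra_simps)
  then have eq: "(\<lambda>\<theta>. cos \<theta> ^ c * (1 - s * cos \<theta>) ^ Suc e)
     = (\<lambda>\<theta>. cos \<theta> ^ c * (1 - s * cos \<theta>) ^ e - s * (cos \<theta> ^ Suc c * (1 - s * cos \<theta>) ^ e))" for s :: real by blast
  have "integral (quarter k) (\<lambda>\<theta>. cos \<theta> ^ c * (1 - s * cos \<theta>) ^ Suc e) = poly p s - s * poly q s" for s
    unfolding eq p(2)[symmetric] q(2)[symmetric]
    by (intro integral_unique has_integral_diff has_integral_mult_right integrable_integral I)
  then have "integral (quarter k) (\<lambda>\<theta>. cos \<theta> ^ c * (1 - s * cos \<theta>) ^ Suc e) = poly (p - pCons 0 q) s" for s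
    by simp
  moreover have "degree (p - pCons 0 q) \<le> Suc e"
    using p(1) q(1) by (intro degree_diff_le order_trans[OF degree_pCons_le]) auto
  ultimately show ?case by blast
qed

lemma trig_integral_0_nonneg_log_arc_form:
  assumes "e \<le> 3"
  shows "log_arc_form N N (trig_integral k 0 (int e))"
proof -
  obtain p where p: "degree p \<le> e" "\<And>s. integral (quarter k) (\<lambda>\<theta>. cos \<theta> ^ 0 * (1 - s * cos \<theta>) ^ e) = poly p s"
    using integral_poly[of e k 0] by blast
  show ?thesis
  proof (rule log_arc_form_poly[of "[:1, 0, -1:] ^ N * p"])
    have "degree ([:1, 0, -1:] ^ N * p) \<le> degree [:1, 0, -1::real:] * N + e"
      using p by (intro order_trans[OF degree_mult_le] add_mono degree_power_le)
    then show "degree ([:1, 0, -1:] ^ N * p) \<le> 2 * N + 3" using assms by simp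
    show "(1 - s\<^sup>2) ^ N * trig_integral k 0 (int e) s = poly ([:1, 0, -1:] ^ N * p) s" for s
      unfolding poly_mult u_poly using p(2)[of s] by (simp add: trig_integral_def)
  qed
qed

text \<open>Integrate the derivative of \<open>s sin \<theta> / (1 - s cos \<theta>)\<^sup>m\<close>.\<close>

lemma trig_integral_0_rec:
  assumes "0 < s" "s < 1"
  shows "real m * (1 - s\<^sup>2) * trig_integral k 0 (- int m - 1) s
     = (2 * real m - 1) * trig_integral k 0 (- int m) s - (real m - 1) * trig_integral k 0 (1 - int m) s
        + s * (sin (quarter_end k) * (1 - s * cos (quarter_end k)) powi (- int m)
               - sin (quarter_end k - pi / 2) * (1 - s * cos (quarter_end k - pi / 2)) powi (- int m))"
proof -
  define f where "f j \<theta> = (s * sin \<theta>) ^ 0 * (1 - s * cos \<theta>) powi j" for j \<theta>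
  have I: "f j integrable_on quarter k" for j unfolding f_def by (rule trig_integral_integrable[OF assms])
  have D0: "1 - s * cos \<theta> \<noteq> 0" for \<theta> using denom_pos[OF assms, of \<theta>] by simp
  have d: "((\<lambda>\<theta>. s * sin \<theta> * (1 - s * cos \<theta>) powi (- int m)) has_real_derivative
      real m * (1 - s\<^sup>2) * f (- int m - 1) \<theta> - (2 * real m - 1) * f (- int m) \<theta> + (real m - 1) * f (1 - int m) \<theta>) (at \<theta>)" for \<theta>
  proof -
    define D c where "D = 1 - s * cos \<theta>" and "c = s * cos \<theta>"
    have "(s * sin \<theta>)\<^sup>2 = s\<^sup>2 - (1 - D)\<^sup>2" by (simp add: D_def power_mult_distrib sin_squared_eq algebra_simps)
    then have S2: "(s * sin \<theta>)\<^sup>2 = - (1 - s\<^sup>2) + 2 * D - D\<^sup>2" by (simp add: power2_eq_square algebra_simps)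
    define p where "p = D powi (- int m - 1)"
    have D: "D \<noteq> 0" using D0 by (simp add: D_def)
    have p1: "D powi (- int m) = p * D" using powi_Suc(1)[OF D, of "- int m - 1"] by (simp add: p_def)
    have p2: "D powi (1 - int m) = p * D\<^sup>2" using powi_Suc(2)[OF D, of "- int m - 1"] by (simp add: p_def)
    have "((\<lambda>\<theta>. s * sin \<theta> * (1 - s * cos \<theta>) powi (- int m)) has_real_derivative
      s * cos \<theta> * (p * D) - real m * (s * sin \<theta>)\<^sup>2 * p) (at \<theta>)"
      using D0[of \<theta>] unfolding p1[symmetric]
      by (auto intro!: derivative_eq_intros simp: D_def p_def power2_eq_square)
    also have "s * cos \<theta> * (p * D) - real m * (s * sin \<theta>)\<^sup>2 * p
      = real m * (1 - s\<^sup>2) * p - (2 * real m - 1) * (p * D) + (real m - 1) * (p * D\<^sup>2)"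
    proof -
      have c1: "s * cos \<theta> = 1 - D" by (simp add: D_def)
      show ?thesis unfolding S2 c1 by (simp add: algebra_simps power2_eq_square)
    qed
    finally have *: "((\<lambda>\<theta>. s * sin \<theta> * (1 - s * cos \<theta>) powi (- int m)) has_real_derivative
      real m * (1 - s\<^sup>2) * p - (2 * real m - 1) * (p * D) + (real m - 1) * (p * D\<^sup>2)) (at \<theta>)" .
    have "f (- int m - 1) \<theta> = p" by (simp add: f_def D_def p_def)
    moreover have "f (- int m) \<theta> = p * D" using p1 by (simp add: f_def D_def)
    moreover have "f (1 - int m) \<theta> = p * D\<^sup>2" using p2 by (simp add: f_def D_def)
    ultimately show ?thesis using * by simp
  qed
  show ?thesis
  proof -
    have "integral (quarter k) (\<lambda>\<theta>. real m * (1 - s\<^sup>2) * f (- int m - 1) \<theta> - (2 * real m - 1) * f (- int m) \<theta> + (real m - 1) * f (1 - int m) \<theta>)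
      = real m * (1 - s\<^sup>2) * integral (quarter k) (f (- int m - 1)) - (2 * real m - 1) * integral (quarter k) (f (- int m))
         + (real m - 1) * integral (quarter k) (f (1 - int m))"
      by (intro integral_unique has_integral_diff has_integral_add has_integral_mult_right integrable_integral I)
    moreover have "trig_integral k 0 j s = integral (quarter k) (f j)" for j by (simp add: trig_integral_def f_def[abs_def])
    ultimately show ?thesis using quarter_FTC(1)[OF d, of k] by (simp add: algebra_simps)
  qed
qed

lemma kepler_values:
  "kepler \<beta> 0 = 0" "kepler \<beta> (pi / 2) = pi / 2 + 2 * arctan \<beta>" "kepler \<beta> pi = pi"
  "kepler \<beta> (3 * (pi / 2)) = 3 * (pi / 2) - 2 * arctan \<beta>" "kepler \<beta> (2 * pi) = 2 * pi"
  by (simp_all only: kepler_def trig_quarter) (simp_all add: arctan_minus)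

text \<open>The function \<open>kepler\<close> is a primitive, and its values at the ends of the quarter are
  multiples of \<open>\<pi>/2\<close> up to \<open>\<plusminus> 2 arctan \<beta> = \<plusminus> arcsin s\<close>.\<close>

lemma trig_integral_0_minus_one:
  assumes "k \<in> {1..4}"
  shows "\<exists>a\<in>{-1,1}. \<forall>s. 0 < s \<and> s < 1 \<longrightarrow> trig_integral k 0 (-1) s = (pi / 2 + a * arcsin s) / sqrt (1 - s\<^sup>2)"
proof -
  have v: "trig_integral k 0 (-1) s = (kepler \<beta> (quarter_end k) - kepler \<beta> (quarter_end k - pi / 2)) / sqrt (1 - s\<^sup>2)"
    if s: "0 < s" "s < 1" and b: "0 < \<beta>" "\<beta> < 1" "s = 2 * \<beta> / (1 + \<beta>\<^sup>2)" "sqrt (1 - s\<^sup>2) = (1 - \<beta>\<^sup>2) / (1 + \<beta>\<^sup>2)"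
    for s \<beta>
  proof -
    have p: "1 + \<beta>\<^sup>2 > 0" "1 - \<beta>\<^sup>2 > 0" using b by (auto simp: add_pos_nonneg power_less_one_iff)
    have "((\<lambda>\<theta>. kepler \<beta> \<theta> / sqrt (1 - s\<^sup>2)) has_real_derivative (s * sin \<theta>) ^ 0 * (1 - s * cos \<theta>) powi (-1)) (at \<theta>)" for \<theta>
    proof -
      have "1 - s * cos \<theta> = (1 - 2 * \<beta> * cos \<theta> + \<beta>\<^sup>2) / (1 + \<beta>\<^sup>2)"
        unfolding b(3) using p by (simp add: field_simps)
      moreover have "1 - 2 * \<beta> * cos \<theta> + \<beta>\<^sup>2 \<noteq> 0" using calculation denom_pos[OF s, of \<theta>] by auto
      ultimately have "(1 - \<beta>\<^sup>2) / (1 - 2 * \<beta> * cos \<theta> + \<beta>\<^sup>2) / sqrt (1 - s\<^sup>2) = (s * sin \<theta>) ^ 0 * (1 - s * cos \<theta>) powi (-1)"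
        unfolding b(4) using p by (simp add: power_int_minus)
      then show ?thesis using DERIV_cdivide[OF kepler_deriv[of \<beta> \<theta>], of "sqrt (1 - s\<^sup>2)"] b by simp
    qed
    from quarter_FTC(1)[OF this, of k] show ?thesis unfolding trig_integral_def by (simp add: diff_divide_distrib)
  qed
  have "\<exists>a\<in>{-1,1}. \<forall>\<beta>. kepler \<beta> (quarter_end k) - kepler \<beta> (quarter_end k - pi / 2) = pi / 2 + a * (2 * arctan \<beta>)"
  proof (rule quarter_cases[OF assms])
    assume k: "k = 1"
    then have "quarter_end k = pi / 2" "quarter_end k - pi / 2 = 0" by (simp_all add: quarter_end_def)
    then show ?thesis by (intro bexI[of _ 1]) (simp_all only: kepler_values, simp_all)
  next
    assume k: "k = 2"
    then have "quarter_end k = pi" "quarter_end k - pi / 2 = pi / 2" by (simp_all add: quarter_end_def)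
    then show ?thesis by (intro bexI[of _ "-1"]) (simp_all only: kepler_values, simp_all)
  next
    assume k: "k = 3"
    then have "quarter_end k = 3 * (pi / 2)" "quarter_end k - pi / 2 = pi" by (simp_all add: quarter_end_def)
    then show ?thesis by (intro bexI[of _ "-1"]) (simp_all only: kepler_values, simp_all)
  next
    assume k: "k = 4"
    then have "quarter_end k = 2 * pi" "quarter_end k - pi / 2 = 3 * (pi / 2)" by (simp_all add: quarter_end_def)
    then show ?thesis by (intro bexI[of _ 1]) (simp_all only: kepler_values, simp_all)
  qed
  then obtain a where a: "a \<in> {-1,1}" "\<And>\<beta>. kepler \<beta> (quarter_end k) - kepler \<beta> (quarter_end k - pi / 2) = pi / 2 + a * (2 * arctan \<beta>)" by blast
  show ?thesis
  proof (rule bexI[OF _ a(1)], intro allI impI)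
    fix s :: real assume s: "0 < s \<and> s < 1"
    then obtain \<beta> where b: "0 < \<beta>" "\<beta> < 1" "s = 2 * \<beta> / (1 + \<beta>\<^sup>2)" "sqrt (1 - s\<^sup>2) = (1 - \<beta>\<^sup>2) / (1 + \<beta>\<^sup>2)"
      "2 * arctan \<beta> = arcsin s" using half_angle_param by metis
    show "trig_integral k 0 (-1) s = (pi / 2 + a * arcsin s) / sqrt (1 - s\<^sup>2)"
      using v[OF _ _ b(1-4)] s a(2)[of \<beta>] b(5) by simp
  qed
qed

lemma real_degree_mult_le: "degree (p :: real poly) \<le> a \<Longrightarrow> degree q \<le> b \<Longrightarrow> degree (p * q) \<le> a + b"
  by (meson add_mono degree_mult_le order_trans)

text \<open>The recursion divides by \<open>1 - s\<^sup>2\<close> once per step, so \<open>m - 1\<close> factors clear the denominators. The boundary term is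
  a multiple of \<open>s\<close>: where \<open>sin \<theta>\<close> does not vanish, \<open>cos \<theta>\<close> does.\<close>

lemma trig_integral_0_reduction:
  assumes "k \<in> {1..4}" "m \<ge> 1"
  shows "\<exists>b a. degree b \<le> m - 1 \<and> degree a \<le> 2 * m \<and> (\<forall>s. 0 < s \<and> s < 1 \<longrightarrow>
     (1 - s\<^sup>2) ^ (m - 1) * trig_integral k 0 (- int m) s = poly b (1 - s\<^sup>2) * trig_integral k 0 (-1) s + poly a s)"
  using assms(2)
proof (induction m rule: less_induct)
  case (less m)
  have bdry: "\<exists>c. \<forall>s j. sin (quarter_end k) * (1 - s * cos (quarter_end k)) powi j
      - sin (quarter_end k - pi / 2) * (1 - s * cos (quarter_end k - pi / 2)) powi j = (c::real)"
    by (rule quarter_cases[OF assms(1)]) (simp_all add: quarter_end_def trig_quarter cos_diff sin_diff trig32)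
  then obtain c where c: "\<And>s j. sin (quarter_end k) * (1 - s * cos (quarter_end k)) powi j
      - sin (quarter_end k - pi / 2) * (1 - s * cos (quarter_end k - pi / 2)) powi j = c" by blast
  note R = trig_integral_0_rec[where k = k, unfolded c]
  (* For m = 2 the coefficient of the second predecessor in the recursion vanishes. *)
  consider "m = 1" | "m = 2" | n where "m = Suc (Suc n)" "n \<ge> 1"
  proof -
    obtain j where j: "m = Suc j" using less.prems by (cases m) auto
    show ?thesis
    proof (cases j)
      case 0 then show ?thesis using j that by auto
    next
      case (Suc n) then show ?thesis using j that by (cases n) auto
    qed
  qed
  then show ?case
  proof cases
    case 1
    then show ?thesis by (intro exI[of _ 1] exI[of _ 0]) auto
  next
    case 2
    have "(1 - s\<^sup>2) * trig_integral k 0 (-2) s = trig_integral k 0 (-1) s + c * s" if "0 < s" "s < 1" for s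
      using R[OF that, of 1] by simp
    then show ?thesis using 2
      by (intro exI[of _ 1] exI[of _ "[:0, c:]"]) (auto simp: mult.commute)
  next
    case (3 n)
    obtain b1 a1 where 1: "degree b1 \<le> n" "degree a1 \<le> 2 * Suc n"
      "\<And>s. 0 < s \<and> s < 1 \<Longrightarrow> (1 - s\<^sup>2) ^ n * trig_integral k 0 (- int (Suc n)) s = poly b1 (1 - s\<^sup>2) * trig_integral k 0 (-1) s + poly a1 s"
      using less.IH[of "Suc n"] 3 by auto
    obtain b0 a0 where 0: "degree b0 \<le> n - 1" "degree a0 \<le> 2 * n"
      "\<And>s. 0 < s \<and> s < 1 \<Longrightarrow> (1 - s\<^sup>2) ^ (n - 1) * trig_integral k 0 (- int n) s = poly b0 (1 - s\<^sup>2) * trig_integral k 0 (-1) s + poly a0 s"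
      using less.IH[of n] 3 by auto
    define M where "M = real (Suc n)"
    have M: "M > 0" by (simp add: M_def)
    define b where "b = smult (1 / M) (smult (2 * M - 1) b1 - smult (M - 1) ([:0, 1:] * b0))"
    define a where "a = smult (1 / M) (smult (2 * M - 1) a1 - smult (M - 1) ([:1, 0, -1:] * a0)
       + smult c ([:0, 1:] * [:1, 0, -1:] ^ n))"
    have db: "degree b \<le> m - 1" unfolding b_def
    proof (intro order_trans[OF degree_smult_le] degree_diff_le)
      show "degree b1 \<le> m - 1" using 1 3 by simp
      have "degree ([:0, 1:] * b0) \<le> 1 + (n - 1)" by (rule real_degree_mult_le) (use 0 in simp_all)
      then show "degree ([:0, 1:] * b0) \<le> m - 1" using 3 by simp
    qed
    have da: "degree a \<le> 2 * m" unfolding a_def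
    proof (intro order_trans[OF degree_smult_le] degree_diff_le degree_add_le)
      show "degree a1 \<le> 2 * m" using 1 3 by simp
      have "degree ([:1, 0, -1:] * a0) \<le> 2 + 2 * n" by (rule real_degree_mult_le) (use 0 in simp_all)
      then show "degree ([:1, 0, -1:] * a0) \<le> 2 * m" using 3 by simp
      have "degree ([:0, 1::real:] * [:1, 0, -1:] ^ n) \<le> 1 + 2 * n"
        by (rule real_degree_mult_le) (simp, rule order_trans[OF degree_power_le], simp)
      then show "degree ([:0, 1::real:] * [:1, 0, -1:] ^ n) \<le> 2 * m" using 3 by simp
    qed
    have "(1 - s\<^sup>2) ^ (m - 1) * trig_integral k 0 (- int m) s = poly b (1 - s\<^sup>2) * trig_integral k 0 (-1) s + poly a s"
      if s: "0 < s \<and> s < 1" for s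
    proof -
      define u where "u = 1 - s\<^sup>2"
      define T where "T = trig_integral k 0 (-1) s"
      have e: "- int (Suc n) - 1 = - int m" "1 - int (Suc n) = - int n" using 3 by simp_all
      have "M * u * trig_integral k 0 (- int m) s = (2 * M - 1) * trig_integral k 0 (- int (Suc n)) s - (M - 1) * trig_integral k 0 (- int n) s + s * c"
        using R[of s "Suc n"] s unfolding e M_def u_def by simp
      then have "u ^ n * (M * u * trig_integral k 0 (- int m) s) = u ^ n * ((2 * M - 1) * trig_integral k 0 (- int (Suc n)) s - (M - 1) * trig_integral k 0 (- int n) s + s * c)"
        by (rule arg_cong)
      also have un: "u ^ n = u * u ^ (n - 1)" using \<open>n \<ge> 1\<close> by (cases n) auto
      then have "u ^ n * ((2 * M - 1) * trig_integral k 0 (- int (Suc n)) s - (M - 1) * trig_integral k 0 (- int n) s + s * c) = (2 * M - 1) * (u ^ n * trig_integral k 0 (- int (Suc n)) s)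
         - (M - 1) * (u * (u ^ (n - 1) * trig_integral k 0 (- int n) s)) + s * c * u ^ n"
        by (simp add: algebra_simps)
      also have "\<dots> = (2 * M - 1) * (poly b1 u * T + poly a1 s) - (M - 1) * (u * (poly b0 u * T + poly a0 s)) + s * c * u ^ n"
        unfolding u_def T_def 1(3)[OF s] 0(3)[OF s] ..
      also have "\<dots> = M * (poly b u * T + poly a s)"
        using M unfolding a_def b_def poly_smult poly_diff poly_add poly_mult u_poly u_def[symmetric]
        by (simp add: field_simps power2_eq_square u_def)
      finally have "M * (u ^ (m - 1) * trig_integral k 0 (- int m) s) = M * (poly b u * T + poly a s)"
        using 3 by (simp add: mult_ac)
      then show ?thesis using M by (simp add: u_def T_def)
    qed
    with da db show ?thesis by blast
  qed
qed

lemma trig_integral_0_neg_log_arc_form: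
  assumes "k \<in> {1..4}" "m \<ge> 1" "m \<le> Suc N"
  shows "log_arc_form N N (trig_integral k 0 (- int m))"
proof -
  obtain b a where ba: "degree b \<le> m - 1" "degree a \<le> 2 * m" "\<And>s. 0 < s \<and> s < 1 \<Longrightarrow>
     (1 - s\<^sup>2) ^ (m - 1) * trig_integral k 0 (- int m) s = poly b (1 - s\<^sup>2) * trig_integral k 0 (-1) s + poly a s"
    using trig_integral_0_reduction[OF assms(1,2)] by blast
  obtain t where t: "\<And>s. 0 < s \<and> s < 1 \<Longrightarrow> trig_integral k 0 (-1) s = (pi / 2 + t * arcsin s) / sqrt (1 - s\<^sup>2)"
    using trig_integral_0_minus_one[OF assms(1)] by blast
  define r where "r = N - (m - 1)"
  have r: "N = r + (m - 1)" using assms(2,3) by (simp add: r_def)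
  have dm: "degree (monom 1 r * b) \<le> N"
    unfolding r by (rule real_degree_mult_le[OF degree_monom_le ba(1)])
  show ?thesis unfolding log_arc_form_def
  proof (rule exI[of _ "[:1, 0, -1:] ^ r * a"], rule exI[of _ 0], rule exI[of _ 0],
      rule exI[of _ "smult t (monom 1 r * b)"], rule exI[of _ "smult (pi / 2) (monom 1 r * b)"],
      intro conjI ballI order_trans[OF degree_smult_le dm])
    have "degree ([:1, 0, -1:] ^ r * a) \<le> 2 * r + 2 * m"
      by (rule real_degree_mult_le) (use ba in \<open>auto intro: order_trans[OF degree_power_le]\<close>)
    then show "degree ([:1, 0, -1:] ^ r * a) \<le> 2 * N + 3" using assms(2) r by simp
    fix s :: real assume "s \<in> {0<..<1}"
    then have s: "0 < s \<and> s < 1" by auto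
    have "(1 - s\<^sup>2) ^ N * trig_integral k 0 (- int m) s = (1 - s\<^sup>2) ^ r * ((1 - s\<^sup>2) ^ (m - 1) * trig_integral k 0 (- int m) s)"
      by (simp add: r power_add)
    also have "\<dots> = (1 - s\<^sup>2) ^ r * (poly b (1 - s\<^sup>2) * ((pi / 2 + t * arcsin s) / sqrt (1 - s\<^sup>2)) + poly a s)"
      unfolding ba(3)[OF s] t[OF s] ..
    also have "\<dots> = poly ([:1, 0, -1:] ^ r * a) s + (poly 0 (1 - s\<^sup>2) * ln (1 - s) + poly 0 (1 - s\<^sup>2) * ln (1 + s))
       + (poly (smult t (monom 1 r * b)) (1 - s\<^sup>2) * arcsin s + poly (smult (pi / 2) (monom 1 r * b)) (1 - s\<^sup>2)) / sqrt (1 - s\<^sup>2)"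
      unfolding poly_mult poly_smult u_poly poly_monom
      by (simp add: algebra_simps add_divide_distrib)
    finally show "(1 - s\<^sup>2) ^ N * trig_integral k 0 (- int m) s = poly ([:1, 0, -1:] ^ r * a) s
      + (poly 0 (1 - s\<^sup>2) * ln (1 - s) + poly 0 (1 - s\<^sup>2) * ln (1 + s))
       + (poly (smult t (monom 1 r * b)) (1 - s\<^sup>2) * arcsin s + poly (smult (pi / 2) (monom 1 r * b)) (1 - s\<^sup>2)) / sqrt (1 - s\<^sup>2)" .
  qed simp_all
qed

text \<open>Two factors \<open>s sin \<theta>\<close> cost one factor \<open>1 - s\<^sup>2\<close> and thus one degree in \<open>u\<close>. The upper bound on \<open>e + i\<close>
  keeps the purely polynomial integrals within degree \<open>2d + 3\<close>.\<close>

lemma trig_integral_log_arc_form: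
  assumes "k \<in> {1..4}" "- int N - 1 \<le> e" "e + int i \<le> 3"
  shows "log_arc_form N (N + i div 2) (trig_integral k i e)"
  using assms(2,3)
proof (induction i arbitrary: e rule: less_induct)
  case (less i)
  consider "i = 0" | "i = 1" | j where "i = Suc (Suc j)"
    by (metis One_nat_def not0_implies_Suc)
  then show ?case
  proof cases
    case 1
    show ?thesis
    proof (cases "e \<ge> 0")
      case True
      then obtain j where "e = int j" using nonneg_int_cases by blast
      then show ?thesis using trig_integral_0_nonneg_log_arc_form[of j N k] less.prems 1 by simp
    next
      case False
      define m where "m = nat (- e)"
      have "e = - int m" "m \<ge> 1" "m \<le> Suc N" using False less.prems(1) by (auto simp: m_def)
      then show ?thesis using trig_integral_0_neg_log_arc_form[OF assms(1), of m N] 1 by simp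
    qed
  next
    case 2
    then show ?thesis using trig_integral_1_log_arc_form[OF assms(1) _, of N e] less.prems by simp
  next
    case (3 j)
    have i2: "i div 2 = Suc (j div 2)" using 3 by simp
    have N: "log_arc_form N (N + j div 2) (trig_integral k j e')" if "e \<le> e'" "e' \<le> e + 2" for e'
      using less.IH[of j e'] 3 less.prems that by simp
    have "log_arc_form N (N + i div 2) (\<lambda>s. (-1) * ((1 - s\<^sup>2) * trig_integral k j e s) + (2 * trig_integral k j (e + 1) s + (-1) * trig_integral k j (e + 2) s))"
      unfolding i2 add_Suc_right
      by (intro log_arc_form_add log_arc_form_cmult log_arc_form_u N log_arc_form_mono[OF N]) auto
    then show ?thesis by (rule log_arc_form_cong) (simp add: trig_integral_rec 3 del: power_Suc)
  qed
qed

section \<open>The Melnikov function in polar coordinates\<close>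

text \<open>Morera's theorem: by Fubini, the integral over a triangle of the parameter integral is the
  integral of the vanishing triangle integrals.\<close>

lemma holomorphic_integral:
  fixes f :: "real \<Rightarrow> complex \<Rightarrow> complex"
  assumes cont: "continuous_on ({a..b} \<times> U) (\<lambda>(t, z). f t z)" and U: "open U"
    and hol: "\<And>t. t \<in> {a..b} \<Longrightarrow> f t holomorphic_on U"
  shows "(\<lambda>z. integral {a..b} (\<lambda>t. f t z)) holomorphic_on U"
proof -
  define F where "F z = integral {a..b} (\<lambda>t. f t z)" for z
  define K where "K p q t = contour_integral (linepath p q) (f t)" for p q t
  have comm: "continuous_on (V \<times> {a..b}) (\<lambda>(z, t). f t z)" if "V \<subseteq> U" for V
  proof -
    have "continuous_on (V \<times> {a..b}) (\<lambda>x. (\<lambda>(t, z). f t z) (snd x, fst x))"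
      by (rule continuous_on_compose2[OF cont]) (use that in \<open>auto intro!: continuous_intros\<close>)
    then show ?thesis by (simp add: case_prod_beta')
  qed
  have contF: "continuous_on U F"
    using integral_continuous_on_param[of U a b "\<lambda>z t. f t z"] comm[OF order_refl]
    by (simp add: F_def[abs_def] cbox_interval)
  have seg: "contour_integral (linepath p q) F = integral {a..b} (K p q) \<and> continuous_on {a..b} (K p q)"
    if "closed_segment p q \<subseteq> U" for p q
  proof -
    have lp: "linepath p q x \<in> U" if "x \<in> {0..1}" for x
      using \<open>closed_segment p q \<subseteq> U\<close> that linepath_in_path by blast
    have c: "continuous_on ({0..1} \<times> {a..b}) (\<lambda>(x, t). f t (linepath p q x) * (q - p))"
    proof -
      have "continuous_on ({0..1} \<times> {a..b}) (\<lambda>x. (\<lambda>(t, z). f t z) (snd x, linepath p q (fst x)))"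
        by (rule continuous_on_compose2[OF cont]) (use lp in \<open>auto intro!: continuous_intros simp: linepath_def\<close>)
      then show ?thesis by (auto intro!: continuous_intros simp: case_prod_beta')
    qed
    have c': "continuous_on ({a..b} \<times> {0..1}) (\<lambda>(t, x). f t (linepath p q x) * (q - p))"
    proof -
      have "continuous_on ({a..b} \<times> {0..1}) (\<lambda>y. (\<lambda>(x, t). f t (linepath p q x) * (q - p)) (snd y, fst y))"
        by (rule continuous_on_compose2[OF c]) (auto intro!: continuous_intros)
      then show ?thesis by (simp add: case_prod_beta')
    qed
    have K: "K p q = (\<lambda>t. integral {0..1} (\<lambda>x. f t (linepath p q x) * (q - p)))"
      unfolding K_def contour_integral_integral by simp
    have "contour_integral (linepath p q) F
        = integral {0..1} (\<lambda>x. integral {a..b} (\<lambda>t. f t (linepath p q x) * (q - p)))"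
      unfolding contour_integral_integral F_def by simp
    also have "\<dots> = integral {a..b} (\<lambda>t. integral {0..1} (\<lambda>x. f t (linepath p q x) * (q - p)))"
    proof -
      have "continuous_on (cbox (0, a) (1, b)) (\<lambda>(x, t). f t (linepath p q x) * (q - p))"
        unfolding cbox_Pair_eq unfolding cbox_interval by (rule c)
      from integral_swap_continuous[OF this] show ?thesis unfolding cbox_interval .
    qed
    also have "\<dots> = integral {a..b} (K p q)" by (simp only: K)
    finally show ?thesis
      using integral_continuous_on_param[of "{a..b}" 0 1 "\<lambda>t x. f t (linepath p q x) * (q - p)"] c'
      by (simp only: K cbox_interval simp_thms)
  qed
  have "F analytic_on U"
  proof (rule Morera_triangle[OF contF U], intro impI)
    fix p q r assume h: "convex hull {p, q, r} \<subseteq> U"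
    have s: "closed_segment p q \<subseteq> U" "closed_segment q r \<subseteq> U" "closed_segment r p \<subseteq> U"
      by (rule order_trans[OF segments_subset_convex_hull(1) h] order_trans[OF _ h], (rule segments_subset_convex_hull)?)+
    have "K p q t + K q r t + K r p t = 0" if "t \<in> {a..b}" for t
    proof -
      have "f t holomorphic_on convex hull {p, q, r}" using hol[OF that] h holomorphic_on_subset by blast
      from Cauchy_theorem_triangle[OF this]
      have 0: "(f t has_contour_integral 0) (linepath p q +++ linepath q r +++ linepath r p)" .
      have ct: "continuous_on (closed_segment v w) (f t)" if "closed_segment v w \<subseteq> U" for v w
        using hol[OF \<open>t \<in> {a..b}\<close>] that holomorphic_on_imp_continuous_on continuous_on_subset by blast
      have i: "f t contour_integrable_on linepath v w" if "closed_segment v w \<subseteq> U" for v w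
        using ct[OF that] contour_integrable_continuous_linepath by blast
      have "contour_integral (linepath p q +++ linepath q r +++ linepath r p) (f t) = K p q t + (K q r t + K r p t)"
        unfolding K_def using i s by (subst contour_integral_join; simp add: contour_integrable_joinI valid_path_join)+
      then show ?thesis using contour_integral_unique[OF 0] by (simp add: add.assoc)
    qed
    then have "integral {a..b} (\<lambda>t. K p q t + K q r t + K r p t) = 0"
      by (subst integral_cong[of _ _ "\<lambda>_. 0"]) auto
    then show "contour_integral (linepath p q) F + contour_integral (linepath q r) F + contour_integral (linepath r p) F = 0"
      using seg[OF s(1)] seg[OF s(2)] seg[OF s(3)]
      by (simp add: integral_add integrable_continuous_interval continuous_on_add)
  qed
  then show ?thesis unfolding F_def by (rule analytic_imp_holomorphic)
qed

definition bipoly :: "(nat \<Rightarrow> nat \<Rightarrow> real) \<Rightarrow> nat \<Rightarrow> 'a::real_normed_field \<Rightarrow> 'a \<Rightarrow> 'a" where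
  "bipoly c n x y = (\<Sum>i\<le>n. \<Sum>j\<le>n - i. of_real (c i j) * x ^ i * y ^ j)"

text \<open>The following functions are given for real and complex radii \<open>z\<close> at once. The first one is \<open>\<eta>/y\<close> at the
  point with polar coordinates \<open>(z, \<theta>)\<close>.\<close>

definition dn :: "real \<Rightarrow> 'a::real_normed_field \<Rightarrow> 'a" where
  "dn \<theta> z = 1 - z * of_real (cos \<theta>)"
text \<open>The Cartesian coordinates of the point with \<open>zeta = z (cos \<theta> + \<i> sin \<theta>)\<close>.\<close>

definition px :: "real \<Rightarrow> real \<Rightarrow> 'a::real_normed_field \<Rightarrow> 'a" where
  "px \<eta> \<theta> z = of_real (\<eta> / sqrt (2 * \<eta>)) * (z * of_real (sin \<theta>)) / dn \<theta> z"
definition py :: "real \<Rightarrow> real \<Rightarrow> 'a::real_normed_field \<Rightarrow> 'a" where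
  "py \<eta> \<theta> z = of_real \<eta> / dn \<theta> z"
text \<open>For a perturbation \<open>(f, g)\<close> with coefficients \<open>a\<close>, \<open>b\<close>, the derivative of \<open>zeta\<close> along \<open>(f, g)\<close> is
  \<open>cis \<theta> (radial + \<i> angular)\<close>, see \<open>polar_components\<close>.\<close>

definition radial :: "real \<Rightarrow> nat \<Rightarrow> (nat \<Rightarrow> nat \<Rightarrow> real) \<Rightarrow> (nat \<Rightarrow> nat \<Rightarrow> real) \<Rightarrow> real \<Rightarrow> 'a::real_normed_field \<Rightarrow> 'a" where
  "radial \<eta> n a b \<theta> z = dn \<theta> z / of_real \<eta> *
     (of_real (sqrt (2 * \<eta>)) * bipoly a n (px \<eta> \<theta> z) (py \<eta> \<theta> z) * of_real (sin \<theta>)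
       + bipoly b n (px \<eta> \<theta> z) (py \<eta> \<theta> z) * (of_real (cos \<theta>) - z))"
definition angular :: "real \<Rightarrow> nat \<Rightarrow> (nat \<Rightarrow> nat \<Rightarrow> real) \<Rightarrow> (nat \<Rightarrow> nat \<Rightarrow> real) \<Rightarrow> real \<Rightarrow> 'a::real_normed_field \<Rightarrow> 'a" where
  "angular \<eta> n a b \<theta> z = dn \<theta> z / of_real \<eta> *
     (of_real (sqrt (2 * \<eta>)) * bipoly a n (px \<eta> \<theta> z) (py \<eta> \<theta> z) * of_real (cos \<theta>)
       - bipoly b n (px \<eta> \<theta> z) (py \<eta> \<theta> z) * of_real (sin \<theta>))"

text \<open>The derivative at \<open>\<epsilon> = 0\<close> of the radius after one turn.\<close>

definition mel1 :: "real \<Rightarrow> nat \<Rightarrow> (nat \<Rightarrow> nat \<Rightarrow> nat \<Rightarrow> real) \<Rightarrow> (nat \<Rightarrow> nat \<Rightarrow> nat \<Rightarrow> real)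
    \<Rightarrow> 'a::{real_normed_field, banach} \<Rightarrow> 'a" where
  "mel1 \<eta> n a b z = (\<Sum>k = 1..4. integral (quarter k) (\<lambda>\<theta>. radial \<eta> n (a k) (b k) \<theta> z / of_real (sqrt (2 * \<eta>))))"

lemma of_real_radial: "radial \<eta> n a b \<theta> (of_real s) = (of_real (radial \<eta> n a b \<theta> s) :: 'a::real_normed_field)"
  by (simp add: radial_def bipoly_def px_def py_def dn_def)
lemma of_real_angular: "angular \<eta> n a b \<theta> (of_real s) = (of_real (angular \<eta> n a b \<theta> s) :: 'a::real_normed_field)"
  by (simp add: angular_def bipoly_def px_def py_def dn_def)

lemma dn_strip: "z \<in> strip \<Longrightarrow> dn \<theta> z \<noteq> 0"
proof
  assume z: "z \<in> strip" and "dn \<theta> z = 0"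
  then have "Re (dn \<theta> z) = 0" by simp
  then have "1 - Re z * cos \<theta> = 0" by (simp add: dn_def)
  moreover have "1 - Re z * cos \<theta> > 0" using z by (intro denom_pos) (auto simp: strip_def)
  ultimately show False by simp
qed

lemma dn_real: "0 < s \<Longrightarrow> s < 1 \<Longrightarrow> dn \<theta> s > (0::real)"
  unfolding dn_def using denom_pos by simp

lemma bipoly_continuous [continuous_intros]:
  "continuous_on S f \<Longrightarrow> continuous_on S g \<Longrightarrow> continuous_on S (\<lambda>x. bipoly c n (f x) (g x))"
  unfolding bipoly_def by (intro continuous_intros)

lemma dn_continuous [continuous_intros]:
  fixes f :: "'b::t2_space \<Rightarrow> real"
  shows "continuous_on S f \<Longrightarrow> continuous_on S g \<Longrightarrow> continuous_on S (\<lambda>x. dn (f x) (g x))"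
  unfolding dn_def by (intro continuous_intros)

lemma px_continuous:
  fixes f :: "'b::t2_space \<Rightarrow> real"
  assumes "continuous_on S f" "continuous_on S g" "\<And>x. x \<in> S \<Longrightarrow> dn (f x) (g x) \<noteq> 0"
  shows "continuous_on S (\<lambda>x. px \<eta> (f x) (g x))"
  unfolding px_def using assms
  by (intro continuous_on_divide continuous_on_mult continuous_on_const continuous_on_of_real continuous_on_sin dn_continuous) auto

lemma py_continuous:
  fixes f :: "'b::t2_space \<Rightarrow> real"
  assumes "continuous_on S f" "continuous_on S g" "\<And>x. x \<in> S \<Longrightarrow> dn (f x) (g x) \<noteq> 0"
  shows "continuous_on S (\<lambda>x. py \<eta> (f x) (g x))"
  unfolding py_def using assms
  by (intro continuous_on_divide continuous_on_const dn_continuous) auto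

lemma radial_continuous_gen:
  fixes f :: "'b::t2_space \<Rightarrow> real"
  assumes "continuous_on S f" "continuous_on S g" "\<And>x. x \<in> S \<Longrightarrow> dn (f x) (g x) \<noteq> 0"
  shows "continuous_on S (\<lambda>x. radial \<eta> n a b (f x) (g x))"
  unfolding radial_def divide_inverse
  by (intro continuous_on_mult continuous_on_add continuous_on_diff continuous_on_const continuous_on_of_real continuous_on_sin continuous_on_cos bipoly_continuous dn_continuous px_continuous py_continuous assms)

lemma angular_continuous_gen:
  fixes f :: "'b::t2_space \<Rightarrow> real"
  assumes "continuous_on S f" "continuous_on S g" "\<And>x. x \<in> S \<Longrightarrow> dn (f x) (g x) \<noteq> 0"
  shows "continuous_on S (\<lambda>x. angular \<eta> n a b (f x) (g x))"
  unfolding angular_def divide_inverse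
  by (intro continuous_on_mult continuous_on_add continuous_on_diff continuous_on_const continuous_on_of_real continuous_on_sin continuous_on_cos bipoly_continuous dn_continuous px_continuous py_continuous assms)

lemma radial_continuous: "continuous_on (T \<times> strip) (\<lambda>(\<theta>, z). radial \<eta> n a b \<theta> z)"
  unfolding case_prod_beta'
  by (rule radial_continuous_gen) (auto intro!: continuous_on_fst continuous_on_snd continuous_on_id dn_strip)
lemma angular_continuous: "continuous_on (T \<times> strip) (\<lambda>(\<theta>, z). angular \<eta> n a b \<theta> z)"
  unfolding case_prod_beta'
  by (rule angular_continuous_gen) (auto intro!: continuous_on_fst continuous_on_snd continuous_on_id dn_strip)

lemma bipoly_holomorphic [holomorphic_intros]:
  "f holomorphic_on S \<Longrightarrow> g holomorphic_on S \<Longrightarrow> (\<lambda>x. bipoly c n (f x) (g x)) holomorphic_on S"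
  unfolding bipoly_def by (intro holomorphic_intros)

lemma dn_holomorphic [holomorphic_intros]: "(\<lambda>z. dn \<theta> z) holomorphic_on S"
  unfolding dn_def by (intro holomorphic_intros)

lemma px_holomorphic: "(\<lambda>z. px \<eta> \<theta> z) holomorphic_on strip"
  unfolding px_def
  by (intro holomorphic_on_divide holomorphic_on_mult holomorphic_on_const holomorphic_on_ident dn_holomorphic dn_strip)

lemma py_holomorphic: "(\<lambda>z. py \<eta> \<theta> z) holomorphic_on strip"
  unfolding py_def by (intro holomorphic_on_divide holomorphic_on_const dn_holomorphic dn_strip)

lemma radial_holomorphic: "(\<lambda>z. radial \<eta> n a b \<theta> z) holomorphic_on strip"
  unfolding radial_def divide_inverse
  by (intro holomorphic_on_mult holomorphic_on_add holomorphic_on_diff holomorphic_on_const holomorphic_on_ident bipoly_holomorphic dn_holomorphic px_holomorphic py_holomorphic)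
lemma angular_holomorphic: "(\<lambda>z. angular \<eta> n a b \<theta> z) holomorphic_on strip"
  unfolding angular_def divide_inverse
  by (intro holomorphic_on_mult holomorphic_on_add holomorphic_on_diff holomorphic_on_const holomorphic_on_ident bipoly_holomorphic dn_holomorphic px_holomorphic py_holomorphic)

lemma mel1_holomorphic: "mel1 \<eta> n a b holomorphic_on strip"
proof -
  have "(\<lambda>z. integral (quarter k) (\<lambda>\<theta>. radial \<eta> n (a k) (b k) \<theta> z / of_real (sqrt (2 * \<eta>)))) holomorphic_on strip" for k
  proof (cases "\<eta> = 0")
    case False
    show ?thesis unfolding quarter_def divide_inverse
      using continuous_on_mult[OF radial_continuous[of _ \<eta> n "a k" "b k"] continuous_on_const]
      by (intro holomorphic_integral strip_open holomorphic_on_mult radial_holomorphic holomorphic_on_const)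
        (simp add: case_prod_beta')
  qed simp
  then show ?thesis unfolding mel1_def[abs_def] by (intro holomorphic_intros) auto
qed

lemma radial_continuous_real: "0 < s \<Longrightarrow> s < 1 \<Longrightarrow> continuous_on T (\<lambda>\<theta>. radial \<eta> n a b \<theta> (s::real))"
  by (intro radial_continuous_gen continuous_on_id continuous_on_const) (metis dn_real less_irrefl)

lemma of_real_mel1:
  assumes "0 < s" "s < 1"
  shows "mel1 \<eta> n a b (of_real s) = (of_real (mel1 \<eta> n a b s) :: complex)"
proof -
  have "integral (quarter k) (\<lambda>\<theta>. radial \<eta> n (a k) (b k) \<theta> (of_real s) / of_real (sqrt (2 * \<eta>)))
     = complex_of_real (integral (quarter k) (\<lambda>\<theta>. radial \<eta> n (a k) (b k) \<theta> s / sqrt (2 * \<eta>)))" for k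
  proof -
    have "(\<lambda>\<theta>. radial \<eta> n (a k) (b k) \<theta> s / sqrt (2 * \<eta>)) integrable_on quarter k"
      unfolding quarter_def divide_inverse
      by (intro integrable_continuous_interval continuous_intros radial_continuous_real assms)
    then have "((\<lambda>\<theta>. of_real (radial \<eta> n (a k) (b k) \<theta> s / sqrt (2 * \<eta>))) has_integral
       complex_of_real (integral (quarter k) (\<lambda>\<theta>. radial \<eta> n (a k) (b k) \<theta> s / sqrt (2 * \<eta>)))) (quarter k)"
      by (intro has_integral_of_real integrable_integral)
    then show ?thesis unfolding of_real_radial of_real_divide[symmetric] by (rule integral_unique)
  qed
  then show ?thesis by (simp only: mel1_def of_real_sum of_real_eq_id id_apply)
qed

text \<open>A monomial \<open>x\<^sup>i y\<^sup>j\<close> is a multiple of \<open>(s sin \<theta>)\<^sup>i\<close> divided by the power \<open>i + j\<close> of \<open>1 - s cos \<theta>\<close>. The factor \<open>s\<close>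
  makes \<open>s sin \<theta>\<close> and \<open>s (cos \<theta> - s) = (1 - s\<^sup>2) - (1 - s cos \<theta>)\<close> out of the trigonometric factors
  of \<open>radial\<close>.\<close>

lemma mel1_log_arc_form:
  assumes "\<eta> > 0"
  shows "log_arc_form (n - 2) (n - 2 + n div 2 + 1) (\<lambda>s. s * mel1 \<eta> n a b s)"
proof -
  define N d where "N = n - 2" and "d = n - 2 + n div 2 + 1"
  define \<kappa> where "\<kappa> = sqrt (2 * \<eta>)"
  have \<kappa>: "\<kappa> > 0" using assms by (simp add: \<kappa>_def)
  define c1 where "c1 k i j = 1 / \<eta> * a k i j * (\<eta> / \<kappa>) ^ i * \<eta> ^ j" for k i j
  define c2 where "c2 k i j = 1 / (\<eta> * \<kappa>) * b k i j * (\<eta> / \<kappa>) ^ i * \<eta> ^ j" for k i j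
  define tm where "tm k i j s = c1 k i j * trig_integral k (Suc i) (1 - int (i + j)) s
     + c2 k i j * ((1 - s\<^sup>2) * trig_integral k i (1 - int (i + j)) s + (-1) * trig_integral k i (2 - int (i + j)) s)" for k i j s
  have v: "s * mel1 \<eta> n a b s = (\<Sum>k = 1..4. \<Sum>i\<le>n. \<Sum>j\<le>n - i. tm k i j s)" if s: "0 < s" "s < 1" for s
  proof -
    have 1: "s * (radial \<eta> n (a k) (b k) \<theta> s / \<kappa>) = (\<Sum>i\<le>n. \<Sum>j\<le>n - i.
        c1 k i j * ((s * sin \<theta>) ^ Suc i * (1 - s * cos \<theta>) powi (1 - int (i + j)))
       + c2 k i j * ((1 - s\<^sup>2) * ((s * sin \<theta>) ^ i * (1 - s * cos \<theta>) powi (1 - int (i + j)))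
          + (-1) * ((s * sin \<theta>) ^ i * (1 - s * cos \<theta>) powi (2 - int (i + j)))))" for k \<theta>
    proof -
      define D S where "D = 1 - s * cos \<theta>" and "S = s * sin \<theta>"
      have D: "D > 0" "dn \<theta> s = D" using denom_pos[OF s, of \<theta>] by (auto simp: D_def dn_def)
      have cs: "s * (cos \<theta> - s) = (1 - s\<^sup>2) - D" by (simp add: D_def power2_eq_square algebra_simps)
      have "s * (radial \<eta> n (a k) (b k) \<theta> s / \<kappa>) =
         D / (\<eta> * \<kappa>) * (\<kappa> * bipoly (a k) n (px \<eta> \<theta> s) (py \<eta> \<theta> s) * S + bipoly (b k) n (px \<eta> \<theta> s) (py \<eta> \<theta> s) * ((1 - s\<^sup>2) - D))"
        unfolding radial_def cs[symmetric] D \<kappa>_def[symmetric] S_def by (simp add: field_simps)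
      also have "\<dots> = (\<Sum>i\<le>n. \<Sum>j\<le>n - i. D / (\<eta> * \<kappa>) * (\<kappa> * (a k i j * px \<eta> \<theta> s ^ i * py \<eta> \<theta> s ^ j) * S
             + (b k i j * px \<eta> \<theta> s ^ i * py \<eta> \<theta> s ^ j) * ((1 - s\<^sup>2) - D)))"
        unfolding bipoly_def
        by (simp only: sum_distrib_left sum_distrib_right sum.distrib distrib_left of_real_eq_id id_apply mult.assoc)
      also have "\<dots> = (\<Sum>i\<le>n. \<Sum>j\<le>n - i.
        c1 k i j * (S ^ Suc i * D powi (1 - int (i + j)))
       + c2 k i j * ((1 - s\<^sup>2) * (S ^ i * D powi (1 - int (i + j))) + (-1) * (S ^ i * D powi (2 - int (i + j)))))"
      proof (intro sum.cong refl)
        fix i j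
        define Z where "Z = (\<eta> / \<kappa>) ^ i * \<eta> ^ j"
        have X: "px \<eta> \<theta> s ^ i * py \<eta> \<theta> s ^ j = Z * S ^ i * (1 / D ^ (i + j))"
          unfolding px_def py_def D Z_def \<kappa>_def[symmetric] S_def
          by (simp add: power_divide power_mult_distrib power_add mult_ac)
        have p1: "D powi (1 - int (i + j)) = D * (1 / D ^ (i + j))"
          using D(1) by (simp only: power_int_diff less_imp_neq[THEN not_sym] simp_thms power_int_of_nat) simp
        have p2: "D powi (2 - int (i + j)) = D\<^sup>2 * (1 / D ^ (i + j))"
          using D(1) by (simp only: power_int_diff less_imp_neq[THEN not_sym] simp_thms power_int_of_nat) simp
        define q where "q = 1 / D ^ (i + j)"
        have "D / (\<eta> * \<kappa>) * (\<kappa> * (a k i j * (Z * S ^ i * q)) * S + (b k i j * (Z * S ^ i * q)) * ((1 - s\<^sup>2) - D))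
          = c1 k i j * (S ^ Suc i * (D * q)) + c2 k i j * ((1 - s\<^sup>2) * (S ^ i * (D * q)) + (-1) * (S ^ i * (D\<^sup>2 * q)))"
          unfolding c1_def c2_def mult.assoc[of _ "(\<eta> / \<kappa>) ^ i" "\<eta> ^ j"] Z_def[symmetric]
          using assms \<kappa> by (simp add: field_simps power2_eq_square)
        then show "D / (\<eta> * \<kappa>) * (\<kappa> * (a k i j * px \<eta> \<theta> s ^ i * py \<eta> \<theta> s ^ j) * S
             + (b k i j * px \<eta> \<theta> s ^ i * py \<eta> \<theta> s ^ j) * ((1 - s\<^sup>2) - D))
           = c1 k i j * (S ^ Suc i * D powi (1 - int (i + j)))
       + c2 k i j * ((1 - s\<^sup>2) * (S ^ i * D powi (1 - int (i + j))) + (-1) * (S ^ i * D powi (2 - int (i + j))))"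
          unfolding p1 p2 mult.assoc[of _ "px \<eta> \<theta> s ^ i" "py \<eta> \<theta> s ^ j"] X q_def .
      qed
      finally show ?thesis unfolding D_def S_def .
    qed
    have "s * integral (quarter k) (\<lambda>\<theta>. radial \<eta> n (a k) (b k) \<theta> s / \<kappa>) = (\<Sum>i\<le>n. \<Sum>j\<le>n - i. tm k i j s)" for k
    proof -
      have "s * integral (quarter k) (\<lambda>\<theta>. radial \<eta> n (a k) (b k) \<theta> s / \<kappa>)
          = integral (quarter k) (\<lambda>\<theta>. s * (radial \<eta> n (a k) (b k) \<theta> s / \<kappa>))" by simp
      also have "\<dots> = (\<Sum>i\<le>n. \<Sum>j\<le>n - i. tm k i j s)"
        unfolding 1 tm_def trig_integral_def
        by (intro integral_unique has_integral_sum has_integral_add has_integral_mult_right integrable_integral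
            trig_integral_integrable s) auto
      finally show ?thesis .
    qed
    then show ?thesis unfolding mel1_def \<kappa>_def[symmetric] by (simp add: sum_distrib_left)
  qed
  have t: "log_arc_form N d (tm k i j)" if "k \<in> {1..4}" "i \<le> n" "j \<le> n - i" for k i j
  proof -
    have "i + j \<le> n" using that by simp
    then have e: "- int N - 1 \<le> 1 - int (i + j)" "- int N - 1 \<le> 2 - int (i + j)" by (auto simp: N_def)
    have "Suc i div 2 \<le> n div 2 + 1" using that(2) by linarith
    then have 1: "log_arc_form N d (trig_integral k (Suc i) (1 - int (i + j)))"
      by (intro log_arc_form_mono[OF trig_integral_log_arc_form[OF that(1) e(1)]]) (auto simp: d_def N_def)
    have i2: "i div 2 \<le> n div 2" using that(2) by (rule div_le_mono)
    have "log_arc_form N (N + i div 2) (trig_integral k i (1 - int (i + j)))" by (rule trig_integral_log_arc_form[OF that(1) e(1)]) auto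
    from log_arc_form_u[OF this] have 2: "log_arc_form N d (\<lambda>s. (1 - s\<^sup>2) * trig_integral k i (1 - int (i + j)) s)"
      by (rule log_arc_form_mono) (use i2 in \<open>simp add: d_def N_def\<close>)
    have 3: "log_arc_form N d (trig_integral k i (2 - int (i + j)))"
      by (rule log_arc_form_mono[OF trig_integral_log_arc_form[OF that(1) e(2)]]) (use i2 in \<open>auto simp: d_def N_def\<close>)
    show ?thesis unfolding tm_def by (intro log_arc_form_add log_arc_form_cmult 1 2 3)
  qed
  have "log_arc_form N d (\<lambda>s. \<Sum>k = 1..4. \<Sum>i\<le>n. \<Sum>j\<le>n - i. tm k i j s)"
    by (intro log_arc_form_sum) (auto intro!: t)
  then have "log_arc_form N d (\<lambda>s. s * mel1 \<eta> n a b s)" by (rule log_arc_form_cong) (simp add: v)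
  then show ?thesis unfolding N_def d_def .
qed

lemma poly_of_real: "poly (map_poly of_real p) (of_real x) = (of_real (poly p x) :: complex)"
  by (induction p) (simp_all add: map_poly_pCons)

text \<open>The real identity extends to the strip by analytic continuation. The form has parameters \<open>D = 2d + 3\<close>
  and \<open>e = e' = d + 1\<close>, so the count is \<open>8d + 9\<close>; with \<open>d = max (n - 2) 0 + n div 2 + 1\<close> this is at most
  \<open>41n - 23\<close>.\<close>

theorem mel1_zeros:
  assumes "\<eta> > 0" "n \<ge> 1"
  shows "zeros_bd (mel1 \<eta> n a b) {0<..<1} (41 * n - 23)"
proof -
  define N d where "N = n - 2" and "d = n - 2 + n div 2 + 1"
  obtain A L L' B C :: "real poly" where P: "degree A \<le> 2 * d + 3" "degree L \<le> d" "degree L' \<le> d" "degree B \<le> d" "degree C \<le> d"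
    "\<And>s. s\<in>{0<..<1} \<Longrightarrow> (1 - s\<^sup>2) ^ N * (s * mel1 \<eta> n a b s) =
        poly A s + (poly L (1 - s\<^sup>2) * ln (1 - s) + poly L' (1 - s\<^sup>2) * ln (1 + s))
         + (poly B (1 - s\<^sup>2) * arcsin s + poly C (1 - s\<^sup>2)) / sqrt (1 - s\<^sup>2)"
    using mel1_log_arc_form[OF assms(1), of n a b] unfolding log_arc_form_def N_def d_def by auto
  define cp :: "real poly \<Rightarrow> complex poly" where "cp = map_poly of_real"
  define W where "W z = uu z ^ N * z" for z :: complex
  define G where "G z = W z * mel1 \<eta> n a b z" for z
  define H where "H z = poly (cp A) z + (poly (cp L) (uu z) * Ln (1 - z) + poly (cp L') (uu z) * Ln (1 + z))
        + (poly (cp B) (uu z) * Arcsin z + poly (cp C) (uu z)) / ww z" for z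
  have W0: "W z \<noteq> 0" if "z \<in> strip" for z using strip_nonpos[OF that] by (auto simp: W_def)
  have Wh: "W holomorphic_on strip" unfolding W_def by (intro holomorphic_intros)
  have Gh: "G holomorphic_on strip" unfolding G_def by (intro holomorphic_intros Wh mel1_holomorphic)
  have ph: "(\<lambda>z. poly p (uu z)) holomorphic_on strip" for p :: "complex poly"
    using poly_uu_deriv[of p] has_field_derivative_at_within unfolding holomorphic_on_def field_differentiable_def by blast
  have "Arcsin holomorphic_on strip"
    using Arcsin_deriv has_field_derivative_at_within unfolding holomorphic_on_def field_differentiable_def by blast
  then have Hh: "H holomorphic_on strip" unfolding H_def using strip_nonpos
    by (intro holomorphic_intros ph poly_holo) auto
  have eqr: "G (of_real s) = H (of_real s)" if s: "s \<in> {0<..<1}" for s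
  proof -
    have s2: "s\<^sup>2 < 1" using s by (simp add: power_less_one_iff)
    have u: "uu (of_real s) = complex_of_real (1 - s\<^sup>2)" by simp
    have l: "Ln (1 - complex_of_real s) = of_real (ln (1 - s))" "Ln (1 + complex_of_real s) = of_real (ln (1 + s))"
      using s Ln_of_real[of "1 - s"] Ln_of_real[of "1 + s"] by auto
    have as: "Arcsin (complex_of_real s) = of_real (arcsin s)" using s by (subst of_real_arcsin) auto
    have "G (of_real s) = of_real ((1 - s\<^sup>2) ^ N * (s * mel1 \<eta> n a b s))"
      unfolding G_def W_def using s by (simp add: of_real_mel1)
    also have "\<dots> = H (of_real s)"
      unfolding P(6)[OF s] H_def ww_of_real[OF s] unfolding u cp_def poly_of_real l as by simp
    finally show ?thesis .
  qed
  have GH: "G z = H z" if z: "z \<in> strip" for z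
  proof -
    have "(\<lambda>z. G z - H z) z = 0"
    proof (rule analytic_continuation[of "\<lambda>z. G z - H z" strip "of_real ` {0<..<1}" "of_real (1/2)"])
      show "(\<lambda>z. G z - H z) holomorphic_on strip" by (intro holomorphic_intros Gh Hh)
      show "connected strip" using strip_convex convex_connected by blast
      show "complex_of_real (1 / 2) islimpt of_real ` {0<..<1}"
      proof -
        have "\<exists>x'\<in>of_real ` {0<..<1}. x' \<noteq> complex_of_real (1 / 2) \<and> dist x' (complex_of_real (1 / 2)) < e" if "e > 0" for e
        proof -
          define x where "x = 1 / 2 + min (e / 2) (1 / 4)"
          have "x \<in> {0<..<1}" "x \<noteq> 1 / 2" "dist x (1 / 2) < e" using that by (auto simp: x_def dist_real_def)
          then show ?thesis
            by (intro bexI[of _ "of_real x"] conjI) (simp_all only: of_real_eq_iff dist_of_real image_eqI simp_thms)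
        qed
        then show ?thesis unfolding islimpt_approachable by blast
      qed
      show "complex_of_real (1 / 2) \<in> strip" by (simp add: strip_def)
    qed (use strip_open of_real_strip eqr z in auto)
    then show ?thesis by simp
  qed
  have c0: "coeff (cp p) i = 0" if "degree p \<le> d" "i \<ge> d + 1" for p i
    using that by (simp add: cp_def coeff_map_poly coeff_eq_0)
  have dA: "degree (cp A) \<le> 2 * d + 3" using P(1) by (intro degree_le) (simp add: cp_def coeff_map_poly coeff_eq_0)
  have rG: "real_on {0<..<1} G" unfolding real_on_def G_def W_def by (auto simp: of_real_mel1)
  have nf: "G z = poly (cp A) z / (z ^ 0 * uu z ^ 0) + (poly (cp L) (uu z) * Ln (1 - z) + poly (cp L') (uu z) * Ln (1 + z))
        + (poly (cp B) (uu z) * Arcsin z + poly (cp C) (uu z)) / (ww z * uu z ^ 0)" if "z \<in> strip" for z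
    using GH[OF that] by (simp add: H_def)
  have "zeros_bd G {0<..<1} ((2 * d + 3) + 3 * (d + 1) + 3 * (d + 1))"
    by (rule zeros_bd_log_arc_form[OF dA _ _ c0[OF P(2)] c0[OF P(3)] c0[OF P(4)] c0[OF P(5)] Gh rG nf]) simp_all
  then have "zeros_bd (mel1 \<eta> n a b) {0<..<1} ((2 * d + 3) + 3 * (d + 1) + 3 * (d + 1))"
    unfolding G_def by (rule zeros_bd_unit[OF _ strip_open of_real_strip Wh W0])
  moreover have "(2 * d + 3) + 3 * (d + 1) + 3 * (d + 1) \<le> 41 * n - 23"
  proof (cases "n = 1")
    case False
    then have n2: "n \<ge> 2" using assms(2) by simp
    obtain m where m: "n = m + 2" using n2 by (metis add.commute le_Suc_ex)
    define q where "q = n div 2"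
    have q: "2 * q \<le> n" by (simp add: q_def)
    have d: "d = m + q + 1" unfolding d_def q_def using m by simp
    have "8 * d + 9 \<le> 41 * n - 23" using q unfolding d m by simp
    then show ?thesis by simp
  qed (simp add: d_def)
  ultimately show ?thesis by (rule zeros_bd_mono)
qed

section \<open>Zeros under small perturbations\<close>

lemma real_on_higher_deriv:
  assumes "real_on S F" "open S" "open U" "of_real ` S \<subseteq> U" "F holomorphic_on U"
  shows "real_on S ((deriv ^^ m) F)"
proof (induction m)
  case (Suc m)
  have "(deriv ^^ m) F holomorphic_on U" using assms(5,3) by (rule holomorphic_higher_deriv)
  then show ?case
    unfolding real_on_def funpow.simps o_apply by (intro ballI real_on_deriv(1)[OF Suc assms(2-4)])
qed (use assms in simp)

lemma Rolle_zeros_le_iterated: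
  assumes "zeros_le ((deriv ^^ m) F) S N"
    and "real_on S F" "open S" "is_interval S" "open U" "of_real ` S \<subseteq> U" "F holomorphic_on U"
  shows "zeros_le F S (N + m)"
  using assms(1)
proof (induction m arbitrary: N)
  case (Suc m)
  have h: "(deriv ^^ m) F holomorphic_on U" using assms(7,5) by (rule holomorphic_higher_deriv)
  have "zeros_le (deriv ((deriv ^^ m) F)) S N" using Suc.prems unfolding funpow.simps o_apply .
  from Rolle_zeros_le[OF this real_on_higher_deriv[OF assms(2,3,5,6,7)] assms(3-6) h]
  have "zeros_le ((deriv ^^ m) F) S (Suc N)" .
  from Suc.IH[OF this] show ?case by simp
qed simp

text \<open>Where the \<open>m\<close>-th derivative of \<open>F\<close> does not vanish, neither does that of a nearby holomorphic function,
  by Cauchy's inequality; \<open>m\<close> applications of Rolle's theorem bound its zeros by \<open>m\<close>.\<close>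

lemma zeros_le_perturb_local:
  fixes D :: "real \<Rightarrow> complex \<Rightarrow> complex"
  assumes U: "open U" "of_real x \<in> U" and F: "F holomorphic_on U"
    and D: "\<And>\<epsilon>. 0 < \<bar>\<epsilon>\<bar> \<Longrightarrow> \<bar>\<epsilon>\<bar> < e1 \<Longrightarrow> D \<epsilon> holomorphic_on U"
    and re: "\<And>\<epsilon> t. 0 < \<bar>\<epsilon>\<bar> \<Longrightarrow> \<bar>\<epsilon>\<bar> < e1 \<Longrightarrow> of_real t \<in> U \<Longrightarrow> D \<epsilon> (of_real t) \<in> \<real>"
    and close: "\<And>\<epsilon> z. 0 < \<bar>\<epsilon>\<bar> \<Longrightarrow> \<bar>\<epsilon>\<bar> < e1 \<Longrightarrow> z \<in> U \<Longrightarrow> cmod (D \<epsilon> z - F z) \<le> C * \<bar>\<epsilon>\<bar>"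
    and m: "(deriv ^^ m) F (of_real x) \<noteq> 0" and "e1 > 0"
  shows "\<exists>r>0. \<exists>e>0. \<forall>\<epsilon>. 0 < \<bar>\<epsilon>\<bar> \<and> \<bar>\<epsilon>\<bar> < e \<longrightarrow> zeros_le (D \<epsilon>) {x - r<..<x + r} m"
proof -
  define c where "c = cmod ((deriv ^^ m) F (of_real x)) / 2"
  have c: "c > 0" using m by (simp add: c_def)
  obtain r1 where r1: "r1 > 0" "cball (of_real x) r1 \<subseteq> U" using U open_contains_cball by blast
  have cont: "continuous_on U ((deriv ^^ m) F)"
    using F U(1) holomorphic_higher_deriv holomorphic_on_imp_continuous_on by blast
  then have "isCont ((deriv ^^ m) F) (of_real x)" using U continuous_on_eq_continuous_at by blast
  then obtain d where d: "d > 0" "\<And>z. dist z (of_real x) < d \<Longrightarrow> dist ((deriv ^^ m) F z) ((deriv ^^ m) F (of_real x)) < c"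
    unfolding continuous_at_eps_delta using c by blast
  define r where "r = min (r1 / 2) (d / 2)"
  have r: "r > 0" "2 * r \<le> r1" "r < d" using r1 d by (auto simp: r_def)
  (* Below this size the error of the m-th derivative, m! C eps / r^m, is less than c. *)
  define e where "e = min e1 (c * r ^ m / (fact m * (\<bar>C\<bar> + 1)))"
  have e: "e > 0" unfolding e_def using assms(8) c r by (simp add: add_nonneg_pos)
  have sub: "cball z r \<subseteq> U" if "z \<in> cball (of_real x) r" for z
  proof -
    have "cball z r \<subseteq> cball (of_real x) r1"
    proof
      fix w assume "w \<in> cball z r"
      then show "w \<in> cball (of_real x) r1"
        using that r dist_triangle[of "of_real x" w z] by (simp add: dist_commute)
    qed
    then show ?thesis using r1 by blast
  qed
  have "zeros_le (D \<epsilon>) {x - r<..<x + r} m" if \<epsilon>: "0 < \<bar>\<epsilon>\<bar>" "\<bar>\<epsilon>\<bar> < e" for \<epsilon>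
  proof -
    have e1: "\<bar>\<epsilon>\<bar> < e1" using \<epsilon>(2) by (simp add: e_def)
    note Dh = D[OF \<epsilon>(1) e1]
    have "zeros_le ((deriv ^^ m) (D \<epsilon>)) {x - r<..<x + r} 0"
    proof (rule zeros_le_0I)
      fix t assume t: "t \<in> {x - r<..<x + r}"
      have dt: "dist (complex_of_real t) (of_real x) < r" using t by (simp add: dist_of_real dist_real_def abs_less_iff)
      then have tb: "complex_of_real t \<in> cball (of_real x) r" by (simp add: dist_commute)
      note s = sub[OF tb]
      have tU: "complex_of_real t \<in> U" using s r by auto
      have "cmod ((deriv ^^ m) (\<lambda>z. D \<epsilon> z - F z) (of_real t)) \<le> fact m * (C * \<bar>\<epsilon>\<bar>) / r ^ m"
      proof (rule Cauchy_inequality)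
        show "(\<lambda>z. D \<epsilon> z - F z) holomorphic_on ball (of_real t) r"
          by (intro holomorphic_on_diff holomorphic_on_subset[OF Dh] holomorphic_on_subset[OF F] order_trans[OF ball_subset_cball s])
        show "continuous_on (cball (complex_of_real t) r) (\<lambda>z. D \<epsilon> z - F z)"
          by (intro continuous_on_diff holomorphic_on_imp_continuous_on holomorphic_on_subset[OF Dh s] holomorphic_on_subset[OF F s])
        show "cmod (D \<epsilon> z - F z) \<le> C * \<bar>\<epsilon>\<bar>" if "cmod (of_real t - z) = r" for z
          using s that by (intro close \<epsilon> e1) (auto simp: dist_norm)
      qed (use r in auto)
      also have "fact m * (C * \<bar>\<epsilon>\<bar>) / r ^ m < c"
      proof -
        have "C * \<bar>\<epsilon>\<bar> \<le> (\<bar>C\<bar> + 1) * \<bar>\<epsilon>\<bar>" using \<epsilon>(1) by (intro mult_right_mono) auto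
        then have "fact m * (C * \<bar>\<epsilon>\<bar>) \<le> (fact m * (\<bar>C\<bar> + 1)) * \<bar>\<epsilon>\<bar>" by (simp add: mult.assoc mult_left_mono)
        also have "\<dots> < (fact m * (\<bar>C\<bar> + 1)) * (c * r ^ m / (fact m * (\<bar>C\<bar> + 1)))"
          using \<epsilon>(2) by (intro mult_strict_left_mono) (auto simp: e_def)
        also have "\<dots> = c * r ^ m"
        proof -
          have "\<bar>C\<bar> + 1 \<noteq> 0" using abs_ge_zero[of C] by linarith
          then show ?thesis by simp
        qed
        finally show ?thesis using r by (simp add: divide_less_eq)
      qed
      finally have 1: "cmod ((deriv ^^ m) (\<lambda>z. D \<epsilon> z - F z) (of_real t)) < c" .
      have 2: "(deriv ^^ m) (\<lambda>z. D \<epsilon> z - F z) (of_real t) = (deriv ^^ m) (D \<epsilon>) (of_real t) - (deriv ^^ m) F (of_real t)"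
        by (rule higher_deriv_diff[OF Dh F U(1) tU])
      have "dist ((deriv ^^ m) F (of_real t)) ((deriv ^^ m) F (of_real x)) < c" using d(2) dt r by simp
      then have 3: "cmod ((deriv ^^ m) F (of_real t)) > c"
        using norm_triangle_ineq2[of "(deriv ^^ m) F (of_real x)" "(deriv ^^ m) F (of_real t)"]
        by (simp add: c_def dist_norm norm_minus_commute)
      show "(deriv ^^ m) (D \<epsilon>) (of_real t) \<noteq> 0" using 1 2 3 by auto
    qed
    then have "zeros_le (D \<epsilon>) {x - r<..<x + r} (0 + m)"
    proof (rule Rolle_zeros_le_iterated[OF _ _ _ _ U(1) _ Dh])
      have *: "complex_of_real t \<in> U" if "t \<in> {x - r<..<x + r}" for t
      proof -
        have "dist (of_real x) (complex_of_real t) < r" using that by (simp add: dist_of_real dist_real_def abs_less_iff)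
        then show ?thesis using r1 r by (simp add: subset_iff)
      qed
      then show "real_on {x - r<..<x + r} (D \<epsilon>)" unfolding real_on_def using re \<epsilon>(1) e1 by blast
      show "of_real ` {x - r<..<x + r} \<subseteq> U" using * by blast
    qed auto
    then show ?thesis by simp
  qed
  with r e show ?thesis by blast
qed

lemma sum_UN_le_nat:
  fixes k :: "'a \<Rightarrow> nat"
  assumes "finite I" "\<And>i. finite (A i)"
  shows "sum k (\<Union>i\<in>I. A i) \<le> (\<Sum>i\<in>I. sum k (A i))"
  using assms(1)
proof (induction I rule: finite_induct)
  case (insert i I)
  have "sum k (A i \<union> (\<Union>i\<in>I. A i)) \<le> sum k (A i) + sum k (\<Union>i\<in>I. A i)"
    using sum.union_inter[of "A i" "\<Union>i\<in>I. A i" k] insert.hyps(1) assms(2) by auto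
  then show ?case using insert by simp
qed simp

text \<open>The local bounds hold near finitely many points that cover the interval, each with \<open>m\<close> the
  order of \<open>F\<close> there; the sum of these orders is bounded by \<open>N\<close>.\<close>

theorem zeros_le_perturb:
  fixes D :: "real \<Rightarrow> complex \<Rightarrow> complex"
  assumes U: "open U" "of_real ` {a..b} \<subseteq> U" and F: "F holomorphic_on U"
    and D: "\<And>\<epsilon>. 0 < \<bar>\<epsilon>\<bar> \<Longrightarrow> \<bar>\<epsilon>\<bar> < e1 \<Longrightarrow> D \<epsilon> holomorphic_on U"
    and re: "\<And>\<epsilon> t. 0 < \<bar>\<epsilon>\<bar> \<Longrightarrow> \<bar>\<epsilon>\<bar> < e1 \<Longrightarrow> of_real t \<in> U \<Longrightarrow> D \<epsilon> (of_real t) \<in> \<real>"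
    and close: "\<And>\<epsilon> z. 0 < \<bar>\<epsilon>\<bar> \<Longrightarrow> \<bar>\<epsilon>\<bar> < e1 \<Longrightarrow> z \<in> U \<Longrightarrow> cmod (D \<epsilon> z - F z) \<le> C * \<bar>\<epsilon>\<bar>"
    and N: "zeros_le F {a..b} N" and "e1 > 0"
  shows "\<exists>e>0. \<forall>\<epsilon>. 0 < \<bar>\<epsilon>\<bar> \<and> \<bar>\<epsilon>\<bar> < e \<longrightarrow> zeros_le (D \<epsilon>) {a..b} N"
proof -
  have "\<exists>m r e. vanishes F (of_real x) m \<and> r > 0 \<and> e > 0 \<and>
      (\<forall>\<epsilon>. 0 < \<bar>\<epsilon>\<bar> \<and> \<bar>\<epsilon>\<bar> < e \<longrightarrow> zeros_le (D \<epsilon>) {x - r<..<x + r} m)" if x: "x \<in> {a..b}" for x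
  proof -
    have xU: "of_real x \<in> U" using U x by auto
    have "\<exists>m. (deriv ^^ m) F (of_real x) \<noteq> 0"
    proof (rule ccontr)
      assume "\<not> ?thesis"
      then have "vanishes F (of_real x) (Suc N)" by (intro vanishes_higher_deriv[OF F U(1) xU]) auto
      then have "sum (\<lambda>_. Suc N) {x} \<le> N"
        using x by (intro N[unfolded zeros_le_def, rule_format]) auto
      then show False by simp
    qed
    then obtain m where m: "(deriv ^^ m) F (of_real x) \<noteq> 0" "\<And>j. j < m \<Longrightarrow> (deriv ^^ j) F (of_real x) = 0"
      using exists_least_iff[of "\<lambda>m. (deriv ^^ m) F (of_real x) \<noteq> 0"] by blast
    have "vanishes F (of_real x) m" by (rule vanishes_higher_deriv[OF F U(1) xU m(2)])
    with zeros_le_perturb_local[OF U(1) xU F D re close m(1) assms(8)] show ?thesis by blast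
  qed
  then obtain m r e where mre: "\<And>x. x \<in> {a..b} \<Longrightarrow> vanishes F (of_real x) (m x)"
      "\<And>x. x \<in> {a..b} \<Longrightarrow> r x > 0" "\<And>x. x \<in> {a..b} \<Longrightarrow> e x > (0::real)"
      "\<And>x \<epsilon>. x \<in> {a..b} \<Longrightarrow> 0 < \<bar>\<epsilon>\<bar> \<Longrightarrow> \<bar>\<epsilon>\<bar> < e x \<Longrightarrow> zeros_le (D \<epsilon>) {x - r x<..<x + r x} (m x)"
    by metis
  have cover: "{a..b} \<subseteq> (\<Union>x\<in>{a..b}. {x - r x<..<x + r x})"
    using mre(2) by auto
  obtain X where X: "X \<subseteq> {a..b}" "finite X" "{a..b} \<subseteq> (\<Union>x\<in>X. {x - r x<..<x + r x})"
    by (rule compactE_image[OF compact_Icc _ cover]) auto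
  define e0 where "e0 = Min (insert 1 (e ` X))"
  have e0: "e0 > 0" "\<And>x. x \<in> X \<Longrightarrow> e0 \<le> e x" using X mre(3) by (auto simp: e0_def Min_gr_iff)
  have "zeros_le (D \<epsilon>) {a..b} N" if \<epsilon>: "0 < \<bar>\<epsilon>\<bar>" "\<bar>\<epsilon>\<bar> < e0" for \<epsilon>
    unfolding zeros_le_def
  proof (intro allI impI, elim conjE)
    fix Y and k :: "real \<Rightarrow> nat"
    assume Y: "finite Y" "Y \<subseteq> {a..b}" "\<forall>x\<in>Y. vanishes (D \<epsilon>) (of_real x) (k x)"
    have "sum k Y \<le> sum k (\<Union>x\<in>X. Y \<inter> {x - r x<..<x + r x})"
      using X Y by (intro sum_mono2) auto
    also have "\<dots> \<le> (\<Sum>x\<in>X. sum k (Y \<inter> {x - r x<..<x + r x}))"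
      using X(2) by (rule sum_UN_le_nat) (use Y(1) in simp)
    also have "\<dots> \<le> sum m X"
    proof (rule sum_mono)
      fix x assume x: "x \<in> X"
      have "zeros_le (D \<epsilon>) {x - r x<..<x + r x} (m x)" using mre(4) x X \<epsilon> e0(2)[OF x] by auto
      then show "sum k (Y \<inter> {x - r x<..<x + r x}) \<le> m x"
        by (rule zeros_le_def[THEN iffD1, rule_format]) (use Y in auto)
    qed
    also have "\<dots> \<le> N" using X mre(1) by (intro N[unfolded zeros_le_def, rule_format]) auto
    finally show "sum k Y \<le> N" .
  qed
  with e0(1) show ?thesis by blast
qed

section \<open>Holomorphic solutions of a differential equation that switches at quarter turns\<close>

definition clamp_quarter :: "nat \<Rightarrow> real \<Rightarrow> real" where "clamp_quarter k t = max (quarter_end k - pi / 2) (min t (quarter_end k))"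

text \<open>The primitive of the function that equals \<open>H k\<close> on the \<open>k\<close>-th quarter turn. At a switching angle both
  \<open>H k\<close> and \<open>H (k + 1)\<close> have a value, so a single integrand cannot be continuous; clamping the upper limit
  also makes the primitive constant outside one turn.\<close>

definition piecewise_integral :: "(nat \<Rightarrow> real \<Rightarrow> 'a::banach) \<Rightarrow> real \<Rightarrow> 'a" where
  "piecewise_integral H t = (\<Sum>k = 1..4. integral {quarter_end k - pi / 2 .. clamp_quarter k t} (H k))"

lemma quarter_end_bounds: "k \<in> {1..4} \<Longrightarrow> 0 \<le> quarter_end k - pi / 2" "k \<in> {1..4} \<Longrightarrow> quarter_end k \<le> 2 * pi"
proof -
  assume k: "k \<in> {1..4}"
  have "1 * (pi / 2) \<le> real k * (pi / 2)" using k by (intro mult_right_mono) auto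
  then show "0 \<le> quarter_end k - pi / 2" by (simp add: quarter_end_def)
  have "real k * (pi / 2) \<le> 4 * (pi / 2)" using k by (intro mult_right_mono) auto
  then show "quarter_end k \<le> 2 * pi" by (simp add: quarter_end_def)
qed

lemma quarter_end_in_quarter: "quarter_end k \<in> quarter k"
  by (simp add: quarter_eq_Icc)

lemma clamp_quarter_le: "quarter_end k - pi / 2 \<le> clamp_quarter k t" "clamp_quarter k t \<le> quarter_end k"
  using pi_gt_zero by (auto simp: clamp_quarter_def)

lemma clamp_quarter_sub: "{quarter_end k - pi / 2 .. clamp_quarter k t} \<subseteq> quarter k"
  using clamp_quarter_le[of k t] by (auto simp: quarter_eq_Icc)

lemma clamp_quarter_lip: "\<bar>clamp_quarter k t - clamp_quarter k t'\<bar> \<le> \<bar>t - t'\<bar>"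
  by (auto simp: clamp_quarter_def max_def min_def)

lemma piecewise_integral_0: "t \<le> 0 \<Longrightarrow> piecewise_integral H t = 0"
proof -
  assume t: "t \<le> 0"
  have "clamp_quarter k t = quarter_end k - pi / 2" if "k \<in> {1..4}" for k
    using quarter_end_bounds(1)[OF that] t by (auto simp: clamp_quarter_def max_def min_def; use pi_gt_zero in linarith)
  then show ?thesis by (simp add: piecewise_integral_def)
qed

lemma piecewise_integral_2pi: "t \<ge> 2 * pi \<Longrightarrow> piecewise_integral H t = (\<Sum>k = 1..4. integral (quarter k) (H k))"
proof -
  assume t: "t \<ge> 2 * pi"
  have "clamp_quarter k t = quarter_end k" if "k \<in> {1..4}" for k
    using quarter_end_bounds(2)[OF that] t by (auto simp: clamp_quarter_def max_def min_def; use pi_gt_zero in linarith)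
  then show ?thesis by (simp add: piecewise_integral_def quarter_eq_Icc)
qed

lemma integral_clq_bound:
  fixes H :: "real \<Rightarrow> 'a::banach"
  assumes "continuous_on (quarter k) H" "\<And>u. u \<in> quarter k \<Longrightarrow> norm (H u) \<le> M"
  shows "norm (integral {quarter_end k - pi / 2 .. clamp_quarter k t} H - integral {quarter_end k - pi / 2 .. clamp_quarter k t'} H) \<le> M * \<bar>t - t'\<bar>"
proof -
  have M0: "M \<ge> 0" using assms(2)[OF quarter_end_in_quarter] norm_ge_zero order_trans by blast
  have *: "norm (integral {quarter_end k - pi / 2 .. clamp_quarter k t} H - integral {quarter_end k - pi / 2 .. clamp_quarter k t'} H) \<le> M * (clamp_quarter k t - clamp_quarter k t')"
    if le: "clamp_quarter k t' \<le> clamp_quarter k t" for t t'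
  proof -
    have i: "H integrable_on {quarter_end k - pi / 2 .. clamp_quarter k t}"
      using assms(1) clamp_quarter_sub[of k t] by (intro integrable_continuous_interval) (rule continuous_on_subset)
    have "integral {quarter_end k - pi / 2 .. clamp_quarter k t'} H + integral {clamp_quarter k t' .. clamp_quarter k t} H = integral {quarter_end k - pi / 2 .. clamp_quarter k t} H"
      by (rule Henstock_Kurzweil_Integration.integral_combine[OF clamp_quarter_le(1) le i])
    then have "integral {quarter_end k - pi / 2 .. clamp_quarter k t} H - integral {quarter_end k - pi / 2 .. clamp_quarter k t'} H = integral {clamp_quarter k t' .. clamp_quarter k t} H"
      by (simp add: algebra_simps)
    moreover have "norm (integral {clamp_quarter k t' .. clamp_quarter k t} H) \<le> M * (clamp_quarter k t - clamp_quarter k t')"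
    proof (rule integral_bound[OF le])
      have s: "{clamp_quarter k t' .. clamp_quarter k t} \<subseteq> quarter k"
        unfolding quarter_eq_Icc using clamp_quarter_le(1)[of k t'] clamp_quarter_le(2)[of k t] by auto
      then show "continuous_on {clamp_quarter k t'..clamp_quarter k t} H" using assms(1) continuous_on_subset by blast
      show "norm (H u) \<le> M" if "u \<in> {clamp_quarter k t'..clamp_quarter k t}" for u using assms(2) s that by blast
    qed
    ultimately show ?thesis by simp
  qed
  have "norm (integral {quarter_end k - pi / 2 .. clamp_quarter k t} H - integral {quarter_end k - pi / 2 .. clamp_quarter k t'} H) \<le> M * \<bar>clamp_quarter k t - clamp_quarter k t'\<bar>"
    using *[of t' t] *[of t t'] by (cases "clamp_quarter k t' \<le> clamp_quarter k t") (auto simp: norm_minus_commute)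
  also have "\<dots> \<le> M * \<bar>t - t'\<bar>" using M0 clamp_quarter_lip by (intro mult_left_mono) auto
  finally show ?thesis .
qed

lemma piecewise_integral_lipschitz:
  fixes H :: "nat \<Rightarrow> real \<Rightarrow> 'a::banach"
  assumes "\<And>k. k \<in> {1..4} \<Longrightarrow> continuous_on (quarter k) (H k)"
    "\<And>k u. k \<in> {1..4} \<Longrightarrow> u \<in> quarter k \<Longrightarrow> norm (H k u) \<le> M"
  shows "norm (piecewise_integral H t - piecewise_integral H t') \<le> 4 * M * \<bar>t - t'\<bar>"
proof -
  have "norm (piecewise_integral H t - piecewise_integral H t') \<le> (\<Sum>k = 1..4::nat. M * \<bar>t - t'\<bar>)"
    unfolding piecewise_integral_def sum_subtractf[symmetric]
    by (intro sum_norm_le integral_clq_bound assms)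
  then show ?thesis by simp
qed

lemma piecewise_integral_bound:
  fixes H :: "nat \<Rightarrow> real \<Rightarrow> 'a::banach"
  assumes "\<And>k. k \<in> {1..4} \<Longrightarrow> continuous_on (quarter k) (H k)"
    "\<And>k u. k \<in> {1..4} \<Longrightarrow> u \<in> quarter k \<Longrightarrow> norm (H k u) \<le> M"
  shows "norm (piecewise_integral H t) \<le> 2 * pi * M"
proof -
  have "norm (integral {quarter_end k - pi / 2 .. clamp_quarter k t} (H k)) \<le> M * (pi / 2)" if k: "k \<in> {1..4}" for k
  proof -
    have M0: "M \<ge> 0" using assms(2)[OF k quarter_end_in_quarter] norm_ge_zero order_trans by blast
    have "norm (integral {quarter_end k - pi / 2 .. clamp_quarter k t} (H k)) \<le> M * (clamp_quarter k t - (quarter_end k - pi / 2))"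
      using clamp_quarter_sub[of k t] assms(1)[OF k]
      by (intro integral_bound clamp_quarter_le) (auto intro: continuous_on_subset assms(2)[OF k])
    also have "\<dots> \<le> M * (pi / 2)" using M0 clamp_quarter_le[of k t] by (intro mult_left_mono) auto
    finally show ?thesis .
  qed
  then have "norm (piecewise_integral H t) \<le> (\<Sum>k = 1..4::nat. M * (pi / 2))"
    unfolding piecewise_integral_def by (intro sum_norm_le) auto
  then show ?thesis by (simp add: mult_ac)
qed

lemma piecewise_integral_diff:
  fixes H :: "nat \<Rightarrow> real \<Rightarrow> 'a::banach"
  assumes "\<And>k. k \<in> {1..4} \<Longrightarrow> continuous_on (quarter k) (H k)"
    "\<And>k. k \<in> {1..4} \<Longrightarrow> continuous_on (quarter k) (H' k)"
  shows "piecewise_integral H t - piecewise_integral H' t = piecewise_integral (\<lambda>k u. H k u - H' k u) t"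
  unfolding piecewise_integral_def sum_subtractf[symmetric]
  by (intro sum.cong refl integral_diff[symmetric] integrable_continuous_interval
      continuous_on_subset[OF assms(1) clamp_quarter_sub] continuous_on_subset[OF assms(2) clamp_quarter_sub])

lemma piecewise_integral_vector_derivative:
  fixes H :: "nat \<Rightarrow> real \<Rightarrow> 'a::banach"
  assumes H: "\<And>k. k \<in> {1..4} \<Longrightarrow> continuous_on (quarter k) (H k)"
    and k: "k \<in> {1..4}" and t: "quarter_end k - pi / 2 < t" "t < quarter_end k"
  shows "(piecewise_integral H has_vector_derivative H k t) (at t)"
proof -
  define S where "S = {quarter_end k - pi / 2 <..< quarter_end k}"
  have S: "open S" "t \<in> S" using t by (auto simp: S_def)
  have other: "clamp_quarter j u = clamp_quarter j t" if jj: "j \<in> {1..4}" "j \<noteq> k" "u \<in> S" for j u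
  proof -
    consider "j < k" | "k < j" using jj(2) linorder_neqE_nat by blast
    then show ?thesis
    proof cases
      case 1
      then have "real j + 1 \<le> real k" by linarith
      then have "(real j + 1) * (pi / 2) \<le> real k * (pi / 2)" by (intro mult_right_mono) auto
      then have "quarter_end j \<le> quarter_end k - pi / 2" by (simp add: quarter_end_def field_simps)
      then show ?thesis using jj S by (auto simp: clamp_quarter_def S_def max_def min_def; use pi_gt_zero in linarith)
    next
      case 2
      then have "real k + 1 \<le> real j" by linarith
      then have "(real k + 1) * (pi / 2) \<le> real j * (pi / 2)" by (intro mult_right_mono) auto
      then have "quarter_end k \<le> quarter_end j - pi / 2" by (simp add: quarter_end_def field_simps)
      then show ?thesis using jj S by (auto simp: clamp_quarter_def S_def max_def min_def; use pi_gt_zero in linarith)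
    qed
  qed
  have same: "clamp_quarter k u = u" if "u \<in> S" for u using that by (auto simp: clamp_quarter_def S_def)
  define c where "c = (\<Sum>j\<in>{1..4} - {k}. integral {quarter_end j - pi / 2 .. clamp_quarter j t} (H j))"
  have "piecewise_integral H u = integral {quarter_end k - pi / 2 .. u} (H k) + c" if "u \<in> S" for u
  proof -
    have "piecewise_integral H u = integral {quarter_end k - pi / 2 .. clamp_quarter k u} (H k) + (\<Sum>j\<in>{1..4} - {k}. integral {quarter_end j - pi / 2 .. clamp_quarter j u} (H j))"
      unfolding piecewise_integral_def using k by (subst sum.remove[of _ k]) auto
    also have "(\<Sum>j\<in>{1..4} - {k}. integral {quarter_end j - pi / 2 .. clamp_quarter j u} (H j)) = c"
      unfolding c_def using other that by (intro sum.cong) auto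
    finally show ?thesis by (simp add: same[OF that])
  qed
  moreover have "((\<lambda>u. integral {quarter_end k - pi / 2 .. u} (H k) + c) has_vector_derivative H k t) (at t)"
  proof -
    have "((\<lambda>u. integral {quarter_end k - pi / 2 .. u} (H k)) has_vector_derivative H k t) (at t within {quarter_end k - pi / 2..quarter_end k})"
      by (rule integral_has_vector_derivative) (use H[OF k] t in \<open>auto simp: quarter_eq_Icc\<close>)
    moreover have "at t within {quarter_end k - pi / 2..quarter_end k} = at t" using t by (intro at_within_Icc_at)
    ultimately show ?thesis using has_vector_derivative_add_const by force
  qed
  ultimately show ?thesis
    using has_vector_derivative_transform_within_open[OF _ S(1,2), of "\<lambda>u. integral {quarter_end k - pi / 2 .. u} (H k) + c" "H k t" "piecewise_integral H"]
    by auto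
qed

lemma piecewise_integral_continuous:
  fixes H :: "nat \<Rightarrow> real \<Rightarrow> 'a::banach"
  assumes H: "\<And>k. k \<in> {1..4} \<Longrightarrow> continuous_on (quarter k) (H k)"
  shows "continuous_on S (piecewise_integral H)"
proof -
  have "\<exists>M. \<forall>u\<in>quarter k. norm (H k u) \<le> M" if "k \<in> {1..4}" for k
  proof -
    have "compact (H k ` quarter k)" using H[OF that] by (intro compact_continuous_image) (auto simp: quarter_eq_Icc)
    then show ?thesis using compact_imp_bounded bounded_iff by (metis image_eqI)
  qed
  then obtain M where M: "\<And>k u. k \<in> {1..4} \<Longrightarrow> u \<in> quarter k \<Longrightarrow> norm (H k u) \<le> M k" by metis
  define B where "B = (\<Sum>k = 1..4::nat. \<bar>M k\<bar>)"
  have MB: "M k \<le> B" if "k \<in> {1..4}" for k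
    unfolding B_def using that member_le_sum[of k "{1..4}" "\<lambda>k. \<bar>M k\<bar>"] by force
  have "(4 * B)-lipschitz_on S (piecewise_integral H)"
  proof (rule lipschitz_onI)
    show "0 \<le> 4 * B" by (simp add: B_def sum_nonneg)
    show "dist (piecewise_integral H t) (piecewise_integral H t') \<le> 4 * B * dist t t'" for t t'
      unfolding dist_norm real_norm_def by (rule piecewise_integral_lipschitz[OF H]) (use M MB in force)+
  qed
  then show ?thesis by (rule lipschitz_on_continuous_on)
qed

text \<open>Complex radii near the real interval \<open>[a, b]\<close>.\<close>

definition rect :: "real \<Rightarrow> real \<Rightarrow> real \<Rightarrow> complex set" where
  "rect a b \<rho> = {z. a - \<rho> < Re z \<and> Re z < b + \<rho> \<and> \<bar>Im z\<bar> < \<rho>}"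

lemma rect_box: "rect a b \<rho> = box (Complex (a - \<rho>) (- \<rho>)) (Complex (b + \<rho>) \<rho>)"
  by (auto simp: rect_def in_box_complex_iff)

lemma rect_open: "open (rect a b \<rho>)" and rect_convex: "convex (rect a b \<rho>)"
  unfolding rect_box by (auto simp: open_box convex_box)

lemma rect_near: "z \<in> rect a b \<rho> \<Longrightarrow> cmod (w - z) \<le> \<delta> \<Longrightarrow> w \<in> rect a b (\<rho> + \<delta>)"
  using abs_Re_le_cmod[of "w - z"] abs_Im_le_cmod[of "w - z"] by (auto simp: rect_def)

lemma rect_mono: "\<rho> \<le> \<rho>' \<Longrightarrow> rect a b \<rho> \<subseteq> rect a b \<rho>'"
  by (auto simp: rect_def)

lemma holomorphic_bounded_lipschitz:
  assumes "f holomorphic_on rect a b (\<rho> + r)" "r > 0"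
    "\<And>z. z \<in> rect a b (\<rho> + r) \<Longrightarrow> cmod (f z) \<le> M"
    "z \<in> rect a b \<rho>" "w \<in> rect a b \<rho>"
  shows "cmod (f z - f w) \<le> M / r * cmod (z - w)"
proof (rule field_differentiable_bound[OF rect_convex _ _ assms(4,5)])
  fix v assume v: "v \<in> rect a b \<rho>"
  have "v \<in> rect a b (\<rho> + r)" using rect_mono[of \<rho> "\<rho> + r"] v assms(2) by auto
  then show "(f has_field_derivative deriv f v) (at v within rect a b \<rho>)"
    using holomorphic_derivI[OF assms(1) rect_open] by (blast intro: has_field_derivative_at_within)
  have sub: "cball v r \<subseteq> rect a b (\<rho> + r)"
    using rect_near[OF v] by (auto simp: dist_norm norm_minus_commute)
  have "cmod ((deriv ^^ 1) f v) \<le> fact 1 * M / r ^ 1"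
  proof (rule Cauchy_inequality)
    show "f holomorphic_on ball v r" using assms(1) sub ball_subset_cball by (blast intro: holomorphic_on_subset)
    show "continuous_on (cball v r) f"
      using assms(1) sub by (blast intro: holomorphic_on_subset holomorphic_on_imp_continuous_on)
    show "cmod (f x) \<le> M" if "cmod (v - x) = r" for x
      using that sub by (intro assms(3)) (auto simp: dist_norm)
  qed (use assms in auto)
  then show "cmod (deriv f v) \<le> M / r" by simp
qed

text \<open>Joint continuity follows from continuity in one variable and a Lipschitz bound in the other one.\<close>

lemma continuous_on_TimesI_lip:
  fixes f :: "real \<Rightarrow> complex \<Rightarrow> complex"
  assumes hol: "\<And>t. f t holomorphic_on U"
    and lip: "\<And>t t' z. z \<in> U \<Longrightarrow> cmod (f t z - f t' z) \<le> L * \<bar>t - t'\<bar>" and U: "open U"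
  shows "continuous_on (UNIV \<times> U) (\<lambda>(t, z). f t z)"
proof (rule continuous_onI)
  fix x :: "real \<times> complex" and e :: real assume x: "x \<in> UNIV \<times> U" and e: "e > 0"
  obtain t z where tz: "x = (t, z)" "z \<in> U" using x by auto
  have "isCont (f t) z" using hol[of t] tz U by (meson holomorphic_on_imp_continuous_on continuous_on_eq_continuous_at)
  then obtain d where d: "d > 0" "\<And>w. dist w z < d \<Longrightarrow> dist (f t w) (f t z) < e / 2"
    unfolding continuous_at_eps_delta using e by (meson half_gt_zero)
  define d' where "d' = min d (e / (2 * (\<bar>L\<bar> + 1)))"
  have d': "d' > 0" using d e by (simp add: d'_def add_nonneg_pos)
  have "dist (f s w) (f t z) \<le> e" if "w \<in> U" "dist (s, w) (t, z) < d'" for s w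
  proof -
    have 1: "dist s t < d'" "dist w z < d'" using that(2) dist_fst_le[of "(s, w)" "(t, z)"] dist_snd_le[of "(s, w)" "(t, z)"] by auto
    have "cmod (f s w - f t w) \<le> L * \<bar>s - t\<bar>" by (rule lip[OF that(1)])
    also have "\<dots> \<le> (\<bar>L\<bar> + 1) * \<bar>s - t\<bar>" by (intro mult_right_mono) auto
    also have "\<dots> \<le> (\<bar>L\<bar> + 1) * (e / (2 * (\<bar>L\<bar> + 1)))"
      using 1(1) by (intro mult_left_mono) (auto simp: d'_def dist_real_def)
    also have "\<dots> = e / 2"
    proof -
      have "\<bar>L\<bar> + 1 \<noteq> 0" using abs_ge_zero[of L] by linarith
      moreover have "c * (e / (2 * c)) = e / 2" if "c \<noteq> 0" for c :: real using that by simp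
      ultimately show ?thesis by blast
    qed
    finally have "dist (f s w) (f t w) \<le> e / 2" by (simp add: dist_norm)
    moreover have "dist (f t w) (f t z) < e / 2" using d 1 by (simp add: d'_def)
    ultimately show ?thesis using dist_triangle[of "f s w" "f t z" "f t w"] by simp
  qed
  then show "\<exists>d>0. \<forall>x'\<in>UNIV \<times> U. dist x' x < d \<longrightarrow> dist (case x' of (t, z) \<Rightarrow> f t z) (case x of (t, z) \<Rightarrow> f t z) \<le> e"
    using d' tz by (intro exI[of _ d']) auto
qed

text \<open>A right-hand side that is bounded by a small \<open>M\<close>, so that solutions move by at most \<open>2\<pi>M \<le> r/2\<close> during
  one turn. The margin \<open>3r\<close> leaves room for this and, by Cauchy's estimate, for a Lipschitz bound
  \<open>M/r\<close>; with \<open>4\<pi>M \<le> r\<close> the Picard operator over the whole turn is a contraction by the factor \<open>1/2\<close>.\<close>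

locale quarter_flow =
  fixes H :: "nat \<Rightarrow> real \<Rightarrow> complex \<Rightarrow> complex" and a b r M :: real
  assumes H_cont: "\<And>k. k \<in> {1..4} \<Longrightarrow> continuous_on (quarter k \<times> rect a b (3 * r)) (\<lambda>(t, z). H k t z)"
    and H_hol: "\<And>k t. k \<in> {1..4} \<Longrightarrow> t \<in> quarter k \<Longrightarrow> H k t holomorphic_on rect a b (3 * r)"
    and H_bd: "\<And>k t z. k \<in> {1..4} \<Longrightarrow> t \<in> quarter k \<Longrightarrow> z \<in> rect a b (3 * r) \<Longrightarrow> cmod (H k t z) \<le> M"
    and H_real: "\<And>k t x. k \<in> {1..4} \<Longrightarrow> t \<in> quarter k \<Longrightarrow> of_real x \<in> rect a b (3 * r) \<Longrightarrow> H k t (of_real x) \<in> \<real>"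
    and r_pos: "r > 0" and M_pos: "M \<ge> 0" and small: "4 * pi * M \<le> r"
begin

lemma H_lip:
  assumes "k \<in> {1..4}" "t \<in> quarter k" "z \<in> rect a b (2 * r)" "w \<in> rect a b (2 * r)"
  shows "cmod (H k t z - H k t w) \<le> M / r * cmod (z - w)"
  by (rule holomorphic_bounded_lipschitz[OF _ r_pos _ assms(3,4)])
    (use H_hol[OF assms(1,2)] H_bd[OF assms(1,2)] in auto)

text \<open>The properties of an approximate solution that the Picard operator preserves and that pass to uniform limits.\<close>

definition admissible :: "(real \<Rightarrow> complex \<Rightarrow> complex) \<Rightarrow> bool" where
  "admissible \<phi> \<longleftrightarrow> continuous_on (UNIV \<times> rect a b r) (\<lambda>(t, z). \<phi> t z) \<and>
     (\<forall>t. \<phi> t holomorphic_on rect a b r) \<and>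
     (\<forall>t. \<forall>z\<in>rect a b r. cmod (\<phi> t z - z) \<le> 2 * pi * M) \<and>
     (\<forall>t x. of_real x \<in> rect a b r \<longrightarrow> \<phi> t (of_real x) \<in> \<real>)"

definition picard :: "(real \<Rightarrow> complex \<Rightarrow> complex) \<Rightarrow> real \<Rightarrow> complex \<Rightarrow> complex" where
  "picard \<phi> t z = z + piecewise_integral (\<lambda>k u. H k u (\<phi> u z)) t"

lemma near_rect:
  assumes "z \<in> rect a b r" "cmod (w - z) \<le> 2 * pi * M"
  shows "w \<in> rect a b (2 * r)"
proof -
  have "0 \<le> pi * M" using M_pos by simp
  then have "cmod (w - z) \<le> r" using assms(2) small by linarith
  from rect_near[OF assms(1) this] show ?thesis by simp
qed

lemma rect23: "rect a b (2 * r) \<subseteq> rect a b (3 * r)" "rect a b r \<subseteq> rect a b (2 * r)"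
  using r_pos by (auto intro!: rect_mono)

lemma H_comp_continuous:
  assumes "continuous_on (UNIV \<times> rect a b r) (\<lambda>(t, z). \<phi> t z)" "\<And>t z. z \<in> rect a b r \<Longrightarrow> cmod (\<phi> t z - z) \<le> 2 * pi * M"
    "k \<in> {1..4}"
  shows "continuous_on (quarter k \<times> rect a b r) (\<lambda>(u, z). H k u (\<phi> u z))"
    and "z \<in> rect a b r \<Longrightarrow> continuous_on (quarter k) (\<lambda>u. H k u (\<phi> u z))"
proof -
  have "continuous_on (quarter k \<times> rect a b r) (\<lambda>x. (\<lambda>(t, z). H k t z) (fst x, (\<lambda>(t, z). \<phi> t z) x))"
  proof (rule continuous_on_compose2[OF H_cont[OF assms(3)]])
    show "continuous_on (quarter k \<times> rect a b r) (\<lambda>x. (fst x, (\<lambda>(t, z). \<phi> t z) x))"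
      by (intro continuous_on_Pair continuous_on_fst continuous_on_id continuous_on_subset[OF assms(1)]) auto
    show "(\<lambda>x. (fst x, (\<lambda>(t, z). \<phi> t z) x)) ` (quarter k \<times> rect a b r) \<subseteq> quarter k \<times> rect a b (3 * r)"
      using near_rect assms(2) rect23 by (auto simp: subset_iff)
  qed
  then show 1: "continuous_on (quarter k \<times> rect a b r) (\<lambda>(u, z). H k u (\<phi> u z))"
    by (simp add: case_prod_beta')
  show "continuous_on (quarter k) (\<lambda>u. H k u (\<phi> u z))" if "z \<in> rect a b r"
  proof -
    have "continuous_on (quarter k) (\<lambda>u. (\<lambda>(u, z). H k u (\<phi> u z)) (u, z))"
      by (rule continuous_on_compose2[OF 1]) (use that in \<open>auto intro!: continuous_intros\<close>)
    then show ?thesis by simp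
  qed
qed

lemma picard_admissible:
  assumes "admissible \<phi>"
  shows "admissible (picard \<phi>)"
proof -
  have c: "continuous_on (UNIV \<times> rect a b r) (\<lambda>(t, z). \<phi> t z)"
    and h: "\<And>t. \<phi> t holomorphic_on rect a b r"
    and d: "\<And>t z. z \<in> rect a b r \<Longrightarrow> cmod (\<phi> t z - z) \<le> 2 * pi * M"
    and re: "\<And>t x. of_real x \<in> rect a b r \<Longrightarrow> \<phi> t (of_real x) \<in> \<real>"
    using assms by (auto simp: admissible_def)
  have Hc: "continuous_on (quarter k \<times> rect a b r) (\<lambda>(u, z). H k u (\<phi> u z))"
      "z \<in> rect a b r \<Longrightarrow> continuous_on (quarter k) (\<lambda>u. H k u (\<phi> u z))" if "k \<in> {1..4}" for k z
    by (rule H_comp_continuous[OF c]; use d that in blast)+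
  have inr: "\<phi> t z \<in> rect a b (3 * r)" if "z \<in> rect a b r" for t z using near_rect[OF that d[OF that]] rect23 by auto
  have bd: "cmod (H k u (\<phi> u z)) \<le> M" if "k \<in> {1..4}" "u \<in> quarter k" "z \<in> rect a b r" for k u z
    using H_bd[OF that(1,2) inr[OF that(3)]] .
  have hol: "picard \<phi> t holomorphic_on rect a b r" for t
  proof -
    have "(\<lambda>z. integral {quarter_end k - pi / 2..clamp_quarter k t} (\<lambda>u. H k u (\<phi> u z))) holomorphic_on rect a b r" if k: "k \<in> {1..4}" for k
    proof (rule holomorphic_integral[OF _ rect_open])
      show "continuous_on ({quarter_end k - pi / 2..clamp_quarter k t} \<times> rect a b r) (\<lambda>(u, z). H k u (\<phi> u z))"
        using Hc(1)[OF k] clamp_quarter_sub[of k t] by (elim continuous_on_subset) auto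
      show "(\<lambda>z. H k u (\<phi> u z)) holomorphic_on rect a b r" if "u \<in> {quarter_end k - pi / 2..clamp_quarter k t}" for u
      proof -
        have "u \<in> quarter k" using that clamp_quarter_sub by blast
        from holomorphic_on_compose_gen[OF h[of u] H_hol[OF k this]] show ?thesis
          using inr by (auto simp: o_def)
      qed
    qed
    then show ?thesis unfolding picard_def[abs_def] piecewise_integral_def by (intro holomorphic_intros) auto
  qed
  have lip: "cmod (picard \<phi> t z - picard \<phi> t' z) \<le> 4 * M * \<bar>t - t'\<bar>" if "z \<in> rect a b r" for t t' z
    unfolding picard_def using piecewise_integral_lipschitz[of "\<lambda>k u. H k u (\<phi> u z)" M t t'] Hc(2)[OF _ that] bd[OF _ _ that] by simp
  have cont: "continuous_on (UNIV \<times> rect a b r) (\<lambda>(t, z). picard \<phi> t z)"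
    by (rule continuous_on_TimesI_lip[OF hol lip rect_open])
  show ?thesis unfolding admissible_def
  proof (intro conjI allI ballI impI cont hol)
    show "cmod (picard \<phi> t z - z) \<le> 2 * pi * M" if "z \<in> rect a b r" for t z
      unfolding picard_def using piecewise_integral_bound[of "\<lambda>k u. H k u (\<phi> u z)" M t] Hc(2)[OF _ that] bd[OF _ _ that] by simp
    fix t x assume x: "complex_of_real x \<in> rect a b r"
    have "integral {quarter_end k - pi / 2..clamp_quarter k t} (\<lambda>u. H k u (\<phi> u (of_real x))) \<in> \<real>" if k: "k \<in> {1..4}" for k
    proof -
      have "H k u (\<phi> u (of_real x)) = of_real (Re (H k u (\<phi> u (of_real x))))" if "u \<in> {quarter_end k - pi / 2..clamp_quarter k t}" for u
      proof -
        obtain y where y: "\<phi> u (of_real x) = of_real y" using re[OF x] Reals_cases by blast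
        have "u \<in> quarter k" using that clamp_quarter_sub by blast
        then have "H k u (of_real y) \<in> \<real>" using H_real[OF k] inr[OF x] y by metis
        then show ?thesis by (simp add: y)
      qed
      then have "integral {quarter_end k - pi / 2..clamp_quarter k t} (\<lambda>u. H k u (\<phi> u (of_real x)))
        = integral {quarter_end k - pi / 2..clamp_quarter k t} (\<lambda>u. complex_of_real (Re (H k u (\<phi> u (of_real x)))))"
        by (intro integral_cong) auto
      also have "\<dots> = of_real (integral {quarter_end k - pi / 2..clamp_quarter k t} (\<lambda>u. Re (H k u (\<phi> u (of_real x)))))"
        using Hc(2)[OF k x] clamp_quarter_sub[of k t]
        by (intro integral_unique has_integral_of_real integrable_integral integrable_continuous_interval continuous_intros)
          (rule continuous_on_subset)
      finally show ?thesis by simp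
    qed
    then show "picard \<phi> t (of_real x) \<in> \<real>" unfolding picard_def piecewise_integral_def by (intro Reals_add sum_in_Reals) (use x in auto)
  qed
qed

lemma picard_contracts:
  assumes "admissible \<phi>" "admissible \<psi>" "\<And>t z. z \<in> rect a b r \<Longrightarrow> cmod (\<phi> t z - \<psi> t z) \<le> e" "z \<in> rect a b r"
  shows "cmod (picard \<phi> t z - picard \<psi> t z) \<le> e / 2"
proof -
  have c: "\<And>k. k \<in> {1..4} \<Longrightarrow> continuous_on (quarter k) (\<lambda>u. H k u (\<phi> u z))"
     "\<And>k. k \<in> {1..4} \<Longrightarrow> continuous_on (quarter k) (\<lambda>u. H k u (\<psi> u z))"
    using assms H_comp_continuous(2) by (auto simp: admissible_def)
  have inr: "\<phi> u z \<in> rect a b (2 * r)" "\<psi> u z \<in> rect a b (2 * r)" for u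
    using near_rect[OF assms(4)] assms by (auto simp: admissible_def)
  have e: "e \<ge> 0" using assms(3)[OF assms(4)] norm_ge_zero order_trans by blast
  have "cmod (piecewise_integral (\<lambda>k u. H k u (\<phi> u z) - H k u (\<psi> u z)) t) \<le> 2 * pi * (M / r * e)"
  proof (rule piecewise_integral_bound)
    show "cmod (H k u (\<phi> u z) - H k u (\<psi> u z)) \<le> M / r * e" if "k \<in> {1..4}" "u \<in> quarter k" for k u
      using H_lip[OF that inr] by (rule order_trans)
        (intro mult_left_mono assms(3)[OF assms(4)] divide_nonneg_pos M_pos r_pos)
  qed (intro continuous_on_diff c)
  also have "2 * pi * (M / r * e) = (4 * pi * M / r) * (e / 2)" by simp
  also have "\<dots> \<le> 1 * (e / 2)" using small r_pos e by (intro mult_right_mono) auto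
  finally have "cmod (piecewise_integral (\<lambda>k u. H k u (\<phi> u z) - H k u (\<psi> u z)) t) \<le> e / 2" by simp
  moreover have "piecewise_integral (\<lambda>k u. H k u (\<phi> u z)) t - piecewise_integral (\<lambda>k u. H k u (\<psi> u z)) t = piecewise_integral (\<lambda>k u. H k u (\<phi> u z) - H k u (\<psi> u z)) t"
    by (rule piecewise_integral_diff; rule c)
  ultimately show ?thesis unfolding picard_def by simp
qed

definition iter :: "nat \<Rightarrow> real \<Rightarrow> complex \<Rightarrow> complex" where
  "iter m = (picard ^^ m) (\<lambda>t z. z)"

lemma iter_admissible: "admissible (iter m)"
proof (induction m)
  case 0
  have "continuous_on (UNIV \<times> rect a b r) (\<lambda>(t::real, z). z)"
    by (simp add: case_prod_beta' continuous_on_snd continuous_on_id)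
  then show ?case using M_pos by (simp add: iter_def admissible_def)
next
  case (Suc m)
  then show ?case using picard_admissible by (simp add: iter_def)
qed

lemma iter_step:
  assumes "z \<in> rect a b r"
  shows "cmod (iter (Suc m) t z - iter m t z) \<le> 2 * pi * M * (1 / 2) ^ m"
  using assms
proof (induction m arbitrary: t z)
  case 0
  then show ?case using iter_admissible[of 1] by (simp add: iter_def admissible_def)
next
  case (Suc m)
  have "cmod (picard (iter (Suc m)) t z - picard (iter m) t z) \<le> (2 * pi * M * (1 / 2) ^ m) / 2"
    by (rule picard_contracts[OF iter_admissible iter_admissible Suc.IH Suc.prems])
  then show ?case by (simp add: iter_def)
qed

text \<open>The Picard iterates converge uniformly, so the limit is holomorphic in the initial value.\<close>

lemma flow_exists:
  obtains \<sigma> where "admissible \<sigma>" "\<And>t z. z \<in> rect a b r \<Longrightarrow> \<sigma> t z = picard \<sigma> t z"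
proof -
  define A where "A = (UNIV :: real set) \<times> rect a b r"
  define f where "f m x = iter (Suc m) (fst x) (snd x) - iter m (fst x) (snd x)" for m x
  have "uniform_limit A (\<lambda>n x. \<Sum>i<n. f i x) (\<lambda>x. suminf (\<lambda>i. f i x)) sequentially"
  proof (rule Weierstrass_m_test)
    show "norm (f m x) \<le> 2 * pi * M * (1 / 2) ^ m" if "x \<in> A" for m x
      using that iter_step by (auto simp: A_def f_def)
    show "summable (\<lambda>m. 2 * pi * M * (1 / 2) ^ m)" by (intro summable_mult summable_geometric) simp
  qed
  moreover have "(\<Sum>i<n. f i x) = iter n (fst x) (snd x) - snd x" for n x
    unfolding f_def by (subst sum_lessThan_telescope) (simp add: iter_def)
  ultimately have ul: "uniform_limit A (\<lambda>n x. iter n (fst x) (snd x) - snd x) (\<lambda>x. suminf (\<lambda>i. f i x)) sequentially"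
    by simp
  define \<sigma> where "\<sigma> t z = z + suminf (\<lambda>i. f i (t, z))" for t z
  have ul2: "uniform_limit A (\<lambda>n x. iter n (fst x) (snd x)) (\<lambda>x. \<sigma> (fst x) (snd x)) sequentially"
  proof -
    have "uniform_limit A (\<lambda>n x. (iter n (fst x) (snd x) - snd x) + snd x) (\<lambda>x. suminf (\<lambda>i. f i x) + snd x) sequentially"
      by (intro uniform_limit_add ul uniform_limit_const)
    then show ?thesis by (simp add: \<sigma>_def add.commute)
  qed
  have pt: "(\<lambda>n. iter n t z) \<longlonglongrightarrow> \<sigma> t z" if "z \<in> rect a b r" for t z
    using tendsto_uniform_limitI[OF ul2, of "(t, z)"] that by (simp add: A_def)
  have adm: "admissible \<sigma>" unfolding admissible_def
  proof (intro conjI allI ballI impI)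
    show "continuous_on (UNIV \<times> rect a b r) (\<lambda>(t, z). \<sigma> t z)"
      using uniform_limit_theorem[OF _ ul2] iter_admissible by (simp add: A_def admissible_def case_prod_beta')
    show "\<sigma> t holomorphic_on rect a b r" for t
    proof (rule holomorphic_uniform_sequence[OF rect_open])
      show "iter n t holomorphic_on rect a b r" for n using iter_admissible by (simp add: admissible_def)
      fix x assume "x \<in> rect a b r"
      then obtain d where d: "d > 0" "cball x d \<subseteq> rect a b r" using rect_open open_contains_cball by blast
      have "uniform_limit (cball x d) (\<lambda>n z. iter n t z) (\<sigma> t) sequentially"
        using ul2 d(2) unfolding uniform_limit_iff A_def by (auto elim!: eventually_mono simp: subset_iff)
      then show "\<exists>d>0. cball x d \<subseteq> rect a b r \<and> uniform_limit (cball x d) (\<lambda>n. iter n t) (\<sigma> t) sequentially"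
        using d by auto
    qed
    show "cmod (\<sigma> t z - z) \<le> 2 * pi * M" if "z \<in> rect a b r" for t z
    proof (rule LIMSEQ_le_const2)
      show "(\<lambda>n. cmod (iter n t z - z)) \<longlonglongrightarrow> cmod (\<sigma> t z - z)" by (intro tendsto_intros pt that)
      show "\<exists>N. \<forall>n\<ge>N. cmod (iter n t z - z) \<le> 2 * pi * M" using iter_admissible that by (auto simp: admissible_def)
    qed
    show "\<sigma> t (of_real x) \<in> \<real>" if "complex_of_real x \<in> rect a b r" for t x
      by (rule closed_sequentially[OF closed_complex_Reals _ pt[OF that]])
        (use iter_admissible that in \<open>auto simp: admissible_def\<close>)
  qed
  have "\<sigma> t z = picard \<sigma> t z" if z: "z \<in> rect a b r" for t z
  proof -
    have "(\<lambda>n. picard (iter n) t z) \<longlonglongrightarrow> picard \<sigma> t z"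
    proof (rule LIMSEQ_I)
      fix e :: real assume e: "e > 0"
      have "\<forall>\<^sub>F n in sequentially. \<forall>x\<in>A. dist (iter n (fst x) (snd x)) (\<sigma> (fst x) (snd x)) < e"
        using ul2 e by (simp add: uniform_limit_iff)
      then obtain N where N: "\<And>n x. n \<ge> N \<Longrightarrow> x \<in> A \<Longrightarrow> dist (iter n (fst x) (snd x)) (\<sigma> (fst x) (snd x)) < e"
        by (auto simp: eventually_sequentially)
      have "cmod (picard (iter n) t z - picard \<sigma> t z) < e" if "n \<ge> N" for n
      proof -
        have "cmod (picard (iter n) t z - picard \<sigma> t z) \<le> e / 2"
        proof (rule picard_contracts[OF iter_admissible adm _ z])
          show "cmod (iter n t z - \<sigma> t z) \<le> e" if "z \<in> rect a b r" for t z
            using N[OF \<open>n \<ge> N\<close>, of "(t, z)"] that by (simp add: A_def dist_norm)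
        qed
        then show ?thesis using e by simp
      qed
      then show "\<exists>no. \<forall>n\<ge>no. norm (picard (iter n) t z - picard \<sigma> t z) < e" by blast
    qed
    moreover have "(\<lambda>n. iter (Suc n) t z) \<longlonglongrightarrow> \<sigma> t z" using pt[OF z] by (rule LIMSEQ_Suc)
    moreover have "iter (Suc n) t z = picard (iter n) t z" for n by (simp add: iter_def)
    ultimately show ?thesis using LIMSEQ_unique by simp
  qed
  with adm show ?thesis using that by blast
qed

end

section \<open>The perturbed system in polar coordinates\<close>

text \<open>The right-hand side of \<open>ds/d\<theta>\<close>.\<close>

definition slope :: "real \<Rightarrow> nat \<Rightarrow> (nat \<Rightarrow> nat \<Rightarrow> nat \<Rightarrow> real) \<Rightarrow> (nat \<Rightarrow> nat \<Rightarrow> nat \<Rightarrow> real) \<Rightarrow> real \<Rightarrow> nat \<Rightarrow> real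
    \<Rightarrow> 'a::real_normed_field \<Rightarrow> 'a" where
  "slope \<eta> n a b \<epsilon> k \<theta> z = of_real \<epsilon> * radial \<eta> n (a k) (b k) \<theta> z
     / (of_real (sqrt (2 * \<eta>)) + of_real \<epsilon> * angular \<eta> n (a k) (b k) \<theta> z / z)"

lemma of_real_slope: "slope \<eta> n a b \<epsilon> k \<theta> (of_real s) = (of_real (slope \<eta> n a b \<epsilon> k \<theta> s) :: 'a::real_normed_field)"
  by (simp add: slope_def of_real_radial of_real_angular)

lemma compact_bound:
  fixes f :: "nat \<Rightarrow> 'b::topological_space \<Rightarrow> complex"
  assumes "\<And>k. k \<in> {1..4} \<Longrightarrow> continuous_on (S k) (f k)" "\<And>k. k \<in> {1..4} \<Longrightarrow> compact (S k)"
  obtains B where "B > 0" "\<And>k x. k \<in> {1..4} \<Longrightarrow> x \<in> S k \<Longrightarrow> cmod (f k x) \<le> B"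
proof -
  have "\<exists>M. \<forall>x\<in>S k. cmod (f k x) \<le> M" if "k \<in> {1..4}" for k
  proof -
    have "compact (f k ` S k)" using assms that by (intro compact_continuous_image) auto
    then show ?thesis using compact_imp_bounded bounded_iff by (metis image_eqI)
  qed
  then obtain M where M: "\<And>k x. k \<in> {1..4} \<Longrightarrow> x \<in> S k \<Longrightarrow> cmod (f k x) \<le> M k" by metis
  define B where "B = 1 + (\<Sum>k = 1..4::nat. \<bar>M k\<bar>)"
  have "B > 0" by (simp add: B_def add_pos_nonneg sum_nonneg)
  moreover have "cmod (f k x) \<le> B" if "k \<in> {1..4}" "x \<in> S k" for k x
    using M[OF that] member_le_sum[of k "{1..4}" "\<lambda>k. \<bar>M k\<bar>"] that(1) by (force simp: B_def)
  ultimately show ?thesis using that by blast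
qed

text \<open>In the coordinates \<open>(s, \<theta>)\<close> the perturbed system is a scalar equation of size \<open>O(\<epsilon>)\<close>, to which
  \<open>quarter_flow\<close> applies with \<open>M = A \<epsilon>\<close>. The limit of \<open>(\<sigma> - z)/\<epsilon>\<close> is \<open>mel1\<close>, because in the
  integral equation the argument \<open>\<sigma>\<close> may be replaced by \<open>z\<close> and the denominator by \<open>\<kappa>\<close> with an error
  \<open>O(\<epsilon>\<^sup>2)\<close>. The parts concerning real radii, stated for the real part of \<open>\<sigma>\<close>, are what the
  comparison with solutions of the planar system uses.\<close>

theorem flow_family:
  fixes lo hi \<eta> :: real
  assumes \<eta>: "\<eta> > 0" and lh: "0 < lo" "lo \<le> hi" "hi < 1"
  obtains r e1 C :: real and \<sigma> :: "real \<Rightarrow> real \<Rightarrow> complex \<Rightarrow> complex"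
  where "r > 0" "e1 > 0" "0 < lo - 3 * r" "hi + 3 * r < 1" "C > 0"
    and "\<And>\<epsilon> k \<theta> s. \<bar>\<epsilon>\<bar> < e1 \<Longrightarrow> k \<in> {1..4} \<Longrightarrow> \<theta> \<in> quarter k \<Longrightarrow> lo - 3 * r < s \<Longrightarrow> s < hi + 3 * r \<Longrightarrow>
       \<bar>\<epsilon> * angular \<eta> n (a k) (b k) \<theta> s / s\<bar> \<le> sqrt (2 * \<eta>) / 2"
    and "\<And>\<epsilon> k \<theta> s s'. \<bar>\<epsilon>\<bar> < e1 \<Longrightarrow> k \<in> {1..4} \<Longrightarrow> \<theta> \<in> quarter k \<Longrightarrow> lo - 2 * r < s \<Longrightarrow> s < hi + 2 * r \<Longrightarrow>
       lo - 2 * r < s' \<Longrightarrow> s' < hi + 2 * r \<Longrightarrow> \<bar>slope \<eta> n a b \<epsilon> k \<theta> s - slope \<eta> n a b \<epsilon> k \<theta> s'\<bar> \<le> C * \<bar>s - s'\<bar>"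
    and "\<And>\<epsilon> s. \<bar>\<epsilon>\<bar> < e1 \<Longrightarrow> lo - r < s \<Longrightarrow> s < hi + r \<Longrightarrow> continuous_on UNIV (\<lambda>\<theta>. Re (\<sigma> \<epsilon> \<theta> (of_real s)))"
    and "\<And>\<epsilon> s. \<bar>\<epsilon>\<bar> < e1 \<Longrightarrow> lo - r < s \<Longrightarrow> s < hi + r \<Longrightarrow> Re (\<sigma> \<epsilon> 0 (of_real s)) = s"
    and "\<And>\<epsilon> \<theta> s. \<bar>\<epsilon>\<bar> < e1 \<Longrightarrow> lo - r < s \<Longrightarrow> s < hi + r \<Longrightarrow> \<bar>Re (\<sigma> \<epsilon> \<theta> (of_real s)) - s\<bar> \<le> r / 2"
    and "\<And>\<epsilon> k \<theta> s. \<bar>\<epsilon>\<bar> < e1 \<Longrightarrow> lo - r < s \<Longrightarrow> s < hi + r \<Longrightarrow> k \<in> {1..4} \<Longrightarrow> quarter_end k - pi / 2 < \<theta> \<Longrightarrow> \<theta> < quarter_end k \<Longrightarrow>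
       ((\<lambda>\<theta>. Re (\<sigma> \<epsilon> \<theta> (of_real s))) has_real_derivative slope \<eta> n a b \<epsilon> k \<theta> (Re (\<sigma> \<epsilon> \<theta> (of_real s)))) (at \<theta>)"
    and "\<And>\<epsilon>. \<bar>\<epsilon>\<bar> < e1 \<Longrightarrow> \<sigma> \<epsilon> (2 * pi) holomorphic_on rect lo hi r"
    and "\<And>\<epsilon> x. \<bar>\<epsilon>\<bar> < e1 \<Longrightarrow> of_real x \<in> rect lo hi r \<Longrightarrow> \<sigma> \<epsilon> (2 * pi) (of_real x) \<in> \<real>"
    and "\<And>\<epsilon> z. 0 < \<bar>\<epsilon>\<bar> \<Longrightarrow> \<bar>\<epsilon>\<bar> < e1 \<Longrightarrow> z \<in> rect lo hi r \<Longrightarrow>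
       cmod ((\<sigma> \<epsilon> (2 * pi) z - z) / of_real \<epsilon> - mel1 \<eta> n a b z) \<le> C * \<bar>\<epsilon>\<bar>"
proof -
  define \<kappa> where "\<kappa> = sqrt (2 * \<eta>)"
  have \<kappa>: "\<kappa> > 0" using \<eta> by (simp add: \<kappa>_def)
  define r where "r = min lo (1 - hi) / 4"
  have "4 * r \<le> lo" "4 * r \<le> 1 - hi" "r > 0" using lh by (auto simp: r_def)
  then have r: "r > 0" "0 < lo - 3 * r" "hi + 3 * r < 1" by linarith+
  define K where "K = cbox (Complex (lo - 3 * r) (- 3 * r)) (Complex (hi + 3 * r) (3 * r))"
  have K: "K \<subseteq> strip" "compact K" "rect lo hi (3 * r) \<subseteq> K"
    using r by (auto simp: K_def in_cbox_complex_iff strip_def rect_def)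
  have cK: "compact (quarter k \<times> K)" for k unfolding quarter_def by (intro compact_Times K compact_Icc)
  define G where "G k \<theta> z = radial \<eta> n (a k) (b k) \<theta> z" for k \<theta> and z :: complex
  define J where "J k \<theta> z = angular \<eta> n (a k) (b k) \<theta> z / z" for k \<theta> and z :: complex
  have Gc: "continuous_on (T \<times> strip) (\<lambda>(\<theta>, z). G k \<theta> z)" for T k unfolding G_def by (rule radial_continuous)
  have Jc: "continuous_on (T \<times> strip) (\<lambda>(\<theta>, z). J k \<theta> z)" for T k
    unfolding J_def case_prod_beta'
    using angular_continuous[of T \<eta> n "a k" "b k"] strip_nonpos(2)
    by (intro continuous_on_divide) (auto simp: case_prod_beta' intro!: continuous_on_snd continuous_on_id)
  have Gh: "G k \<theta> holomorphic_on strip" for k \<theta> unfolding G_def by (rule radial_holomorphic)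
  have Jh: "J k \<theta> holomorphic_on strip" for k \<theta> unfolding J_def
    by (intro holomorphic_on_divide angular_holomorphic holomorphic_on_ident strip_nonpos(2))
  have sub: "quarter k \<times> K \<subseteq> quarter k \<times> strip" for k using K by auto
  obtain B1 where B1: "B1 > 0" "\<And>k x. k \<in> {1..4} \<Longrightarrow> x \<in> quarter k \<times> K \<Longrightarrow> cmod ((\<lambda>(\<theta>, z). G k \<theta> z) x) \<le> B1"
    using compact_bound[of "\<lambda>k. quarter k \<times> K" "\<lambda>k (\<theta>, z). G k \<theta> z", OF continuous_on_subset[OF Gc sub] cK] by blast
  obtain B2 where B2: "B2 > 0" "\<And>k x. k \<in> {1..4} \<Longrightarrow> x \<in> quarter k \<times> K \<Longrightarrow> cmod ((\<lambda>(\<theta>, z). J k \<theta> z) x) \<le> B2"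
    using compact_bound[of "\<lambda>k. quarter k \<times> K" "\<lambda>k (\<theta>, z). J k \<theta> z", OF continuous_on_subset[OF Jc sub] cK] by blast
  have GB: "cmod (G k \<theta> z) \<le> B1" and JB: "cmod (J k \<theta> z) \<le> B2"
    if "k \<in> {1..4}" "\<theta> \<in> quarter k" "z \<in> rect lo hi (3 * r)" for k \<theta> z
    using B1(2)[OF that(1), of "(\<theta>, z)"] B2(2)[OF that(1), of "(\<theta>, z)"] that K by auto
  define A where "A = 2 * B1 / \<kappa>"
  have A: "A > 0" using B1 \<kappa> by (simp add: A_def)
  (* The first bound keeps the angular speed above kappa / 2, the second one is the smallness condition for the contraction. *)
  define e1 where "e1 = min (\<kappa> / (2 * B2)) (r / (4 * pi * A))"
  have e1: "e1 > 0" using \<kappa> B2 r A by (simp add: e1_def)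
  define H where "H \<epsilon> k \<theta> z = of_real \<epsilon> * G k \<theta> z / (of_real \<kappa> + of_real \<epsilon> * J k \<theta> z)" for \<epsilon> k \<theta> z
  have Hs: "slope \<eta> n a b \<epsilon> k \<theta> z = H \<epsilon> k \<theta> z" for \<epsilon> k \<theta> and z :: complex
    by (simp add: slope_def H_def G_def J_def \<kappa>_def)
  have eJ: "cmod (of_real \<epsilon> * J k \<theta> z) \<le> \<kappa> / 2" if "\<bar>\<epsilon>\<bar> < e1" "k \<in> {1..4}" "\<theta> \<in> quarter k" "z \<in> rect lo hi (3 * r)" for \<epsilon> k \<theta> z
  proof -
    have "cmod (of_real \<epsilon> * J k \<theta> z) \<le> \<bar>\<epsilon>\<bar> * B2" using JB[OF that(2-4)] by (simp add: norm_mult mult_left_mono)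
    also have "\<dots> \<le> \<kappa> / (2 * B2) * B2" using that(1) B2(1) by (intro mult_right_mono) (auto simp: e1_def)
    finally show ?thesis using B2(1) by simp
  qed
  have den: "cmod (of_real \<kappa> + of_real \<epsilon> * J k \<theta> z) \<ge> \<kappa> / 2" if "\<bar>\<epsilon>\<bar> < e1" "k \<in> {1..4}" "\<theta> \<in> quarter k" "z \<in> rect lo hi (3 * r)" for \<epsilon> k \<theta> z
    using eJ[OF that] norm_diff_ineq[of "complex_of_real \<kappa>" "of_real \<epsilon> * J k \<theta> z"] \<kappa> by simp
  have den0: "of_real \<kappa> + of_real \<epsilon> * J k \<theta> z \<noteq> 0" if "\<bar>\<epsilon>\<bar> < e1" "k \<in> {1..4}" "\<theta> \<in> quarter k" "z \<in> rect lo hi (3 * r)" for \<epsilon> k \<theta> z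
    using den[OF that] \<kappa> by auto
  have Hbd: "cmod (H \<epsilon> k \<theta> z) \<le> A * \<bar>\<epsilon>\<bar>" if "\<bar>\<epsilon>\<bar> < e1" "k \<in> {1..4}" "\<theta> \<in> quarter k" "z \<in> rect lo hi (3 * r)" for \<epsilon> k \<theta> z
  proof -
    have "cmod (H \<epsilon> k \<theta> z) \<le> (\<bar>\<epsilon>\<bar> * B1) / (\<kappa> / 2)"
      unfolding H_def norm_divide norm_mult using den[OF that] GB[OF that(2-4)] \<kappa> B1(1)
      by (intro frac_le) (auto intro: mult_left_mono)
    then show ?thesis by (simp add: A_def field_simps)
  qed
  have QF: "quarter_flow (H \<epsilon>) lo hi r (A * \<bar>\<epsilon>\<bar>)" if e: "\<bar>\<epsilon>\<bar> < e1" for \<epsilon>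
  proof
    have rs: "rect lo hi (3 * r) \<subseteq> strip" using K by auto
    show "continuous_on (quarter k \<times> rect lo hi (3 * r)) (\<lambda>(t, z). H \<epsilon> k t z)" if "k \<in> {1..4}" for k
      unfolding H_def case_prod_beta'
      using continuous_on_subset[OF Gc[of "quarter k" k], of "quarter k \<times> rect lo hi (3 * r)"]
        continuous_on_subset[OF Jc[of "quarter k" k], of "quarter k \<times> rect lo hi (3 * r)"] rs den0[OF e that]
      by (intro continuous_on_divide continuous_on_mult continuous_on_add continuous_on_const) (auto simp: case_prod_beta')
    show "H \<epsilon> k t holomorphic_on rect lo hi (3 * r)" if "k \<in> {1..4}" "t \<in> quarter k" for k t
      unfolding H_def[abs_def] using den0[OF e that]
      by (intro holomorphic_on_divide holomorphic_on_mult holomorphic_on_add holomorphic_on_const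
         holomorphic_on_subset[OF Gh rs] holomorphic_on_subset[OF Jh rs]) auto
    show "cmod (H \<epsilon> k t z) \<le> A * \<bar>\<epsilon>\<bar>" if "k \<in> {1..4}" "t \<in> quarter k" "z \<in> rect lo hi (3 * r)" for k t z
      by (rule Hbd[OF e that])
    show "H \<epsilon> k t (of_real x) \<in> \<real>" for k t x unfolding Hs[symmetric] of_real_slope by simp
    show "0 < r" by (rule r)
    show "0 \<le> A * \<bar>\<epsilon>\<bar>" using A by simp
    have "4 * pi * A * \<bar>\<epsilon>\<bar> \<le> 4 * pi * A * (r / (4 * pi * A))"
      using e A by (intro mult_left_mono) (auto simp: e1_def)
    then show "4 * pi * (A * \<bar>\<epsilon>\<bar>) \<le> r" using A by (simp add: mult.assoc)
  qed
  have "\<exists>\<phi>. quarter_flow.admissible lo hi r (A * \<bar>\<epsilon>\<bar>) \<phi> \<and>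
      (\<forall>t. \<forall>z\<in>rect lo hi r. \<phi> t z = z + piecewise_integral (\<lambda>k u. H \<epsilon> k u (\<phi> u z)) t)" if e: "\<bar>\<epsilon>\<bar> < e1" for \<epsilon>
  proof -
    interpret quarter_flow "H \<epsilon>" lo hi r "A * \<bar>\<epsilon>\<bar>" by (rule QF[OF e])
    show ?thesis using flow_exists unfolding picard_def by metis
  qed
  then obtain \<sigma> where \<sigma>: "\<And>\<epsilon>. \<bar>\<epsilon>\<bar> < e1 \<Longrightarrow> quarter_flow.admissible lo hi r (A * \<bar>\<epsilon>\<bar>) (\<sigma> \<epsilon>)"
      "\<And>\<epsilon> t z. \<bar>\<epsilon>\<bar> < e1 \<Longrightarrow> z \<in> rect lo hi r \<Longrightarrow> \<sigma> \<epsilon> t z = z + piecewise_integral (\<lambda>k u. H \<epsilon> k u (\<sigma> \<epsilon> u z)) t"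
    by metis
  have adm: "continuous_on (UNIV \<times> rect lo hi r) (\<lambda>(t, z). \<sigma> \<epsilon> t z)" "\<And>t. \<sigma> \<epsilon> t holomorphic_on rect lo hi r"
     "\<And>t z. z \<in> rect lo hi r \<Longrightarrow> cmod (\<sigma> \<epsilon> t z - z) \<le> 2 * pi * (A * \<bar>\<epsilon>\<bar>)"
     "\<And>t x. of_real x \<in> rect lo hi r \<Longrightarrow> \<sigma> \<epsilon> t (of_real x) \<in> \<real>" if e: "\<bar>\<epsilon>\<bar> < e1" for \<epsilon>
    using \<sigma>(1)[OF e] unfolding quarter_flow.admissible_def[OF QF[OF e]] by auto
  have rr: "of_real s \<in> rect lo hi \<rho> \<longleftrightarrow> lo - \<rho> < s \<and> s < hi + \<rho>" if "\<rho> > 0" for s \<rho> using that by (simp add: rect_def)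
  define C where "C = A * \<bar>e1\<bar> / r + 2 * pi * (2 * pi * A * A / r) + 2 * pi * (2 * B1 * B2 / (\<kappa> * \<kappa>))"
  have C0: "C > 0" using A r B1 B2 \<kappa> e1 by (auto simp: C_def intro!: add_pos_pos)
  have C1: "A * \<bar>\<epsilon>\<bar> / r \<le> C" if "\<bar>\<epsilon>\<bar> < e1" for \<epsilon>
  proof -
    have "A * \<bar>\<epsilon>\<bar> / r \<le> A * \<bar>e1\<bar> / r" using that A r by (intro divide_right_mono mult_left_mono) auto
    moreover have "0 \<le> 2 * pi * (2 * pi * A * A / r)" "0 \<le> 2 * pi * (2 * B1 * B2 / (\<kappa> * \<kappa>))" using A r B1 B2 \<kappa> by auto
    ultimately show ?thesis by (simp add: C_def)
  qed
  have sre: "\<sigma> \<epsilon> t (of_real s) = of_real (Re (\<sigma> \<epsilon> t (of_real s)))" if "\<bar>\<epsilon>\<bar> < e1" "lo - r < s" "s < hi + r" for \<epsilon> t s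
    using adm(4)[OF that(1), of s t] that rr[OF r(1)] by simp
  have b1: "\<bar>Re (\<sigma> \<epsilon> \<theta> (of_real s)) - s\<bar> \<le> r / 2" if "\<bar>\<epsilon>\<bar> < e1" "lo - r < s" "s < hi + r" for \<epsilon> \<theta> s
  proof -
    have s: "of_real s \<in> rect lo hi r" using rr[OF r(1)] that by simp
    have "cmod (\<sigma> \<epsilon> \<theta> (of_real s) - of_real s) \<le> r / 2"
      using adm(3)[OF that(1) s, of \<theta>] quarter_flow.small[OF QF[OF that(1)]] by simp
    then show ?thesis using abs_Re_le_cmod[of "\<sigma> \<epsilon> \<theta> (of_real s) - of_real s"] by simp
  qed
  have cHs: "continuous_on (quarter k) (\<lambda>u. H \<epsilon> k u (\<sigma> \<epsilon> u z))" if "\<bar>\<epsilon>\<bar> < e1" "z \<in> rect lo hi r" "k \<in> {1..4}" for \<epsilon> z k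
  proof -
    interpret quarter_flow "H \<epsilon>" lo hi r "A * \<bar>\<epsilon>\<bar>" by (rule QF[OF that(1)])
    show ?thesis by (rule H_comp_continuous(2)[OF adm(1)[OF that(1)] adm(3)[OF that(1)] that(3,2)])
  qed
  have conv: "cmod ((\<sigma> \<epsilon> (2 * pi) z - z) / of_real \<epsilon> - mel1 \<eta> n a b z) \<le> C * \<bar>\<epsilon>\<bar>"
    if e: "0 < \<bar>\<epsilon>\<bar>" "\<bar>\<epsilon>\<bar> < e1" and z: "z \<in> rect lo hi r" for \<epsilon> z
  proof -
    interpret quarter_flow "H \<epsilon>" lo hi r "A * \<bar>\<epsilon>\<bar>" by (rule QF[OF e(2)])
    have z3: "z \<in> rect lo hi (3 * r)" "z \<in> rect lo hi (2 * r)" using rect23 z by auto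
    have sz: "\<sigma> \<epsilon> u z \<in> rect lo hi (2 * r)" for u using near_rect[OF z adm(3)[OF e(2) z]] .
    have cG: "continuous_on (quarter k) (\<lambda>u. of_real \<epsilon> * (G k u z / of_real \<kappa>))" if "k \<in> {1..4}" for k
    proof -
      have "continuous_on (quarter k) (\<lambda>u. (\<lambda>(\<theta>, z). G k \<theta> z) (u, z))"
        by (rule continuous_on_compose2[OF Gc[of "quarter k"]]) (use z3 K in \<open>auto intro!: continuous_intros\<close>)
      then show ?thesis using \<kappa> by (intro continuous_intros) auto
    qed
    have m1: "of_real \<epsilon> * mel1 \<eta> n a b z = piecewise_integral (\<lambda>k u. of_real \<epsilon> * (G k u z / of_real \<kappa>)) (2 * pi)"
      unfolding piecewise_integral_2pi[OF order_refl] mel1_def G_def \<kappa>_def by (simp add: sum_distrib_left)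
    have s1: "\<sigma> \<epsilon> (2 * pi) z - z = piecewise_integral (\<lambda>k u. H \<epsilon> k u (\<sigma> \<epsilon> u z)) (2 * pi)" using \<sigma>(2)[OF e(2) z, of "2 * pi"] by (simp add: algebra_simps)
    have "(\<sigma> \<epsilon> (2 * pi) z - z) - of_real \<epsilon> * mel1 \<eta> n a b z
        = piecewise_integral (\<lambda>k u. H \<epsilon> k u (\<sigma> \<epsilon> u z) - of_real \<epsilon> * (G k u z / of_real \<kappa>)) (2 * pi)"
      unfolding s1 m1 by (rule piecewise_integral_diff[OF cHs[OF e(2) z] cG])
    also have "cmod \<dots> \<le> 2 * pi * ((2 * pi * A * A / r + 2 * B1 * B2 / (\<kappa> * \<kappa>)) * (\<bar>\<epsilon>\<bar> * \<bar>\<epsilon>\<bar>))"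
    proof (rule piecewise_integral_bound)
      show "continuous_on (quarter k) (\<lambda>u. H \<epsilon> k u (\<sigma> \<epsilon> u z) - of_real \<epsilon> * (G k u z / of_real \<kappa>))" if "k \<in> {1..4}" for k
        by (intro continuous_on_diff cHs[OF e(2) z that] cG[OF that])
      fix k u assume k: "k \<in> {1..4}" "u \<in> quarter k"
      have "cmod (H \<epsilon> k u (\<sigma> \<epsilon> u z) - H \<epsilon> k u z) \<le> A * \<bar>\<epsilon>\<bar> / r * cmod (\<sigma> \<epsilon> u z - z)"
        by (rule H_lip[OF k sz z3(2)])
      also have "\<dots> \<le> A * \<bar>\<epsilon>\<bar> / r * (2 * pi * (A * \<bar>\<epsilon>\<bar>))"
        using A r by (intro mult_left_mono adm(3)[OF e(2) z]) auto
      finally have 1: "cmod (H \<epsilon> k u (\<sigma> \<epsilon> u z) - H \<epsilon> k u z) \<le> 2 * pi * A * A / r * (\<bar>\<epsilon>\<bar> * \<bar>\<epsilon>\<bar>)" by (simp add: mult_ac)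
      have d: "of_real \<kappa> + of_real \<epsilon> * J k u z \<noteq> 0" by (rule den0[OF e(2) k z3(1)])
      have "H \<epsilon> k u z - of_real \<epsilon> * (G k u z / of_real \<kappa>) =
         - (of_real \<epsilon> * of_real \<epsilon> * G k u z * J k u z) / (of_real \<kappa> * (of_real \<kappa> + of_real \<epsilon> * J k u z))"
        unfolding H_def using d \<kappa> by (simp add: field_simps)
      also have "cmod \<dots> \<le> (\<bar>\<epsilon>\<bar> * \<bar>\<epsilon>\<bar> * B1 * B2) / (\<kappa> * (\<kappa> / 2))"
        unfolding norm_divide norm_minus_cancel norm_mult
        using den[OF e(2) k z3(1)] GB[OF k z3(1)] JB[OF k z3(1)] \<kappa> B1(1) B2(1)
        by (intro frac_le mult_mono) auto
      also have "\<dots> = 2 * B1 * B2 / (\<kappa> * \<kappa>) * (\<bar>\<epsilon>\<bar> * \<bar>\<epsilon>\<bar>)" by (simp add: field_simps)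
      finally have 2: "cmod (H \<epsilon> k u z - of_real \<epsilon> * (G k u z / of_real \<kappa>)) \<le> 2 * B1 * B2 / (\<kappa> * \<kappa>) * (\<bar>\<epsilon>\<bar> * \<bar>\<epsilon>\<bar>)" .
      show "cmod (H \<epsilon> k u (\<sigma> \<epsilon> u z) - of_real \<epsilon> * (G k u z / of_real \<kappa>))
         \<le> (2 * pi * A * A / r + 2 * B1 * B2 / (\<kappa> * \<kappa>)) * (\<bar>\<epsilon>\<bar> * \<bar>\<epsilon>\<bar>)"
        using norm_triangle_ineq[of "H \<epsilon> k u (\<sigma> \<epsilon> u z) - H \<epsilon> k u z" "H \<epsilon> k u z - of_real \<epsilon> * (G k u z / of_real \<kappa>)"] 1 2
        by (simp add: distrib_right)
    qed
    also have "\<dots> \<le> (C * \<bar>\<epsilon>\<bar>) * \<bar>\<epsilon>\<bar>"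
    proof -
      have "2 * pi * (2 * pi * A * A / r + 2 * B1 * B2 / (\<kappa> * \<kappa>)) \<le> C"
        unfolding C_def distrib_left using A r e1 by (simp add: add_increasing)
      then have "2 * pi * (2 * pi * A * A / r + 2 * B1 * B2 / (\<kappa> * \<kappa>)) * (\<bar>\<epsilon>\<bar> * \<bar>\<epsilon>\<bar>) \<le> C * (\<bar>\<epsilon>\<bar> * \<bar>\<epsilon>\<bar>)"
        by (rule mult_right_mono) simp
      then show ?thesis by (simp only: mult.assoc)
    qed
    finally have *: "cmod ((\<sigma> \<epsilon> (2 * pi) z - z) - of_real \<epsilon> * mel1 \<eta> n a b z) \<le> (C * \<bar>\<epsilon>\<bar>) * \<bar>\<epsilon>\<bar>" .
    have "(\<sigma> \<epsilon> (2 * pi) z - z) / of_real \<epsilon> - mel1 \<eta> n a b z = ((\<sigma> \<epsilon> (2 * pi) z - z) - of_real \<epsilon> * mel1 \<eta> n a b z) / of_real \<epsilon>"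
      using e(1) by (simp add: field_simps)
    also have "cmod \<dots> \<le> (C * \<bar>\<epsilon>\<bar>) * \<bar>\<epsilon>\<bar> / \<bar>\<epsilon>\<bar>"
      unfolding norm_divide norm_of_real by (rule divide_right_mono[OF *]) simp
    finally show ?thesis using e(1) by simp
  qed
  show ?thesis
  proof (rule that[of r e1 C \<sigma>, OF r(1) e1 r(2,3) C0])
    show "\<bar>\<epsilon> * angular \<eta> n (a k) (b k) \<theta> s / s\<bar> \<le> sqrt (2 * \<eta>) / 2"
      if "\<bar>\<epsilon>\<bar> < e1" "k \<in> {1..4}" "\<theta> \<in> quarter k" "lo - 3 * r < s" "s < hi + 3 * r" for \<epsilon> k \<theta> s
    proof -
      have "of_real s \<in> rect lo hi (3 * r)" using rr that r by simp
      from eJ[OF that(1-3) this] have "cmod (of_real (\<epsilon> * angular \<eta> n (a k) (b k) \<theta> s / s)) \<le> \<kappa> / 2"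
        by (simp add: J_def of_real_angular)
      then show ?thesis unfolding norm_of_real \<kappa>_def .
    qed
    show "\<bar>slope \<eta> n a b \<epsilon> k \<theta> s - slope \<eta> n a b \<epsilon> k \<theta> s'\<bar> \<le> C * \<bar>s - s'\<bar>"
      if "\<bar>\<epsilon>\<bar> < e1" "k \<in> {1..4}" "\<theta> \<in> quarter k" "lo - 2 * r < s" "s < hi + 2 * r" "lo - 2 * r < s'" "s' < hi + 2 * r" for \<epsilon> k \<theta> s s'
    proof -
      interpret quarter_flow "H \<epsilon>" lo hi r "A * \<bar>\<epsilon>\<bar>" by (rule QF[OF that(1)])
      have m: "of_real s \<in> rect lo hi (2 * r)" "of_real s' \<in> rect lo hi (2 * r)" using rr that r by simp_all
      have "cmod (of_real (slope \<eta> n a b \<epsilon> k \<theta> s - slope \<eta> n a b \<epsilon> k \<theta> s')) \<le> A * \<bar>\<epsilon>\<bar> / r * cmod (of_real (s - s'))"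
        using H_lip[OF that(2,3) m] unfolding Hs[symmetric] of_real_slope of_real_diff[symmetric] .
      also have "\<dots> \<le> C * cmod (of_real (s - s'))" by (intro mult_right_mono C1[OF that(1)]) auto
      finally show ?thesis unfolding norm_of_real .
    qed
    show "continuous_on UNIV (\<lambda>\<theta>. Re (\<sigma> \<epsilon> \<theta> (of_real s)))" if "\<bar>\<epsilon>\<bar> < e1" "lo - r < s" "s < hi + r" for \<epsilon> s
    proof -
      have "continuous_on UNIV (\<lambda>\<theta>. (\<lambda>(t, z). \<sigma> \<epsilon> t z) (\<theta>, of_real s))"
        by (rule continuous_on_compose2[OF adm(1)[OF that(1)]]) (use that rr[OF r(1)] in \<open>auto intro!: continuous_intros\<close>)
      then show ?thesis by (auto intro!: continuous_intros)
    qed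
    show "Re (\<sigma> \<epsilon> 0 (of_real s)) = s" if "\<bar>\<epsilon>\<bar> < e1" "lo - r < s" "s < hi + r" for \<epsilon> s
      using \<sigma>(2)[OF that(1), of "of_real s" 0] that rr[OF r(1)] by (simp add: piecewise_integral_0)
    show "((\<lambda>\<theta>. Re (\<sigma> \<epsilon> \<theta> (of_real s))) has_real_derivative slope \<eta> n a b \<epsilon> k \<theta> (Re (\<sigma> \<epsilon> \<theta> (of_real s)))) (at \<theta>)"
      if "\<bar>\<epsilon>\<bar> < e1" "lo - r < s" "s < hi + r" "k \<in> {1..4}" "quarter_end k - pi / 2 < \<theta>" "\<theta> < quarter_end k" for \<epsilon> k \<theta> s
    proof -
      have s: "of_real s \<in> rect lo hi r" using rr[OF r(1)] that by simp
      have "((\<lambda>t. of_real s + piecewise_integral (\<lambda>k u. H \<epsilon> k u (\<sigma> \<epsilon> u (of_real s))) t) has_vector_derivative 0 + H \<epsilon> k \<theta> (\<sigma> \<epsilon> \<theta> (of_real s))) (at \<theta>)"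
        by (intro has_vector_derivative_add has_vector_derivative_const piecewise_integral_vector_derivative cHs[OF that(1) s] that)
      then have "((\<lambda>t. \<sigma> \<epsilon> t (of_real s)) has_vector_derivative H \<epsilon> k \<theta> (\<sigma> \<epsilon> \<theta> (of_real s))) (at \<theta>)"
        unfolding \<sigma>(2)[OF that(1) s, symmetric] by simp
      then have "((\<lambda>t. Re (\<sigma> \<epsilon> t (of_real s))) has_real_derivative Re (H \<epsilon> k \<theta> (\<sigma> \<epsilon> \<theta> (of_real s)))) (at \<theta>)"
        using bounded_linear.has_vector_derivative[OF bounded_linear_Re] has_real_derivative_iff_has_vector_derivative by blast
      moreover have "Re (H \<epsilon> k \<theta> (\<sigma> \<epsilon> \<theta> (of_real s))) = slope \<eta> n a b \<epsilon> k \<theta> (Re (\<sigma> \<epsilon> \<theta> (of_real s)))"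
        by (subst sre[OF that(1-3)]) (simp only: Hs[symmetric] of_real_slope Re_complex_of_real)
      ultimately show ?thesis by simp
    qed
  qed (use b1 conv adm in auto)
qed

section \<open>Angles and radii along a path in the plane\<close>

lemma deriv_lower_bound:
  fixes f :: "real \<Rightarrow> real"
  assumes "a \<le> b" "continuous_on {a..b} f" "finite F"
    "\<And>t. t \<in> {a<..<b} - F \<Longrightarrow> \<exists>d\<ge>m. (f has_real_derivative d) (at t)"
  shows "f b - f a \<ge> m * (b - a)"
proof -
  define f' where "f' t = (if t \<in> {a<..<b} - F then (SOME d. d \<ge> m \<and> (f has_real_derivative d) (at t)) else m)" for t
  have f': "f' t \<ge> m \<and> (f has_real_derivative f' t) (at t)" if "t \<in> {a<..<b} - F" for t
    using someI_ex[OF assms(4)[OF that, unfolded Bex_def]] that by (simp add: f'_def)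
  have "(f' has_integral f b - f a) {a..b}"
    by (rule fundamental_theorem_of_calculus_interior_strong[OF assms(3,1) _ assms(2)])
       (use f' in \<open>auto simp flip: has_real_derivative_iff_has_vector_derivative\<close>)
  moreover have "((\<lambda>_. m) has_integral m * (b - a)) {a..b}"
    using has_integral_const_real[of m a b] assms(1) by (simp add: mult.commute)
  moreover have "m \<le> f' t" for t using f'[of t] by (auto simp: f'_def)
  ultimately show ?thesis using has_integral_le by blast
qed

text \<open>A negative value would, looking back to the last zero \<open>c\<close>, contradict the fact that
  \<open>- D\<^sup>2 exp (- 2Lt)\<close> does not decrease.\<close>

lemma gronwall_sign:
  fixes D :: "real \<Rightarrow> real"
  assumes "a \<le> b" "continuous_on {a..b} D" "finite F"
    "\<And>t. t \<in> {a<..<b} - F \<Longrightarrow> \<exists>d. (D has_real_derivative d) (at t) \<and> \<bar>d\<bar> \<le> L * \<bar>D t\<bar>"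
    "D a \<ge> 0"
  shows "D b \<ge> 0"
proof (rule ccontr)
  assume neg: "\<not> D b \<ge> 0"
  then have "D b \<le> 0" by simp
  from IVT2'[OF this assms(5,1,2)] obtain c where c: "a \<le> c" "c \<le> b" "D c = 0" by blast
  define E where "E t = - (D t)\<^sup>2 * exp (- 2 * L * t)" for t
  have "E b - E c \<ge> 0 * (b - c)"
  proof (rule deriv_lower_bound[OF c(2) _ assms(3)])
    show "continuous_on {c..b} E" unfolding E_def
      using continuous_on_subset[OF assms(2), of "{c..b}"] c by (intro continuous_intros) auto
    fix t assume t: "t \<in> {c<..<b} - F"
    then obtain d where d: "(D has_real_derivative d) (at t)" "\<bar>d\<bar> \<le> L * \<bar>D t\<bar>" using assms(4)[of t] c by auto
    have "(E has_real_derivative (- (2 * D t * d)) * exp (- 2 * L * t) + (- (D t)\<^sup>2) * (exp (- 2 * L * t) * (- 2 * L))) (at t)"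
      unfolding E_def by (auto intro!: derivative_eq_intros d(1))
    moreover have "D t * d \<le> L * (D t)\<^sup>2"
    proof -
      have "D t * d \<le> \<bar>D t\<bar> * \<bar>d\<bar>" by (simp add: abs_mult[symmetric])
      also have "\<dots> \<le> \<bar>D t\<bar> * (L * \<bar>D t\<bar>)" by (intro mult_left_mono d) auto
      finally show ?thesis by (simp add: power2_eq_square mult_ac)
    qed
    then have "0 \<le> (2 * (L * (D t)\<^sup>2 - D t * d)) * exp (- 2 * L * t)" by simp
    moreover have "(2 * (L * (D t)\<^sup>2 - D t * d)) * exp (- 2 * L * t)
        = (- (2 * D t * d)) * exp (- 2 * L * t) + (- (D t)\<^sup>2) * (exp (- 2 * L * t) * (- 2 * L))"
      by (simp add: algebra_simps)
    ultimately show "\<exists>d\<ge>0. (E has_real_derivative d) (at t)" by metis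
  qed
  then have "(D b)\<^sup>2 * exp (- 2 * L * b) \<le> 0" using c(3) by (simp add: E_def)
  moreover have "(D b)\<^sup>2 * exp (- 2 * L * b) > 0" using neg by simp
  ultimately show False by simp
qed

text \<open>Near \<open>t\<close> a continuous logarithm differs from a branch of the principal one by a constant.\<close>

lemma log_lift_derivative:
  fixes g Z :: "real \<Rightarrow> complex"
  assumes "open U" "t \<in> U" "continuous_on U g" "\<And>u. u \<in> U \<Longrightarrow> Z u = exp (g u)"
    "(Z has_vector_derivative Z') (at t)"
  shows "(g has_vector_derivative Z' / Z t) (at t)"
proof -
  have "isCont g t" using assms(1-3) continuous_on_eq_continuous_at by blast
  then obtain d where d: "d > 0" "\<And>u. dist u t < d \<Longrightarrow> dist (g u) (g t) < pi"
    unfolding continuous_at_eps_delta using pi_gt_zero by blast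
  have Zt: "Z t \<noteq> 0" using assms(2,4) by simp
  define V where "V = U \<inter> ball t d"
  have V: "open V" "t \<in> V" using assms(1,2) d by (auto simp: V_def)
  have eq: "g t + Ln (Z u / Z t) = g u" if "u \<in> V" for u
  proof -
    have "Z u / Z t = exp (g u - g t)" using assms(2,4) that by (simp add: V_def exp_diff)
    moreover have "cmod (g u - g t) < pi" using d(2)[of u] that by (simp add: V_def dist_norm abs_minus_commute)
    then have "\<bar>Im (g u - g t)\<bar> < pi" using abs_Im_le_cmod order_le_less_trans by blast
    then have "Ln (exp (g u - g t)) = g u - g t" by (intro Ln_exp) auto
    ultimately show ?thesis by simp
  qed
  have "((\<lambda>u. Z u / Z t) has_vector_derivative Z' / Z t) (at t)"
    using assms(5) by (rule has_vector_derivative_divide)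
  moreover have "(Ln has_field_derivative inverse (Z t / Z t)) (at (Z t / Z t))"
    using Zt by (intro has_field_derivative_Ln) auto
  ultimately have "(Ln \<circ> (\<lambda>u. Z u / Z t) has_vector_derivative Z' / Z t * inverse (Z t / Z t)) (at t)"
    by (rule field_vector_diff_chain_at)
  then have "((\<lambda>u. g t + Ln (Z u / Z t)) has_vector_derivative Z' / Z t) (at t)"
    using Zt by (auto simp: o_def intro!: derivative_eq_intros)
  then show ?thesis
    by (rule has_vector_derivative_transform_within_open[OF _ V]) (use eq in auto)
qed

text \<open>The coordinate in which the unperturbed system is a rotation with angular velocity \<open>sqrt (2\<eta>)\<close>.\<close>

definition zeta :: "real \<Rightarrow> real \<times> real \<Rightarrow> complex" where
  "zeta \<eta> p = Complex (1 - \<eta> / snd p) (sqrt (2 * \<eta>) * fst p / snd p)"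

definition pt :: "real \<Rightarrow> real \<Rightarrow> real \<Rightarrow> real \<times> real" where
  "pt \<eta> s \<theta> = (px \<eta> \<theta> s, py \<eta> \<theta> s)"

lemma zeta_pt: "\<eta> > 0 \<Longrightarrow> dn \<theta> s > 0 \<Longrightarrow> zeta \<eta> (pt \<eta> s \<theta>) = of_real s * cis \<theta>"
  by (simp add: zeta_def pt_def px_def py_def complex_eq_iff) (simp add: dn_def)

lemma pt_zeta:
  assumes "\<eta> > 0" "snd p > 0" "zeta \<eta> p = of_real s * cis \<theta>"
  shows "p = pt \<eta> s \<theta>" "dn \<theta> s > 0"
proof -
  have 1: "1 - \<eta> / snd p = s * cos \<theta>" "sqrt (2 * \<eta>) * fst p / snd p = s * sin \<theta>"
    using assms(3) by (auto simp: zeta_def complex_eq_iff)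
  have d: "dn \<theta> s = \<eta> / snd p" using 1(1) by (simp add: dn_def)
  then show "dn \<theta> s > 0" using assms by simp
  have "py \<eta> \<theta> s = snd p" unfolding py_def d using assms by simp
  moreover have "px \<eta> \<theta> s = fst p"
    unfolding px_def d 1(2)[symmetric] of_real_eq_id id_apply using assms by simp
  ultimately show "p = pt \<eta> s \<theta>" by (simp add: pt_def prod_eq_iff)
qed

lemma pt_quadrant_sign:
  assumes "\<eta> > 0" "0 < s" "s < 1"
  shows "fst (pt \<eta> s \<theta>) > 0 \<longleftrightarrow> sin \<theta> > 0" "fst (pt \<eta> s \<theta>) < 0 \<longleftrightarrow> sin \<theta> < 0"
    "snd (pt \<eta> s \<theta>) > \<eta> \<longleftrightarrow> cos \<theta> > 0" "snd (pt \<eta> s \<theta>) < \<eta> \<longleftrightarrow> cos \<theta> < 0" "snd (pt \<eta> s \<theta>) > \<eta> / 2"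
proof -
  have d: "dn \<theta> s > 0" by (rule dn_real[OF assms(2,3)])
  have k: "\<eta> / sqrt (2 * \<eta>) > 0" using assms by simp
  have "fst (pt \<eta> s \<theta>) = (\<eta> / sqrt (2 * \<eta>) * s / dn \<theta> s) * sin \<theta>" by (simp add: pt_def px_def)
  moreover have "\<eta> / sqrt (2 * \<eta>) * s / dn \<theta> s > 0" using d k assms by simp
  ultimately obtain c where x: "fst (pt \<eta> s \<theta>) = c * sin \<theta>" and c: "c > 0" by blast
  show "fst (pt \<eta> s \<theta>) > 0 \<longleftrightarrow> sin \<theta> > 0" "fst (pt \<eta> s \<theta>) < 0 \<longleftrightarrow> sin \<theta> < 0"
    unfolding x using c by (auto simp: zero_less_mult_iff mult_less_0_iff)
  have y: "snd (pt \<eta> s \<theta>) = \<eta> / dn \<theta> s" by (simp add: pt_def py_def)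
  have "snd (pt \<eta> s \<theta>) > \<eta> \<longleftrightarrow> dn \<theta> s < 1" unfolding y using d assms(1) by (simp add: less_divide_eq)
  then show "snd (pt \<eta> s \<theta>) > \<eta> \<longleftrightarrow> cos \<theta> > 0" using assms(2) by (simp add: dn_def zero_less_mult_iff)
  have "snd (pt \<eta> s \<theta>) < \<eta> \<longleftrightarrow> dn \<theta> s > 1" unfolding y using d assms(1) by (simp add: divide_less_eq)
  then show "snd (pt \<eta> s \<theta>) < \<eta> \<longleftrightarrow> cos \<theta> < 0" using assms(2) by (simp add: dn_def mult_less_0_iff)
  have "dn \<theta> s < 2"
  proof -
    have "- s * cos \<theta> \<le> \<bar>s\<bar> * \<bar>cos \<theta>\<bar>" by (metis abs_ge_self abs_minus_cancel abs_mult)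
    also have "\<dots> \<le> \<bar>s\<bar> * 1" by (intro mult_left_mono) auto
    finally show ?thesis using assms by (simp add: dn_def)
  qed
  then show "snd (pt \<eta> s \<theta>) > \<eta> / 2" unfolding y using d assms(1) by (simp add: less_divide_eq)
qed

lemma open_quarter_trig:
  assumes "k \<in> {1..4::nat}" "quarter_end k - pi / 2 < \<theta>" "\<theta> < quarter_end k"
  shows "k = 1 \<Longrightarrow> sin \<theta> > 0 \<and> cos \<theta> > 0" "k = 2 \<Longrightarrow> sin \<theta> > 0 \<and> cos \<theta> < 0"
    "k = 3 \<Longrightarrow> sin \<theta> < 0 \<and> cos \<theta> < 0" "k = 4 \<Longrightarrow> sin \<theta> < 0 \<and> cos \<theta> > 0"
proof -
  show "sin \<theta> > 0 \<and> cos \<theta> > 0" if "k = 1"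
    using assms that by (auto simp: quarter_end_def intro!: sin_gt_zero cos_gt_zero_pi)
  show "sin \<theta> > 0 \<and> cos \<theta> < 0" if "k = 2"
  proof -
    have b: "pi / 2 < \<theta>" "\<theta> < pi" using assms that by (auto simp: quarter_end_def)
    have "0 < cos (pi - \<theta>)" by (rule cos_gt_zero_pi) (use b in linarith)+
    moreover have "0 < sin \<theta>" by (rule sin_gt_zero) (use b in linarith)+
    ultimately show ?thesis by simp
  qed
  show "sin \<theta> < 0 \<and> cos \<theta> < 0" if "k = 3"
  proof -
    have b: "pi < \<theta>" "\<theta> < pi + pi / 2" using assms that by (auto simp: quarter_end_def)
    have "0 < cos (\<theta> - pi)" by (rule cos_gt_zero_pi) (use b in linarith)+
    moreover have "0 < sin (\<theta> - pi)" by (rule sin_gt_zero) (use b in linarith)+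
    ultimately show ?thesis by simp
  qed
  show "sin \<theta> < 0 \<and> cos \<theta> > 0" if "k = 4"
  proof -
    have b: "pi + pi / 2 < \<theta>" "\<theta> < 2 * pi" using assms that by (auto simp: quarter_end_def)
    have "0 < cos (2 * pi - \<theta>)" by (rule cos_gt_zero_pi) (use b in linarith)+
    moreover have "0 < sin (2 * pi - \<theta>)" by (rule sin_gt_zero) (use b in linarith)+
    ultimately show ?thesis by (simp add: cos_diff sin_diff)
  qed
qed

lemma pt_in_quadrant:
  assumes "\<eta> > 0" "0 < s" "s < 1" "k \<in> {1..4::nat}" "quarter_end k - pi / 2 < \<theta>" "\<theta> < quarter_end k"
  shows "pt \<eta> s \<theta> \<in> quadrant \<eta> k"
  using pt_quadrant_sign[OF assms(1-3), of \<theta>] open_quarter_trig[OF assms(4-6)]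
  by (rule_tac quarter_cases[OF assms(4)]) (auto simp: quadrant_def case_prod_beta')

lemma angle_cases:
  assumes "0 \<le> \<theta>" "\<theta> \<le> 2 * pi"
  obtains "sin \<theta> = 0 \<or> cos \<theta> = 0" "\<theta> \<in> {0, pi / 2, pi, 3 * (pi / 2), 2 * pi}" | k where "k \<in> {1..4::nat}" "quarter_end k - pi / 2 < \<theta>" "\<theta> < quarter_end k"
proof -
  consider "\<theta> \<in> {0, pi / 2, pi, 3 * (pi / 2), 2 * pi}" | "0 < \<theta>" "\<theta> < pi / 2" | "pi / 2 < \<theta>" "\<theta> < pi"
    | "pi < \<theta>" "\<theta> < 3 * (pi / 2)" | "3 * (pi / 2) < \<theta>" "\<theta> < 2 * pi"
    using assms by fastforce
  then show ?thesis
  proof cases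
    case 1
    then have "sin \<theta> = 0 \<or> cos \<theta> = 0" using trig_quarter(1) by (elim insertE emptyE) (simp_all only: cos_pi_half sin_zero sin_pi sin_two_pi simp_thms)
    then show ?thesis using 1 that by blast
  next
    case 2 then show ?thesis using that(2)[of 1] by (simp add: quarter_end_def)
  next
    case 3 then show ?thesis using that(2)[of 2] by (simp add: quarter_end_def)
  next
    case 4 then show ?thesis using that(2)[of 3] by (simp add: quarter_end_def)
  next
    case 5 then show ?thesis using that(2)[of 4] by (simp add: quarter_end_def)
  qed
qed

lemma quadrant_disjoint: "p \<in> quadrant \<eta> j \<Longrightarrow> p \<in> quadrant \<eta> k \<Longrightarrow> j = k"
  by (auto simp: quadrant_def split: if_splits)

lemma quadrant_angle:
  assumes "\<eta> > 0" "0 < s" "s < 1" "pt \<eta> s \<theta> \<in> quadrant \<eta> k" "0 \<le> \<theta>" "\<theta> \<le> 2 * pi"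
  shows "k \<in> {1..4}" "quarter_end k - pi / 2 < \<theta>" "\<theta> < quarter_end k"
proof -
  have "sin \<theta> \<noteq> 0 \<and> cos \<theta> \<noteq> 0"
    using assms(4) pt_quadrant_sign[OF assms(1-3), of \<theta>]
    by (auto simp: quadrant_def case_prod_beta' split: if_splits)
  then obtain j where j: "j \<in> {1..4::nat}" "quarter_end j - pi / 2 < \<theta>" "\<theta> < quarter_end j"
    using angle_cases[OF assms(5,6)] by blast
  have "j = k" using pt_in_quadrant[OF assms(1-3) j] assms(4) by (rule quadrant_disjoint)
  with j show "k \<in> {1..4}" "quarter_end k - pi / 2 < \<theta>" "\<theta> < quarter_end k" by auto
qed

text \<open>The radial and angular components form a vector that, rotated by \<open>\<theta>\<close>, is the derivative of \<open>zeta\<close> along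
  the perturbation.\<close>

lemma polar_components:
  fixes \<eta> s \<theta> :: real
  assumes "\<eta> > 0"
  shows "radial \<eta> n a b \<theta> s * cos \<theta> - angular \<eta> n a b \<theta> s * sin \<theta>
       = (dn \<theta> s)\<^sup>2 / \<eta> * bipoly b n (px \<eta> \<theta> s) (py \<eta> \<theta> s)"
    "radial \<eta> n a b \<theta> s * sin \<theta> + angular \<eta> n a b \<theta> s * cos \<theta>
       = dn \<theta> s / \<eta> * (sqrt (2 * \<eta>) * bipoly a n (px \<eta> \<theta> s) (py \<eta> \<theta> s) - s * sin \<theta> * bipoly b n (px \<eta> \<theta> s) (py \<eta> \<theta> s))"
proof -
  define f g k S c D where "f = bipoly a n (px \<eta> \<theta> s) (py \<eta> \<theta> s)" and "g = bipoly b n (px \<eta> \<theta> s) (py \<eta> \<theta> s)"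
    and "k = sqrt (2 * \<eta>)" and "S = sin \<theta>" and "c = cos \<theta>" and "D = dn \<theta> s"
  have D: "D = 1 - s * c" by (simp add: D_def dn_def c_def)
  have r: "radial \<eta> n a b \<theta> s = D / \<eta> * (k * f * S + g * (c - s))"
    and t: "angular \<eta> n a b \<theta> s = D / \<eta> * (k * f * c - g * S)"
    by (simp_all add: radial_def angular_def f_def g_def k_def S_def c_def D_def)
  have S2: "S * S = 1 - c * c" using sin_squared_eq[of \<theta>] by (simp add: S_def c_def power2_eq_square)
  have "radial \<eta> n a b \<theta> s * c - angular \<eta> n a b \<theta> s * S = D / \<eta> * (g * (c * (c - s)) + g * (S * S))"
    unfolding r t by (simp add: algebra_simps)
  also have "\<dots> = D\<^sup>2 / \<eta> * g" unfolding S2 by (simp add: D power2_eq_square algebra_simps)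
  finally show "radial \<eta> n a b \<theta> s * cos \<theta> - angular \<eta> n a b \<theta> s * sin \<theta>
       = (dn \<theta> s)\<^sup>2 / \<eta> * bipoly b n (px \<eta> \<theta> s) (py \<eta> \<theta> s)" by (simp add: S_def c_def D_def g_def)
  have "radial \<eta> n a b \<theta> s * S + angular \<eta> n a b \<theta> s * c = D / \<eta> * (k * f * (S * S) + k * f * (c * c) - g * (s * S))"
    unfolding r t by (simp add: algebra_simps)
  also have "\<dots> = D / \<eta> * (k * f - s * S * g)" unfolding S2 by (simp add: algebra_simps)
  finally show "radial \<eta> n a b \<theta> s * sin \<theta> + angular \<eta> n a b \<theta> s * cos \<theta>
       = dn \<theta> s / \<eta> * (sqrt (2 * \<eta>) * bipoly a n (px \<eta> \<theta> s) (py \<eta> \<theta> s) - s * sin \<theta> * bipoly b n (px \<eta> \<theta> s) (py \<eta> \<theta> s))"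
    by (simp add: S_def c_def D_def f_def g_def k_def)
qed

lemma pw_solution_subset:
  assumes "pw_solution \<eta> \<epsilon> f g \<gamma> I" "I' \<subseteq> I"
  shows "pw_solution \<eta> \<epsilon> f g \<gamma> I'"
  unfolding pw_solution_def
proof (intro conjI allI ballI impI)
  show "continuous_on I' \<gamma>" using assms continuous_on_subset by (auto simp: pw_solution_def)
  show "finite {t \<in> I' \<inter> {u..v}. \<gamma> t \<notin> (\<Union>k\<in>{1..4}. quadrant \<eta> k)}" for u v
  proof (rule finite_subset)
    show "finite {t \<in> I \<inter> {u..v}. \<gamma> t \<notin> (\<Union>k\<in>{1..4}. quadrant \<eta> k)}" using assms(1) by (simp add: pw_solution_def)
  qed (use assms(2) in auto)
  show "(\<gamma> has_vector_derivative vfield \<eta> \<epsilon> f g k (\<gamma> t)) (at t within I')"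
    if "t \<in> I'" "k \<in> {1..4}" "\<gamma> t \<in> quadrant \<eta> k" for t k
    by (rule has_vector_derivative_within_subset[OF _ assms(2)]) (use assms that in \<open>auto simp: pw_solution_def\<close>)
qed

lemma zeta_continuous: "continuous_on {p. snd p > 0} (zeta \<eta>)"
  unfolding zeta_def[abs_def] Complex_eq by (intro continuous_intros) auto

lemma zeta_vector_derivative:
  assumes "(\<gamma> has_vector_derivative (vx, vy)) (at t)" "\<gamma> t = (x, y)" "y > 0"
  shows "((\<lambda>t. zeta \<eta> (\<gamma> t)) has_vector_derivative
     Complex (\<eta> * vy / y\<^sup>2) (sqrt (2 * \<eta>) * (vx * y - x * vy) / y\<^sup>2)) (at t)"
proof -
  have X: "((\<lambda>t. fst (\<gamma> t)) has_real_derivative vx) (at t)" and Y: "((\<lambda>t. snd (\<gamma> t)) has_real_derivative vy) (at t)"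
    using bounded_linear.has_vector_derivative[OF bounded_linear_fst assms(1)]
      bounded_linear.has_vector_derivative[OF bounded_linear_snd assms(1)]
    by (simp_all add: has_real_derivative_iff_has_vector_derivative)
  show ?thesis unfolding has_vector_derivative_complex_iff zeta_def complex.sel
    using assms(2,3)
    by (auto intro!: derivative_eq_intros X Y simp: power2_eq_square field_simps)
qed

section \<open>Orbits near a compact family of closed orbits\<close>

lemma reduce_angle:
  obtains \<theta>' where "0 \<le> \<theta>'" "\<theta>' < 2 * pi" "sin \<theta>' = sin \<theta>" "cos \<theta>' = cos (\<theta>::real)"
  using sincos_total_2pi[of "cos \<theta>" "sin \<theta>"] by (metis sin_cos_squared_add2)

lemma angle_cong:
  assumes "sin \<theta>' = sin \<theta>" "cos \<theta>' = cos \<theta>"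
  shows "radial \<eta> n a b \<theta>' s = radial \<eta> n a b \<theta> s" "angular \<eta> n a b \<theta>' s = angular \<eta> n a b \<theta> s" "pt \<eta> s' \<theta>' = pt \<eta> s' \<theta>"
  by (simp_all add: radial_def angular_def px_def py_def dn_def pt_def assms)

text \<open>The perturbed system with a fixed small \<open>\<epsilon>\<close>, near the circles of radius \<open>s\<close> with \<open>lo \<le> s \<le> hi\<close>. The curve with
  radius \<open>c s \<theta>\<close> at the angle \<open>\<theta>\<close> solves the equation in polar form with initial radius \<open>s\<close>. The angular
  perturbation is small enough for the angle to increase, with a speed between \<open>\<kappa>/2\<close> and \<open>3\<kappa>/2\<close>. Initial radii range
  over the \<open>r\<close>-neighbourhood of \<open>[lo, hi]\<close>; the curves stay in the \<open>2r\<close>-neighbourhood, where the slope is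
  Lipschitz.\<close>

locale near_annulus =
  fixes \<eta> :: real and n :: nat and a b :: "nat \<Rightarrow> nat \<Rightarrow> nat \<Rightarrow> real" and \<epsilon> :: real
    and f g :: "nat \<Rightarrow> real \<Rightarrow> real \<Rightarrow> real" and lo hi r C :: real and c :: "real \<Rightarrow> real \<Rightarrow> real"
  assumes eta: "\<eta> > 0"
    and f_poly: "\<And>k x y. k \<in> {1..4} \<Longrightarrow> f k x y = bipoly (a k) n x y"
    and g_poly: "\<And>k x y. k \<in> {1..4} \<Longrightarrow> g k x y = bipoly (b k) n x y"
    and r: "r > 0" "0 < lo - 3 * r" "hi + 3 * r < 1" "lo \<le> hi" "C > 0"
    and ang: "\<And>k \<theta> s. k \<in> {1..4} \<Longrightarrow> \<theta> \<in> quarter k \<Longrightarrow> lo - 3 * r < s \<Longrightarrow> s < hi + 3 * r \<Longrightarrow>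
       \<bar>\<epsilon> * angular \<eta> n (a k) (b k) \<theta> s / s\<bar> \<le> sqrt (2 * \<eta>) / 2"
    and slope_lip: "\<And>k \<theta> s s'. k \<in> {1..4} \<Longrightarrow> \<theta> \<in> quarter k \<Longrightarrow> lo - 2 * r < s \<Longrightarrow> s < hi + 2 * r \<Longrightarrow>
       lo - 2 * r < s' \<Longrightarrow> s' < hi + 2 * r \<Longrightarrow> \<bar>slope \<eta> n a b \<epsilon> k \<theta> s - slope \<eta> n a b \<epsilon> k \<theta> s'\<bar> \<le> C * \<bar>s - s'\<bar>"
    and c_cont: "\<And>s. lo - r < s \<Longrightarrow> s < hi + r \<Longrightarrow> continuous_on UNIV (c s)"
    and c_0: "\<And>s. lo - r < s \<Longrightarrow> s < hi + r \<Longrightarrow> c s 0 = s"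
    and c_near: "\<And>\<theta> s. lo - r < s \<Longrightarrow> s < hi + r \<Longrightarrow> \<bar>c s \<theta> - s\<bar> \<le> r / 2"
    and c_deriv: "\<And>k \<theta> s. lo - r < s \<Longrightarrow> s < hi + r \<Longrightarrow> k \<in> {1..4} \<Longrightarrow> quarter_end k - pi / 2 < \<theta> \<Longrightarrow> \<theta> < quarter_end k \<Longrightarrow>
       (c s has_real_derivative slope \<eta> n a b \<epsilon> k \<theta> (c s \<theta>)) (at \<theta>)"
    and c_end: "continuous_on {lo - r<..<hi + r} (\<lambda>s. c s (2 * pi))"
begin

abbreviation "\<kappa> \<equiv> sqrt (2 * \<eta>)"
abbreviation "G k \<theta> s \<equiv> radial \<eta> n (a k) (b k) \<theta> s"
abbreviation "J k \<theta> s \<equiv> angular \<eta> n (a k) (b k) \<theta> s"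
abbreviation "Z \<equiv> zeta \<eta>"
abbreviation "P \<equiv> pt \<eta>"
abbreviation "sol \<gamma> I \<equiv> pw_solution \<eta> \<epsilon> f g \<gamma> I"

lemma kappa_pos: "\<kappa> > 0" using eta by simp

lemma c_range: "lo - r < s \<Longrightarrow> s < hi + r \<Longrightarrow> lo - 2 * r + r / 2 \<le> c s \<theta>"
    "lo - r < s \<Longrightarrow> s < hi + r \<Longrightarrow> c s \<theta> \<le> hi + 2 * r - r / 2"
  using c_near[of s \<theta>] by linarith+

lemma ang_any:
  assumes "lo - 3 * r < s" "s < hi + 3 * r" "P s \<theta> \<in> quadrant \<eta> k" "k \<in> {1..4}"
  shows "\<bar>\<epsilon> * J k \<theta> s / s\<bar> \<le> \<kappa> / 2"
proof -
  obtain \<theta>' where \<theta>': "0 \<le> \<theta>'" "\<theta>' < 2 * pi" "sin \<theta>' = sin \<theta>" "cos \<theta>' = cos \<theta>" by (rule reduce_angle)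
  note e = angle_cong[OF \<theta>'(3,4)]
  have s: "0 < s" "s < 1" using assms r by linarith+
  have "P s \<theta>' \<in> quadrant \<eta> k" using assms(3) e(3) by simp
  from quadrant_angle[OF eta s this] have "\<theta>' \<in> quarter k" using \<theta>' by (simp add: quarter_eq_Icc)
  from ang[OF assms(4) this assms(1,2)] show ?thesis unfolding e .
qed

text \<open>While a solution stays in an annulus around the centre, its \<open>zeta\<close>-image has a continuous logarithm, whose imaginary part
  is an angle along the solution. Off the finitely many times at which the solution is on a switching line, angle and radius
  satisfy the polar equations. The lift may be normalised at one time.\<close>

lemma polar_lift:
  assumes "t0 \<le> t1" "sol \<gamma> {t0..t1}"
    and pos: "\<And>t. t \<in> {t0..t1} \<Longrightarrow> snd (\<gamma> t) > 0 \<and> lo - 2 * r < cmod (Z (\<gamma> t)) \<and> cmod (Z (\<gamma> t)) < hi + 2 * r"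
    and ts: "ts \<in> {t0..t1}" "Z (\<gamma> ts) = of_real (cmod (Z (\<gamma> ts))) * cis \<theta>s"
  obtains \<theta> F where "continuous_on {t0..t1} \<theta>" "\<theta> ts = \<theta>s" "\<And>t. t \<in> {t0..t1} \<Longrightarrow> \<gamma> t = P (cmod (Z (\<gamma> t))) (\<theta> t)"
    "finite F" "\<And>t. t \<in> {t0<..<t1} - F \<Longrightarrow> \<exists>k\<in>{1..4}. \<gamma> t \<in> quadrant \<eta> k \<and>
       (\<theta> has_real_derivative \<kappa> + \<epsilon> * J k (\<theta> t) (cmod (Z (\<gamma> t))) / cmod (Z (\<gamma> t))) (at t) \<and>
       ((\<lambda>t. cmod (Z (\<gamma> t))) has_real_derivative \<epsilon> * G k (\<theta> t) (cmod (Z (\<gamma> t)))) (at t)"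
proof -
  define F where "F = {t \<in> {t0..t1} \<inter> {t0..t1}. \<gamma> t \<notin> (\<Union>k\<in>{1..4}. quadrant \<eta> k)}"
  have F: "finite F" using assms(2) unfolding pw_solution_def F_def by blast
  have gc: "continuous_on {t0..t1} \<gamma>" using assms(2) by (simp add: pw_solution_def)
  have Zc: "continuous_on {t0..t1} (\<lambda>t. Z (\<gamma> t))"
    by (rule continuous_on_compose2[OF zeta_continuous gc]) (use pos in auto)
  have Z0: "Z (\<gamma> t) \<noteq> 0" if "t \<in> {t0..t1}" for t using pos[OF that] r by auto
  obtain g0 where g0: "continuous_on {t0..t1} g0" "\<And>t. t \<in> {t0..t1} \<Longrightarrow> Z (\<gamma> t) = exp (g0 t)"
    using continuous_logarithm_on_contractible[OF Zc] Z0 convex_imp_contractible[OF convex_real_interval(5)] by metis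
  have "exp (g0 ts) = exp (of_real (ln (cmod (Z (\<gamma> ts)))) + \<i> * of_real \<theta>s)"
  proof -
    obtain q where q: "q = cmod (Z (\<gamma> ts))" "q > 0" using Z0[OF ts(1)] by simp
    have e1: "exp (of_real (ln q) + \<i> * of_real \<theta>s) = of_real q * cis \<theta>s"
      using q(2) by (simp add: exp_add exp_of_real cis_conv_exp)
    have "exp (g0 ts) = of_real q * cis \<theta>s" using ts(2) g0(2)[OF ts(1)] q(1) by metis
    then show ?thesis unfolding q(1)[symmetric] e1 .
  qed
  then obtain m :: int where m: "g0 ts = of_real (ln (cmod (Z (\<gamma> ts)))) + \<i> * of_real \<theta>s + of_int (2 * m) * of_real pi * \<i>"
    unfolding exp_eq by auto
  define g' where "g' t = g0 t - of_int (2 * m) * of_real pi * \<i>" for t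
  have eg: "exp (g' t) = exp (g0 t)" for t unfolding exp_eq g'_def by (intro exI[of _ "- m"]) simp
  define \<theta> where "\<theta> t = Im (g' t)" for t
  have Zg: "Z (\<gamma> t) = exp (g' t)" if "t \<in> {t0..t1}" for t using g0(2)[OF that] eg by simp
  have gcont: "continuous_on {t0..t1} g'" unfolding g'_def by (intro continuous_intros g0)
  have Zp: "Z (\<gamma> t) = of_real (cmod (Z (\<gamma> t))) * cis (\<theta> t)" if "t \<in> {t0..t1}" for t
    unfolding Zg[OF that] \<theta>_def by (simp add: exp_eq_polar norm_mult)
  have gp: "\<gamma> t = P (cmod (Z (\<gamma> t))) (\<theta> t)" "dn (\<theta> t) (cmod (Z (\<gamma> t))) > 0" if "t \<in> {t0..t1}" for t
    using pt_zeta[OF eta _ Zp[OF that]] pos[OF that] by auto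
  show ?thesis
  proof (rule that[of \<theta> F])
    show "continuous_on {t0..t1} \<theta>" unfolding \<theta>_def by (intro continuous_intros gcont)
    show "\<theta> ts = \<theta>s" unfolding \<theta>_def g'_def m by simp
    show "\<gamma> t = P (cmod (Z (\<gamma> t))) (\<theta> t)" if "t \<in> {t0..t1}" for t by (rule gp[OF that])
    fix t assume t: "t \<in> {t0<..<t1} - F"
    then have ti: "t \<in> {t0..t1}" "t0 < t" "t < t1" by auto
    obtain k where k: "k \<in> {1..4}" "\<gamma> t \<in> quadrant \<eta> k" using t by (auto simp: F_def)
    obtain x y where xy: "\<gamma> t = (x, y)" by (cases "\<gamma> t")
    define S where "S = cmod (Z (\<gamma> t))"
    define D where "D = dn (\<theta> t) S"
    have S: "S > 0" "S < 1" using pos[OF ti(1)] r unfolding S_def by linarith+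
    have D: "D > 0" using gp(2)[OF ti(1)] by (simp add: D_def S_def)
    have y: "y > 0" using pos[OF ti(1)] xy by simp
    have xyp: "x = px \<eta> (\<theta> t) S" "y = py \<eta> (\<theta> t) S" using gp(1)[OF ti(1)] xy by (auto simp: pt_def S_def)
    have yD: "y = \<eta> / D" using xyp by (simp add: py_def D_def)
    have xD: "\<kappa> * x = \<eta> * (S * sin (\<theta> t)) / D" using xyp eta by (simp add: px_def D_def)
    have Dc: "S * cos (\<theta> t) = 1 - D" by (simp add: D_def dn_def)
    define fv gv where "fv = f k x y" and "gv = g k x y"
    have "(\<gamma> has_vector_derivative vfield \<eta> \<epsilon> f g k (\<gamma> t)) (at t within {t0..t1})"
      using assms(2) k ti unfolding pw_solution_def by blast
    then have "(\<gamma> has_vector_derivative (y - 2 * x\<^sup>2 - \<eta> + \<epsilon> * fv, - 2 * x * y + \<epsilon> * gv)) (at t)"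
      using at_within_Icc_at[OF ti(2,3)] by (simp add: xy vfield_def fv_def gv_def)
    from zeta_vector_derivative[OF this xy y, of \<eta>]
    have ZD: "((\<lambda>t. Z (\<gamma> t)) has_vector_derivative Complex (\<eta> * (- 2 * x * y + \<epsilon> * gv) / y\<^sup>2)
        (\<kappa> * ((y - 2 * x\<^sup>2 - \<eta> + \<epsilon> * fv) * y - x * (- 2 * x * y + \<epsilon> * gv)) / y\<^sup>2)) (at t)" .
    define W where "W = Complex (\<epsilon> * G k (\<theta> t) S / S) (\<kappa> + \<epsilon> * J k (\<theta> t) S / S)"
    have G1: "G k (\<theta> t) S * cos (\<theta> t) - J k (\<theta> t) S * sin (\<theta> t) = D\<^sup>2 / \<eta> * gv"
      and G2: "G k (\<theta> t) S * sin (\<theta> t) + J k (\<theta> t) S * cos (\<theta> t) = D / \<eta> * (\<kappa> * fv - S * sin (\<theta> t) * gv)"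
      using polar_components[OF eta, of n "a k" "b k" "\<theta> t" S] k
      by (simp_all add: D_def fv_def gv_def f_poly g_poly xyp)
    have kk: "\<kappa> * \<kappa> = 2 * \<eta>" using eta by simp
    have xy': "\<kappa> * x / y = S * sin (\<theta> t)" unfolding xD yD using eta D by simp
    have R: "\<eta> * (- 2 * x * y + \<epsilon> * gv) / y\<^sup>2 = Re (of_real S * cis (\<theta> t) * W)"
    proof -
      have "Re (of_real S * cis (\<theta> t) * W) = \<epsilon> * (G k (\<theta> t) S * cos (\<theta> t) - J k (\<theta> t) S * sin (\<theta> t)) - \<kappa> * (S * sin (\<theta> t))"
        using S by (simp add: W_def field_simps)
      also have "\<dots> = \<epsilon> * (D\<^sup>2 / \<eta> * gv) - \<kappa> * (\<kappa> * x / y)" unfolding G1 xy' ..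
      also have "\<kappa> * (\<kappa> * x / y) = 2 * \<eta> * x / y" using kk by (simp add: mult.assoc[symmetric])
      also have "D\<^sup>2 / \<eta> = \<eta> / y\<^sup>2" unfolding yD using eta D by (simp add: field_simps power2_eq_square)
      finally show ?thesis using y by (simp add: field_simps power2_eq_square)
    qed
    have I: "\<kappa> * ((y - 2 * x\<^sup>2 - \<eta> + \<epsilon> * fv) * y - x * (- 2 * x * y + \<epsilon> * gv)) / y\<^sup>2 = Im (of_real S * cis (\<theta> t) * W)"
    proof -
      have "Im (of_real S * cis (\<theta> t) * W) = \<epsilon> * (G k (\<theta> t) S * sin (\<theta> t) + J k (\<theta> t) S * cos (\<theta> t)) + \<kappa> * (S * cos (\<theta> t))"
        using S by (simp add: W_def field_simps)
      also have "\<dots> = \<epsilon> * (D / \<eta> * (\<kappa> * fv - \<kappa> * x / y * gv)) + \<kappa> * (1 - D)" unfolding G2 xy' Dc ..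
      also have "D / \<eta> = 1 / y" unfolding yD using eta D by simp
      also have "D = \<eta> / y" unfolding yD using eta D by simp
      finally have 1: "Im (of_real S * cis (\<theta> t) * W)
          = \<epsilon> * (1 / y * (\<kappa> * fv - \<kappa> * x / y * gv)) + \<kappa> * (1 - \<eta> / y)" .
      show ?thesis unfolding 1 using y by (simp add: field_simps power2_eq_square)
    qed
    have ZW: "Complex (\<eta> * (- 2 * x * y + \<epsilon> * gv) / y\<^sup>2)
        (\<kappa> * ((y - 2 * x\<^sup>2 - \<eta> + \<epsilon> * fv) * y - x * (- 2 * x * y + \<epsilon> * gv)) / y\<^sup>2) = Z (\<gamma> t) * W"
      using Zp[OF ti(1)] unfolding S_def[symmetric] R I by (simp add: complex_eq_iff)
    have "(g' has_vector_derivative Z (\<gamma> t) * W / Z (\<gamma> t)) (at t)"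
    proof (rule log_lift_derivative[where U = "{t0<..<t1}" and Z = "\<lambda>t. Z (\<gamma> t)"])
      show "continuous_on {t0<..<t1} g'" using gcont by (rule continuous_on_subset) auto
      show "Z (\<gamma> u) = exp (g' u)" if "u \<in> {t0<..<t1}" for u using Zg[of u] that by simp
      show "((\<lambda>t. Z (\<gamma> t)) has_vector_derivative Z (\<gamma> t) * W) (at t)" using ZD unfolding ZW .
    qed (use ti in auto)
    then have gW: "(g' has_vector_derivative W) (at t)" using Z0[OF ti(1)] by simp
    have "(\<theta> has_real_derivative Im W) (at t)" unfolding \<theta>_def by (rule has_field_derivative_Im[OF gW])
    moreover have "((\<lambda>t. cmod (Z (\<gamma> t))) has_real_derivative S * Re W) (at t)"
    proof -
      have eS: "exp (Re (g' u)) = cmod (Z (\<gamma> u))" if "u \<in> {t0<..<t1}" for u using Zg[of u] that by simp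
      have "((\<lambda>t. exp (Re (g' t))) has_real_derivative exp (Re (g' t)) * Re W) (at t)"
        by (rule DERIV_fun_exp[OF has_field_derivative_Re[OF gW]])
      then have "((\<lambda>t. cmod (Z (\<gamma> t))) has_real_derivative exp (Re (g' t)) * Re W) (at t)"
        by (rule has_field_derivative_transform_within_open[of _ _ _ "{t0<..<t1}"]) (use eS ti in auto)
      then show ?thesis using eS[of t] ti by (simp add: S_def)
    qed
    ultimately show "\<exists>k\<in>{1..4}. \<gamma> t \<in> quadrant \<eta> k \<and>
       (\<theta> has_real_derivative \<kappa> + \<epsilon> * J k (\<theta> t) (cmod (Z (\<gamma> t))) / cmod (Z (\<gamma> t))) (at t) \<and>
       ((\<lambda>t. cmod (Z (\<gamma> t))) has_real_derivative \<epsilon> * G k (\<theta> t) (cmod (Z (\<gamma> t)))) (at t)"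
      using k S unfolding S_def[symmetric] W_def by (intro bexI[of _ k]) auto
  qed (rule F)
qed

lemma slope_mult:
  assumes "lo - 3 * r < s" "s < hi + 3 * r" "\<bar>\<epsilon> * J k \<theta> s / s\<bar> \<le> \<kappa> / 2"
  shows "slope \<eta> n a b \<epsilon> k \<theta> s * (\<kappa> + \<epsilon> * J k \<theta> s / s) = \<epsilon> * G k \<theta> s"
proof -
  have "\<kappa> + \<epsilon> * J k \<theta> s / s \<noteq> 0" using assms(3) kappa_pos by linarith
  then show ?thesis by (simp add: slope_def)
qed

lemma angle_increasing:
  assumes "u \<le> v" "continuous_on {u..v} \<theta>" "finite F"
    "\<And>t. t \<in> {u<..<v} - F \<Longrightarrow> \<exists>k\<in>{1..4}. \<gamma> t \<in> quadrant \<eta> k \<and>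
       (\<theta> has_real_derivative \<kappa> + \<epsilon> * J k (\<theta> t) (cmod (Z (\<gamma> t))) / cmod (Z (\<gamma> t))) (at t)"
    "\<And>t. t \<in> {u..v} \<Longrightarrow> \<gamma> t = P (cmod (Z (\<gamma> t))) (\<theta> t)"
    "\<And>t. t \<in> {u..v} \<Longrightarrow> lo - 2 * r < cmod (Z (\<gamma> t)) \<and> cmod (Z (\<gamma> t)) < hi + 2 * r"
  shows "\<theta> v - \<theta> u \<ge> \<kappa> / 2 * (v - u)"
proof (rule deriv_lower_bound[OF assms(1-3)])
  fix t assume t: "t \<in> {u<..<v} - F"
  then have ti: "t \<in> {u..v}" by auto
  obtain k where k: "k \<in> {1..4}" "\<gamma> t \<in> quadrant \<eta> k"
    "(\<theta> has_real_derivative \<kappa> + \<epsilon> * J k (\<theta> t) (cmod (Z (\<gamma> t))) / cmod (Z (\<gamma> t))) (at t)"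
    using assms(4)[OF t] by blast
  have "\<bar>\<epsilon> * J k (\<theta> t) (cmod (Z (\<gamma> t))) / cmod (Z (\<gamma> t))\<bar> \<le> \<kappa> / 2"
    using assms(6)[OF ti] r k assms(5)[OF ti] by (intro ang_any) auto
  then have "\<kappa> / 2 \<le> \<kappa> + \<epsilon> * J k (\<theta> t) (cmod (Z (\<gamma> t))) / cmod (Z (\<gamma> t))" by linarith
  then show "\<exists>d\<ge>\<kappa> / 2. (\<theta> has_real_derivative d) (at t)" using k(3) by blast
qed

text \<open>Both radii, that of the solution and that of the curve at the same angle, satisfy the same
  scalar equation along the solution, so \<open>gronwall_sign\<close> applies to their difference. The restriction to one turn
  comes from the curve being a graph over \<open>[0, 2\<pi>]\<close> only. With both signs of \<open>\<sigma>\<close> it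
  yields uniqueness.\<close>

lemma comparison:
  assumes s0: "lo - r < s0" "s0 < hi + r"
    and uv: "u \<le> v" "continuous_on {u..v} \<theta>" "continuous_on {u..v} (\<lambda>t. cmod (Z (\<gamma> t)))" "finite F"
    and d: "\<And>t. t \<in> {u<..<v} - F \<Longrightarrow> \<exists>k\<in>{1..4}. \<gamma> t \<in> quadrant \<eta> k \<and>
       (\<theta> has_real_derivative \<kappa> + \<epsilon> * J k (\<theta> t) (cmod (Z (\<gamma> t))) / cmod (Z (\<gamma> t))) (at t) \<and>
       ((\<lambda>t. cmod (Z (\<gamma> t))) has_real_derivative \<epsilon> * G k (\<theta> t) (cmod (Z (\<gamma> t)))) (at t)"
    and p: "\<And>t. t \<in> {u..v} \<Longrightarrow> \<gamma> t = P (cmod (Z (\<gamma> t))) (\<theta> t)"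
    and S: "\<And>t. t \<in> {u..v} \<Longrightarrow> lo - 2 * r < cmod (Z (\<gamma> t)) \<and> cmod (Z (\<gamma> t)) < hi + 2 * r"
    and th: "\<And>t. t \<in> {u..v} \<Longrightarrow> 0 \<le> \<theta> t \<and> \<theta> t \<le> 2 * pi"
    and sg: "\<bar>\<sigma>\<bar> = 1" "\<sigma> * (cmod (Z (\<gamma> u)) - c s0 (\<theta> u)) \<ge> 0"
  shows "\<sigma> * (cmod (Z (\<gamma> v)) - c s0 (\<theta> v)) \<ge> 0"
proof (rule gronwall_sign[where D = "\<lambda>t. \<sigma> * (cmod (Z (\<gamma> t)) - c s0 (\<theta> t))" and L = "3 / 2 * \<kappa> * C", OF uv(1) _ uv(4) _ sg(2)])
  have "continuous_on {u..v} (\<lambda>t. c s0 (\<theta> t))"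
    by (rule continuous_on_compose2[OF c_cont[OF s0] uv(2)]) auto
  then show "continuous_on {u..v} (\<lambda>t. \<sigma> * (cmod (Z (\<gamma> t)) - c s0 (\<theta> t)))"
    by (intro continuous_intros uv)
  fix t assume t: "t \<in> {u<..<v} - F"
  then have ti: "t \<in> {u..v}" by auto
  define s where "s = cmod (Z (\<gamma> t))"
  obtain k where k: "k \<in> {1..4}" "\<gamma> t \<in> quadrant \<eta> k"
    "(\<theta> has_real_derivative \<kappa> + \<epsilon> * J k (\<theta> t) s / s) (at t)"
    "((\<lambda>t. cmod (Z (\<gamma> t))) has_real_derivative \<epsilon> * G k (\<theta> t) s) (at t)"
    using d[OF t] unfolding s_def by blast
  have sr: "lo - 2 * r < s" "s < hi + 2 * r" "0 < s" "s < 1" using S[OF ti] r unfolding s_def by linarith+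
  have cr: "lo - 2 * r < c s0 (\<theta> t)" "c s0 (\<theta> t) < hi + 2 * r" using c_range[OF s0, of "\<theta> t"] r by linarith+
  have q: "P s (\<theta> t) \<in> quadrant \<eta> k" using p[OF ti] k(2) by (simp add: s_def)
  note qa = quadrant_angle[OF eta sr(3,4) q]
  have qa: "quarter_end k - pi / 2 < \<theta> t" "\<theta> t < quarter_end k" using qa th[OF ti] by auto
  have qu: "\<theta> t \<in> quarter k" using qa by (simp add: quarter_eq_Icc)
  have an: "\<bar>\<epsilon> * J k (\<theta> t) s / s\<bar> \<le> \<kappa> / 2" using sr r by (intro ang k qu) auto
  define \<omega> where "\<omega> = \<kappa> + \<epsilon> * J k (\<theta> t) s / s"
  have w: "0 \<le> \<omega>" "\<omega> \<le> 3 / 2 * \<kappa>" using an kappa_pos unfolding \<omega>_def by linarith+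
  have "((\<lambda>t. c s0 (\<theta> t)) has_real_derivative slope \<eta> n a b \<epsilon> k (\<theta> t) (c s0 (\<theta> t)) * \<omega>) (at t)"
    unfolding \<omega>_def by (rule DERIV_chain2[OF c_deriv[OF s0 k(1) qa] k(3)])
  then have "((\<lambda>t. \<sigma> * (cmod (Z (\<gamma> t)) - c s0 (\<theta> t))) has_real_derivative
      \<sigma> * (\<epsilon> * G k (\<theta> t) s - slope \<eta> n a b \<epsilon> k (\<theta> t) (c s0 (\<theta> t)) * \<omega>)) (at t)"
    by (intro DERIV_cmult DERIV_diff k(4))
  also have "\<epsilon> * G k (\<theta> t) s = slope \<eta> n a b \<epsilon> k (\<theta> t) s * \<omega>"
    unfolding \<omega>_def using sr r by (intro slope_mult[symmetric] an) auto
  finally have D: "((\<lambda>t. \<sigma> * (cmod (Z (\<gamma> t)) - c s0 (\<theta> t))) has_real_derivative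
      \<sigma> * (slope \<eta> n a b \<epsilon> k (\<theta> t) s * \<omega> - slope \<eta> n a b \<epsilon> k (\<theta> t) (c s0 (\<theta> t)) * \<omega>)) (at t)" .
  have "\<bar>\<sigma> * (slope \<eta> n a b \<epsilon> k (\<theta> t) s * \<omega> - slope \<eta> n a b \<epsilon> k (\<theta> t) (c s0 (\<theta> t)) * \<omega>)\<bar>
     = \<omega> * \<bar>slope \<eta> n a b \<epsilon> k (\<theta> t) s - slope \<eta> n a b \<epsilon> k (\<theta> t) (c s0 (\<theta> t))\<bar>"
    using w(1) sg(1) by (simp add: left_diff_distrib[symmetric] abs_mult)
  also have "\<dots> \<le> (3 / 2 * \<kappa>) * (C * \<bar>s - c s0 (\<theta> t)\<bar>)"
    using w sr cr k qu eta by (intro mult_mono slope_lip) auto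
  also have "\<dots> = 3 / 2 * \<kappa> * C * \<bar>\<sigma> * (s - c s0 (\<theta> t))\<bar>" using sg(1) by (simp add: abs_mult)
  finally show "\<exists>d. ((\<lambda>t. \<sigma> * (cmod (Z (\<gamma> t)) - c s0 (\<theta> t))) has_real_derivative d) (at t) \<and>
      \<bar>d\<bar> \<le> 3 / 2 * \<kappa> * C * \<bar>\<sigma> * (cmod (Z (\<gamma> t)) - c s0 (\<theta> t))\<bar>"
    using D unfolding s_def by blast
qed

text \<open>An open annulus in the coordinate \<open>zeta\<close>. The condition on \<open>y\<close> makes it evident that \<open>zeta\<close> is continuous there.\<close>

definition tube :: "(real \<times> real) set" where
  "tube = {p. snd p > \<eta> / 2 \<and> lo - 2 * r < cmod (Z p) \<and> cmod (Z p) < hi + 2 * r}"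

lemma tube_open: "open tube"
proof -
  have o: "open {p :: real \<times> real. snd p > \<eta> / 2}" by (intro open_Collect_less continuous_intros)
  have c: "continuous_on {p. snd p > \<eta> / 2} (\<lambda>p. cmod (Z p))"
    by (intro continuous_on_norm continuous_on_subset[OF zeta_continuous]) (use eta in auto)
  have "tube = {p. snd p > \<eta> / 2} \<inter> (\<lambda>p. cmod (Z p)) -` {lo - 2 * r<..<hi + 2 * r}" by (auto simp: tube_def)
  then show ?thesis using continuous_open_preimage[OF c o open_greaterThanLessThan] by simp
qed

lemma pt_tube: "lo - 2 * r < s \<Longrightarrow> s < hi + 2 * r \<Longrightarrow> P s \<theta> \<in> tube"
  "lo - 2 * r < s \<Longrightarrow> s < hi + 2 * r \<Longrightarrow> cmod (Z (P s \<theta>)) = s"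
  "lo - 2 * r < s \<Longrightarrow> s < hi + 2 * r \<Longrightarrow> Z (P s \<theta>) = of_real s * cis \<theta>"
proof -
  assume "lo - 2 * r < s" "s < hi + 2 * r"
  then have s: "lo - 2 * r < s" "s < hi + 2 * r" "0 < s" "s < 1" using r by linarith+
  show z: "Z (P s \<theta>) = of_real s * cis \<theta>" by (rule zeta_pt[OF eta dn_real[OF s(3,4)]])
  show n: "cmod (Z (P s \<theta>)) = s" using s unfolding z by (simp add: norm_mult)
  show "P s \<theta> \<in> tube" unfolding tube_def using pt_quadrant_sign(5)[OF eta s(3,4)] s n by simp
qed

lemma tube_pos: "p \<in> tube \<Longrightarrow> snd p > 0 \<and> lo - 2 * r < cmod (Z p) \<and> cmod (Z p) < hi + 2 * r"
  using eta by (auto simp: tube_def)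

lemma cmod_Z_continuous:
  assumes "sol \<gamma> {u..v}" "\<And>t. t \<in> {u..v} \<Longrightarrow> snd (\<gamma> t) > 0"
  shows "continuous_on {u..v} (\<lambda>t. cmod (Z (\<gamma> t)))"
proof -
  have gc: "continuous_on {u..v} \<gamma>" using assms(1) by (simp add: pw_solution_def)
  have "continuous_on {u..v} (\<lambda>t. Z (\<gamma> t))"
    by (rule continuous_on_compose2[OF zeta_continuous gc]) (use assms(2) in auto)
  then show ?thesis by (intro continuous_intros)
qed

text \<open>In the tube, \<open>comparison\<close> with both signs shows that a solution that starts on the curve stays on it, until
  the end of the time interval or of the turn.\<close>

lemma follow_tube:
  assumes s0: "lo - r < s0" "s0 < hi + r" and uv: "u \<le> v" "sol \<gamma> {u..v}"
    and tub: "\<And>t. t \<in> {u..v} \<Longrightarrow> \<gamma> t \<in> tube"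
    and st: "0 \<le> \<theta>0" "\<theta>0 < 2 * pi" "\<gamma> u = P (c s0 \<theta>0) \<theta>0"
  obtains \<theta> w where "u \<le> w" "w \<le> v" "continuous_on {u..w} \<theta>" "\<theta> u = \<theta>0"
    "\<And>t t'. u \<le> t \<Longrightarrow> t \<le> t' \<Longrightarrow> t' \<le> w \<Longrightarrow> \<theta> t' - \<theta> t \<ge> \<kappa> / 2 * (t' - t)"
    "\<And>t. u \<le> t \<Longrightarrow> t \<le> w \<Longrightarrow> \<theta> t \<le> 2 * pi \<and> \<gamma> t = P (c s0 (\<theta> t)) (\<theta> t)"
    "\<theta> w = 2 * pi \<or> (w = v \<and> \<theta> w < 2 * pi)"
proof -
  have cr: "lo - 2 * r < c s0 \<theta>" "c s0 \<theta> < hi + 2 * r" for \<theta> using c_range[OF s0, of \<theta>] r by linarith+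
  have su: "Z (\<gamma> u) = of_real (cmod (Z (\<gamma> u))) * cis \<theta>0" unfolding st(3) pt_tube(2)[OF cr] by (rule pt_tube(3)[OF cr])
  obtain \<theta> F where th: "continuous_on {u..v} \<theta>" "\<theta> u = \<theta>0" "\<And>t. t \<in> {u..v} \<Longrightarrow> \<gamma> t = P (cmod (Z (\<gamma> t))) (\<theta> t)"
    "finite F" "\<And>t. t \<in> {u<..<v} - F \<Longrightarrow> \<exists>k\<in>{1..4}. \<gamma> t \<in> quadrant \<eta> k \<and>
       (\<theta> has_real_derivative \<kappa> + \<epsilon> * J k (\<theta> t) (cmod (Z (\<gamma> t))) / cmod (Z (\<gamma> t))) (at t) \<and>
       ((\<lambda>t. cmod (Z (\<gamma> t))) has_real_derivative \<epsilon> * G k (\<theta> t) (cmod (Z (\<gamma> t)))) (at t)"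
    using polar_lift[OF uv tube_pos[OF tub] _ su] uv by auto
  have inc: "\<theta> t' - \<theta> t \<ge> \<kappa> / 2 * (t' - t)" if "u \<le> t" "t \<le> t'" "t' \<le> v" for t t'
  proof (rule angle_increasing[OF that(2) _ th(4), where \<gamma> = \<gamma>])
    show "continuous_on {t..t'} \<theta>" using th(1) by (rule continuous_on_subset) (use that in auto)
    show "\<exists>k\<in>{1..4}. \<gamma> x \<in> quadrant \<eta> k \<and>
       (\<theta> has_real_derivative \<kappa> + \<epsilon> * J k (\<theta> x) (cmod (Z (\<gamma> x))) / cmod (Z (\<gamma> x))) (at x)"
      if "x \<in> {t<..<t'} - F" for x using th(5)[of x] that \<open>u \<le> t\<close> \<open>t' \<le> v\<close> by auto
  qed (use th(3) tub tube_pos that in auto)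
  have mono: "\<theta> t \<le> \<theta> t'" if "u \<le> t" "t \<le> t'" "t' \<le> v" for t t'
  proof -
    have "0 \<le> \<kappa> / 2 * (t' - t)" using that kappa_pos by simp
    then show ?thesis using inc[OF that] by linarith
  qed
  have Scont: "continuous_on {u..v} (\<lambda>t. cmod (Z (\<gamma> t)))" using cmod_Z_continuous[OF uv(2)] tub tube_pos by blast
  have eq: "\<gamma> t = P (c s0 (\<theta> t)) (\<theta> t)" if t: "u \<le> t" "t \<le> v" "\<theta> t \<le> 2 * pi" for t
  proof -
    have sub: "{u..t} \<subseteq> {u..v}" using t by auto
    have "\<sigma> * (cmod (Z (\<gamma> t)) - c s0 (\<theta> t)) \<ge> 0" if "\<bar>\<sigma>\<bar> = 1" for \<sigma>
    proof (rule comparison[OF s0 t(1) continuous_on_subset[OF th(1) sub] continuous_on_subset[OF Scont sub] th(4) _ _ _ _ that])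
      show "0 \<le> \<theta> x \<and> \<theta> x \<le> 2 * pi" if "x \<in> {u..t}" for x
        using mono[of u x] mono[of x t] that t st th(2) by auto
      show "0 \<le> \<sigma> * (cmod (Z (\<gamma> u)) - c s0 (\<theta> u))" by (simp add: st(3) pt_tube(2)[OF cr] th(2))
    qed (use th(3,5) tub tube_pos t in auto)
    from this[of 1] this[of "-1"] have "cmod (Z (\<gamma> t)) = c s0 (\<theta> t)" by simp
    then show ?thesis using th(3)[of t] t by simp
  qed
  show ?thesis
  proof (cases "\<theta> v < 2 * pi")
    case True
    show ?thesis
    proof (rule that[of v \<theta>])
      show "\<theta> t \<le> 2 * pi \<and> \<gamma> t = P (c s0 (\<theta> t)) (\<theta> t)" if "u \<le> t" "t \<le> v" for t
        using mono[of t v] that True eq[of t] by auto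
    qed (use uv th inc True in auto)
  next
    case False
    then have "\<exists>w. u \<le> w \<and> w \<le> v \<and> \<theta> w = 2 * pi" using uv th st by (intro IVT') auto
    then obtain w where w: "u \<le> w" "w \<le> v" "\<theta> w = 2 * pi" by blast
    show ?thesis
    proof (rule that[of w \<theta>])
      show "continuous_on {u..w} \<theta>" using th(1) by (rule continuous_on_subset) (use w in auto)
      show "\<theta> t \<le> 2 * pi \<and> \<gamma> t = P (c s0 (\<theta> t)) (\<theta> t)" if "u \<le> t" "t \<le> w" for t
        using mono[of t w] that w eq[of t] by auto
    qed (use w th inc in auto)
  qed
qed

lemma stays_in_tube:
  assumes "sol \<gamma> I" "t \<in> I" "\<gamma> t \<in> tube"
  obtains d where "d > 0" "\<And>u. u \<in> I \<Longrightarrow> \<bar>u - t\<bar> < d \<Longrightarrow> \<gamma> u \<in> tube"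
proof -
  have "continuous_on I \<gamma>" using assms(1) by (simp add: pw_solution_def)
  then obtain A where A: "open A" "A \<inter> I = \<gamma> -` tube \<inter> I" using tube_open by (auto simp: continuous_on_open_invariant)
  have "t \<in> A" using A assms by auto
  then obtain d where d: "d > 0" "ball t d \<subseteq> A" using A(1) openE by blast
  have "\<gamma> u \<in> tube" if "u \<in> I" "\<bar>u - t\<bar> < d" for u
  proof -
    have "u \<in> A" using d(2) that by (auto simp: dist_real_def abs_minus_commute subset_iff)
    then show ?thesis using A(2) that by blast
  qed
  then show ?thesis using that d(1) by blast
qed

text \<open>The solution cannot leave the tube before completing the turn: as long as it is in the tube it is on
  the curve, and the curve keeps a positive distance from the boundary of the tube.\<close>

lemma follow:
  assumes s0: "lo - r < s0" "s0 < hi + r" and uv: "u \<le> v" "sol \<gamma> {u..v}"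
    and st: "0 \<le> \<theta>0" "\<theta>0 < 2 * pi" "\<gamma> u = P (c s0 \<theta>0) \<theta>0"
  obtains \<theta> w where "u \<le> w" "w \<le> v" "continuous_on {u..w} \<theta>" "\<theta> u = \<theta>0"
    "\<And>t t'. u \<le> t \<Longrightarrow> t \<le> t' \<Longrightarrow> t' \<le> w \<Longrightarrow> \<theta> t' - \<theta> t \<ge> \<kappa> / 2 * (t' - t)"
    "\<And>t. u \<le> t \<Longrightarrow> t \<le> w \<Longrightarrow> \<theta> t \<le> 2 * pi \<and> \<gamma> t = P (c s0 (\<theta> t)) (\<theta> t)"
    "\<theta> w = 2 * pi \<or> (w = v \<and> \<theta> w < 2 * pi)"
proof -
  have cr: "lo - 2 * r < c s0 \<theta>" "c s0 \<theta> < hi + 2 * r" for \<theta> using c_range[OF s0, of \<theta>] r by linarith+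
  define B where "B = {t \<in> {u..v}. \<forall>x\<in>{u..t}. \<gamma> x \<in> tube}"
  (* The turn is completed at time t. *)
  define Q where "Q t \<longleftrightarrow> (\<exists>\<theta>. continuous_on {u..t} \<theta> \<and> \<theta> u = \<theta>0 \<and>
      (\<forall>x y. u \<le> x \<longrightarrow> x \<le> y \<longrightarrow> y \<le> t \<longrightarrow> \<theta> y - \<theta> x \<ge> \<kappa> / 2 * (y - x)) \<and>
      (\<forall>x. u \<le> x \<longrightarrow> x \<le> t \<longrightarrow> \<theta> x \<le> 2 * pi \<and> \<gamma> x = P (c s0 (\<theta> x)) (\<theta> x)) \<and> \<theta> t = 2 * pi)" for t
  show ?thesis
  proof (cases "\<exists>t\<in>{u..v}. Q t")
    case True
    then obtain t \<theta> where "t \<in> {u..v}" "continuous_on {u..t} \<theta>" "\<theta> u = \<theta>0"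
      "\<And>x y. u \<le> x \<Longrightarrow> x \<le> y \<Longrightarrow> y \<le> t \<Longrightarrow> \<theta> y - \<theta> x \<ge> \<kappa> / 2 * (y - x)"
      "\<And>x. u \<le> x \<Longrightarrow> x \<le> t \<Longrightarrow> \<theta> x \<le> 2 * pi \<and> \<gamma> x = P (c s0 (\<theta> x)) (\<theta> x)" "\<theta> t = 2 * pi"
      unfolding Q_def by blast
    then show ?thesis using that[of t \<theta>] by auto
  next
    case noQ: False
    have ne: "x \<in> A \<Longrightarrow> A \<noteq> {}" for x :: real and A by auto
    have ut: "\<gamma> u \<in> tube" unfolding st(3) by (rule pt_tube(1)[OF cr])
    have uB: "u \<in> B" unfolding B_def using uv(1) ut by simp
    have Bv: "t \<le> v" if "t \<in> B" for t using that unfolding B_def by simp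
    have Bbd: "bdd_above B" using Bv by (rule bdd_aboveI)
    define m where "m = Sup B"
    have m: "u \<le> m" "m \<le> v" unfolding m_def using cSup_upper[OF uB Bbd] cSup_least[OF _ Bv] uB by blast+
    have below: "\<gamma> x \<in> tube" if "u \<le> x" "x < m" for x
    proof -
      have "B \<noteq> {}" using uB by (rule ne)
      from less_cSupD[OF this that(2)[unfolded m_def]] obtain t where "t \<in> B" "x < t" by (rule bexE)
      then show ?thesis using that unfolding B_def by simp
    qed
    (* Before time m the orbit lies on the curve, hence at distance at least r/2 from the boundary of the tube. *)
    have on: "\<exists>s \<phi>. lo - 2 * r + r / 2 \<le> s \<and> s \<le> hi + 2 * r - r / 2 \<and> \<gamma> x = P s \<phi>" if x: "u \<le> x" "x < m" for x
    proof -
      have sx: "sol \<gamma> {u..x}" using pw_solution_subset[OF uv(2)] x m by auto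
      have tb: "\<gamma> t \<in> tube" if "t \<in> {u..x}" for t using below that x by auto
      obtain \<theta> w where w: "u \<le> w" "w \<le> x" "continuous_on {u..w} \<theta>" "\<theta> u = \<theta>0"
        "\<And>t t'. u \<le> t \<Longrightarrow> t \<le> t' \<Longrightarrow> t' \<le> w \<Longrightarrow> \<theta> t' - \<theta> t \<ge> \<kappa> / 2 * (t' - t)"
        "\<And>t. u \<le> t \<Longrightarrow> t \<le> w \<Longrightarrow> \<theta> t \<le> 2 * pi \<and> \<gamma> t = P (c s0 (\<theta> t)) (\<theta> t)"
        "\<theta> w = 2 * pi \<or> (w = x \<and> \<theta> w < 2 * pi)"
        by (rule follow_tube[OF s0 x(1) sx tb st], assumption, rule that; assumption)
      have "\<not> Q w" using noQ w(1,2) x m by auto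
      then have "\<theta> w \<noteq> 2 * pi" unfolding Q_def using w by blast
      then have "w = x" using w(7) by blast
      then show ?thesis using w(6)[of x] x c_range[OF s0] by blast
    qed
    have mt: "\<gamma> m \<in> tube"
    proof (cases "m = u")
      case True
      then show ?thesis using uB by (auto simp: B_def)
    next
      case False
      then have um: "u < m" using m by simp
      define K where "K = (\<lambda>(s, \<phi>). P s \<phi>) ` ({lo - 2 * r + r / 2 .. hi + 2 * r - r / 2} \<times> {0..2 * pi})"
      have pcont: "continuous_on ({lo - 2 * r + r / 2 .. hi + 2 * r - r / 2} \<times> {0..2 * pi}) (\<lambda>(s, \<phi>). P s \<phi>)"
      proof -
        have nz: "dn (snd x) (fst x) \<noteq> 0" if "x \<in> {lo - 2 * r + r / 2 .. hi + 2 * r - r / 2} \<times> {0..2 * pi}" for x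
        proof -
          have "0 < fst x" "fst x < 1" using that r by (auto simp: mem_Times_iff)
          then show ?thesis using dn_real by (metis less_irrefl)
        qed
        show ?thesis unfolding pt_def case_prod_beta'
          by (intro continuous_on_Pair px_continuous py_continuous continuous_on_fst continuous_on_snd continuous_on_id nz)
      qed
      have "compact K" unfolding K_def by (intro compact_continuous_image[OF pcont] compact_Times compact_Icc)
      then have Kc: "closed K" by (rule compact_imp_closed)
      have inK: "\<gamma> x \<in> K" if xx: "u \<le> x" "x < m" for x
      proof -
        obtain s \<phi> where s: "lo - 2 * r + r / 2 \<le> s" "s \<le> hi + 2 * r - r / 2" "\<gamma> x = P s \<phi>" using on[OF xx] by blast
        obtain \<phi>' where p: "0 \<le> \<phi>'" "\<phi>' < 2 * pi" "sin \<phi>' = sin \<phi>" "cos \<phi>' = cos \<phi>" by (rule reduce_angle)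
        show ?thesis unfolding K_def s(3) angle_cong(3)[OF p(3,4), symmetric] using s p by force
      qed
      have "continuous_on {u..m} \<gamma>" using uv(2) m unfolding pw_solution_def by (auto elim: continuous_on_subset)
      then have "continuous (at m within {u..m}) \<gamma>" using m by (simp add: continuous_on_eq_continuous_within)
      then have lim: "(\<gamma> \<longlongrightarrow> \<gamma> m) (at m within {u..m})" by (simp add: continuous_within)
      have nb: "at m within {u..m} \<noteq> bot" using um by (simp add: trivial_limit_within islimpt_Icc)
      have "\<forall>\<^sub>F x in at m within {u..m}. \<gamma> x \<in> K"
        unfolding eventually_at by (intro exI[of _ 1]) (auto intro: inK)
      then have "\<gamma> m \<in> K" by (rule Lim_in_closed_set[OF Kc _ nb lim])
      then show ?thesis unfolding K_def using pt_tube(1) r by auto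
    qed
    have mB: "\<gamma> x \<in> tube" if "x \<in> {u..m}" for x using below[of x] mt that by (cases "x = m") auto
    have mv: "m = v"
    proof (rule ccontr)
      assume "m \<noteq> v"
      then have mlt: "m < v" using m by simp
      obtain d where d: "d > 0" "\<And>x. x \<in> {u..v} \<Longrightarrow> \<bar>x - m\<bar> < d \<Longrightarrow> \<gamma> x \<in> tube"
        using stays_in_tube[OF uv(2) _ mt] m by auto
      define m' where "m' = min v (m + d / 2)"
      have m': "m < m'" "m' \<le> v" "m' < m + d" using mlt d by (auto simp: m'_def)
      have "m' \<in> B" unfolding B_def
      proof (intro CollectI conjI ballI)
        show "m' \<in> {u..v}" using m m' by auto
        fix x assume x: "x \<in> {u..m'}"
        show "\<gamma> x \<in> tube"
        proof (cases "x \<le> m")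
          case True then show ?thesis using mB x by auto
        next
          case False
          then show ?thesis using d(2)[of x] x m' by auto
        qed
      qed
      then have "m' \<le> m" unfolding m_def by (rule cSup_upper[OF _ Bbd])
      then show False using m' by simp
    qed
    have tb: "\<gamma> t \<in> tube" if "t \<in> {u..v}" for t using mB mv that by simp
    show ?thesis by (rule follow_tube[OF s0 uv tb st], assumption, rule that; assumption)
  qed
qed

section \<open>The first return map\<close>

text \<open>The converse of the computation in \<open>polar_lift\<close>: solutions of the polar equations are solutions of the planar
  system. The derivative of \<open>zeta\<close> along the perturbed system has real part \<open>q'\<close> and imaginary part \<open>p'\<close>.\<close>

lemma pt_solution_derivative:
  assumes k: "k \<in> {1..4}" and S: "0 < S t" "S t < 1"
    and dS: "(S has_real_derivative \<epsilon> * G k (\<theta> t) (S t)) (at t)"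
    and dth: "(\<theta> has_real_derivative \<kappa> + \<epsilon> * J k (\<theta> t) (S t) / S t) (at t)"
  shows "((\<lambda>t. P (S t) (\<theta> t)) has_vector_derivative vfield \<eta> \<epsilon> f g k (P (S t) (\<theta> t))) (at t)"
proof -
  define D p where "D = dn (\<theta> t) (S t)" and "p = S t * sin (\<theta> t)"
  define x y where "x = px \<eta> (\<theta> t) (S t)" and "y = py \<eta> (\<theta> t) (S t)"
  define fv gv where "fv = f k x y" and "gv = g k x y"
  define S' \<theta>' where "S' = \<epsilon> * G k (\<theta> t) (S t)" and "\<theta>' = \<kappa> + \<epsilon> * J k (\<theta> t) (S t) / S t"
  have D: "D > 0" unfolding D_def by (rule dn_real[OF S])
  have kk: "\<kappa> * \<kappa> = 2 * \<eta>" "\<kappa> \<noteq> 0" using eta by auto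
  define K where "K = \<kappa>"
  have y: "y = \<eta> / D" by (simp add: y_def py_def D_def)
  have x: "x = \<eta> / \<kappa> * p / D" by (simp add: x_def px_def D_def p_def)
  have G1: "G k (\<theta> t) (S t) * cos (\<theta> t) - J k (\<theta> t) (S t) * sin (\<theta> t) = D\<^sup>2 / \<eta> * gv"
    and G2: "G k (\<theta> t) (S t) * sin (\<theta> t) + J k (\<theta> t) (S t) * cos (\<theta> t) = D / \<eta> * (\<kappa> * fv - p * gv)"
    using polar_components[OF eta, of n "a k" "b k" "\<theta> t" "S t"] k
    by (simp_all add: D_def fv_def gv_def f_poly g_poly x_def y_def p_def)
  have Sth: "S t * \<theta>' = \<kappa> * S t + \<epsilon> * J k (\<theta> t) (S t)" using S by (simp add: \<theta>'_def field_simps)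
  define q' p' where "q' = - \<kappa> * p + \<epsilon> * (D\<^sup>2 / \<eta> * gv)" and "p' = \<kappa> * (1 - D) + \<epsilon> * (D / \<eta> * (\<kappa> * fv - p * gv))"
  have q: "S' * cos (\<theta> t) - sin (\<theta> t) * (S t * \<theta>') = q'"
    unfolding Sth S'_def q'_def G1[symmetric] p_def by (simp add: algebra_simps)
  have pp: "S' * sin (\<theta> t) + cos (\<theta> t) * (S t * \<theta>') = p'"
    unfolding Sth S'_def p'_def G2[symmetric] by (simp add: D_def dn_def algebra_simps)
  have dD: "((\<lambda>t. dn (\<theta> t) (S t)) has_real_derivative - q') (at t)"
    unfolding q[symmetric] dn_def S'_def \<theta>'_def
    by (auto intro!: derivative_eq_intros dS dth simp: algebra_simps)
  have dp: "((\<lambda>t. S t * sin (\<theta> t)) has_real_derivative p') (at t)"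
    unfolding pp[symmetric] S'_def \<theta>'_def
    by (auto intro!: derivative_eq_intros dS dth simp: algebra_simps)
  have dy: "((\<lambda>t. py \<eta> (\<theta> t) (S t)) has_real_derivative \<eta> * q' / D\<^sup>2) (at t)"
    unfolding py_def of_real_eq_id id_apply using D unfolding D_def
    by (auto intro!: derivative_eq_intros dD simp: power2_eq_square)
  have dx: "((\<lambda>t. px \<eta> (\<theta> t) (S t)) has_real_derivative \<eta> / \<kappa> * (p' * D + p * q') / D\<^sup>2) (at t)"
  proof -
    have "(\<lambda>t. px \<eta> (\<theta> t) (S t)) = (\<lambda>t. \<eta> / \<kappa> * ((S t * sin (\<theta> t)) / dn (\<theta> t) (S t)))"
      by (simp add: px_def fun_eq_iff)
    moreover have "((\<lambda>t. \<eta> / \<kappa> * ((S t * sin (\<theta> t)) / dn (\<theta> t) (S t))) has_real_derivative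
        \<eta> / \<kappa> * ((p' * dn (\<theta> t) (S t) - (S t * sin (\<theta> t)) * - q') / (dn (\<theta> t) (S t) * dn (\<theta> t) (S t)))) (at t)"
      using D unfolding D_def by (intro DERIV_cmult DERIV_divide dp dD) simp
    ultimately show ?thesis by (simp add: D_def p_def power2_eq_square)
  qed
  have ey: "\<eta> * q' / D\<^sup>2 = - 2 * x * y + \<epsilon> * gv"
  proof -
    have "- 2 * x * y = - (2 * \<eta>) * \<eta> * p / (\<kappa> * D\<^sup>2)" unfolding x y by (simp add: power2_eq_square mult_ac)
    also have "\<dots> = - (2 * \<eta> / \<kappa>) * \<eta> * p / D\<^sup>2" by simp
    also have "2 * \<eta> / \<kappa> = K" using eta by (simp add: K_def real_div_sqrt)
    finally have "- 2 * x * y = - K * \<eta> * p / D\<^sup>2" .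
    moreover have "\<eta> * (- K * p + \<epsilon> * (D\<^sup>2 / \<eta> * gv)) / D\<^sup>2 = - K * \<eta> * p / D\<^sup>2 + \<epsilon> * gv"
      using D eta by (simp add: distrib_left right_diff_distrib diff_divide_distrib add_divide_distrib)
    ultimately show ?thesis unfolding q'_def K_def by simp
  qed
  have ex: "\<eta> / \<kappa> * (p' * D + p * q') / D\<^sup>2 = y - 2 * x\<^sup>2 - \<eta> + \<epsilon> * fv"
  proof -
    have "2 * x\<^sup>2 = (2 * \<eta>) * \<eta> * p\<^sup>2 / (\<kappa> * \<kappa> * D\<^sup>2)" unfolding x by (simp add: power2_eq_square mult_ac del: real_sqrt_mult_self)
    also have "\<dots> = \<eta> * p\<^sup>2 / D\<^sup>2" by (subst kk(1)) (use eta in simp)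
    finally have x2: "2 * x\<^sup>2 = \<eta> * p\<^sup>2 / D\<^sup>2" .
    have "p' * D + p * q' = \<kappa> * ((1 - D) * D - p\<^sup>2 + \<epsilon> * (D\<^sup>2 / \<eta>) * fv)"
      unfolding p'_def q'_def by (simp add: algebra_simps power2_eq_square)
    then have "\<eta> / \<kappa> * (p' * D + p * q') / D\<^sup>2 = \<eta> * ((1 - D) * D - p\<^sup>2 + \<epsilon> * (D\<^sup>2 / \<eta>) * fv) / D\<^sup>2"
      using kk(2) by simp
    also have "\<dots> = \<eta> * D / D\<^sup>2 - \<eta> * D\<^sup>2 / D\<^sup>2 - \<eta> * p\<^sup>2 / D\<^sup>2 + \<epsilon> * (\<eta> * (D\<^sup>2 / \<eta>)) * fv / D\<^sup>2"
      by (simp add: add_divide_distrib diff_divide_distrib algebra_simps power2_eq_square)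
    also have "\<dots> = \<eta> / D - \<eta> - \<eta> * p\<^sup>2 / D\<^sup>2 + \<epsilon> * fv"
      using D eta by (simp add: power2_eq_square)
    finally show ?thesis unfolding x2 y by simp
  qed
  have "((\<lambda>t. (px \<eta> (\<theta> t) (S t), py \<eta> (\<theta> t) (S t))) has_vector_derivative
      (\<eta> / \<kappa> * (p' * D + p * q') / D\<^sup>2, \<eta> * q' / D\<^sup>2)) (at t)"
    using dx dy by (intro has_vector_derivative_Pair) (simp_all add: has_real_derivative_iff_has_vector_derivative)
  then show ?thesis unfolding ex ey by (simp add: pt_def vfield_def x_def y_def fv_def gv_def)
qed

text \<open>The ordinate of the section point with radius \<open>s\<close>.\<close>

definition ysec :: "real \<Rightarrow> real" where "ysec s = \<eta> / (1 - s)"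

lemma pt_section: "P s 0 = (0, ysec s)" "P s (2 * pi) = (0, ysec s)"
  by (simp_all add: pt_def px_def py_def dn_def ysec_def)

lemma s_range:
  assumes "lo - r < s0" "s0 < hi + r"
  shows "lo - 2 * r < c s0 \<theta>" "c s0 \<theta> < hi + 2 * r" "0 < c s0 \<theta>" "c s0 \<theta> < 1"
  using c_range[OF assms, of \<theta>] r by linarith+

lemma section_angle:
  assumes "0 < s" "s < 1" "0 \<le> \<theta>" "\<theta> \<le> 2 * pi" "fst (P s \<theta>) = 0" "snd (P s \<theta>) > \<eta>"
  shows "\<theta> = 0 \<or> \<theta> = 2 * pi"
proof -
  have "sin \<theta> = 0" "cos \<theta> > 0" using pt_quadrant_sign[OF eta assms(1,2), of \<theta>] assms(5,6) by (auto simp: not_less antisym_conv)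
  note sc = this
  show ?thesis
  proof (rule angle_cases[OF assms(3,4)])
    assume "\<theta> \<in> {0, pi / 2, pi, 3 * (pi / 2), 2 * pi}"
    then consider "\<theta> = 0" | "\<theta> = pi / 2" | "\<theta> = pi" | "\<theta> = 3 * (pi / 2)" | "\<theta> = 2 * pi" by blast
    then show ?thesis
    proof cases
      case 2
      have "cos \<theta> = 0" unfolding 2 by (rule cos_pi_half)
      then show ?thesis using sc(2) by simp
    next
      case 3 then show ?thesis using sc(2) by simp
    next
      case 4
      then have "sin \<theta> = - 1" by (simp only: trig_quarter(2))
      then show ?thesis using sc(1) by simp
    qed simp_all
  next
    fix k :: nat assume k: "k \<in> {1..4}" "quarter_end k - pi / 2 < \<theta>" "\<theta> < quarter_end k"
    consider "k = 1" | "k = 2" | "k = 3" | "k = 4" using k(1) by fastforce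
    then show ?thesis using open_quarter_trig[OF k] sc by cases auto
  qed
qed

text \<open>The time at which the angle \<open>u\<close> is reached is the integral \<open>\<tau>\<close> of the reciprocal angular speed along the curve; its
  inverse \<open>\<Theta>\<close> parametrises the curve by time.\<close>

lemma first_return_exists:
  assumes s0: "lo - r < s0" "s0 < hi + r"
  shows "first_return \<eta> \<epsilon> f g (ysec s0) (ysec (c s0 (2 * pi)))"
proof -
  note sr = s_range[OF s0]
  define \<omega> where "\<omega> k u = \<kappa> + \<epsilon> * J k u (c s0 u) / c s0 u" for k u
  have w: "\<kappa> / 2 \<le> \<omega> k u" "\<omega> k u \<le> 3 / 2 * \<kappa>" if "k \<in> {1..4}" "u \<in> quarter k" for k u
    using ang[OF that, of "c s0 u"] sr[of u] r unfolding \<omega>_def by linarith+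
  have w0: "\<omega> k u > 0" if "k \<in> {1..4}" "u \<in> quarter k" for k u using w[OF that] kappa_pos by linarith
  have cc: "continuous_on T (c s0)" for T using c_cont[OF s0] continuous_on_subset by blast
  have wc: "continuous_on (quarter k) (\<lambda>u. 1 / \<omega> k u)" if "k \<in> {1..4}" for k
  proof -
    have nz: "dn u (c s0 u) \<noteq> 0" for u using dn_real[OF sr(3,4)[of u], of u] by simp
    have "continuous_on (quarter k) (\<lambda>u. J k u (c s0 u))"
      by (intro angular_continuous_gen continuous_on_id cc nz)
    then have "continuous_on (quarter k) (\<omega> k)" unfolding \<omega>_def[abs_def]
      using sr(3) by (intro continuous_on_add continuous_on_divide continuous_on_mult continuous_on_const cc) (auto simp: less_imp_neq[THEN not_sym])
    then show ?thesis using w0[OF that] by (intro continuous_on_divide continuous_on_const) (auto simp: less_imp_neq[THEN not_sym])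
  qed
  define \<tau> where "\<tau> = piecewise_integral (\<lambda>k u. 1 / \<omega> k u)"
  have tc: "continuous_on T \<tau>" for T unfolding \<tau>_def by (rule piecewise_integral_continuous[OF wc])
  have t0: "\<tau> 0 = 0" unfolding \<tau>_def by (rule piecewise_integral_0) simp
  have td: "(\<tau> has_real_derivative 1 / \<omega> k u) (at u)" if "k \<in> {1..4}" "quarter_end k - pi / 2 < u" "u < quarter_end k" for k u
    unfolding \<tau>_def has_real_derivative_iff_has_vector_derivative by (rule piecewise_integral_vector_derivative[OF wc that])
  (* The switching angles. *)
  define E where "E = {0, pi / 2, pi, 3 * (pi / 2), 2 * pi}"
  have inc: "\<tau> v - \<tau> u \<ge> 2 / (3 * \<kappa>) * (v - u)" if "0 \<le> u" "u \<le> v" "v \<le> 2 * pi" for u v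
  proof (rule deriv_lower_bound[OF that(2) tc, of E])
    show "finite E" by (simp add: E_def)
    fix x assume x: "x \<in> {u<..<v} - E"
    then have "0 \<le> x" "x \<le> 2 * pi" using that by auto
    then obtain k where k: "k \<in> {1..4::nat}" "quarter_end k - pi / 2 < x" "x < quarter_end k"
      using x by (auto elim!: angle_cases simp: E_def)
    then have "x \<in> quarter k" by (simp add: quarter_eq_Icc)
    note wx = w0[OF k(1) this] w(2)[OF k(1) this]
    have "2 / (3 * \<kappa>) = 1 / (3 / 2 * \<kappa>)" by simp
    also have "\<dots> \<le> 1 / \<omega> k x" using wx by (intro divide_left_mono mult_pos_pos) (use kappa_pos in auto)
    finally show "\<exists>d\<ge>2 / (3 * \<kappa>). (\<tau> has_real_derivative d) (at x)" using td[OF k] by blast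
  qed
  have smono: "\<tau> u < \<tau> v" if "0 \<le> u" "u < v" "v \<le> 2 * pi" for u v
  proof -
    have "0 < 2 / (3 * \<kappa>) * (v - u)" using that kappa_pos by simp
    then show ?thesis using inc[of u v] that by linarith
  qed
  define T where "T = \<tau> (2 * pi)"
  have T: "T > 0" using smono[of 0 "2 * pi"] t0 by (simp add: T_def)
  have inj: "inj_on \<tau> {0..2 * pi}"
  proof (rule inj_onI)
    fix u v assume "u \<in> {0..2 * pi}" "v \<in> {0..2 * pi}" "\<tau> u = \<tau> v"
    then show "u = v" using smono[of u v] smono[of v u] by (cases u v rule: linorder_cases) auto
  qed
  have img: "\<tau> ` {0..2 * pi} = {0..T}"
  proof
    show "\<tau> ` {0..2 * pi} \<subseteq> {0..T}"
    proof
      fix x assume "x \<in> \<tau> ` {0..2 * pi}"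
      then obtain u where u: "0 \<le> u" "u \<le> 2 * pi" "x = \<tau> u" by auto
      show "x \<in> {0..T}" using smono[of 0 u] smono[of u "2 * pi"] u t0 T by (cases "u = 0"; cases "u = 2 * pi") (auto simp: T_def)
    qed
    show "{0..T} \<subseteq> \<tau> ` {0..2 * pi}"
    proof
      fix x assume x: "x \<in> {0..T}"
      have "\<exists>u. 0 \<le> u \<and> u \<le> 2 * pi \<and> \<tau> u = x" using x t0 by (intro IVT' tc) (auto simp: T_def)
      then show "x \<in> \<tau> ` {0..2 * pi}" by auto
    qed
  qed
  define \<Theta> where "\<Theta> = the_inv_into {0..2 * pi} \<tau>"
  have Th: "0 \<le> \<Theta> t" "\<Theta> t \<le> 2 * pi" "\<tau> (\<Theta> t) = t" if "t \<in> {0..T}" for t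
    using the_inv_into_into[OF inj _ order_refl, of t] f_the_inv_into_f[OF inj, of t] that img by (auto simp: \<Theta>_def)
  have Tht: "\<Theta> (\<tau> u) = u" if "0 \<le> u" "u \<le> 2 * pi" for u
    unfolding \<Theta>_def using the_inv_into_f_f[OF inj] that by simp
  have Thc: "continuous_on {0..T} \<Theta>"
    unfolding \<Theta>_def img[symmetric] by (rule continuous_on_inv_into[OF tc compact_Icc inj])
  define \<gamma> where "\<gamma> t = P (c s0 (\<Theta> t)) (\<Theta> t)" for t
  have Scont: "continuous_on {0..T} (\<lambda>t. c s0 (\<Theta> t))" by (rule continuous_on_compose2[OF cc Thc]) auto
  have gcont: "continuous_on {0..T} \<gamma>"
  proof -
    have nz: "dn (\<Theta> t) (c s0 (\<Theta> t)) \<noteq> 0" for t using dn_real[OF sr(3,4)[of "\<Theta> t"], of "\<Theta> t"] by simp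
    show ?thesis unfolding \<gamma>_def pt_def by (intro continuous_on_Pair px_continuous py_continuous Thc Scont nz)
  qed
  have sl: "sol \<gamma> {0..T}" unfolding pw_solution_def
  proof (intro conjI allI ballI impI gcont)
    fix u v
    show "finite {t \<in> {0..T} \<inter> {u..v}. \<gamma> t \<notin> (\<Union>k\<in>{1..4}. quadrant \<eta> k)}"
    proof (rule finite_subset)
      show "finite (\<tau> ` E)" by (simp add: E_def)
      show "{t \<in> {0..T} \<inter> {u..v}. \<gamma> t \<notin> (\<Union>k\<in>{1..4}. quadrant \<eta> k)} \<subseteq> \<tau> ` E"
      proof
        fix t assume "t \<in> {t \<in> {0..T} \<inter> {u..v}. \<gamma> t \<notin> (\<Union>k\<in>{1..4}. quadrant \<eta> k)}"
        then have t: "t \<in> {0..T}" "\<gamma> t \<notin> (\<Union>k\<in>{1..4}. quadrant \<eta> k)" by auto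
        have "\<Theta> t \<in> E"
        proof (rule angle_cases[OF Th(1,2)[OF t(1)]])
          fix k :: nat assume k: "k \<in> {1..4}" "quarter_end k - pi / 2 < \<Theta> t" "\<Theta> t < quarter_end k"
          have "\<gamma> t \<in> quadrant \<eta> k" unfolding \<gamma>_def by (rule pt_in_quadrant[OF eta sr(3,4) k])
          then show ?thesis using t(2) k(1) by blast
        qed (simp add: E_def)
        then show "t \<in> \<tau> ` E" using Th(3)[OF t(1)] by force
      qed
    qed
  next
    fix t k assume t: "t \<in> {0..T}" and k: "k \<in> {1..4}" "\<gamma> t \<in> quadrant \<eta> k"
    have q: "quarter_end k - pi / 2 < \<Theta> t" "\<Theta> t < quarter_end k"
      using quadrant_angle[OF eta sr(3,4) k(2)[unfolded \<gamma>_def] Th(1,2)[OF t]] by auto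
    have qq: "\<Theta> t \<in> quarter k" using q by (simp add: quarter_eq_Icc)
    have "\<Theta> t > 0" "\<Theta> t < 2 * pi" using q quarter_end_bounds[OF k(1)] by auto
    then have ti: "0 < t" "t < T" using smono[of 0 "\<Theta> t"] smono[of "\<Theta> t" "2 * pi"] Th(3)[OF t] t0 by (auto simp: T_def)
    have "(\<Theta> has_real_derivative inverse (1 / \<omega> k (\<Theta> t))) (at t)"
    proof (rule DERIV_inverse_function[where f = \<tau> and a = 0 and b = T])
      show "(\<tau> has_real_derivative 1 / \<omega> k (\<Theta> t)) (at (\<Theta> t))" by (rule td[OF k(1) q])
      show "1 / \<omega> k (\<Theta> t) \<noteq> 0" using w0[OF k(1) qq] by simp
      show "\<tau> (\<Theta> y) = y" if "0 < y" "y < T" for y using Th(3)[of y] that by simp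
      show "isCont \<Theta> t" using continuous_on_interior[OF Thc] ti by simp
    qed (use ti in auto)
    then have dT: "(\<Theta> has_real_derivative \<omega> k (\<Theta> t)) (at t)" by simp
    have dS: "((\<lambda>t. c s0 (\<Theta> t)) has_real_derivative \<epsilon> * G k (\<Theta> t) (c s0 (\<Theta> t))) (at t)"
    proof -
      have "slope \<eta> n a b \<epsilon> k (\<Theta> t) (c s0 (\<Theta> t)) * \<omega> k (\<Theta> t) = \<epsilon> * G k (\<Theta> t) (c s0 (\<Theta> t))"
        unfolding \<omega>_def using sr[of "\<Theta> t"] r by (intro slope_mult ang k(1) qq) auto
      then show ?thesis using DERIV_chain2[OF c_deriv[OF s0 k(1) q] dT] by simp
    qed
    have "(\<gamma> has_vector_derivative vfield \<eta> \<epsilon> f g k (\<gamma> t)) (at t)"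
      unfolding \<gamma>_def by (rule pt_solution_derivative[OF k(1) sr(3,4) dS dT[unfolded \<omega>_def]])
    then show "(\<gamma> has_vector_derivative vfield \<eta> \<epsilon> f g k (\<gamma> t)) (at t within {0..T})"
      by (rule has_vector_derivative_at_within)
  qed
  have y: "ysec s > \<eta>" if "0 < s" "s < 1" for s using that eta by (simp add: ysec_def less_divide_eq)
  have e0: "\<gamma> 0 = (0, ysec s0)" using Tht[of 0] t0 c_0[OF s0] pt_section(1)[of s0] by (simp add: \<gamma>_def)
  have eT: "\<gamma> T = (0, ysec (c s0 (2 * pi)))" using Tht[of "2 * pi"] pt_section(2)[of "c s0 (2 * pi)"] by (simp add: \<gamma>_def T_def)
  have nosec: "\<gamma> t \<notin> {(x, y). x = 0 \<and> y > \<eta>}" if t: "t \<in> {0<..<T}" for t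
  proof
    assume "\<gamma> t \<in> {(x, y). x = 0 \<and> y > \<eta>}"
    then have "fst (\<gamma> t) = 0" "snd (\<gamma> t) > \<eta>" by auto
    moreover have ti: "t \<in> {0..T}" using t by auto
    ultimately have "\<Theta> t = 0 \<or> \<Theta> t = 2 * pi" unfolding \<gamma>_def by (intro section_angle[OF sr(3,4) Th(1,2)])
    then show False using Th(3)[OF ti] t t0 by (auto simp: T_def)
  qed
  have y0: "ysec s0 > \<eta>" by (rule y) (use s0 r in linarith)+
  have y1: "ysec (c s0 (2 * pi)) > \<eta>" by (rule y[OF sr(3,4)])
  have all: "\<forall>t\<in>{0<..<T}. \<gamma> t \<notin> {(x, y). x = 0 \<and> y > \<eta>}" by (rule ballI, rule nosec)
  have "\<exists>\<gamma> T. T > 0 \<and> sol \<gamma> {0..T} \<and> \<gamma> 0 = (0, ysec s0) \<and> \<gamma> T = (0, ysec (c s0 (2 * pi))) \<and>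
            (\<forall>t\<in>{0<..<T}. \<gamma> t \<notin> {(x, y). x = 0 \<and> y > \<eta>})"
    by (rule exI[of _ \<gamma>], rule exI[of _ T]) (intro conjI T sl e0 eT all)
  then show ?thesis unfolding first_return_def using y0 y1 by (intro conjI)
qed

text \<open>Any solution follows the curve. At the end of the turn it is on the section, and before
  it is not.\<close>

lemma first_return_unique:
  assumes s0: "lo - r < s0" "s0 < hi + r" and fr: "first_return \<eta> \<epsilon> f g (ysec s0) y1"
  shows "y1 = ysec (c s0 (2 * pi))"
proof -
  note fr' = fr[unfolded first_return_def]
  obtain \<gamma> T where gT: "T > 0 \<and> sol \<gamma> {0..T} \<and> \<gamma> 0 = (0, ysec s0) \<and> \<gamma> T = (0, y1) \<and>
    (\<forall>t\<in>{0<..<T}. \<gamma> t \<notin> {(x, y). x = 0 \<and> y > \<eta>})"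
    by (rule exE[OF fr'[THEN conjunct2, THEN conjunct2]], erule exE, rule that)
  have g: "T > 0" "sol \<gamma> {0..T}" "\<gamma> 0 = (0, ysec s0)" "\<gamma> T = (0, y1)" "y1 > \<eta>"
    using gT fr' by (simp_all only: simp_thms)
  have g6: "\<gamma> t \<notin> {(x, y). x = 0 \<and> y > \<eta>}" if "t \<in> {0<..<T}" for t
    using gT that by (elim conjE) (rule bspec)
  have st: "\<gamma> 0 = P (c s0 0) 0" using g(3) c_0[OF s0] pt_section(1) by simp
  have T0: "0 \<le> T" using g(1) by simp
  have p0: "(0::real) < 2 * pi" by simp
  obtain \<theta> w where w: "0 \<le> w" "w \<le> T" "continuous_on {0..w} \<theta>" "\<theta> 0 = 0"
    "\<And>t t'. 0 \<le> t \<Longrightarrow> t \<le> t' \<Longrightarrow> t' \<le> w \<Longrightarrow> \<theta> t' - \<theta> t \<ge> \<kappa> / 2 * (t' - t)"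
    "\<And>t. 0 \<le> t \<Longrightarrow> t \<le> w \<Longrightarrow> \<theta> t \<le> 2 * pi \<and> \<gamma> t = P (c s0 (\<theta> t)) (\<theta> t)"
    "\<theta> w = 2 * pi \<or> (w = T \<and> \<theta> w < 2 * pi)"
    by (rule follow[OF s0 T0 g(2) order_refl p0 st], rule that; assumption)
  show ?thesis
  proof (cases "\<theta> w = 2 * pi")
    case True
    have gw: "\<gamma> w = (0, ysec (c s0 (2 * pi)))" using w(6)[of w] w(1) True pt_section(2) by simp
    have "ysec (c s0 (2 * pi)) > \<eta>" using s_range(3,4)[OF s0, of "2 * pi"] eta by (simp add: ysec_def less_divide_eq)
    moreover have "w > 0" using w(1,4) True by (cases "w = 0") auto
    ultimately have "\<not> w < T" using g6[of w] gw by auto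
    then have "w = T" using w(2) by simp
    then show ?thesis using gw g(4) by simp
  next
    case False
    then have wT: "w = T" "\<theta> T < 2 * pi" using w(7) by auto
    have gT: "(0, y1) = P (c s0 (\<theta> T)) (\<theta> T)" using w(6)[of T] wT g(4) T0 by simp
    have "0 < \<kappa> / 2 * T" using kappa_pos g(1) by simp
    then have tp: "\<theta> T > 0" using w(5)[of 0 T] w(4) wT T0 by simp
    have "\<theta> T = 0 \<or> \<theta> T = 2 * pi"
      by (rule section_angle[OF s_range(3,4)[OF s0, of "\<theta> T"]]) (use tp wT gT[symmetric] g(5) in auto)
    then show ?thesis using tp wT by simp
  qed
qed

lemma displacement_eq:
  assumes s0: "lo - r < s0" "s0 < hi + r"
  shows "displacement \<eta> \<epsilon> f g (ysec s0) = ysec (c s0 (2 * pi)) - ysec s0"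
proof -
  have "(THE y'. first_return \<eta> \<epsilon> f g (ysec s0) y') = ysec (c s0 (2 * pi))"
    by (rule the_equality, rule first_return_exists[OF s0], rule first_return_unique[OF s0])
  then show ?thesis by (simp add: displacement_def)
qed

section \<open>Periodic orbits that meet the section\<close>

text \<open>The arc of radius \<open>c s' \<theta>\<close> at the angle \<open>\<theta> \<in> [0, 2\<pi>]\<close> and the piece of the section between its ends form a closed
  curve. This is its outside for \<open>\<sigma> = 1\<close> and its inside for \<open>\<sigma> = -1\<close>, with suitable boundary points. Points below
  \<open>y = \<eta>/2\<close> count as outside, since a solution about which nothing is known may be anywhere in the plane.\<close>

definition beyond :: "real \<Rightarrow> real \<Rightarrow> real \<times> real \<Rightarrow> bool" where
  "beyond \<sigma> s' p \<longleftrightarrow> (if snd p < \<eta> / 2 then \<sigma> > 0 else \<sigma> * (cmod (Z p) - c s' (Arg2pi (Z p))) \<ge> 0)"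

lemma beyond_pt:
  assumes "lo - 2 * r < s" "s < hi + 2 * r" "0 \<le> \<phi>" "\<phi> < 2 * pi"
  shows "beyond \<sigma> s' (P s \<phi>) \<longleftrightarrow> \<sigma> * (s - c s' \<phi>) \<ge> 0"
proof -
  have sp: "s > 0" using assms r by linarith
  have "Arg2pi (Z (P s \<phi>)) = \<phi>"
    by (rule Arg2pi_unique[OF _ sp assms(3,4)]) (simp add: pt_tube(3)[OF assms(1,2)] cis_conv_exp)
  moreover have "\<not> snd (P s \<phi>) < \<eta> / 2" using pt_tube(1)[OF assms(1,2), of \<phi>] by (auto simp: tube_def)
  ultimately show ?thesis unfolding beyond_def by (simp add: pt_tube(2)[OF assms(1,2)])
qed

text \<open>The spiral arc with initial radius \<open>s'\<close> cannot be crossed by solutions, since it is a solution. On the section all solutions cross in the direction of increasing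
  angle, so the radius is compared with the end of the arc just before the crossing and with its
  beginning afterwards; when the arc drifts in the direction \<open>\<sigma>\<close>, this can only lead into the side
  \<open>\<sigma>\<close>. The set of times with
  \<open>beyond\<close> is therefore closed under limits from the left and open to the right.\<close>

lemma no_return:
  assumes s': "lo - r < s'" "s' < hi + r" and sg: "\<bar>\<sigma>\<bar> = 1" "\<sigma> * (c s' (2 * pi) - s') > 0"
    and sl: "sol \<gamma> UNIV" and t12: "t1 < t2"
  assumes N1: "beyond \<sigma> s' (\<gamma> t1)"
  shows "beyond \<sigma> s' (\<gamma> t2)"
proof -
  define A B where "A = lo - 2 * r + r / 2" and "B = hi + 2 * r - r / 2"
  have cAB: "A \<le> c s' \<phi>" "c s' \<phi> \<le> B" for \<phi> using c_range[OF s', of \<phi>] by (auto simp: A_def B_def)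
  have AB: "0 < A" "B < 1" "lo - 2 * r < A" "B < hi + 2 * r" using r by (auto simp: A_def B_def)
  have s0: "\<sigma> \<noteq> 0" using sg(1) by auto
  have gc: "continuous_on UNIV \<gamma>" using sl by (simp add: pw_solution_def)
  have half: "cmod (Z p) \<ge> 1" if "snd p = \<eta> / 2" for p
  proof -
    have "Re (Z p) = -1" unfolding zeta_def that using eta by simp
    then show ?thesis using abs_Re_le_cmod[of "Z p"] by simp
  qed
  (* Outside the tube the side is constant: outwards of it and inwards of it. *)
  define U1 where "U1 = {p. snd p < \<eta> / 2} \<union> {p. snd p > 0 \<and> cmod (Z p) > B}"
  define U2 where "U2 = {p. snd p > \<eta> / 2 \<and> cmod (Z p) < A}"
  have czp: "continuous_on {p. snd p > 0} (\<lambda>p. cmod (Z p))" by (intro continuous_on_norm zeta_continuous)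
  have opos: "open {p :: real \<times> real. snd p > u}" for u by (intro open_Collect_less continuous_intros)
  have U1: "open U1"
  proof -
    have "open ({p. snd p > 0} \<inter> (\<lambda>p. cmod (Z p)) -` {B<..})"
      by (rule continuous_open_preimage[OF czp opos open_greaterThan])
    moreover have "{p. snd p > 0} \<inter> (\<lambda>p. cmod (Z p)) -` {B<..} = {p. snd p > 0 \<and> cmod (Z p) > B}" by auto
    moreover have "open {p :: real \<times> real. snd p < \<eta> / 2}" by (intro open_Collect_less continuous_intros)
    ultimately show ?thesis unfolding U1_def by auto
  qed
  have U2: "open U2"
  proof -
    have "open ({p. snd p > \<eta> / 2} \<inter> (\<lambda>p. cmod (Z p)) -` {..<A})"
      by (rule continuous_open_preimage[OF continuous_on_subset[OF czp] opos open_lessThan]) (use eta in auto)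
    moreover have "{p. snd p > \<eta> / 2} \<inter> (\<lambda>p. cmod (Z p)) -` {..<A} = U2" by (auto simp: U2_def)
    ultimately show ?thesis by simp
  qed
  have NU1: "beyond \<sigma> s' p \<longleftrightarrow> \<sigma> > 0" if "p \<in> U1" for p
    using that cAB(2)[of "Arg2pi (Z p)"] s0 unfolding beyond_def U1_def
    by (auto simp: zero_le_mult_iff)
  have NU2: "beyond \<sigma> s' p \<longleftrightarrow> \<sigma> < 0" if "p \<in> U2" for p
    using that cAB(1)[of "Arg2pi (Z p)"] s0 unfolding beyond_def U2_def
    by (auto simp: zero_le_mult_iff)
  have near: "\<exists>d>0. \<forall>t. \<bar>t - s\<bar> < d \<longrightarrow> \<gamma> t \<in> U" if "open U" "\<gamma> s \<in> U" for U s
  proof -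
    have "open (\<gamma> -` U)" using gc that(1) by (simp add: continuous_on_open_vimage)
    moreover have "s \<in> \<gamma> -` U" using that by simp
    ultimately obtain d where "d > 0" "ball s d \<subseteq> \<gamma> -` U" using openE by blast
    then show ?thesis by (intro exI[of _ d]) (auto simp: dist_real_def abs_minus_commute subset_iff)
  qed
  have constN: "\<exists>d>0. \<forall>t. \<bar>t - s\<bar> < d \<longrightarrow> (beyond \<sigma> s' (\<gamma> t) \<longleftrightarrow> beyond \<sigma> s' (\<gamma> s))" if "\<gamma> s \<in> U1 \<or> \<gamma> s \<in> U2" for s
    using that
  proof
    assume u: "\<gamma> s \<in> U1"
    from near[OF U1 u] obtain d where d: "d > 0" "\<forall>t. \<bar>t - s\<bar> < d \<longrightarrow> \<gamma> t \<in> U1" by (elim exE conjE)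
    show ?thesis using d NU1[OF u] NU1 by (intro exI[of _ d]) simp
  next
    assume u: "\<gamma> s \<in> U2"
    from near[OF U2 u] obtain d where d: "d > 0" "\<forall>t. \<bar>t - s\<bar> < d \<longrightarrow> \<gamma> t \<in> U2" by (elim exE conjE)
    show ?thesis using d NU2[OF u] NU2 by (intro exI[of _ d]) simp
  qed
  have cases3: "p \<in> U1 \<or> p \<in> U2 \<or> (p \<in> tube \<and> snd p > \<eta> / 2)" for p
  proof (cases "p \<in> U1 \<or> p \<in> U2")
    case False
    then have 1: "snd p \<ge> \<eta> / 2" "cmod (Z p) \<le> B" using eta unfolding U1_def by auto
    have "snd p \<noteq> \<eta> / 2" using half[of p] 1(2) AB(2) by auto
    with 1 have 2: "snd p > \<eta> / 2" by simp
    then have "cmod (Z p) \<ge> A" using False unfolding U2_def by auto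
    then show ?thesis using 1 2 AB unfolding tube_def by auto
  qed blast
  have tubeN: "beyond \<sigma> s' p \<longleftrightarrow> \<sigma> * (cmod (Z p) - c s' (Arg2pi (Z p))) \<ge> 0" if "p \<in> tube" for p
    using that unfolding beyond_def tube_def by auto
  (* A local angle lift, with the comparison along it as long as the angle stays within one turn. *)
  define lift where "lift s d \<phi> \<theta> \<longleftrightarrow> continuous_on {s - d..s + d} \<theta> \<and> \<theta> s = \<phi> \<and>
        (\<forall>t\<in>{s - d..s + d}. \<gamma> t \<in> tube \<and> \<gamma> t = P (cmod (Z (\<gamma> t))) (\<theta> t)) \<and>
        (\<forall>u v. s - d \<le> u \<longrightarrow> u \<le> v \<longrightarrow> v \<le> s + d \<longrightarrow> \<theta> v - \<theta> u \<ge> \<kappa> / 2 * (v - u)) \<and>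
        (\<forall>u v. s - d \<le> u \<longrightarrow> u \<le> v \<longrightarrow> v \<le> s + d \<longrightarrow> 0 \<le> \<theta> u \<longrightarrow> \<theta> v \<le> 2 * pi \<longrightarrow>
           \<sigma> * (cmod (Z (\<gamma> u)) - c s' (\<theta> u)) \<ge> 0 \<longrightarrow> \<sigma> * (cmod (Z (\<gamma> v)) - c s' (\<theta> v)) \<ge> 0)" for s d \<phi> \<theta>
  have lifts: "\<exists>d>0. \<forall>\<phi>. Z (\<gamma> s) = of_real (cmod (Z (\<gamma> s))) * cis \<phi> \<longrightarrow> (\<exists>\<theta>. lift s d \<phi> \<theta>)"
    if s: "\<gamma> s \<in> tube" for s
  proof -
    obtain d0 where d0': "d0 > 0" "\<forall>t. \<bar>t - s\<bar> < d0 \<longrightarrow> \<gamma> t \<in> tube" using near[OF tube_open s] by (elim exE conjE)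
    note d0 = d0'(1) d0'(2)[rule_format]
    define d where "d = d0 / 2"
    have d: "d > 0" "\<And>t. t \<in> {s - d..s + d} \<Longrightarrow> \<gamma> t \<in> tube" using d0(1) by (auto simp: d_def intro!: d0(2))
    have sd: "s - d \<le> s + d" "s \<in> {s - d..s + d}" using d(1) by auto
    have sl': "sol \<gamma> {s - d..s + d}" by (rule pw_solution_subset[OF sl]) simp
    show ?thesis
    proof (intro exI[of _ d] conjI allI impI d(1))
      fix \<phi> assume phi: "Z (\<gamma> s) = of_real (cmod (Z (\<gamma> s))) * cis \<phi>"
      obtain \<theta> F where th: "continuous_on {s - d..s + d} \<theta>" "\<theta> s = \<phi>" "\<And>t. t \<in> {s - d..s + d} \<Longrightarrow> \<gamma> t = P (cmod (Z (\<gamma> t))) (\<theta> t)"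
        "finite F" "\<And>t. t \<in> {s - d<..<s + d} - F \<Longrightarrow> \<exists>k\<in>{1..4}. \<gamma> t \<in> quadrant \<eta> k \<and>
         (\<theta> has_real_derivative \<kappa> + \<epsilon> * J k (\<theta> t) (cmod (Z (\<gamma> t))) / cmod (Z (\<gamma> t))) (at t) \<and>
         ((\<lambda>t. cmod (Z (\<gamma> t))) has_real_derivative \<epsilon> * G k (\<theta> t) (cmod (Z (\<gamma> t)))) (at t)"
        by (rule polar_lift[OF sd(1) sl' tube_pos[OF d(2)] sd(2) phi], assumption, rule that; assumption)
      have inc: "\<theta> v - \<theta> u \<ge> \<kappa> / 2 * (v - u)" if uv: "s - d \<le> u" "u \<le> v" "v \<le> s + d" for u v
      proof (rule angle_increasing[OF uv(2) _ th(4), where \<gamma> = \<gamma>])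
        show "continuous_on {u..v} \<theta>" using th(1) by (rule continuous_on_subset) (use uv in auto)
        show "\<exists>k\<in>{1..4}. \<gamma> x \<in> quadrant \<eta> k \<and>
          (\<theta> has_real_derivative \<kappa> + \<epsilon> * J k (\<theta> x) (cmod (Z (\<gamma> x))) / cmod (Z (\<gamma> x))) (at x)"
          if "x \<in> {u<..<v} - F" for x using th(5)[of x] that uv by auto
      qed (use th(3) d(2) tube_pos uv in auto)
      have mono: "\<theta> u \<le> \<theta> v" if "s - d \<le> u" "u \<le> v" "v \<le> s + d" for u v
      proof -
        have "0 \<le> \<kappa> / 2 * (v - u)" using that kappa_pos by simp
        then show ?thesis using inc[OF that] by linarith
      qed
      have Sc: "continuous_on {s - d..s + d} (\<lambda>t. cmod (Z (\<gamma> t)))" using cmod_Z_continuous[OF sl'] d(2) tube_pos by blast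
      have cmp: "\<sigma> * (cmod (Z (\<gamma> v)) - c s' (\<theta> v)) \<ge> 0"
        if uv: "s - d \<le> u" "u \<le> v" "v \<le> s + d" and b: "0 \<le> \<theta> u" "\<theta> v \<le> 2 * pi"
          and st: "\<sigma> * (cmod (Z (\<gamma> u)) - c s' (\<theta> u)) \<ge> 0" for u v
      proof (rule comparison[where \<gamma> = \<gamma> and \<theta> = \<theta> and u = u and v = v and \<sigma> = \<sigma>, OF s' uv(2) _ _ th(4) _ _ _ _ sg(1) st])
        have sub: "{u..v} \<subseteq> {s - d..s + d}" using uv by auto
        show "continuous_on {u..v} \<theta>" "continuous_on {u..v} (\<lambda>t. cmod (Z (\<gamma> t)))"
          using th(1) Sc sub continuous_on_subset by blast+
        show "0 \<le> \<theta> x \<and> \<theta> x \<le> 2 * pi" if "x \<in> {u..v}" for x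
          using mono[of u x] mono[of x v] that uv b by auto
        fix x assume x: "x \<in> {u..v}"
        then have xi: "x \<in> {s - d..s + d}" using sub by (rule set_rev_mp)
        show "\<gamma> x = P (cmod (Z (\<gamma> x))) (\<theta> x)" by (rule th(3)[OF xi])
        show "lo - 2 * r < cmod (Z (\<gamma> x)) \<and> cmod (Z (\<gamma> x)) < hi + 2 * r" using tube_pos[OF d(2)[OF xi]] by (rule conjunct2)
      next
        fix x assume "x \<in> {u<..<v} - F"
        then have "x \<in> {s - d<..<s + d} - F" using uv by auto
        from th(5)[OF this] show "\<exists>k\<in>{1..4}. \<gamma> x \<in> quadrant \<eta> k \<and>
          (\<theta> has_real_derivative \<kappa> + \<epsilon> * J k (\<theta> x) (cmod (Z (\<gamma> x))) / cmod (Z (\<gamma> x))) (at x) \<and>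
          ((\<lambda>t. cmod (Z (\<gamma> t))) has_real_derivative \<epsilon> * G k (\<theta> x) (cmod (Z (\<gamma> x)))) (at x)" .
      qed
      show "\<exists>\<theta>. lift s d \<phi> \<theta>" unfolding lift_def
      proof (rule exI[of _ \<theta>], intro conjI)
        show "continuous_on {s - d..s + d} \<theta>" "\<theta> s = \<phi>" by (fact th(1), fact th(2))
        show "\<forall>t\<in>{s - d..s + d}. \<gamma> t \<in> tube \<and> \<gamma> t = P (cmod (Z (\<gamma> t))) (\<theta> t)"
          by (rule ballI, rule conjI, erule d(2), erule th(3))
        show "\<forall>u v. s - d \<le> u \<longrightarrow> u \<le> v \<longrightarrow> v \<le> s + d \<longrightarrow> \<theta> v - \<theta> u \<ge> \<kappa> / 2 * (v - u)"
          by (rule allI, rule allI, rule impI, rule impI, rule impI, rule inc)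
        show "\<forall>u v. s - d \<le> u \<longrightarrow> u \<le> v \<longrightarrow> v \<le> s + d \<longrightarrow> 0 \<le> \<theta> u \<longrightarrow> \<theta> v \<le> 2 * pi \<longrightarrow>
           \<sigma> * (cmod (Z (\<gamma> u)) - c s' (\<theta> u)) \<ge> 0 \<longrightarrow> \<sigma> * (cmod (Z (\<gamma> v)) - c s' (\<theta> v)) \<ge> 0"
          by (rule allI, rule allI, rule impI, rule impI, rule impI, rule impI, rule impI, rule impI, rule cmp)
      qed
    qed
  qed
  have argp: "Z p = of_real (cmod (Z p)) * cis (Arg2pi (Z p))" for p
    using Arg2pi_eq[of "Z p"] by (simp add: cis_conv_exp)
  have forward: "\<exists>d>0. \<forall>t. s < t \<and> t < s + d \<longrightarrow> beyond \<sigma> s' (\<gamma> t)" if Ns: "beyond \<sigma> s' (\<gamma> s)" for s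
  proof (cases "\<gamma> s \<in> U1 \<or> \<gamma> s \<in> U2")
    case True
    from constN[OF this] obtain d where d: "d > 0" "\<forall>t. \<bar>t - s\<bar> < d \<longrightarrow> (beyond \<sigma> s' (\<gamma> t) \<longleftrightarrow> beyond \<sigma> s' (\<gamma> s))" by (elim exE conjE)
    have "beyond \<sigma> s' (\<gamma> t)" if "s < t" "t < s + d" for t using d(2)[rule_format, of t] that Ns by simp
    then show ?thesis using d(1) by (intro exI[of _ d]) simp
  next
    case False
    then have ts: "\<gamma> s \<in> tube" using cases3 by blast
    define \<phi> where "\<phi> = Arg2pi (Z (\<gamma> s))"
    have phi: "0 \<le> \<phi>" "\<phi> < 2 * pi" using Arg2pi by (auto simp: \<phi>_def)
    obtain d where d1: "d > 0" and ex: "\<forall>\<phi>. Z (\<gamma> s) = of_real (cmod (Z (\<gamma> s))) * cis \<phi> \<longrightarrow> (\<exists>\<theta>. lift s d \<phi> \<theta>)"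
      using lifts[OF ts] by (elim exE conjE)
    obtain \<theta> where L: "lift s d \<phi> \<theta>" using ex[rule_format, OF argp[of "\<gamma> s", folded \<phi>_def]] by (elim exE)
    note LL = L[unfolded lift_def]
    have d: "d > 0" "continuous_on {s - d..s + d} \<theta>" "\<theta> s = \<phi>"
      "\<And>t. t \<in> {s - d..s + d} \<Longrightarrow> \<gamma> t \<in> tube \<and> \<gamma> t = P (cmod (Z (\<gamma> t))) (\<theta> t)"
      "\<And>u v. s - d \<le> u \<Longrightarrow> u \<le> v \<Longrightarrow> v \<le> s + d \<Longrightarrow> \<theta> v - \<theta> u \<ge> \<kappa> / 2 * (v - u)"
      "\<And>u v. s - d \<le> u \<Longrightarrow> u \<le> v \<Longrightarrow> v \<le> s + d \<Longrightarrow> 0 \<le> \<theta> u \<Longrightarrow> \<theta> v \<le> 2 * pi \<Longrightarrow>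
           \<sigma> * (cmod (Z (\<gamma> u)) - c s' (\<theta> u)) \<ge> 0 \<Longrightarrow> \<sigma> * (cmod (Z (\<gamma> v)) - c s' (\<theta> v)) \<ge> 0"
      by (rule d1, rule LL[THEN conjunct1], rule LL[THEN conjunct2, THEN conjunct1],
          erule LL[THEN conjunct2, THEN conjunct2, THEN conjunct1, rule_format],
          erule (2) LL[THEN conjunct2, THEN conjunct2, THEN conjunct2, THEN conjunct1, rule_format],
          erule (5) LL[THEN conjunct2, THEN conjunct2, THEN conjunct2, THEN conjunct2, rule_format])
    have "continuous (at s within {s - d..s + d}) \<theta>" using d(1,2) by (simp add: continuous_on_eq_continuous_within)
    then obtain e where e: "e > 0" "\<And>t. t \<in> {s - d..s + d} \<Longrightarrow> dist t s < e \<Longrightarrow> dist (\<theta> t) (\<theta> s) < 2 * pi - \<phi>"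
      unfolding continuous_within_eps_delta by (elim allE[of _ "2 * pi - \<phi>"]) (use phi in auto)
    have "beyond \<sigma> s' (\<gamma> t)" if t: "s < t" "t < s + min d e" for t
    proof -
      have ti: "t \<in> {s - d..s + d}" using t d(1) by auto
      have "dist (\<theta> t) (\<theta> s) < 2 * pi - \<phi>" using e(2)[OF ti] t by (simp add: dist_real_def)
      then have t2: "\<theta> t < 2 * pi" using d(3) by (simp add: dist_real_def)
      have "0 \<le> \<kappa> / 2 * (t - s)" using t kappa_pos by simp
      then have t1: "\<phi> \<le> \<theta> t" using d(5)[of s t] d(1,3) ti t by simp
      have "\<sigma> * (cmod (Z (\<gamma> s)) - c s' (\<theta> s)) \<ge> 0" using Ns tubeN[OF ts] by (simp add: d(3) \<phi>_def)
      then have "\<sigma> * (cmod (Z (\<gamma> t)) - c s' (\<theta> t)) \<ge> 0" using d(6)[of s t] d(1,3) ti t t2 phi by auto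
      moreover have "beyond \<sigma> s' (P (cmod (Z (\<gamma> t))) (\<theta> t)) \<longleftrightarrow> \<sigma> * (cmod (Z (\<gamma> t)) - c s' (\<theta> t)) \<ge> 0"
        by (rule beyond_pt) (use tube_pos[of "\<gamma> t"] d(4)[OF ti] t1 t2 phi in auto)
      ultimately show ?thesis using d(4)[OF ti] by simp
    qed
    then show ?thesis using d(1) e(1) by (intro exI[of _ "min d e"]) auto
  qed
  have left: "beyond \<sigma> s' (\<gamma> s)" if acc: "\<And>d. d > 0 \<Longrightarrow> \<exists>t. s - d < t \<and> t < s \<and> beyond \<sigma> s' (\<gamma> t)" for s
  proof (cases "\<gamma> s \<in> U1 \<or> \<gamma> s \<in> U2")
    case True
    from constN[OF this] obtain d where d: "d > 0" "\<forall>t. \<bar>t - s\<bar> < d \<longrightarrow> (beyond \<sigma> s' (\<gamma> t) \<longleftrightarrow> beyond \<sigma> s' (\<gamma> s))" by (elim exE conjE)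
    obtain t where "s - d < t" "t < s" "beyond \<sigma> s' (\<gamma> t)" using acc[OF d(1)] by (elim exE conjE)
    then show ?thesis using d(2)[rule_format, of t] by simp
  next
    case False
    then have ts: "\<gamma> s \<in> tube" using cases3 by blast
    define \<phi> where "\<phi> = Arg2pi (Z (\<gamma> s))"
    (* Approaching the section from the past the angle tends to a full turn, not to zero. *)
    define \<phi>' where "\<phi>' = (if \<phi> = 0 then 2 * pi else \<phi>)"
    have phi: "0 \<le> \<phi>" "\<phi> < 2 * pi" using Arg2pi by (auto simp: \<phi>_def)
    have phi': "0 < \<phi>'" "\<phi>' \<le> 2 * pi" using phi by (auto simp: \<phi>'_def)
    have "cis \<phi>' = cis \<phi>" by (simp add: \<phi>'_def)
    then have zphi: "Z (\<gamma> s) = of_real (cmod (Z (\<gamma> s))) * cis \<phi>'" using argp[of "\<gamma> s"] by (simp add: \<phi>_def)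
    obtain d where d1: "d > 0" and ex: "\<forall>\<phi>. Z (\<gamma> s) = of_real (cmod (Z (\<gamma> s))) * cis \<phi> \<longrightarrow> (\<exists>\<theta>. lift s d \<phi> \<theta>)"
      using lifts[OF ts] by (elim exE conjE)
    obtain \<theta> where L: "lift s d \<phi>' \<theta>" using ex[rule_format, OF zphi] by (elim exE)
    note LL = L[unfolded lift_def]
    have d: "d > 0" "continuous_on {s - d..s + d} \<theta>" "\<theta> s = \<phi>'"
      "\<And>t. t \<in> {s - d..s + d} \<Longrightarrow> \<gamma> t \<in> tube \<and> \<gamma> t = P (cmod (Z (\<gamma> t))) (\<theta> t)"
      "\<And>u v. s - d \<le> u \<Longrightarrow> u \<le> v \<Longrightarrow> v \<le> s + d \<Longrightarrow> \<theta> v - \<theta> u \<ge> \<kappa> / 2 * (v - u)"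
      "\<And>u v. s - d \<le> u \<Longrightarrow> u \<le> v \<Longrightarrow> v \<le> s + d \<Longrightarrow> 0 \<le> \<theta> u \<Longrightarrow> \<theta> v \<le> 2 * pi \<Longrightarrow>
           \<sigma> * (cmod (Z (\<gamma> u)) - c s' (\<theta> u)) \<ge> 0 \<Longrightarrow> \<sigma> * (cmod (Z (\<gamma> v)) - c s' (\<theta> v)) \<ge> 0"
      by (rule d1, rule LL[THEN conjunct1], rule LL[THEN conjunct2, THEN conjunct1],
          erule LL[THEN conjunct2, THEN conjunct2, THEN conjunct1, rule_format],
          erule (2) LL[THEN conjunct2, THEN conjunct2, THEN conjunct2, THEN conjunct1, rule_format],
          erule (5) LL[THEN conjunct2, THEN conjunct2, THEN conjunct2, THEN conjunct2, rule_format])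
    have "continuous (at s within {s - d..s + d}) \<theta>" using d(1,2) by (simp add: continuous_on_eq_continuous_within)
    then obtain e where e: "e > 0" "\<And>t. t \<in> {s - d..s + d} \<Longrightarrow> dist t s < e \<Longrightarrow> dist (\<theta> t) (\<theta> s) < \<phi>'"
      unfolding continuous_within_eps_delta by (elim allE[of _ "\<phi>'"]) (use phi' in auto)
    have "min d e > 0" using d(1) e(1) by simp
    from acc[OF this] obtain t where t: "s - min d e < t" "t < s" "beyond \<sigma> s' (\<gamma> t)" by (elim exE conjE)
    have ti: "t \<in> {s - d..s + d}" using t d(1) by auto
    have "dist (\<theta> t) (\<theta> s) < \<phi>'" using e(2)[OF ti] t by (simp add: dist_real_def)
    then have t1: "\<theta> t > 0" using d(3) by (simp add: dist_real_def)
    have "0 < \<kappa> / 2 * (s - t)" using t kappa_pos by simp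
    then have t2: "\<theta> t < 2 * pi" using d(5)[of t s] d(1,3) ti t phi' by simp
    have "beyond \<sigma> s' (P (cmod (Z (\<gamma> t))) (\<theta> t)) \<longleftrightarrow> \<sigma> * (cmod (Z (\<gamma> t)) - c s' (\<theta> t)) \<ge> 0"
      by (rule beyond_pt) (use tube_pos[of "\<gamma> t"] d(4)[OF ti] t1 t2 in auto)
    then have "\<sigma> * (cmod (Z (\<gamma> t)) - c s' (\<theta> t)) \<ge> 0" using t(3) d(4)[OF ti] by simp
    then have fin: "\<sigma> * (cmod (Z (\<gamma> s)) - c s' \<phi>') \<ge> 0" using d(6)[of t s] d(1,3) ti t t1 phi' by auto
    show ?thesis
    proof (cases "\<phi> = 0")
      case True
      have "c s' 0 = s'" by (rule c_0[OF s'])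
      then have "\<sigma> * (cmod (Z (\<gamma> s)) - c s' 0) = \<sigma> * (cmod (Z (\<gamma> s)) - c s' (2 * pi)) + \<sigma> * (c s' (2 * pi) - s')"
        by (simp add: algebra_simps)
      also have "\<dots> \<ge> 0" using fin sg(2) True by (simp add: \<phi>'_def)
      finally show ?thesis using tubeN[OF ts] True by (simp add: \<phi>_def)
    next
      case False
      then show ?thesis using fin tubeN[OF ts] by (simp add: \<phi>'_def \<phi>_def)
    qed
  qed
  (* A supremum argument: the property cannot get lost at the last time at which it holds. *)
  define Bs where "Bs = {t. t1 \<le> t \<and> t \<le> t2 \<and> beyond \<sigma> s' (\<gamma> t)}"
  have t1B: "t1 \<in> Bs" using t12 N1 by (simp add: Bs_def)
  have ne: "Bs \<noteq> {}" using t1B by auto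
  have ub: "t \<le> t2" if "t \<in> Bs" for t using that by (simp add: Bs_def)
  have bdd: "bdd_above Bs" using ub by (rule bdd_aboveI)
  define m where "m = Sup Bs"
  have m: "t1 \<le> m" "m \<le> t2" unfolding m_def using cSup_upper[OF t1B bdd] cSup_least[OF ne ub] by auto
  have Nm: "beyond \<sigma> s' (\<gamma> m)"
  proof (cases "m \<in> Bs")
    case True then show ?thesis by (simp add: Bs_def)
  next
    case False
    show ?thesis
    proof (rule left)
      fix d :: real assume "d > 0"
      then have "m - d < Sup Bs" by (simp add: m_def)
      from less_cSupD[OF ne this] obtain t where t: "t \<in> Bs" "m - d < t" by blast
      have "t \<le> m" unfolding m_def by (rule cSup_upper[OF t(1) bdd])
      then have "t < m" using False t(1) by (cases "t = m") auto
      then show "\<exists>t. m - d < t \<and> t < m \<and> beyond \<sigma> s' (\<gamma> t)" using t by (auto simp: Bs_def)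
    qed
  qed
  show ?thesis
  proof (cases "m = t2")
    case True then show ?thesis using Nm by simp
  next
    case False
    then have mlt: "m < t2" using m by simp
    obtain d where d': "d > 0" "\<forall>t. m < t \<and> t < m + d \<longrightarrow> beyond \<sigma> s' (\<gamma> t)" using forward[OF Nm] by (elim exE conjE)
    note d = d'(1) d'(2)[rule_format, OF conjI]
    define x where "x = min t2 (m + d / 2)"
    have x: "m < x" "x \<le> t2" "x < m + d" using mlt d by (auto simp: x_def)
    have "x \<in> Bs" using x m d(2)[OF x(1,3)] by (simp add: Bs_def)
    then have "x \<le> m" unfolding m_def by (rule cSup_upper[OF _ bdd])
    then show ?thesis using x by simp
  qed
qed

abbreviation "loop s0 \<equiv> (\<lambda>\<phi>. P (c s0 \<phi>) \<phi>) ` {0..2 * pi}"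

lemma loop_compact:
  assumes "lo - r < s0" "s0 < hi + r"
  shows "compact (loop s0)"
proof -
  have nz: "dn \<phi> (c s0 \<phi>) \<noteq> 0" for \<phi> using dn_real[OF s_range(3,4)[OF assms, of \<phi>], of \<phi>] by simp
  have cc: "continuous_on {0..2 * pi} (c s0)" using continuous_on_subset[OF c_cont[OF assms]] by blast
  show ?thesis unfolding pt_def
    by (intro compact_continuous_image compact_Icc continuous_on_Pair px_continuous py_continuous continuous_on_id cc nz)
qed

text \<open>A closed curve is a graph over the angle, so it meets the section once.\<close>

lemma loop_section:
  assumes "lo - r < s0" "s0 < hi + r" "c s0 (2 * pi) = s0" "(0, y) \<in> loop s0" "y > \<eta>"
  shows "y = ysec s0"
proof -
  obtain \<phi> where phi: "0 \<le> \<phi>" "\<phi> \<le> 2 * pi" "P (c s0 \<phi>) \<phi> = (0, y)" using assms(4) by auto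
  have "\<phi> = 0 \<or> \<phi> = 2 * pi"
    by (rule section_angle[OF s_range(3,4)[OF assms(1,2), of \<phi>] phi(1,2)]) (use phi(3) assms(5) in auto)
  then have "P s0 0 = (0, y)"
  proof
    assume "\<phi> = 0" then show ?thesis using phi(3) c_0[OF assms(1,2)] by simp
  next
    assume "\<phi> = 2 * pi" then show ?thesis using phi(3) assms(3) pt_section[of s0] by simp
  qed
  then show ?thesis using pt_section(1)[of s0] by simp
qed

text \<open>The angular speed is at least \<open>\<kappa>/2\<close>, so that a turn is completed within time \<open>4\<pi>/\<kappa>\<close>.\<close>

lemma revolution:
  assumes s0: "lo - r < s0" "s0 < hi + r" and sl: "sol \<gamma> UNIV" and t0: "\<gamma> t0 = (0, ysec s0)"
  obtains w \<theta> where "t0 \<le> w" "continuous_on {t0..w} \<theta>" "\<theta> t0 = 0" "\<theta> w = 2 * pi"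
    "\<And>t. t0 \<le> t \<Longrightarrow> t \<le> w \<Longrightarrow> \<gamma> t = P (c s0 (\<theta> t)) (\<theta> t)"
proof -
  define V where "V = 4 * pi / \<kappa>"
  have V: "V > 0" "\<kappa> / 2 * V = 2 * pi" using kappa_pos by (auto simp: V_def)
  have st: "\<gamma> t0 = P (c s0 0) 0" using t0 c_0[OF s0] pt_section(1)[of s0] by simp
  have le: "t0 \<le> t0 + V" using V by simp
  have p0: "(0::real) < 2 * pi" by simp
  have sl': "sol \<gamma> {t0..t0 + V}" by (rule pw_solution_subset[OF sl]) simp
  obtain \<theta> w where w: "t0 \<le> w" "w \<le> t0 + V" "continuous_on {t0..w} \<theta>" "\<theta> t0 = 0"
    "\<And>t t'. t0 \<le> t \<Longrightarrow> t \<le> t' \<Longrightarrow> t' \<le> w \<Longrightarrow> \<theta> t' - \<theta> t \<ge> \<kappa> / 2 * (t' - t)"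
    "\<And>t. t0 \<le> t \<Longrightarrow> t \<le> w \<Longrightarrow> \<theta> t \<le> 2 * pi \<and> \<gamma> t = P (c s0 (\<theta> t)) (\<theta> t)"
    "\<theta> w = 2 * pi \<or> (w = t0 + V \<and> \<theta> w < 2 * pi)"
    by (rule follow[OF s0 le sl' order_refl p0 st], rule that; assumption)
  have "\<theta> w = 2 * pi" using w(5)[OF order_refl w(1) order_refl] w(4,7) V by auto
  then show ?thesis using w by (intro that[of w \<theta>]) auto
qed

text \<open>If the radius changed from \<open>s0\<close> to \<open>s1\<close> during the first turn, an intermediate radius \<open>s'\<close> close to \<open>s0\<close> would drift in the
  same direction; by \<open>no_return\<close> the orbit could not get back from \<open>s1\<close> to \<open>s0\<close>, as it must by periodicity.
  Hence the curve closes up; the orbit runs through all of it, and never leaves it.\<close>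

lemma periodic_orbit_loop:
  assumes per: "pw_periodic_orbit \<eta> \<epsilon> f g \<Gamma>" and on: "(0, ysec s0) \<in> \<Gamma>" and s0: "lo - r < s0" "s0 < hi + r"
  shows "c s0 (2 * pi) = s0" "\<Gamma> = loop s0"
proof -
  obtain \<gamma> T where g: "sol \<gamma> UNIV" "T > 0" "\<forall>t. \<gamma> (t + T) = \<gamma> t" "\<Gamma> = range \<gamma>"
    using per unfolding pw_periodic_orbit_def by (elim exE conjE)
  have rep: "\<gamma> (t + real m * T) = \<gamma> t" for t m
  proof (induction m)
    case (Suc m)
    have "t + real (Suc m) * T = (t + real m * T) + T" by (simp add: algebra_simps)
    then have "\<gamma> (t + real (Suc m) * T) = \<gamma> (t + real m * T)" using g(3) by (simp only:)
    then show ?case using Suc by simp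
  qed simp
  have late: "\<exists>m. t' < t + real m * T" for t t'
  proof -
    obtain m where "(t' - t) / T < real m" using reals_Archimedean2 by blast
    then show ?thesis using g(2) by (intro exI[of _ m]) (simp add: field_simps)
  qed
  obtain t0 where t0: "\<gamma> t0 = (0, ysec s0)" using on g(4) by auto
  obtain w \<theta> where w: "t0 \<le> w" "continuous_on {t0..w} \<theta>" "\<theta> t0 = 0" "\<theta> w = 2 * pi"
    "\<And>t. t0 \<le> t \<Longrightarrow> t \<le> w \<Longrightarrow> \<gamma> t = P (c s0 (\<theta> t)) (\<theta> t)"
    by (rule revolution[OF s0 g(1) t0], rule that; assumption)
  define s1 where "s1 = c s0 (2 * pi)"
  have gw: "\<gamma> w = P s1 0" using w(5)[OF w(1) order_refl] w(4) pt_section[of s1] by (simp add: s1_def)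
  have gt0: "\<gamma> t0 = P s0 0" using t0 pt_section(1)[of s0] by simp
  have s0r: "lo - 2 * r < s0" "s0 < hi + 2 * r" using s0 r by linarith+
  have s1r: "lo - 2 * r < s1" "s1 < hi + 2 * r" using s_range[OF s0] by (auto simp: s1_def)
  show closed: "c s0 (2 * pi) = s0"
  proof (rule ccontr)
    assume "c s0 (2 * pi) \<noteq> s0"
    define \<sigma> where "\<sigma> = sgn (s1 - s0)"
    have sg: "\<bar>\<sigma>\<bar> = 1" "\<sigma> * (s1 - s0) = \<bar>s1 - s0\<bar>" "\<bar>s1 - s0\<bar> > 0" "\<sigma> * \<sigma> = 1"
      using \<open>c s0 (2 * pi) \<noteq> s0\<close> by (auto simp: \<sigma>_def s1_def sgn_if)
    define d where "d s = \<sigma> * (c s (2 * pi) - s)" for s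
    have "continuous_on {lo - r<..<hi + r} d" unfolding d_def by (intro continuous_intros c_end)
    moreover have "d s0 > 0" using sg by (simp add: d_def s1_def)
    ultimately have "\<exists>e>0. \<forall>s\<in>{lo - r<..<hi + r}. dist s s0 < e \<longrightarrow> dist (d s) (d s0) < d s0"
      unfolding continuous_on_iff using s0 by simp
    then obtain e where e: "e > 0" "\<forall>s\<in>{lo - r<..<hi + r}. dist s s0 < e \<longrightarrow> dist (d s) (d s0) < d s0"
      by (elim exE conjE)
    (* Small enough for s' to lie between s0 and s1, in the range of initial radii, and to drift like s0. *)
    define q where "q = Min {e, \<bar>s1 - s0\<bar>, s0 - (lo - r), hi + r - s0} / 2"
    have "Min {e, \<bar>s1 - s0\<bar>, s0 - (lo - r), hi + r - s0} > 0" using e(1) sg(3) s0 by (subst Min_gr_iff) auto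
    then have q: "0 < q" "q < e" "q < \<bar>s1 - s0\<bar>" "q < s0 - (lo - r)" "q < hi + r - s0"
      unfolding q_def by (auto simp: min_def split: if_splits)
    define s' where "s' = s0 + \<sigma> * q"
    have aq: "\<bar>\<sigma> * q\<bar> = q" using q(1) sg(1) by (simp add: abs_mult)
    have s': "lo - r < s'" "s' < hi + r" "dist s' s0 < e" using aq q by (auto simp: s'_def dist_real_def)
    have "dist (d s') (d s0) < d s0" using e(2) s' by simp
    then have ds: "\<sigma> * (c s' (2 * pi) - s') > 0" by (simp add: d_def dist_real_def)
    have "\<sigma> * (s1 - s') = \<bar>s1 - s0\<bar> - \<sigma> * \<sigma> * q" "\<sigma> * (s0 - s') = - (\<sigma> * \<sigma> * q)"
      using sg(2) by (auto simp: s'_def algebra_simps)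
    then have sides: "\<sigma> * (s1 - s') \<ge> 0" "\<sigma> * (s0 - s') < 0" using sg(4) q by auto
    have c0: "c s' 0 = s'" by (rule c_0[OF s'(1,2)])
    obtain m where m: "w < t0 + real m * T" using late by blast
    have p0: "(0::real) < 2 * pi" by simp
    have "beyond \<sigma> s' (\<gamma> w)" unfolding gw beyond_pt[OF s1r order_refl p0] c0 by (rule sides(1))
    then have "beyond \<sigma> s' (\<gamma> (t0 + real m * T))" by (rule no_return[OF s'(1,2) sg(1) ds g(1) m])
    then show False using sides(2) unfolding rep gt0 beyond_pt[OF s0r order_refl p0] c0 by simp
  qed
  show "\<Gamma> = loop s0"
  proof (rule subset_antisym; rule subsetI)
    fix p assume "p \<in> loop s0"
    then obtain \<phi> where phi: "0 \<le> \<phi>" "\<phi> \<le> 2 * pi" "p = P (c s0 \<phi>) \<phi>" by auto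
    have "\<exists>t\<ge>t0. t \<le> w \<and> \<theta> t = \<phi>" by (rule IVT'[OF _ _ w(1,2)]) (use phi w(3,4) in auto)
    then obtain t where "t0 \<le> t" "t \<le> w" "\<theta> t = \<phi>" by (elim exE conjE)
    then have "p = \<gamma> t" using w(5)[of t] phi(3) by simp
    then show "p \<in> \<Gamma>" using g(4) by simp
  next
    have gc: "continuous_on UNIV \<gamma>" using g(1) by (simp add: pw_solution_def)
    have ahead: "\<gamma> t \<in> loop s0" if t: "t0 \<le> t" for t
    proof (rule ccontr)
      assume out: "\<gamma> t \<notin> loop s0"
      define A where "A = {t0..t} \<inter> \<gamma> -` loop s0"
      have "closed (\<gamma> -` loop s0)" using gc compact_imp_closed[OF loop_compact[OF s0]] by (simp add: continuous_on_closed_vimage)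
      then have "compact A" unfolding A_def by (intro compact_Int_closed compact_Icc)
      moreover have "t0 \<in> A"
      proof -
        have "\<gamma> t0 = P (c s0 0) 0" using gt0 c_0[OF s0] by simp
        then show ?thesis using t by (auto simp: A_def)
      qed
      ultimately obtain m where m: "m \<in> A" "\<forall>x\<in>A. x \<le> m" using compact_attains_sup[of A] by auto
      then have mt: "m < t" using out unfolding A_def by (cases "m = t") auto
      have "\<exists>\<phi>. 0 \<le> \<phi> \<and> \<phi> < 2 * pi \<and> \<gamma> m = P (c s0 \<phi>) \<phi>"
      proof -
        obtain \<phi> where phi: "0 \<le> \<phi>" "\<phi> \<le> 2 * pi" "\<gamma> m = P (c s0 \<phi>) \<phi>" using m(1) by (auto simp: A_def)
        show ?thesis
        proof (cases "\<phi> = 2 * pi")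
          case True
          have "\<gamma> m = P (c s0 0) 0" using phi(3) True closed c_0[OF s0] pt_section[of s0] by simp
          then show ?thesis by (intro exI[of _ 0]) simp
        next
          case False then show ?thesis using phi by (intro exI[of _ \<phi>]) simp
        qed
      qed
      then obtain \<phi> where phi: "0 \<le> \<phi>" "\<phi> < 2 * pi" "\<gamma> m = P (c s0 \<phi>) \<phi>" by (elim exE conjE)
      have sl': "sol \<gamma> {m..t}" by (rule pw_solution_subset[OF g(1)]) simp
      obtain \<psi> v where v: "m \<le> v" "v \<le> t" "continuous_on {m..v} \<psi>" "\<psi> m = \<phi>"
        "\<And>x x'. m \<le> x \<Longrightarrow> x \<le> x' \<Longrightarrow> x' \<le> v \<Longrightarrow> \<psi> x' - \<psi> x \<ge> \<kappa> / 2 * (x' - x)"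
        "\<And>x. m \<le> x \<Longrightarrow> x \<le> v \<Longrightarrow> \<psi> x \<le> 2 * pi \<and> \<gamma> x = P (c s0 (\<psi> x)) (\<psi> x)"
        "\<psi> v = 2 * pi \<or> (v = t \<and> \<psi> v < 2 * pi)"
        by (rule follow[OF s0 less_imp_le[OF mt] sl' phi], rule that; assumption)
      have mv: "m < v" using v(1,4,7) phi(2) mt by (cases "v = m") auto
      have "0 \<le> \<kappa> / 2 * (v - m)" using mv kappa_pos by simp
      then have "0 \<le> \<psi> v" using v(5)[of m v] v(1,4) phi(1) by simp
      then have "\<gamma> v \<in> loop s0" using v(6)[OF v(1) order_refl] by auto
      then have "v \<in> A" using v m by (auto simp: A_def)
      then show False using m(2) mv by force
    qed
    fix p assume "p \<in> \<Gamma>"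
    then obtain t where p: "p = \<gamma> t" using g(4) by auto
    obtain m where "t0 < t + real m * T" using late by blast
    then have "\<gamma> (t + real m * T) \<in> loop s0" by (intro ahead) simp
    then show "p \<in> loop s0" unfolding rep p .
  qed
qed

end

section \<open>The Melnikov function along the ellipses\<close>

text \<open>The point \<open>exp (\<i> t)\<close> is mapped to \<open>(exp (\<i> t) + \<beta>) / (1 + \<beta> exp (\<i> t))\<close>, a Moebius transformation of the
  unit circle; the two identities are its real and imaginary part, with the squared modulus of the denominator
  cleared.\<close>

lemma kepler_trig:
  assumes "\<bar>\<beta>\<bar> < 1"
  shows "cos (kepler (- \<beta>) t) * (1 + 2 * \<beta> * cos t + \<beta>\<^sup>2) = (1 + \<beta>\<^sup>2) * cos t + 2 * \<beta>"
    "sin (kepler (- \<beta>) t) * (1 + 2 * \<beta> * cos t + \<beta>\<^sup>2) = (1 - \<beta>\<^sup>2) * sin t"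
proof -
  define x y where "x = cos t" and "y = sin t"
  have y2: "y * y = 1 - x * x" using sin_squared_eq[of t] by (simp add: x_def y_def power2_eq_square)
  define D S where "D = 1 + \<beta> * x" and "S = \<beta> * y"
  have D: "D > 0" using kepler_denom_pos[of "- \<beta>" t] assms by (simp add: D_def x_def)
  define Q where "Q = 1 + 2 * \<beta> * x + \<beta>\<^sup>2"
  have SS: "S * S = \<beta> * \<beta> * (1 - x * x)" using y2 by (simp add: S_def mult_ac)
  have Q: "Q = D\<^sup>2 + S\<^sup>2" unfolding power2_eq_square[of S] SS by (simp add: Q_def D_def power2_eq_square algebra_simps)
  have Q0: "Q > 0" unfolding Q using D by (simp add: add_pos_nonneg)
  define v a where "v = S / D" and "a = arctan v"
  have k: "kepler (- \<beta>) t = t - 2 * a"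
    by (simp add: kepler_def a_def v_def S_def D_def x_def y_def arctan_minus)
  have v: "1 + v\<^sup>2 = Q / D\<^sup>2" unfolding Q v_def using D by (simp add: field_simps)
  have ca: "(cos a)\<^sup>2 = D\<^sup>2 / Q"
    unfolding a_def cos_arctan v using D Q0 by (simp add: power_divide real_sqrt_divide)
  have sa: "sin a = cos a * v" unfolding a_def sin_arctan cos_arctan by simp
  have c2: "cos (2 * a) * Q = D\<^sup>2 - S\<^sup>2"
  proof -
    have "cos (2 * a) = (cos a)\<^sup>2 * (1 - v\<^sup>2)" unfolding cos_double sa by (simp add: power_mult_distrib algebra_simps)
    then have "cos (2 * a) * Q = D\<^sup>2 * (1 - v\<^sup>2)" using Q0 by (simp add: ca)
    then show ?thesis using D by (simp add: v_def power_divide right_diff_distrib)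
  qed
  have s2: "sin (2 * a) * Q = 2 * D * S"
  proof -
    have "sin (2 * a) = (cos a)\<^sup>2 * (2 * v)" unfolding sin_double sa by (simp add: power2_eq_square)
    then have "sin (2 * a) * Q = D\<^sup>2 * (2 * v)" using Q0 by (simp add: ca)
    then show ?thesis using D by (simp add: v_def power2_eq_square)
  qed
  have "cos (t - 2 * a) * Q = x * (cos (2 * a) * Q) + y * (sin (2 * a) * Q)"
    by (simp add: cos_diff x_def y_def algebra_simps)
  also have "\<dots> = x * (D * D - S * S) + 2 * D * \<beta> * (y * y)" unfolding c2 s2 by (simp add: S_def power2_eq_square)
  also have "\<dots> = (1 + \<beta>\<^sup>2) * x + 2 * \<beta>" unfolding SS y2 by (simp add: D_def power2_eq_square algebra_simps)
  finally show "cos (kepler (- \<beta>) t) * (1 + 2 * \<beta> * cos t + \<beta>\<^sup>2) = (1 + \<beta>\<^sup>2) * cos t + 2 * \<beta>"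
    by (simp add: k Q_def x_def)
  have "sin (t - 2 * a) * Q = y * (cos (2 * a) * Q) - x * (sin (2 * a) * Q)"
    by (simp add: sin_diff x_def y_def algebra_simps)
  also have "\<dots> = y * ((D * D - S * S) - 2 * D * \<beta> * x)" unfolding c2 s2 by (simp add: S_def power2_eq_square algebra_simps)
  also have "\<dots> = (1 - \<beta>\<^sup>2) * y" unfolding SS by (simp add: D_def power2_eq_square algebra_simps)
  finally show "sin (kepler (- \<beta>) t) * (1 + 2 * \<beta> * cos t + \<beta>\<^sup>2) = (1 - \<beta>\<^sup>2) * sin t"
    by (simp add: k Q_def x_def y_def)
qed

text \<open>The polar angle \<open>\<theta>\<close> of the point with parameter \<open>t\<close> on the ellipse.\<close>

lemma orbit_angle:
  assumes "0 < s" "s < 1"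
  obtains \<theta> :: "real \<Rightarrow> real" where "\<theta> 0 = 0" "\<theta> (2 * pi) = 2 * pi"
    "\<And>t. (\<theta> has_real_derivative sqrt (1 - s\<^sup>2) / (1 + s * cos t)) (at t)"
    "\<And>t. cos (\<theta> t) = (s + cos t) / (1 + s * cos t)"
    "\<And>t. sin (\<theta> t) = sqrt (1 - s\<^sup>2) * sin t / (1 + s * cos t)"
proof -
  obtain \<beta> where b: "0 < \<beta>" "\<beta> < 1" "s = 2 * \<beta> / (1 + \<beta>\<^sup>2)" "sqrt (1 - s\<^sup>2) = (1 - \<beta>\<^sup>2) / (1 + \<beta>\<^sup>2)"
    using half_angle_param[OF assms] by blast
  have b1: "\<bar>\<beta>\<bar> < 1" "\<bar>- \<beta>\<bar> < 1" using b by auto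
  have B: "1 + \<beta>\<^sup>2 > 0" by (simp add: add_pos_nonneg)
  define Q where "Q t = 1 + 2 * \<beta> * cos t + \<beta>\<^sup>2" for t
  have sQ: "1 + s * cos t = Q t / (1 + \<beta>\<^sup>2)" for t unfolding b(3) Q_def using B by (simp add: field_simps)
  have "1 + s * cos t > 0" for t using denom_pos[OF assms, of "t + pi"] by simp
  moreover have "Q t = (1 + s * cos t) * (1 + \<beta>\<^sup>2)" for t unfolding sQ using B by simp
  ultimately have Q: "Q t > 0" for t using B by (simp only: mult_pos_pos)
  show ?thesis
  proof (rule that[of "kepler (- \<beta>)"])
    show "kepler (- \<beta>) 0 = 0" "kepler (- \<beta>) (2 * pi) = 2 * pi" by (simp_all add: kepler_def)
    fix t
    have "(kepler (- \<beta>) has_real_derivative (1 - \<beta>\<^sup>2) / Q t) (at t)"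
      using kepler_deriv[OF b1(2), of t] by (simp add: Q_def)
    also have "(1 - \<beta>\<^sup>2) / Q t = sqrt (1 - s\<^sup>2) / (1 + s * cos t)" unfolding b(4) sQ using B by simp
    finally show "(kepler (- \<beta>) has_real_derivative sqrt (1 - s\<^sup>2) / (1 + s * cos t)) (at t)" .
    have "s + cos t = ((1 + \<beta>\<^sup>2) * cos t + 2 * \<beta>) / (1 + \<beta>\<^sup>2)" unfolding b(3) using B by (simp add: field_simps)
    then show "cos (kepler (- \<beta>) t) = (s + cos t) / (1 + s * cos t)"
      unfolding sQ using kepler_trig(1)[OF b1(1), of t] Q[of t] B by (simp add: Q_def[symmetric] eq_divide_eq)
    show "sin (kepler (- \<beta>) t) = sqrt (1 - s\<^sup>2) * sin t / (1 + s * cos t)"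
      unfolding sQ b(4) using kepler_trig(2)[OF b1(1), of t] Q[of t] B by (simp add: Q_def[symmetric] eq_divide_eq)
  qed
qed

text \<open>Along the ellipse \<open>y\<^sup>-\<^sup>3 (g dx - f dy) = (s/(\<eta>\<kappa>)) radial d\<theta>\<close>: the one-form is the derivative of the
  first integral along the perturbation times \<open>dt\<close>, and the first integral is a function of the radius alone. Substitution of
  the angle turns the integral over the part of the ellipse in the \<open>k\<close>-th quadrant into the integral over
  the \<open>k\<close>-th quarter.\<close>

lemma melnikov_mel1:
  assumes eta: "\<eta> > 0" and s: "0 < s" "s < 1"
    and f: "\<And>k x y. k \<in> {1..4} \<Longrightarrow> f k x y = bipoly (a k) n x y"
    and g: "\<And>k x y. k \<in> {1..4} \<Longrightarrow> g k x y = bipoly (b k) n x y"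
  shows "melnikov \<eta> f g ((s\<^sup>2 - 1) / (2 * \<eta>)) = s / \<eta> * mel1 \<eta> n a b s"
proof -
  define w \<kappa> h where "w = sqrt (1 - s\<^sup>2)" and "\<kappa> = sqrt (2 * \<eta>)" and "h = (s\<^sup>2 - 1) / (2 * \<eta>)"
  have s2: "s\<^sup>2 < 1" using s by (simp add: power_less_one_iff)
  have w: "w > 0" "w * w = 1 - s * s" using s2 by (simp_all add: w_def power2_eq_square)
  have kp: "\<kappa> > 0" "\<kappa> * \<kappa> = 2 * \<eta>" using eta by (auto simp: \<kappa>_def)
  have hw: "h = - (w * w) / (2 * \<eta>)" by (simp add: h_def w power2_eq_square)
  have h0: "h < 0" "h \<noteq> 0" using eta s2 by (simp_all add: h_def divide_neg_pos)
  obtain \<theta> where th: "\<theta> 0 = 0" "\<theta> (2 * pi) = 2 * pi"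
    "\<And>t. (\<theta> has_real_derivative w / (1 + s * cos t)) (at t)"
    "\<And>t. cos (\<theta> t) = (s + cos t) / (1 + s * cos t)"
    "\<And>t. sin (\<theta> t) = w * sin t / (1 + s * cos t)"
    by (rule orbit_angle[OF s, folded w_def], rule that; assumption)
  have q: "1 + s * cos t > 0" for t using denom_pos[OF s, of "t + pi"] by simp
  have R: "sqrt (- 1 / (4 * h) - \<eta> / 2) = \<eta> * s / (\<kappa> * w)"
  proof (rule real_sqrt_unique)
    have "(\<eta> * s / (\<kappa> * w))\<^sup>2 = \<eta> * \<eta> * (s * s) / ((\<kappa> * \<kappa>) * (w * w))" by (simp add: power2_eq_square mult_ac)
    also have "\<dots> = \<eta> * (1 - w * w) / (2 * (w * w))" unfolding kp(2) using w(2) eta by simp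
    also have "\<dots> = - 1 / (4 * h) - \<eta> / 2" unfolding hw using w(1) eta by (simp add: field_simps)
    finally show "(\<eta> * s / (\<kappa> * w))\<^sup>2 = - 1 / (4 * h) - \<eta> / 2" .
    show "0 \<le> \<eta> * s / (\<kappa> * w)" using eta s kp w by simp
  qed
  have mh: "sqrt (- h) = w / \<kappa>"
  proof (rule real_sqrt_unique)
    show "(w / \<kappa>)\<^sup>2 = - h" unfolding hw kp(2)[symmetric] by (simp add: power2_eq_square)
  qed (use w kp in simp)
  define A B where "A = \<eta> * s / (\<kappa> * w)" and "B = \<eta> * s / (w * w)"
  have AB: "A / (w / \<kappa>) = B" using kp(1) w(1) by (simp add: A_def B_def)
  have path: "orbit_path \<eta> h t = (A * sin t, \<eta> / (w * w) + B * cos t)" for t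
  proof -
    have "- 1 / (2 * h) = \<eta> / (w * w)" unfolding hw using w(1) eta by simp
    then show ?thesis unfolding orbit_path_def Let_def R mh A_def[symmetric] AB by simp
  qed
  define y where "y t = \<eta> * (1 + s * cos t) / (w * w)" for t
  have y: "y t > 0" for t using q[of t] eta w(1) by (simp add: y_def)
  have path2: "orbit_path \<eta> h t = (A * sin t, y t)" for t
    unfolding path y_def B_def by (simp add: distrib_left add_divide_distrib mult_ac)
  have dnt: "dn (\<theta> t) s = w * w / (1 + s * cos t)" for t
    unfolding dn_def w(2) using q[of t] by (simp add: th(4) field_simps)
  have pt: "orbit_path \<eta> h t = pt \<eta> s (\<theta> t)" for t
  proof -
    have c1: "\<eta> / \<kappa> * (s * (w * x / p)) / (w * w / p) = \<eta> * s / (\<kappa> * w) * x" if "p > 0" for x p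
      using that w(1) kp(1) by (simp add: field_simps)
    have c2: "\<eta> / (w * w / p) = \<eta> * p / (w * w)" for p by simp
    have "px \<eta> (\<theta> t) s = A * sin t"
      unfolding px_def dnt th(5) of_real_eq_id id_apply \<kappa>_def[symmetric] A_def by (rule c1[OF q])
    moreover have "py \<eta> (\<theta> t) s = y t"
      unfolding py_def dnt of_real_eq_id id_apply y_def by (rule c2)
    ultimately show ?thesis unfolding path2 pt_def by simp
  qed
  have pxy: "px \<eta> (\<theta> t) s = A * sin t" "py \<eta> (\<theta> t) s = y t" for t using pt[of t] unfolding path2 pt_def by auto
  have vd: "vector_derivative (orbit_path \<eta> h) (at t) = (A * cos t, - (B * sin t))" for t
  proof (rule vector_derivative_at)
    show "(orbit_path \<eta> h has_vector_derivative (A * cos t, - (B * sin t))) (at t)"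
      unfolding path[abs_def]
      by (intro has_vector_derivative_Pair)
        (auto intro!: derivative_eq_intros simp: has_real_derivative_iff_has_vector_derivative[symmetric])
  qed
  define G where "G k \<phi> = radial \<eta> n (a k) (b k) \<phi> s / \<kappa>" for k \<phi>
  have integrand: "(case orbit_path \<eta> h t of (x, y) \<Rightarrow> g k x y / y ^ 3) * fst (vector_derivative (orbit_path \<eta> h) (at t))
      + (case orbit_path \<eta> h t of (x, y) \<Rightarrow> - f k x y / y ^ 3) * snd (vector_derivative (orbit_path \<eta> h) (at t))
      = s / \<eta> * (w / (1 + s * cos t) * G k (\<theta> t))" if k: "k \<in> {1..4}" for k t
  proof -
    define F E where "F = f k (A * sin t) (y t)" and "E = g k (A * sin t) (y t)"
    have yq: "1 + s * cos t = y t * (w * w) / \<eta>" using eta w(1) by (simp add: y_def)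
    have e1: "dn (\<theta> t) s = \<eta> / y t" unfolding dnt yq using w(1) eta y[of t] by simp
    have e2: "sin (\<theta> t) = \<eta> * sin t / (w * y t)" unfolding th(5) yq using w(1) eta y[of t] by (simp add: mult_ac)
    have e3: "cos (\<theta> t) - s = \<eta> * cos t / y t"
    proof -
      have e0: "(s + x) / (1 + s * x) - s = x * (1 - s * s) / (1 + s * x)" if "1 + s * x \<noteq> 0" for x
        using that by (simp add: field_simps)
      have "cos (\<theta> t) - s = cos t * (1 - s * s) / (1 + s * cos t)" unfolding th(4) by (rule e0) (use q[of t] in simp)
      then show ?thesis unfolding w(2)[symmetric] yq using w(1) eta y[of t] by (simp add: mult_ac)
    qed
    have "radial \<eta> n (a k) (b k) (\<theta> t) s = 1 / y t * (\<kappa> * F * (\<eta> * sin t / (w * y t)) + E * (\<eta> * cos t / y t))"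
      unfolding radial_def pxy of_real_eq_id id_apply e1 e2 e3 f[OF k, symmetric] g[OF k, symmetric] F_def[symmetric] E_def[symmetric] \<kappa>_def[symmetric]
      using eta by simp
    then have "s / \<eta> * (w / (1 + s * cos t) * G k (\<theta> t))
      = s / \<eta> * (w / (y t * (w * w) / \<eta>) * (1 / y t * (\<kappa> * F * (\<eta> * sin t / (w * y t)) + E * (\<eta> * cos t / y t)) / \<kappa>))"
      unfolding G_def yq by simp
    also have "\<dots> = E / y t ^ 3 * (A * cos t) + F / y t ^ 3 * (B * sin t)"
      unfolding A_def B_def using w(1) kp(1) y[of t] eta by (simp add: field_simps power3_eq_cube)
    finally show ?thesis unfolding vd path2 by (simp add: F_def E_def)
  qed
  have thmono: "\<theta> u < \<theta> v" if "u < v" for u v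
    by (rule DERIV_pos_imp_increasing[OF that]) (use th(3) q w in force)
  have thle: "\<theta> u \<le> \<theta> v \<longleftrightarrow> u \<le> v" "\<theta> u < \<theta> v \<longleftrightarrow> u < v" for u v
    using thmono[of u v] thmono[of v u] by (cases u v rule: linorder_cases; simp)+
  have thc: "continuous_on T \<theta>" for T using th(3) by (intro DERIV_continuous_on[of T \<theta>]) (blast intro: has_field_derivative_at_within)
  have line: "line_integral (\<lambda>(x, y). g k x y / y ^ 3) (\<lambda>(x, y). - f k x y / y ^ 3) (orbit_path \<eta> h)
      {t \<in> {0..2 * pi}. orbit_path \<eta> h t \<in> quadrant \<eta> k} = s / \<eta> * integral (quarter k) (G k)" if k: "k \<in> {1..4}" for k
  proof -
    note qb = quarter_end_bounds[OF k]
    have ex: "\<exists>t\<ge>0. t \<le> 2 * pi \<and> \<theta> t = x" if "0 \<le> x" "x \<le> 2 * pi" for x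
      by (rule IVT'[OF _ _ _ thc]) (use that th in auto)
    have qb': "quarter_end k - pi / 2 \<le> 2 * pi" "0 \<le> quarter_end k" using qb pi_gt_zero by linarith+
    obtain t0 where t0: "0 \<le> t0" "\<theta> t0 = quarter_end k - pi / 2" using ex[OF qb(1) qb'(1)] by (elim exE conjE)
    obtain t1 where t1: "t1 \<le> 2 * pi" "\<theta> t1 = quarter_end k" using ex[OF qb'(2) qb(2)] by (elim exE conjE)
    have tle: "t0 < t1" using thle(2)[of t0 t1] t0 t1 by simp
    have S: "{t \<in> {0..2 * pi}. orbit_path \<eta> h t \<in> quadrant \<eta> k} = {t0<..<t1}"
    proof (intro equalityI subsetI)
      fix t assume "t \<in> {t \<in> {0..2 * pi}. orbit_path \<eta> h t \<in> quadrant \<eta> k}"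
      then have t: "0 \<le> t" "t \<le> 2 * pi" "pt \<eta> s (\<theta> t) \<in> quadrant \<eta> k" by (auto simp: pt)
      have "0 \<le> \<theta> t" "\<theta> t \<le> 2 * pi" using thle(1)[of 0 t] thle(1)[of t "2 * pi"] t th by auto
      from quadrant_angle(2,3)[OF eta s t(3) this] have "\<theta> t0 < \<theta> t" "\<theta> t < \<theta> t1" using t0(2) t1(2) by simp_all
      then show "t \<in> {t0<..<t1}" using thle(2) by simp
    next
      fix t assume t: "t \<in> {t0<..<t1}"
      then have "quarter_end k - pi / 2 < \<theta> t" "\<theta> t < quarter_end k" using thmono[of t0 t] thmono[of t t1] t0(2) t1(2) by auto
      from pt_in_quadrant[OF eta s k this] show "t \<in> {t \<in> {0..2 * pi}. orbit_path \<eta> h t \<in> quadrant \<eta> k}"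
        using t t0(1) t1(1) by (simp add: pt)
    qed
    have cG: "continuous_on {quarter_end k - pi / 2..quarter_end k} (G k)"
      unfolding G_def by (intro continuous_on_divide radial_continuous_real s continuous_on_const) (use kp in simp)
    have "((\<lambda>t. (w / (1 + s * cos t)) *\<^sub>R G k (\<theta> t)) has_integral integral {\<theta> t0..\<theta> t1} (G k)) {t0..t1}"
    proof (rule has_integral_substitution[where g = \<theta> and f = "G k" and c = "quarter_end k - pi / 2" and d = "quarter_end k"
          and g' = "\<lambda>t. w / (1 + s * cos t)" and a = t0 and b = t1])
      show "t0 \<le> t1" "\<theta> t0 \<le> \<theta> t1" using tle thle by auto
      show "\<theta> ` {t0..t1} \<subseteq> {quarter_end k - pi / 2..quarter_end k}"
      proof
        fix x assume "x \<in> \<theta> ` {t0..t1}"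
        then obtain t where "t0 \<le> t" "t \<le> t1" "x = \<theta> t" by auto
        then have "\<theta> t0 \<le> x" "x \<le> \<theta> t1" using thle(1) by auto
        then show "x \<in> {quarter_end k - pi / 2..quarter_end k}" using t0(2) t1(2) by simp
      qed
      show "continuous_on {quarter_end k - pi / 2..quarter_end k} (G k)" by (rule cG)
      show "(\<theta> has_real_derivative w / (1 + s * cos t)) (at t within {t0..t1})" for t
        by (rule has_field_derivative_at_within[OF th(3)])
    qed
    then have "((\<lambda>t. s / \<eta> * (w / (1 + s * cos t) * G k (\<theta> t))) has_integral s / \<eta> * integral (quarter k) (G k)) {t0<..<t1}"
      unfolding has_integral_Icc_iff_Ioo t0(2) t1(2) quarter_eq_Icc real_scaleR_def by (rule has_integral_mult_right)
    then show ?thesis unfolding line_integral_def S integrand[OF k] by (rule integral_unique)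
  qed
  show ?thesis unfolding melnikov_def h_def[symmetric] mel1_def sum_distrib_left
    by (rule sum.cong[OF refl]) (simp only: line G_def[abs_def] \<kappa>_def of_real_eq_id id_apply)
qed

section \<open>Counting limit cycles\<close>

lemma higher_deriv_real_restriction:
  assumes F: "F holomorphic_on U" "open U" and re: "\<And>x. of_real x \<in> U \<Longrightarrow> F (of_real x) = of_real (d x)"
    and x: "of_real x \<in> U"
  shows "(deriv ^^ j) F (of_real x) = of_real ((deriv ^^ j) d x)"
proof -
  define V where "V = {x :: real. (of_real x :: complex) \<in> U}"
  have "V = (of_real :: real \<Rightarrow> complex) -` U" by (auto simp: V_def)
  then have V: "open V" "(of_real :: real \<Rightarrow> complex) ` V \<subseteq> U"
    using F(2) by (auto simp: V_def intro!: open_vimage continuous_intros)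
  have ro: "real_on V F" using re by (simp add: real_on_def V_def)
  have "\<forall>x\<in>V. (deriv ^^ j) F (of_real x) = of_real ((deriv ^^ j) d x)"
  proof (induction j)
    case 0 then show ?case using re by (simp add: V_def)
  next
    case (Suc j)
    show ?case
    proof
      fix x assume x: "x \<in> V"
      have hol: "(deriv ^^ j) F holomorphic_on U" by (rule holomorphic_higher_deriv[OF F])
      have roj: "real_on V ((deriv ^^ j) F)" by (rule real_on_higher_deriv[OF ro V(1) F(2) V(2) F(1)])
      note rd = real_on_deriv[OF roj V(1) F(2) V(2) hol x]
      have "((deriv ^^ j) d has_real_derivative Re (deriv ((deriv ^^ j) F) (of_real x))) (at x)"
        by (rule has_field_derivative_transform_within_open[OF rd(2) V(1) x]) (use Suc in simp)
      then have "deriv ((deriv ^^ j) d) x = Re (deriv ((deriv ^^ j) F) (of_real x))" by (rule DERIV_imp_deriv)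
      then show "(deriv ^^ Suc j) F (of_real x) = of_real ((deriv ^^ Suc j) d x)" using rd(1) by simp
    qed
  qed
  then show ?thesis using x by (simp add: V_def)
qed

lemma zero_mult_attained:
  assumes "\<And>m. (\<forall>j<m. (deriv ^^ j) d y = 0) \<Longrightarrow> m \<le> N"
  obtains m where "zero_mult d y = enat m" "\<forall>j<m. (deriv ^^ j) d y = 0"
proof -
  define M where "M = {m. \<forall>j<m. (deriv ^^ j) d y = 0}"
  have "M \<subseteq> {..N}" using assms by (auto simp: M_def)
  then have f: "finite M" by (rule finite_subset) simp
  have ne: "M \<noteq> {}" by (auto simp: M_def)
  have "zero_mult d y = enat (Max M)"
  proof (rule antisym)
    show "zero_mult d y \<le> enat (Max M)" unfolding zero_mult_def
      by (rule Sup_least) (use f in \<open>auto simp: M_def\<close>)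
    show "enat (Max M) \<le> zero_mult d y" unfolding zero_mult_def
      by (rule Sup_upper) (use Max_in[OF f ne] in \<open>auto simp: M_def\<close>)
  qed
  moreover have "\<forall>j<Max M. (deriv ^^ j) d y = 0" using Max_in[OF f ne] by (simp add: M_def)
  ultimately show ?thesis by (rule that)
qed

lemma sum_enat: "finite A \<Longrightarrow> (\<Sum>x\<in>A. enat (f x)) = enat (\<Sum>x\<in>A. f x)"
  by (induction A rule: finite_induct) (simp_all add: zero_enat_def)

context near_annulus
begin

text \<open>In the coordinate \<open>s = 1 - \<eta>/y\<close> of the section the first return map is \<open>\<rho>\<close>, so the displacement is
  \<open>\<eta>/(1 - \<rho>) - \<eta>/(1 - s) = \<eta> (\<rho> - s) / ((1 - \<rho>) (1 - s))\<close>: it differs from \<open>\<rho> - s\<close> by a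
  coordinate change and a factor without zeros. Real and complex derivatives agree on the real axis.\<close>

lemma displacement_zero_vanishes:
  assumes hol: "\<rho> holomorphic_on rect lo hi r"
    and re: "\<And>x. lo - r < x \<Longrightarrow> x < hi + r \<Longrightarrow> \<rho> (of_real x) = of_real (c x (2 * pi))"
    and s0: "lo - r < s0" "s0 < hi + r" and z: "\<forall>j<m. (deriv ^^ j) (displacement \<eta> \<epsilon> f g) (ysec s0) = 0"
  shows "vanishes (\<lambda>z. \<rho> z - z) (of_real s0) m"
proof -
  define U where "U = {z \<in> rect lo hi r. \<rho> z \<noteq> 1}"
  have in_rect: "of_real x \<in> rect lo hi r \<longleftrightarrow> lo - r < x \<and> x < hi + r" for x using r(1) by (simp add: rect_def)
  have U: "open U"
  proof -
    have "open (rect lo hi r \<inter> \<rho> -` (- {1}))"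
      by (rule continuous_open_preimage[OF holomorphic_on_imp_continuous_on[OF hol] rect_open]) auto
    moreover have "U = rect lo hi r \<inter> \<rho> -` (- {1})" by (auto simp: U_def)
    ultimately show ?thesis by simp
  qed
  have U1: "z \<noteq> 1" if "z \<in> U" for z using that r by (auto simp: U_def rect_def)
  have sU: "of_real s0 \<in> U" using in_rect s0 re[OF s0] s_range(4)[OF s0, of "2 * pi"] by (simp add: U_def)
  define \<psi> \<phi> where "\<psi> z = of_real \<eta> / (1 - z)" and "\<phi> w = 1 - of_real \<eta> / w" for z w :: complex
  have eta0: "(of_real \<eta> :: complex) \<noteq> 0" using eta by simp
  have inv: "\<phi> (\<psi> z) = z" if "z \<noteq> 1" for z using that eta0 by (simp add: \<phi>_def \<psi>_def)
  define W where "W = {w. w \<noteq> 0} \<inter> \<phi> -` U"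
  have phol: "\<phi> holomorphic_on {w. w \<noteq> 0}" unfolding \<phi>_def by (intro holomorphic_intros) auto
  have o: "open {w :: complex. w \<noteq> 0}" by (simp add: open_Collect_neq)
  have W: "open W" unfolding W_def
    by (rule continuous_open_preimage[OF holomorphic_on_imp_continuous_on[OF phol] o U])
  define \<Phi> where "\<Phi> w = of_real \<eta> / (1 - \<rho> (\<phi> w)) - w" for w
  have rp: "(\<lambda>w. \<rho> (\<phi> w)) holomorphic_on W"
    by (rule holomorphic_on_compose_gen[OF holomorphic_on_subset[OF phol] hol, unfolded o_def]) (auto simp: W_def U_def)
  have hP: "\<Phi> holomorphic_on W" unfolding \<Phi>_def
    by (intro holomorphic_on_diff holomorphic_on_divide holomorphic_on_const holomorphic_on_ident rp) (auto simp: W_def U_def)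
  have real: "\<Phi> (of_real y) = of_real (displacement \<eta> \<epsilon> f g y)" if y: "of_real y \<in> W" for y
  proof -
    define s where "s = 1 - \<eta> / y"
    have y0: "y \<noteq> 0" using y by (auto simp: W_def)
    have ph: "\<phi> (of_real y) = of_real s" by (simp add: \<phi>_def s_def)
    then have "of_real s \<in> rect lo hi r" using y by (simp add: W_def U_def)
    then have s: "lo - r < s" "s < hi + r" using in_rect by auto
    have ys: "y = ysec s" using y0 eta by (simp add: ysec_def s_def)
    show ?thesis unfolding \<Phi>_def ph re[OF s] using displacement_eq[OF s] by (simp add: ys[symmetric]) (simp add: ysec_def)
  qed
  have ps: "\<psi> (of_real s0) = of_real (ysec s0)" by (simp add: \<psi>_def ysec_def)
  have s1: "(of_real s0 :: complex) \<noteq> 1" using U1[OF sU] .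
  have yW: "of_real (ysec s0) \<in> W" unfolding ps[symmetric] W_def using inv[OF s1] sU s1 eta0 by (simp add: \<psi>_def)
  have v1: "vanishes \<Phi> (\<psi> (of_real s0)) m" unfolding ps
  proof (rule vanishes_higher_deriv[OF hP W yW])
    fix j assume j: "j < m"
    have "(deriv ^^ j) \<Phi> (of_real (ysec s0)) = of_real ((deriv ^^ j) (displacement \<eta> \<epsilon> f g) (ysec s0))"
      by (rule higher_deriv_real_restriction[OF hP W real yW])
    then show "(deriv ^^ j) \<Phi> (of_real (ysec s0)) = 0" using z j by (simp only: of_real_0)
  qed
  have v2: "\<psi> analytic_on {of_real s0}" unfolding \<psi>_def[abs_def]
    by (intro analytic_on_divide analytic_on_diff analytic_on_const analytic_on_ident) (use s1 in auto)
  have v3: "vanishes (\<lambda>z. \<Phi> (\<psi> z)) (of_real s0) m" by (rule vanishes_compose[OF v1 v2])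
  have "(\<lambda>z. (1 - \<rho> z) * (1 - z) / of_real \<eta>) holomorphic_on rect lo hi r"
    by (intro holomorphic_on_divide holomorphic_on_mult holomorphic_on_diff holomorphic_on_const holomorphic_on_ident hol eta0)
  then have "(\<lambda>z. (1 - \<rho> z) * (1 - z) / of_real \<eta>) analytic_on {of_real s0}"
    unfolding analytic_at using in_rect s0 rect_open by (intro exI[of _ "rect lo hi r"]) simp
  with v3 have "vanishes (\<lambda>z. (1 - \<rho> z) * (1 - z) / of_real \<eta> * \<Phi> (\<psi> z)) (of_real s0) m"
    by (rule vanishes_mult)
  then show ?thesis
  proof (rule vanishes_cong[OF _ U sU])
    fix z assume z: "z \<in> U"
    have n: "1 - z \<noteq> 0" "1 - \<rho> z \<noteq> 0" using U1[OF z] z by (auto simp: U_def)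
    have "\<Phi> (\<psi> z) = of_real \<eta> / (1 - \<rho> z) - of_real \<eta> / (1 - z)" unfolding \<Phi>_def inv[OF U1[OF z]] by (simp add: \<psi>_def)
    then show "(1 - \<rho> z) * (1 - z) / of_real \<eta> * \<Phi> (\<psi> z) = \<rho> z - z" using n eta0 by (simp add: field_simps)
  qed
qed

text \<open>The map from fixed radii to closed curves is onto the limit cycles in question, and the multiplicity of a curve is the order of
  the displacement at its only section point.\<close>

lemma limit_cycles_count:
  assumes hol: "\<rho> holomorphic_on rect lo hi r"
    and re: "\<And>x. lo - r < x \<Longrightarrow> x < hi + r \<Longrightarrow> \<rho> (of_real x) = of_real (c x (2 * pi))"
    and N: "zeros_le (\<lambda>z. \<rho> z - z) {lo..hi} N"
    and K: "\<And>y. y > \<eta> \<Longrightarrow> first_integral \<eta> (0, y) \<in> K \<Longrightarrow> \<exists>s\<in>{lo..hi}. y = ysec s"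
  shows "finite (limit_cycles_near \<eta> \<epsilon> f g K) \<and>
    (\<Sum>\<Gamma>\<in>limit_cycles_near \<eta> \<epsilon> f g K. cycle_mult \<eta> \<epsilon> f g \<Gamma>) \<le> enat N"
proof -
  define LC where "LC = limit_cycles_near \<eta> \<epsilon> f g K"
  define Zs where "Zs = {s \<in> {lo..hi}. c s (2 * pi) = s}"
  have Zr: "lo - r < s" "s < hi + r" "s \<in> {lo..hi}" "c s (2 * pi) = s" if "s \<in> Zs" for s using that r by (auto simp: Zs_def)
  let ?d = "displacement \<eta> \<epsilon> f g"
  have van: "vanishes (\<lambda>z. \<rho> z - z) (of_real s) m" if "s \<in> Zs" "\<forall>j<m. (deriv ^^ j) ?d (ysec s) = 0" for s m
    by (rule displacement_zero_vanishes[OF hol re Zr(1,2)[OF that(1)] that(2)])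
  have total: "sum m X \<le> N" if "finite X" "X \<subseteq> Zs" "\<And>s. s \<in> X \<Longrightarrow> \<forall>j<m s. (deriv ^^ j) ?d (ysec s) = 0" for X m
  proof -
    have "X \<subseteq> {lo..hi}" using that(2) by (auto simp: Zs_def)
    moreover have "\<forall>s\<in>X. vanishes (\<lambda>z. \<rho> z - z) (of_real s) (m s)" using that(2,3) by (auto intro: van)
    ultimately show ?thesis using N that(1) unfolding zeros_le_def by (elim allE impE) (intro conjI, assumption+)
  qed
  have zero: "\<forall>j<Suc 0. (deriv ^^ j) ?d (ysec s) = 0" if "s \<in> Zs" for s
    using displacement_eq[OF Zr(1,2)[OF that]] Zr(4)[OF that] by simp
  have fin: "finite Zs"
  proof (rule ccontr)
    assume "infinite Zs"
    then obtain X where X: "finite X" "card X = Suc N" "X \<subseteq> Zs" using infinite_arbitrarily_large by blast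
    have "sum (\<lambda>_. Suc 0) X \<le> N" by (rule total[OF X(1,3)]) (use zero X(3) in blast)
    then show False using X(2) by simp
  qed
  have "\<exists>m. zero_mult ?d (ysec s) = enat m \<and> (\<forall>j<m. (deriv ^^ j) ?d (ysec s) = 0)" if s: "s \<in> Zs" for s
  proof -
    have "m \<le> N" if "\<forall>j<m. (deriv ^^ j) ?d (ysec s) = 0" for m
      using total[of "{s}" "\<lambda>_. m"] s that by simp
    then show ?thesis using zero_mult_attained[of ?d "ysec s" N] by blast
  qed
  then obtain \<mu> where mu: "\<And>s. s \<in> Zs \<Longrightarrow> zero_mult ?d (ysec s) = enat (\<mu> s)"
    "\<And>s. s \<in> Zs \<Longrightarrow> \<forall>j<\<mu> s. (deriv ^^ j) ?d (ysec s) = 0" by metis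
  have cm: "cycle_mult \<eta> \<epsilon> f g (loop s) = enat (\<mu> s)" if s: "s \<in> Zs" for s
  proof -
    have "ysec s > \<eta>" using Zr[OF s] r eta by (simp add: ysec_def less_divide_eq)
    moreover have "(0, ysec s) \<in> loop s"
    proof -
      have "(0, ysec s) = P (c s 0) 0" using c_0[OF Zr(1,2)[OF s]] pt_section(1)[of s] by simp
      then show ?thesis by (intro image_eqI[of _ _ 0]) auto
    qed
    ultimately have "{y. y > \<eta> \<and> (0, y) \<in> loop s} = {ysec s}"
      using loop_section[OF Zr(1,2)[OF s] Zr(4)[OF s]] by blast
    then show ?thesis unfolding cycle_mult_def using mu(1)[OF s] by simp
  qed
  have "LC \<subseteq> loop ` Zs"
  proof
    fix \<Gamma> assume "\<Gamma> \<in> LC"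
    then obtain y where y: "pw_periodic_orbit \<eta> \<epsilon> f g \<Gamma>" "y > \<eta>" "(0, y) \<in> \<Gamma>" "first_integral \<eta> (0, y) \<in> K"
      by (auto simp: LC_def limit_cycles_near_def limit_cycle_def)
    obtain s where s: "s \<in> {lo..hi}" "y = ysec s" using K[OF y(2,4)] by blast
    have sr: "lo - r < s" "s < hi + r" using s(1) r by auto
    note pl = periodic_orbit_loop[OF y(1) y(3)[unfolded s(2)] sr]
    show "\<Gamma> \<in> loop ` Zs" using pl s(1) by (auto simp: Zs_def)
  qed
  then obtain X where X: "X \<subseteq> Zs" "inj_on loop X" "LC = loop ` X" unfolding subset_image_inj by (elim exE conjE)
  have fX: "finite X" using X(1) fin by (rule finite_subset)
  have "(\<Sum>\<Gamma>\<in>LC. cycle_mult \<eta> \<epsilon> f g \<Gamma>) = (\<Sum>s\<in>X. cycle_mult \<eta> \<epsilon> f g (loop s))"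
    unfolding X(3) by (rule sum.reindex_cong[OF X(2) refl refl])
  also have "\<dots> = (\<Sum>s\<in>X. enat (\<mu> s))" using X(1) by (intro sum.cong refl cm) auto
  also have "\<dots> = enat (sum \<mu> X)" by (rule sum_enat[OF fX])
  also have "\<dots> \<le> enat N" using total[OF fX X(1), of \<mu>] mu(2) X(1) by auto
  finally show ?thesis using X(3) fX unfolding LC_def[symmetric] by simp
qed

end

lemma zeros_le_scaled:
  assumes "zeros_le (\<lambda>z. F z / k) S N"
  shows "zeros_le F S N"
proof -
  have "vanishes (\<lambda>z. F z / k) x m" if "vanishes F x m" for x m
    using vanishes_mult[OF that, of "\<lambda>_. inverse k"] by (simp add: divide_inverse mult.commute)
  then show ?thesis using assms unfolding zeros_le_def by simp
qed

lemma section_level: "\<eta> > 0 \<Longrightarrow> s \<noteq> 1 \<Longrightarrow> first_integral \<eta> (0, \<eta> / (1 - s)) = (s\<^sup>2 - 1) / (2 * \<eta>)"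
proof -
  assume a: "\<eta> > 0" "s \<noteq> 1"
  then have "(- (\<eta> / (1 - s)) + \<eta> / 2) / (\<eta> / (1 - s))\<^sup>2 = (- (1 - s) + (1 - s)\<^sup>2 / 2) / \<eta>"
    by (simp add: field_simps power2_eq_square)
  also have "\<dots> = (s\<^sup>2 - 1) / (2 * \<eta>)" using a by (simp add: power2_diff field_simps)
  finally show ?thesis by (simp add: first_integral_def)
qed

theorem theorem1p1:
  fixes \<eta> :: real and n :: nat and f g :: "nat \<Rightarrow> real \<Rightarrow> real \<Rightarrow> real"
  assumes "\<eta> > 0" and "n \<ge> 1"
    and "\<forall>k\<in>{1..4}. poly2_deg_le n (f k) \<and> poly2_deg_le n (g k)"
    and "\<exists>h\<in>{- 1 / (2 * \<eta>)<..<0}. melnikov \<eta> f g h \<noteq> 0"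
  shows "bifurcating_limit_cycles_le \<eta> f g (41 * n - 23)"
proof -
  define N where "N = 41 * n - 23"
  have "\<exists>c. \<forall>x y. f k x y = bipoly c n x y" "\<exists>c. \<forall>x y. g k x y = bipoly c n x y" if "k \<in> {1..4}" for k
    using assms(3) that unfolding poly2_deg_le_def bipoly_def of_real_eq_id id_apply by blast+
  then obtain a b where fb: "\<And>k x y. k \<in> {1..4} \<Longrightarrow> f k x y = bipoly (a k) n x y"
    and gb: "\<And>k x y. k \<in> {1..4} \<Longrightarrow> g k x y = bipoly (b k) n x y" by metis
  define amp where "amp h = sqrt (1 + 2 * \<eta> * h)" for h
  have amp: "0 < amp h" "amp h < 1" "h = ((amp h)\<^sup>2 - 1) / (2 * \<eta>)" if "- 1 / (2 * \<eta>) < h" "h < 0" for h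
  proof -
    have "0 < 1 + 2 * \<eta> * h" using that(1) assms(1) by (simp add: field_simps)
    moreover have "1 + 2 * \<eta> * h < 1" using that(2) assms(1) by (simp add: mult_pos_neg)
    ultimately show "0 < amp h" "amp h < 1" "h = ((amp h)\<^sup>2 - 1) / (2 * \<eta>)" using assms(1) by (auto simp: amp_def)
  qed
  have mel: "zeros_le (mel1 \<eta> n a b) {0<..<1} N"
  proof -
    obtain h where h: "- 1 / (2 * \<eta>) < h" "h < 0" "melnikov \<eta> f g h \<noteq> 0" using assms(4) by auto
    define s where "s = amp h"
    have s: "0 < s" "s < 1" "h = (s\<^sup>2 - 1) / (2 * \<eta>)" unfolding s_def using amp[OF h(1,2)] by auto
    have "melnikov \<eta> f g ((s\<^sup>2 - 1) / (2 * \<eta>)) = s / \<eta> * mel1 \<eta> n a b s"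
      by (rule melnikov_mel1[OF assms(1) s(1,2) fb gb])
    then have "mel1 \<eta> n a b s \<noteq> 0" using h(3) s(3) by auto
    then have "mel1 \<eta> n a b (of_real s) \<noteq> (0 :: complex)" unfolding of_real_mel1[OF s(1,2)] by simp
    then show ?thesis using mel1_zeros[OF assms(1,2), of a b] s(1,2) unfolding zeros_bd_def N_def by auto
  qed
  have "\<exists>e>0. \<forall>\<epsilon>. 0 < \<bar>\<epsilon>\<bar> \<and> \<bar>\<epsilon>\<bar> < e \<longrightarrow> finite (limit_cycles_near \<eta> \<epsilon> f g K) \<and>
      (\<Sum>\<Gamma>\<in>limit_cycles_near \<eta> \<epsilon> f g K. cycle_mult \<eta> \<epsilon> f g \<Gamma>) \<le> enat N"
    if K: "compact K" "K \<subseteq> {- 1 / (2 * \<eta>)<..<0}" for K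
  proof (cases "K = {}")
    case True
    then have "limit_cycles_near \<eta> \<epsilon> f g K = {}" for \<epsilon> by (simp add: limit_cycles_near_def)
    then show ?thesis by (intro exI[of _ 1]) simp
  next
    case False
    obtain h1 where h1: "h1 \<in> K" "\<forall>h\<in>K. h1 \<le> h" using compact_attains_inf[OF K(1) False] by blast
    obtain h2 where h2: "h2 \<in> K" "\<forall>h\<in>K. h \<le> h2" using compact_attains_sup[OF K(1) False] by blast
    (* The radii of the orbits with the extreme values of H in K. *)
    define lo hi where "lo = amp h1" and "hi = amp h2"
    have lh: "0 < lo" "lo \<le> hi" "hi < 1" using amp[of h1] amp[of h2] h1 h2 K(2) assms(1) by (auto simp: lo_def hi_def amp_def)
    have sec: "\<exists>s\<in>{lo..hi}. y = \<eta> / (1 - s)" if y: "y > \<eta>" "first_integral \<eta> (0, y) \<in> K" for y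
    proof -
      define s where "s = 1 - \<eta> / y"
      have y0: "y > 0" using y(1) assms(1) by simp
      have s: "0 < s" "s \<noteq> 1" "y = \<eta> / (1 - s)" using y(1) y0 assms(1) by (auto simp: s_def)
      have "(s\<^sup>2 - 1) / (2 * \<eta>) \<in> K" using y(2) section_level[OF assms(1) s(2)] s(3) by simp
      then have "h1 \<le> (s\<^sup>2 - 1) / (2 * \<eta>)" "(s\<^sup>2 - 1) / (2 * \<eta>) \<le> h2" using h1 h2 by auto
      then have "1 + 2 * \<eta> * h1 \<le> s\<^sup>2" "s\<^sup>2 \<le> 1 + 2 * \<eta> * h2" using assms(1) by (simp_all add: field_simps)
      then have "lo \<le> sqrt (s\<^sup>2)" "sqrt (s\<^sup>2) \<le> hi" unfolding lo_def hi_def amp_def by (simp_all only: real_sqrt_le_iff)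
      then show ?thesis using s by (intro bexI[of _ s]) auto
    qed
    obtain r e1 C \<sigma> where ff: "r > 0" "e1 > 0" "0 < lo - 3 * r" "hi + 3 * r < 1" "C > 0"
      "\<And>\<epsilon> k \<theta> s. \<bar>\<epsilon>\<bar> < e1 \<Longrightarrow> k \<in> {1..4} \<Longrightarrow> \<theta> \<in> quarter k \<Longrightarrow> lo - 3 * r < s \<Longrightarrow> s < hi + 3 * r \<Longrightarrow>
         \<bar>\<epsilon> * angular \<eta> n (a k) (b k) \<theta> s / s\<bar> \<le> sqrt (2 * \<eta>) / 2"
      "\<And>\<epsilon> k \<theta> s s'. \<bar>\<epsilon>\<bar> < e1 \<Longrightarrow> k \<in> {1..4} \<Longrightarrow> \<theta> \<in> quarter k \<Longrightarrow> lo - 2 * r < s \<Longrightarrow> s < hi + 2 * r \<Longrightarrow>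
         lo - 2 * r < s' \<Longrightarrow> s' < hi + 2 * r \<Longrightarrow> \<bar>slope \<eta> n a b \<epsilon> k \<theta> s - slope \<eta> n a b \<epsilon> k \<theta> s'\<bar> \<le> C * \<bar>s - s'\<bar>"
      "\<And>\<epsilon> s. \<bar>\<epsilon>\<bar> < e1 \<Longrightarrow> lo - r < s \<Longrightarrow> s < hi + r \<Longrightarrow> continuous_on UNIV (\<lambda>\<theta>. Re (\<sigma> \<epsilon> \<theta> (of_real s)))"
      "\<And>\<epsilon> s. \<bar>\<epsilon>\<bar> < e1 \<Longrightarrow> lo - r < s \<Longrightarrow> s < hi + r \<Longrightarrow> Re (\<sigma> \<epsilon> 0 (of_real s)) = s"
      "\<And>\<epsilon> \<theta> s. \<bar>\<epsilon>\<bar> < e1 \<Longrightarrow> lo - r < s \<Longrightarrow> s < hi + r \<Longrightarrow> \<bar>Re (\<sigma> \<epsilon> \<theta> (of_real s)) - s\<bar> \<le> r / 2"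
      "\<And>\<epsilon> k \<theta> s. \<bar>\<epsilon>\<bar> < e1 \<Longrightarrow> lo - r < s \<Longrightarrow> s < hi + r \<Longrightarrow> k \<in> {1..4} \<Longrightarrow> quarter_end k - pi / 2 < \<theta> \<Longrightarrow> \<theta> < quarter_end k \<Longrightarrow>
         ((\<lambda>\<theta>. Re (\<sigma> \<epsilon> \<theta> (of_real s))) has_real_derivative slope \<eta> n a b \<epsilon> k \<theta> (Re (\<sigma> \<epsilon> \<theta> (of_real s)))) (at \<theta>)"
      "\<And>\<epsilon>. \<bar>\<epsilon>\<bar> < e1 \<Longrightarrow> \<sigma> \<epsilon> (2 * pi) holomorphic_on rect lo hi r"
      "\<And>\<epsilon> x. \<bar>\<epsilon>\<bar> < e1 \<Longrightarrow> of_real x \<in> rect lo hi r \<Longrightarrow> \<sigma> \<epsilon> (2 * pi) (of_real x) \<in> \<real>"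
      "\<And>\<epsilon> z. 0 < \<bar>\<epsilon>\<bar> \<Longrightarrow> \<bar>\<epsilon>\<bar> < e1 \<Longrightarrow> z \<in> rect lo hi r \<Longrightarrow>
         cmod ((\<sigma> \<epsilon> (2 * pi) z - z) / of_real \<epsilon> - mel1 \<eta> n a b z) \<le> C * \<bar>\<epsilon>\<bar>"
      by (rule flow_family[OF assms(1) lh, where n = n and a = a and b = b], rule that; assumption)
    have in_rect: "of_real x \<in> rect lo hi r" if "lo - r < x" "x < hi + r" for x using that ff(1) by (simp add: rect_def)
    have rs: "rect lo hi r \<subseteq> strip" using ff(1,3,4) by (auto simp: rect_def strip_def)
    have "\<exists>e>0. \<forall>\<epsilon>. 0 < \<bar>\<epsilon>\<bar> \<and> \<bar>\<epsilon>\<bar> < e \<longrightarrow> zeros_le (\<lambda>z. (\<sigma> \<epsilon> (2 * pi) z - z) / of_real \<epsilon>) {lo..hi} N"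
    proof (rule zeros_le_perturb[where U = "rect lo hi r" and F = "mel1 \<eta> n a b" and ?e1.0 = e1 and C = C])
      show "open (rect lo hi r)" by (rule rect_open)
      show "of_real ` {lo..hi} \<subseteq> rect lo hi r" using in_rect ff(1) by auto
      show "mel1 \<eta> n a b holomorphic_on rect lo hi r" using mel1_holomorphic rs by (rule holomorphic_on_subset)
      show "zeros_le (mel1 \<eta> n a b) {lo..hi} N" using mel by (rule zeros_le_subset) (use lh in auto)
      show "e1 > 0" by (rule ff)
      fix \<epsilon> :: real assume e: "0 < \<bar>\<epsilon>\<bar>" "\<bar>\<epsilon>\<bar> < e1"
      show "(\<lambda>z. (\<sigma> \<epsilon> (2 * pi) z - z) / of_real \<epsilon>) holomorphic_on rect lo hi r"
        using e(1) by (intro holomorphic_on_divide holomorphic_on_diff ff(12)[OF e(2)] holomorphic_on_ident holomorphic_on_const) simp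
      show "(\<sigma> \<epsilon> (2 * pi) (of_real t) - of_real t) / of_real \<epsilon> \<in> \<real>" if "of_real t \<in> rect lo hi r" for t
        by (intro Reals_divide Reals_diff ff(13)[OF e(2) that] Reals_of_real)
      show "cmod ((\<sigma> \<epsilon> (2 * pi) z - z) / of_real \<epsilon> - mel1 \<eta> n a b z) \<le> C * \<bar>\<epsilon>\<bar>" if "z \<in> rect lo hi r" for z
        by (rule ff(14)[OF e that])
    qed
    then obtain e where e: "e > 0" "\<forall>\<epsilon>. 0 < \<bar>\<epsilon>\<bar> \<and> \<bar>\<epsilon>\<bar> < e \<longrightarrow> zeros_le (\<lambda>z. (\<sigma> \<epsilon> (2 * pi) z - z) / of_real \<epsilon>) {lo..hi} N"
      by (elim exE conjE)
    have "finite (limit_cycles_near \<eta> \<epsilon> f g K) \<and>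
      (\<Sum>\<Gamma>\<in>limit_cycles_near \<eta> \<epsilon> f g K. cycle_mult \<eta> \<epsilon> f g \<Gamma>) \<le> enat N"
      if eps: "0 < \<bar>\<epsilon>\<bar>" "\<bar>\<epsilon>\<bar> < e" "\<bar>\<epsilon>\<bar> < e1" for \<epsilon>
    proof -
      define c where "c s \<theta> = Re (\<sigma> \<epsilon> \<theta> (of_real s))" for s \<theta>
      have sc: "\<sigma> \<epsilon> (2 * pi) (of_real x) = of_real (c x (2 * pi))" if "lo - r < x" "x < hi + r" for x
        unfolding c_def using ff(13)[OF eps(3) in_rect[OF that]] by (simp add: of_real_Re)
      interpret near_annulus \<eta> n a b \<epsilon> f g lo hi r C c
      proof
        show "\<eta> > 0" by (rule assms)
        show "f k x y = bipoly (a k) n x y" "g k x y = bipoly (b k) n x y" if "k \<in> {1..4}" for k x y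
          using fb gb that by auto
        show "r > 0" "0 < lo - 3 * r" "hi + 3 * r < 1" "lo \<le> hi" "C > 0" using ff(1,3,4,5) lh(2) by auto
        show "\<bar>\<epsilon> * angular \<eta> n (a k) (b k) \<theta> s / s\<bar> \<le> sqrt (2 * \<eta>) / 2"
          if "k \<in> {1..4}" "\<theta> \<in> quarter k" "lo - 3 * r < s" "s < hi + 3 * r" for k \<theta> s by (rule ff(6)[OF eps(3) that])
        show "\<bar>slope \<eta> n a b \<epsilon> k \<theta> s - slope \<eta> n a b \<epsilon> k \<theta> s'\<bar> \<le> C * \<bar>s - s'\<bar>"
          if "k \<in> {1..4}" "\<theta> \<in> quarter k" "lo - 2 * r < s" "s < hi + 2 * r" "lo - 2 * r < s'" "s' < hi + 2 * r" for k \<theta> s s'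
          by (rule ff(7)[OF eps(3) that])
        show "continuous_on {lo - r<..<hi + r} (\<lambda>s. c s (2 * pi))"
        proof -
          have "continuous_on {lo - r<..<hi + r} (\<lambda>s. \<sigma> \<epsilon> (2 * pi) (of_real s))"
            by (rule continuous_on_compose2[OF holomorphic_on_imp_continuous_on[OF ff(12)[OF eps(3)]]])
              (auto intro!: continuous_intros in_rect)
          then show ?thesis unfolding c_def by (intro continuous_intros)
        qed
        fix s assume s: "lo - r < s" "s < hi + r"
        show "continuous_on UNIV (c s)" unfolding c_def[abs_def] by (rule ff(8)[OF eps(3) s])
        show "c s 0 = s" unfolding c_def by (rule ff(9)[OF eps(3) s])
        show "\<bar>c s \<theta> - s\<bar> \<le> r / 2" for \<theta> unfolding c_def by (rule ff(10)[OF eps(3) s])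
        show "(c s has_real_derivative slope \<eta> n a b \<epsilon> k \<theta> (c s \<theta>)) (at \<theta>)"
          if "k \<in> {1..4}" "quarter_end k - pi / 2 < \<theta>" "\<theta> < quarter_end k" for k \<theta>
          unfolding c_def[abs_def] by (rule ff(11)[OF eps(3) s that])
      qed
      have "zeros_le (\<lambda>z. (\<sigma> \<epsilon> (2 * pi) z - z) / of_real \<epsilon>) {lo..hi} N" using e(2) eps(1,2) by blast
      then have zl: "zeros_le (\<lambda>z. \<sigma> \<epsilon> (2 * pi) z - z) {lo..hi} N" by (rule zeros_le_scaled)
      show ?thesis
        by (rule limit_cycles_count[OF ff(12)[OF eps(3)] sc zl]) (use sec in \<open>auto simp: ysec_def\<close>)
    qed
    then show ?thesis using e(1) ff(2) by (intro exI[of _ "min e e1"]) simp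
  qed
  then show ?thesis unfolding bifurcating_limit_cycles_le_def N_def by simp
qed

end
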